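(* Let $p$ be a prime and $k$ a field of characteristic $p$. Let $P$ be a non-trivial finite abelian $p$-group and $E$ a finite $p'$-group acting on $P$. Suppose that $[P,E]=P$. Then: (i) Every $E$-stable derivation on $kP$ has image contained in the Jacobson radical $J(kP)$. (ii) If the $\mathbb{F}_pE$-module $P/\Phi(P)$ is multiplicity free, then $\mathrm{HH}^1(kP)^E$ is a solvable Lie algebra. Conversely, if $p$ is odd and $\mathrm{HH}^1(kP)^E$ is a solvable Lie algebra, then the $\mathbb{F}_pE$-module $P/\Phi(P)$ is multiplicity free.
   Context: A $p'$-group is a finite group of order prime to $p$. $[P,E]$ is the subgroup of $P$ generated by all elements $({}^eu)u^{-1}$ with $u\in P$, $e\in E$. $\Phi(P)$ is the Frattini subgroup, the smallest normal subgroup of $P$ with elementary abelian quotient; the action of $E$ makes $P/\Phi(P)$ a semisimple $\mathbb{F}_pE$-module. A semisimple module is multiplicity free if it is a direct sum of pairwise non-isomorphic simple modules. For a $k$-algebra $A$, $\mathrm{HH}^1(A)=\mathrm{Der}(A)/\mathrm{IDer}(A)$ ($k$-linear derivations modulo inner derivations), with Lie bracket induced by $[f,g]=f\circ g-g\circ f$. The group $E$ acts on $kP$ by algebra automorphisms, hence on $\mathrm{Der}(kP)$ and on $\mathrm{HH}^1(kP)$ by conjugation $f\mapsto \epsilon\circ f\circ\epsilon^{-1}$ (where $\epsilon$ is the automorphism of $kP$ given by $e\in E$); $\mathrm{HH}^1(kP)^E$ is the Lie subalgebra of $E$-fixed points. A derivation $f$ on $kP$ is $E$-stable if it is fixed by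 $E$, i.e. $f({}^eu)={}^ef(u)$ for all $e\in E$, $u\in P$. *)

theory Defs
  imports "HOL-Algebra.Bij" "HOL-Algebra.Generated_Groups" "HOL-Algebra.Ideal" "HOL-Algebra.Module"
    "HOL-Number_Theory.Residues"
begin

section \<open>Rings and group algebras\<close>

definition ring_char :: "('a, 'b) ring_scheme \<Rightarrow> nat" where
  "ring_char R = (THE n. \<forall>m::nat. [m] \<cdot>\<^bsub>R\<^esub> \<one>\<^bsub>R\<^esub> = \<zero>\<^bsub>R\<^esub> \<longleftrightarrow> n dvd m)"

text \<open>The Jacobson radical of a commutative ring. (Over a noncommutative ring one would have to
  use maximal left ideals, whereas \<^const>\<open>maximalideal\<close> is two-sided.)\<close>

definition jacobson_radical :: "('a, 'b) ring_scheme \<Rightarrow> 'a set" where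
  "jacobson_radical R = {x \<in> carrier R. \<forall>I. maximalideal I R \<longrightarrow> x \<in> I}"

text \<open>The group algebra of a finite group \<open>G\<close> over \<open>R\<close>: an element is its coefficient function,
  extensional on \<open>carrier G\<close>, and multiplication is convolution.\<close>

definition group_algebra ::
    "('k, 'm) ring_scheme \<Rightarrow> ('g, 'n) monoid_scheme \<Rightarrow> ('k, 'g \<Rightarrow> 'k) module" where
  "group_algebra R G =
    \<lparr>carrier = carrier G \<rightarrow>\<^sub>E carrier R,
     monoid.mult = (\<lambda>a b. \<lambda>u\<in>carrier G.
        finsum R (\<lambda>v. a v \<otimes>\<^bsub>R\<^esub> b (inv\<^bsub>G\<^esub> v \<otimes>\<^bsub>G\<^esub> u)) (carrier G)),
     one = (\<lambda>u\<in>carrier G. if u = \<one>\<^bsub>G\<^esub> then \<one>\<^bsub>R\<^esub> else \<zero>\<^bsub>R\<^esub>),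
     zero = (\<lambda>u\<in>carrier G. \<zero>\<^bsub>R\<^esub>),
     add = (\<lambda>a b. \<lambda>u\<in>carrier G. a u \<oplus>\<^bsub>R\<^esub> b u),
     smult = (\<lambda>c a. \<lambda>u\<in>carrier G. c \<otimes>\<^bsub>R\<^esub> a u)\<rparr>"

text \<open>The linear extension of an automorphism \<open>\<alpha>\<close> of \<open>G\<close> to the group algebra: it sends
  \<open>\<Sum>u. a u \<cdot> u\<close> to \<open>\<Sum>u. a u \<cdot> \<alpha> u\<close>, whose coefficient at \<open>u\<close> is \<open>a (\<alpha>\<^sup>-\<^sup>1 u)\<close>.\<close>

definition group_algebra_map ::
    "('g, 'n) monoid_scheme \<Rightarrow> ('g \<Rightarrow> 'g) \<Rightarrow> ('g \<Rightarrow> 'k) \<Rightarrow> 'g \<Rightarrow> 'k" where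
  "group_algebra_map G \<alpha> a = (\<lambda>u\<in>carrier G. a (inv_into (carrier G) \<alpha> u))"


section \<open>Modules over a ring that need not be commutative\<close>

text \<open>The locale \<^locale>\<open>module\<close> is restricted to commutative rings of scalars, but
  the locale \<^locale>\<open>submodule\<close> is not. The ring operations \<open>mult\<close> and \<open>one\<close> of a module
  record carry no meaning here.\<close>

definition simple_module ::
    "('r, 'm) ring_scheme \<Rightarrow> ('r, 'v, 'n) module_scheme \<Rightarrow> bool" where
  "simple_module R M \<longleftrightarrow>
     carrier M \<noteq> {\<zero>\<^bsub>M\<^esub>} \<and>
     (\<forall>N. submodule N R M \<longrightarrow> N = {\<zero>\<^bsub>M\<^esub>} \<or> N = carrier M)"

definition module_isomorphic ::
    "('r, 'm) ring_scheme \<Rightarrow> ('r, 'v, 'n) module_scheme \<Rightarrow> ('r, 'w, 'l) module_scheme \<Rightarrow> bool"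
  where
  "module_isomorphic R M N \<longleftrightarrow>
     (\<exists>h. bij_betw h (carrier M) (carrier N) \<and>
          (\<forall>x\<in>carrier M. \<forall>y\<in>carrier M. h (x \<oplus>\<^bsub>M\<^esub> y) = h x \<oplus>\<^bsub>N\<^esub> h y) \<and>
          (\<forall>r\<in>carrier R. \<forall>x\<in>carrier M. h (r \<odot>\<^bsub>M\<^esub> x) = r \<odot>\<^bsub>N\<^esub> h x))"

definition internal_direct_sum :: "('r, 'v, 'n) module_scheme \<Rightarrow> 'v set set \<Rightarrow> bool" where
  "internal_direct_sum M \<S> \<longleftrightarrow>
     finite \<S> \<and>
     bij_betw (\<lambda>f. finsum M f \<S>) (\<Pi>\<^sub>E N\<in>\<S>. N) (carrier M)"

text \<open>A finite direct sum of pairwise non-isomorphic simple modules. The summands may be taken to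
  form a set rather than a family, since equal summands would be isomorphic.\<close>

definition multiplicity_free ::
    "('r, 'm) ring_scheme \<Rightarrow> ('r, 'v, 'n) module_scheme \<Rightarrow> bool" where
  "multiplicity_free R M \<longleftrightarrow>
     (\<exists>\<S>. (\<forall>N\<in>\<S>. submodule N R M \<and> simple_module R (M\<lparr>carrier := N\<rparr>)) \<and>
          internal_direct_sum M \<S> \<and>
          (\<forall>N\<in>\<S>. \<forall>N'\<in>\<S>. N \<noteq> N' \<longrightarrow>
             \<not> module_isomorphic R (M\<lparr>carrier := N\<rparr>) (M\<lparr>carrier := N'\<rparr>)))"


section \<open>Groups acted upon by automorphisms\<close>

definition commutator_of_action ::
    "('g, 'm) monoid_scheme \<Rightarrow> ('e, 'n) monoid_scheme \<Rightarrow> ('e \<Rightarrow> 'g \<Rightarrow> 'g) \<Rightarrow> 'g set" where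
  "commutator_of_action P E \<phi> =
     generate P {\<phi> e u \<otimes>\<^bsub>P\<^esub> inv\<^bsub>P\<^esub> u | e u. e \<in> carrier E \<and> u \<in> carrier P}"

definition elementary_abelian :: "nat \<Rightarrow> ('g, 'm) monoid_scheme \<Rightarrow> bool" where
  "elementary_abelian p G \<longleftrightarrow>
     comm_group G \<and> (\<forall>x\<in>carrier G. x [^]\<^bsub>G\<^esub> p = \<one>\<^bsub>G\<^esub>)"

text \<open>The Frattini subgroup of a finite \<open>p\<close>-group, as the smallest normal subgroup with
  elementary abelian quotient.\<close>

definition frattini :: "nat \<Rightarrow> ('g, 'm) monoid_scheme \<Rightarrow> 'g set" where
  "frattini p P = \<Inter>{N. N \<lhd> P \<and> elementary_abelian p (P Mod N)}"

text \<open>\<open>P/\<Phi>(P)\<close>, written additively, as a module over \<open>\<F>\<^sub>p E\<close>: the element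
  \<open>\<Sum>e. a e \<cdot> e\<close>, with \<open>a e\<close> in \<open>\<F>\<^sub>p = {0..p-1}\<close>, sends a coset \<open>S\<close> to \<open>\<Prod>e. (\<phi> e S) ^ (a e)\<close>.\<close>

definition frattini_quotient_module ::
    "nat \<Rightarrow> ('g, 'm) monoid_scheme \<Rightarrow> ('e, 'n) monoid_scheme \<Rightarrow> ('e \<Rightarrow> 'g \<Rightarrow> 'g)
      \<Rightarrow> ('e \<Rightarrow> int, 'g set) module" where
  "frattini_quotient_module p P E \<phi> =
    (let V = P Mod frattini p P in
     \<lparr>carrier = carrier V,
      monoid.mult = undefined,
      one = undefined,
      zero = \<one>\<^bsub>V\<^esub>,
      add = monoid.mult V,
      smult = (\<lambda>a S. finprod V (\<lambda>e. (\<phi> e ` S) [^]\<^bsub>V\<^esub> a e) (carrier E))\<rparr>)"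


section \<open>Lie algebras\<close>

text \<open>As for modules, the ring operations \<open>mult\<close> and \<open>one\<close> carry no meaning.\<close>

record ('k, 'l) lie_alg = "('k, 'l) module" +
  lie_bracket :: "['l, 'l] \<Rightarrow> 'l"

text \<open>\<open>[H, H]\<close>, the subspace generated by all brackets of elements of \<open>H\<close>.\<close>

definition lie_derived ::
    "('k, 'm) ring_scheme \<Rightarrow> ('k, 'l, 'n) lie_alg_scheme \<Rightarrow> 'l set \<Rightarrow> 'l set" where
  "lie_derived K L H =
     \<Inter>{N. submodule N K L \<and> (\<forall>x\<in>H. \<forall>y\<in>H. lie_bracket L x y \<in> N)}"

definition lie_solvable ::
    "('k, 'm) ring_scheme \<Rightarrow> ('k, 'l, 'n) lie_alg_scheme \<Rightarrow> bool" where
  "lie_solvable K L \<longleftrightarrow> (\<exists>n. (lie_derived K L ^^ n) (carrier L) = {\<zero>\<^bsub>L\<^esub>})"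

definition lie_quotient ::
    "('k, 'l, 'n) lie_alg_scheme \<Rightarrow> 'l set \<Rightarrow> ('k, 'l set) lie_alg" where
  "lie_quotient L I =
    \<lparr>carrier = a_rcosets\<^bsub>L\<^esub> I,
     monoid.mult = undefined,
     one = undefined,
     zero = I,
     add = set_add L,
     smult = (\<lambda>c S. \<Union>x\<in>S. I +>\<^bsub>L\<^esub> (c \<odot>\<^bsub>L\<^esub> x)),
     lie_bracket = (\<lambda>S T. \<Union>x\<in>S. \<Union>y\<in>T. I +>\<^bsub>L\<^esub> lie_bracket L x y)\<rparr>"


section \<open>Derivations and first Hochschild cohomology\<close>

definition derivations ::
    "('k, 'm) ring_scheme \<Rightarrow> ('k, 'a, 'n) module_scheme \<Rightarrow> ('a \<Rightarrow> 'a) set" where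
  "derivations K A =
    {f \<in> carrier A \<rightarrow>\<^sub>E carrier A.
       (\<forall>x\<in>carrier A. \<forall>y\<in>carrier A. f (x \<oplus>\<^bsub>A\<^esub> y) = f x \<oplus>\<^bsub>A\<^esub> f y) \<and>
       (\<forall>c\<in>carrier K. \<forall>x\<in>carrier A. f (c \<odot>\<^bsub>A\<^esub> x) = c \<odot>\<^bsub>A\<^esub> f x) \<and>
       (\<forall>x\<in>carrier A. \<forall>y\<in>carrier A. f (x \<otimes>\<^bsub>A\<^esub> y) = f x \<otimes>\<^bsub>A\<^esub> y \<oplus>\<^bsub>A\<^esub> x \<otimes>\<^bsub>A\<^esub> f y)}"

definition inner_derivations :: "('k, 'a, 'n) module_scheme \<Rightarrow> ('a \<Rightarrow> 'a) set" where
  "inner_derivations A =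
    {\<lambda>x\<in>carrier A. a \<otimes>\<^bsub>A\<^esub> x \<ominus>\<^bsub>A\<^esub> x \<otimes>\<^bsub>A\<^esub> a | a. a \<in> carrier A}"

definition Der ::
    "('k, 'm) ring_scheme \<Rightarrow> ('k, 'a, 'n) module_scheme \<Rightarrow> ('k, 'a \<Rightarrow> 'a) lie_alg" where
  "Der K A =
    \<lparr>carrier = derivations K A,
     monoid.mult = undefined,
     one = undefined,
     zero = (\<lambda>x\<in>carrier A. \<zero>\<^bsub>A\<^esub>),
     add = (\<lambda>f g. \<lambda>x\<in>carrier A. f x \<oplus>\<^bsub>A\<^esub> g x),
     smult = (\<lambda>c f. \<lambda>x\<in>carrier A. c \<odot>\<^bsub>A\<^esub> f x),
     lie_bracket = (\<lambda>f g. \<lambda>x\<in>carrier A. f (g x) \<ominus>\<^bsub>A\<^esub> g (f x))\<rparr>"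

definition HH1 ::
    "('k, 'm) ring_scheme \<Rightarrow> ('k, 'a, 'n) module_scheme \<Rightarrow> ('k, ('a \<Rightarrow> 'a) set) lie_alg" where
  "HH1 K A = lie_quotient (Der K A) (inner_derivations A)"

text \<open>Conjugation of \<open>f\<close> by an automorphism \<open>\<epsilon>\<close> of \<open>A\<close>. A class in \<open>Der/IDer\<close> is a set of
  derivations, so its conjugate is the image of that set.\<close>

definition conj_by :: "('k, 'a, 'n) module_scheme \<Rightarrow> ('a \<Rightarrow> 'a) \<Rightarrow> ('a \<Rightarrow> 'a) \<Rightarrow> 'a \<Rightarrow> 'a" where
  "conj_by A \<epsilon> f = (\<lambda>x\<in>carrier A. \<epsilon> (f (inv_into (carrier A) \<epsilon> x)))"

definition stable_derivations ::
    "('k, 'm) ring_scheme \<Rightarrow> ('g, 'n) monoid_scheme \<Rightarrow> ('e, 'l) monoid_scheme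
      \<Rightarrow> ('e \<Rightarrow> 'g \<Rightarrow> 'g) \<Rightarrow> (('g \<Rightarrow> 'k) \<Rightarrow> 'g \<Rightarrow> 'k) set" where
  "stable_derivations K P E \<phi> =
    {f \<in> derivations K (group_algebra K P).
       \<forall>e\<in>carrier E. conj_by (group_algebra K P) (group_algebra_map P (\<phi> e)) f = f}"

definition HH1_fixed ::
    "('k, 'm) ring_scheme \<Rightarrow> ('g, 'n) monoid_scheme \<Rightarrow> ('e, 'l) monoid_scheme
      \<Rightarrow> ('e \<Rightarrow> 'g \<Rightarrow> 'g) \<Rightarrow> ('k, (('g \<Rightarrow> 'k) \<Rightarrow> 'g \<Rightarrow> 'k) set) lie_alg" where
  "HH1_fixed K P E \<phi> =
    (HH1 K (group_algebra K P))
      \<lparr>carrier := {S \<in> carrier (HH1 K (group_algebra K P)).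
         \<forall>e\<in>carrier E.
           conj_by (group_algebra K P) (group_algebra_map P (\<phi> e)) ` S = S}\<rparr>"

end

theory Submission
  imports "HOL-Algebra.Group_Action" "HOL-Computational_Algebra.Fundamental_Theorem_Algebra"
    "HOL-Computational_Algebra.Polynomial_Factorial" Defs
begin

text \<open>A derivation \<open>f\<close> of \<open>kP\<close> is determined by the homomorphism \<open>u \<mapsto> u\<^sup>-\<^sup>1 f(u)\<close> from \<open>P\<close> to
  \<open>(kP, +)\<close>. If \<open>f\<close> is \<open>E\<close>-stable, then composing it with the augmentation gives a homomorphism from
  \<open>P\<close> to \<open>(k, +)\<close> that is constant on \<open>E\<close>-orbits, hence trivial on \<open>[P, E] = P\<close>; so the image of \<open>f\<close>
  lies in the augmentation ideal \<open>J\<close>, which is nilpotent.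

  Since \<open>kP\<close> is commutative, \<open>HH\<^sup>1(kP)\<^sup>E\<close> is the Lie algebra of stable derivations. Those with image in
  \<open>J\<^sup>2\<close> form a nilpotent ideal, and the quotient by it is \<open>k \<otimes> D\<close> with \<open>D\<close> the endomorphism ring of the
  \<open>\<F>\<^sub>p E\<close>-module \<open>P/\<Phi>(P)\<close>; lifts to stable derivations are obtained by averaging over \<open>E\<close>. In the
  multiplicity free case \<open>D\<close> is a product of finite division rings, commutative by Wedderburn's
  theorem, so brackets of stable derivations have image in \<open>J\<^sup>2\<close>. Otherwise an isomorphism between two
  simple summands yields matrix units \<open>\<alpha>, \<beta>\<close> in \<open>D\<close> with the relations of \<open>sl\<^sub>2\<close>; as \<open>2\<close> is
  invertible in \<open>k\<close>, nonzero multiples of \<open>\<alpha>\<close>, \<open>\<beta>\<close> and \<open>\<alpha>\<beta> - \<beta>\<alpha>\<close> survive in every term of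
  the derived series.\<close>

section \<open>Wedderburn's little theorem\<close>

text \<open>The work takes place in J/J^2, where u -> u - 1 is additive with kernel \<Phi>(P).
  Neither this quotient nor k \<otimes> P/\<Phi>(P) is formed: \<open>cg\<close> is congruence
  modulo J^2, and \<open>induces f c \<tau>\<close> says that f acts on J/J^2 as the pure tensor c
  \<otimes> \<tau>. A general stable derivation enters only as a k-combination of averages that
  induce pure tensors, so commutativity of D over the prime field is enough and no extension of
  scalars is made. Elements of the prime field are represented by integers up to congruence modulo
  p.

  Part (i) is the entry point of part (ii). If two derivations have values in J^m, their bracket has
  values in J^(2m-1), which is deeper only for m >= 2. Part (i) gives just m = 1, and exactly at
  that step the commutativity of D has to supply the missing power; from m = 2 on the bracket alone
  descends.

  Odd p is required because of [\<gamma>, \<alpha>] = 2\<alpha> for \<gamma> = [\<alpha>, \<beta>]: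
  in characteristic 2 this bracket vanishes, sl_2 is nilpotent, and nothing would keep the derived
  series from dying out.\<close>

lemma poly_of_int_poly_mult:
  "poly (map_poly of_int (a * b)) (z :: complex) =
     poly (map_poly of_int a) z * poly (map_poly of_int b) z"
proof -
  have add: "poly (map_poly of_int (f + g)) z = poly (map_poly of_int f) z + poly (map_poly of_int g) z"
    for f g :: "int poly"
    by (induction f g rule: poly_induct2) (simp_all add: map_poly_pCons algebra_simps)
  have smult: "poly (map_poly of_int (Polynomial.smult c f)) z = of_int c * poly (map_poly of_int f) z"
    for c and f :: "int poly"
    by (subst map_poly_smult) auto
  show ?thesis
    by (induction a) (simp_all add: map_poly_pCons add smult algebra_simps)
qed

lemma poly_of_int_poly_of_int:
  "poly (map_poly of_int f) (of_int x :: complex) = of_int (poly f x)"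
  by (induction f) (simp_all add: map_poly_pCons)

text \<open>Evaluation at \<open>z\<close> is multiplicative into a field, so some factor of a
  vanishing product vanishes. The prime factors multiply to \<open>f\<close> only up to a unit,
  which is why divisibility by their product is used instead of equality.\<close>

lemma prime_factor_root:
  assumes "f \<noteq> 0" "poly (map_poly of_int f) (z :: complex) = 0"
  obtains h :: "int poly" where "prime_elem h" "h dvd f" "poly (map_poly of_int h) z = 0"
proof -
  have *: "poly (map_poly of_int (prod_mset B)) z = 0 \<Longrightarrow>
      \<exists>h\<in>#B. poly (map_poly of_int h) z = 0" for B :: "int poly multiset"
    by (induction B) (auto simp: poly_of_int_poly_mult)
  have "f dvd prod_mset (prime_factorization f)"
    using assms(1) by (metis dvd_refl normalize_dvd_iff prod_mset_prime_factorization_weak dvd_normalize_iff)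
  then obtain k where "prod_mset (prime_factorization f) = f * k" by (elim dvdE)
  then have "poly (map_poly of_int (prod_mset (prime_factorization f))) z = 0"
    using assms(2) by (simp add: poly_of_int_poly_mult)
  from *[OF this] obtain h where "h \<in># prime_factorization f" "poly (map_poly of_int h) z = 0"
    by auto
  then show thesis
    using that in_prime_factors_imp_prime in_prime_factors_imp_dvd prime_imp_prime_elem by metis
qed

text \<open>Comparison of real parts: on the unit circle only 1 has real part 1, so the inequality
  is strict.\<close>

lemma norm_of_nat_minus_root_of_unity_gt:
  assumes "cmod x = 1" "x \<noteq> 1"
  shows "cmod (of_nat q - x) > real q - 1"
proof -
  have "Re x \<le> 1" using complex_Re_le_cmod[of x] assms by simp
  moreover have "Re x \<noteq> 1"
  proof
    assume "Re x = 1"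
    then have "Im x = 0" using assms(1) by (simp add: cmod_def)
    with \<open>Re x = 1\<close> show False using assms(2) by (simp add: complex_eq_iff)
  qed
  ultimately have "real q - 1 < Re (of_nat q - x)" by simp
  also have "\<dots> \<le> cmod (of_nat q - x)" by (rule complex_Re_le_cmod)
  finally show ?thesis .
qed

text \<open>Over the complex numbers \<open>h\<close> splits; at \<open>q\<close> each linear factor
  has modulus above q - 1 >= 1, and the leading coefficient, a nonzero integer, has modulus at least
  1.\<close>

lemma poly_int_gt_of_roots_of_unity:
  fixes h :: "int poly"
  assumes q: "q \<ge> (2::nat)" and "h \<noteq> 0"
    and root: "poly (map_poly of_int h) (z :: complex) = 0"
    and unit: "\<And>x. poly (map_poly of_int h) (x::complex) = 0 \<Longrightarrow> cmod x = 1 \<and> x \<noteq> 1"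
  shows "\<bar>poly h (int q)\<bar> > int q - 1"
proof -
  define H where "H = (map_poly of_int h :: complex poly)"
  have lc: "lead_coeff H = of_int (lead_coeff h)" "degree H = degree h"
    unfolding H_def by (simp_all add: degree_map_poly coeff_map_poly)
  have "H \<noteq> 0" using lc assms(2) by auto
  then obtain A where A: "H = Polynomial.smult (lead_coeff H) (\<Prod>x\<in>#A. [:- x, 1:])"
    using alg_closed_imp_factorization by blast
  \<comment> \<open>The root \<open>z\<close> guarantees at least one linear factor; without one the
    product would only be bounded below by 1.\<close>
  have "A \<noteq> {#}"
  proof
    assume "A = {#}"
    then have "H = [:lead_coeff H:]" using A by simp
    then have "poly H z = lead_coeff H" by (metis poly_const_conv)
    then show False using root \<open>H \<noteq> 0\<close> H_def by auto
  qed
  have roots: "poly H x = 0" if "x \<in># A" for x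
  proof -
    have "poly (\<Prod>x\<in>#A. [:- x, 1:]) x = 0"
      using that by (induction A) auto
    then show ?thesis by (subst A) simp
  qed
  have gt: "cmod (of_nat q - x) > real q - 1" if "x \<in># A" for x
    using roots[OF that] unit norm_of_nat_minus_root_of_unity_gt unfolding H_def by blast
  have prod: "cmod (poly (\<Prod>x\<in>#B. [:- x, 1:]) (of_nat q)) > real q - 1"
    if "B \<noteq> {#}" "\<And>x. x \<in># B \<Longrightarrow> cmod (of_nat q - x) > real q - 1" for B
    using that
  proof (induction B)
    case (add x B)
    have x: "cmod (of_nat q - x) > real q - 1" using add by auto
    show ?case
    proof (cases "B = {#}")
      case True then show ?thesis using x by (simp add: norm_minus_commute)
    next
      case False
      then have IH: "cmod (poly (\<Prod>x\<in>#B. [:- x, 1:]) (of_nat q)) > real q - 1" using add by auto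
      have "(real q - 1) * 1 < cmod (of_nat q - x) * cmod (poly (\<Prod>x\<in>#B. [:- x, 1:]) (of_nat q))"
        using x IH q by (intro mult_less_le_imp_less) auto
      moreover have "poly [:- x, 1:] (of_nat q) = of_nat q - x" by simp
      ultimately show ?thesis
        by (simp only: image_mset_add_mset prod_mset.add_mset poly_mult norm_mult mult_1_right)
    qed
  qed auto
  have "real q - 1 < cmod (poly (\<Prod>x\<in>#A. [:- x, 1:]) (of_nat q))"
    using prod[OF \<open>A \<noteq> {#}\<close> gt] .
  also have "\<dots> \<le> \<bar>real_of_int (lead_coeff h)\<bar> * \<dots>"
  proof -
    have "1 \<le> \<bar>lead_coeff h\<bar>" using assms(2) by (metis leading_coeff_0_iff zero_less_abs_iff int_one_le_iff_zero_less)
    then have "1 \<le> \<bar>real_of_int (lead_coeff h)\<bar>" by linarith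
    then show ?thesis by (simp add: mult_le_cancel_right1)
  qed
  also have "\<dots> = cmod (poly H (of_nat q))"
    using arg_cong[OF A, of "\<lambda>f. cmod (poly f (of_nat q))"] lc by (simp add: norm_mult)
  also have "\<dots> = \<bar>real_of_int (poly h (int q))\<bar>"
    using poly_of_int_poly_of_int[of h "int q"] unfolding H_def by simp
  finally show ?thesis by linarith
qed

text \<open>The prime factor of \<open>X\<^sup>n - 1\<close> that vanishes at a primitive \<open>n\<close>-th root of unity plays the role of
  the cyclotomic polynomial.\<close>

lemma cyclotomic_divisor:
  fixes n q :: nat
  assumes n: "n \<ge> 2" and q: "q \<ge> 2"
  obtains c :: int where "c dvd int q ^ n - 1" "\<bar>c\<bar> > int q - 1"
    "\<And>d m. \<lbrakk>d > 0; d < n; d dvd n; (int q ^ d - 1) * m = int q ^ n - 1\<rbrakk> \<Longrightarrow> c dvd m"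
proof -
  define z where "z = cis (2 * pi / real n)"
  define F where "F = (\<lambda>d. (Polynomial.monom 1 d - 1 :: int poly))"
  have F0: "F n \<noteq> 0" if "n > 0" for n
    using that unfolding F_def
    by (metis degree_1 degree_monom_eq eq_iff_diff_eq_0 less_numeral_extra(3) one_neq_zero)
  have evF: "poly (map_poly of_int (F d)) x = x ^ d - 1" for d and x :: complex
  proof -
    have "map_poly of_int (F d) = (Polynomial.monom 1 d - 1 :: complex poly)"
      by (rule poly_eqI) (simp add: F_def coeff_map_poly)
    then show ?thesis by (simp add: poly_monom)
  qed
  have evFi: "poly (F d) x = x ^ d - 1" for d and x :: int by (simp add: F_def poly_monom)
  \<comment> \<open>\<open>z\<close> has exact order \<open>n\<close>: otherwise d/n would be an
    integer strictly between 0 and 1.\<close>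
  have zd: "z ^ d \<noteq> 1" if "d > 0" "d < n" for d
  proof
    assume "z ^ d = 1"
    then have "cis (2 * pi * real d / real n) = 1" unfolding z_def by (simp add: DeMoivre mult.commute)
    then have "cos (2 * pi * real d / real n) = 1" by (simp add: complex_eq_iff)
    then obtain k :: int where "2 * pi * real d / real n = of_int k * 2 * pi"
      using cos_one_2pi_int by auto
    then have "real d / real n = of_int k" using n by (simp add: field_simps)
    moreover have "0 < real d / real n" "real d / real n < 1" using that by auto
    ultimately have "0 < k" "k < 1" by (metis of_int_0_less_iff, metis of_int_less_1_iff)
    then show False by linarith
  qed
  have zn: "z ^ n = 1" unfolding z_def using n by (simp add: DeMoivre)
  obtain h where h: "prime_elem h" "h dvd F n" "poly (map_poly of_int h) z = 0"
    using prime_factor_root[of "F n" z] F0[of n] n evF zn by auto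
  \<comment> \<open>This is what singles out \<open>h\<close> among the prime factors of X^n - 1:
    being prime, it must then divide the cofactor of X^d - 1 in X^n - 1.\<close>
  have ndvd: "\<not> h dvd F d" if "d > 0" "d < n" for d
  proof
    assume "h dvd F d"
    then have "poly (map_poly of_int (F d)) z = 0" using h(3) by (auto elim!: dvdE simp: poly_of_int_poly_mult)
    then show False using evF zd[OF that] by simp
  qed
  have hQ: "h dvd Q" if "F n = F d * Q" "d > 0" "d < n" for d Q
    using h(2) that ndvd[of d] prime_elem_dvd_mult_iff[OF h(1)] by metis
  have Fdvd: "\<exists>Q. F n = F d * Q" if dn: "d dvd n" for d
  proof -
    obtain k where k: "n = d * k" using dn by (elim dvdE)
    have "F n = Polynomial.monom 1 d ^ k - 1 ^ k" unfolding F_def k by (simp add: monom_power)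
    then show ?thesis unfolding F_def by (metis power_diff_sumr2)
  qed
  obtain Q1 where Q1: "F n = F 1 * Q1" using Fdvd[of 1] by auto
  have "(\<Sum>i<n. Polynomial.monom 1 i) = Q1"
  proof -
    have "F n = F 1 * (\<Sum>i<n. Polynomial.monom 1 i)"
    proof -
      have "F n = Polynomial.monom 1 1 ^ n - 1 ^ n" unfolding F_def by (simp add: monom_power)
      also have "\<dots> = F 1 * (\<Sum>i<n. Polynomial.monom 1 i)"
        by (subst power_diff_sumr2) (simp add: F_def monom_power)
      finally show ?thesis .
    qed
    then show ?thesis using Q1 F0[of 1] by auto
  qed
  \<comment> \<open>(X^n - 1)/(X - 1) is 1 + X + ... + X^(n-1), with value n at 1. As
    \<open>h\<close> divides this quotient, 1 is not a root of \<open>h\<close>, which the strict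
    estimate requires.\<close>
  then have Q11: "poly (map_poly of_int Q1) (1::complex) = of_nat n"
    using poly_of_int_poly_of_int[of Q1 1] by (auto simp: poly_sum poly_monom)
  have unit: "cmod x = 1 \<and> x \<noteq> 1" if "poly (map_poly of_int h) x = 0" for x :: complex
  proof
    have "poly (map_poly of_int (F n)) x = 0"
      using h(2) that by (auto elim!: dvdE simp: poly_of_int_poly_mult)
    then have "x ^ n = 1" using evF by simp
    then have "cmod x ^ n = 1" by (metis norm_one norm_power)
    then show "cmod x = 1" using n by (metis norm_ge_zero power_eq_1_iff abs_of_nonneg not_numeral_le_zero real_norm_def)
    show "x \<noteq> 1"
    proof
      assume "x = 1"
      then have "poly (map_poly of_int Q1) x = 0"
        using hQ[OF Q1] n that by (auto elim!: dvdE simp: poly_of_int_poly_mult)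
      then show False using Q11 \<open>x = 1\<close> n by simp
    qed
  qed
  show thesis
  proof (rule that[of "poly h (int q)"])
    show "poly h (int q) dvd int q ^ n - 1"
      using h(2) evFi[of n "int q"] by (metis dvd_def poly_mult)
    show "\<bar>poly h (int q)\<bar> > int q - 1"
      using poly_int_gt_of_roots_of_unity[OF q _ h(3) unit] h(1) by auto
    fix d m assume d: "d > 0" "d < n" "d dvd n" "(int q ^ d - 1) * m = int q ^ n - 1"
    obtain Q where Q: "F n = F d * Q" using Fdvd d by auto
    have "(int q ^ d - 1) * m = (int q ^ d - 1) * poly Q (int q)"
      using d(4) evFi[of n "int q"] evFi[of d "int q"] unfolding Q by simp
    moreover have "int q ^ d - 1 \<noteq> 0" 
      using q d(1) by (metis eq_iff_diff_eq_0 less_le_not_le nat_power_eq_Suc_0_iff of_nat_1 of_nat_eq_iff of_nat_power One_nat_def not_less numeral_2_eq_2 Suc_n_not_le_n less_irrefl)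
    ultimately have "m = poly Q (int q)" by simp
    then show "poly h (int q) dvd m" using hQ[OF Q d(1,2)] by (metis dvd_def poly_mult)
  qed
qed

text \<open>\<open>B\<close> is a left vector space over the division ring \<open>C\<close>, and the
  exponent is its dimension. No basis is chosen: a subspace \<open>N\<close> is enlarged by one
  vector \<open>x\<close> at a time, and each enlargement multiplies the order by
  \<open>card C\<close>.\<close>

lemma (in ring) card_power_of_division_subring:
  assumes fin: "finite (carrier R)" and nontriv: "\<one> \<noteq> \<zero>"
    and C: "C \<subseteq> carrier R" "\<zero> \<in> C" "\<one> \<in> C"
    and C_diff: "\<And>x y. x \<in> C \<Longrightarrow> y \<in> C \<Longrightarrow> x \<ominus> y \<in> C"
    and C_mult: "\<And>x y. x \<in> C \<Longrightarrow> y \<in> C \<Longrightarrow> x \<otimes> y \<in> C"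
    and C_inv: "\<And>x. x \<in> C \<Longrightarrow> x \<noteq> \<zero> \<Longrightarrow> \<exists>y\<in>C. y \<otimes> x = \<one>"
    and B: "B \<subseteq> carrier R" "\<zero> \<in> B"
    and B_add: "\<And>x y. x \<in> B \<Longrightarrow> y \<in> B \<Longrightarrow> x \<oplus> y \<in> B"
    and B_mult: "\<And>c x. c \<in> C \<Longrightarrow> x \<in> B \<Longrightarrow> c \<otimes> x \<in> B"
  shows "\<exists>m. card B = card C ^ m"
proof -
  have C_neg: "\<ominus> x \<in> C" if "x \<in> C" for x
    using C_diff[OF C(2) that] that C(1) by (auto simp: minus_eq)
  have C_add: "x \<oplus> y \<in> C" if "x \<in> C" "y \<in> C" for x y
    using C_diff[OF that(1) C_neg[OF that(2)]] that C(1) by (auto simp: minus_eq)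
  have finC: "finite C" using C(1) fin finite_subset by blast
  have "card {\<zero>, \<one>} \<le> card C" using C finC by (intro card_mono) auto
  then have cC: "card C \<ge> 2" using nontriv by simp
  have main: "\<exists>m. card B = card C ^ m"
    if N: "N \<subseteq> B" "\<zero> \<in> N" "\<exists>m. card N = card C ^ m"
      and Nadd: "\<And>x y. x \<in> N \<Longrightarrow> y \<in> N \<Longrightarrow> x \<oplus> y \<in> N"
      and Nsmult: "\<And>c x. c \<in> C \<Longrightarrow> x \<in> N \<Longrightarrow> c \<otimes> x \<in> N" for N
    using N Nadd Nsmult
  proof (induction "card B - card N" arbitrary: N rule: less_induct)
    case less
    show ?case
    proof (cases "N = B")
      case True then show ?thesis using less.prems by auto
    next
      case False
      then obtain x where x: "x \<in> B" "x \<notin> N" using less.prems(1) by auto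
      define N' where "N' = (\<lambda>(n, c). n \<oplus> c \<otimes> x) ` (N \<times> C)"
      note cl = subsetD[OF subset_trans[OF less.prems(1) B(1)]] subsetD[OF C(1)] subsetD[OF B(1) x(1)] x(2)
      \<comment> \<open>Uniqueness of n + c x: if two coefficients differed, inverting their
        difference would put \<open>x\<close> into \<open>N\<close>.\<close>
      have "inj_on (\<lambda>(n, c). n \<oplus> c \<otimes> x) (N \<times> C)"
      proof (rule inj_onI, clarify)
        fix n c n' c' assume a: "n \<in> N" "c \<in> C" "n' \<in> N" "c' \<in> C" "n \<oplus> c \<otimes> x = n' \<oplus> c' \<otimes> x"
        note cr = cl(1)[OF a(1)] cl(1)[OF a(3)] cl(2)[OF a(2)] cl(2)[OF a(4)] cl(3)
        have "n' \<oplus> \<ominus> n = (n' \<oplus> c' \<otimes> x) \<oplus> \<ominus> n \<oplus> \<ominus> (c' \<otimes> x)"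
          using cr by algebra
        also have "\<dots> = (c \<ominus> c') \<otimes> x" unfolding a(5)[symmetric] using cr by algebra
        finally have e: "(c \<ominus> c') \<otimes> x = n' \<oplus> \<ominus> n" ..
        have "\<ominus> n = (\<ominus> \<one>) \<otimes> n" using cr by algebra
        then have "n' \<oplus> \<ominus> n \<in> N" using less.prems(4,5) a C_neg[OF C(3)] by metis
        have "c = c'"
        proof (rule ccontr)
          assume "c \<noteq> c'"
          then have "c \<ominus> c' \<noteq> \<zero>" using cr by (simp add: minus_eq) (metis a_inv_closed minus_equality minus_minus)
          then obtain y where y: "y \<in> C" "y \<otimes> (c \<ominus> c') = \<one>" using C_inv C_diff a by blast
          have "x = y \<otimes> ((c \<ominus> c') \<otimes> x)" using y cr cl(2)[OF y(1)] by (simp add: m_assoc[symmetric])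
          then show False using \<open>n' \<oplus> \<ominus> n \<in> N\<close> e less.prems(5)[OF y(1)] x(2) by metis
        qed
        moreover have "n = n'" using a(5) \<open>c = c'\<close> cr by (metis add.right_cancel m_closed)
        ultimately show "n = n' \<and> c = c'" by simp
      qed
      then have cN': "card N' = card N * card C"
        unfolding N'_def by (simp add: card_image card_cartesian_product)
      have N'_sub: "N' \<subseteq> B" unfolding N'_def using less.prems(1) x(1) B_add B_mult by auto
      obtain m where m: "card N = card C ^ m" using less.prems(3) by auto
      have "card N > 0" using m cC by simp
      then have "card N < card N'" using cN' cC by simp
      moreover have "card N' \<le> card B" using N'_sub finite_subset[OF B(1) fin] by (rule card_mono[rotated])
      ultimately have "card B - card N' < card B - card N" by linarith
      then show ?thesis
      proof (rule less.hyps)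
        show "N' \<subseteq> B" by (fact N'_sub)
        show "\<zero> \<in> N'" unfolding N'_def using less.prems(2) C(2) cl(3) by (force intro!: image_eqI[of _ _ "(\<zero>, \<zero>)"])
        show "\<exists>m. card N' = card C ^ m" using cN' m by (auto intro: exI[of _ "Suc m"])
        fix y z assume "y \<in> N'" "z \<in> N'"
        then obtain n c n' c' where a: "n \<in> N" "c \<in> C" "n' \<in> N" "c' \<in> C"
          "y = n \<oplus> c \<otimes> x" "z = n' \<oplus> c' \<otimes> x" unfolding N'_def by auto
        note cr = cl(1)[OF a(1)] cl(1)[OF a(3)] cl(2)[OF a(2)] cl(2)[OF a(4)] cl(3)
        have "y \<oplus> z = (n \<oplus> n') \<oplus> (c \<oplus> c') \<otimes> x" unfolding a using cr by algebra
        then show "y \<oplus> z \<in> N'" unfolding N'_def using a less.prems(4) C_add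
          by (intro image_eqI[of _ _ "(n \<oplus> n', c \<oplus> c')"]) auto
      next
        fix b y assume b: "b \<in> C" "y \<in> N'"
        then obtain n c where a: "n \<in> N" "c \<in> C" "y = n \<oplus> c \<otimes> x" unfolding N'_def by auto
        note cr = cl(1)[OF a(1)] cl(2)[OF a(2)] cl(2)[OF b(1)] cl(3)
        have "b \<otimes> y = (b \<otimes> n) \<oplus> (b \<otimes> c) \<otimes> x" unfolding a using cr by algebra
        then show "b \<otimes> y \<in> N'" unfolding N'_def using a b less.prems(5) C_mult
          by (intro image_eqI[of _ _ "(b \<otimes> n, b \<otimes> c)"]) auto
      qed
    qed
  qed
  show ?thesis
    proof (rule main[of "{\<zero>}"])
    show "\<exists>m. card {\<zero>} = card C ^ m" by (rule exI[of _ 0]) simp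
  qed (use C(1) B in auto)
qed

text \<open>Class equation of the unit group. Let \<open>q\<close> be the order of the centre and
  \<open>q ^ n\<close> that of the ring. A noncentral class has (q^n - 1)/(q^d - 1) elements for a
  proper divisor d of n, a number divisible by the \<open>c\<close> of
  \<open>cyclotomic_divisor\<close>. Hence \<open>c\<close> divides q^n - q, the number of
  noncentral units, and q^n - 1, so also their difference q - 1; but \<open>c\<close> is larger than
  that in absolute value.\<close>

theorem (in ring) wedderburn:
  assumes fin: "finite (carrier R)"
    and div: "\<And>x. x \<in> carrier R \<Longrightarrow> x \<noteq> \<zero> \<Longrightarrow> x \<in> Units R"
    and xy: "x \<in> carrier R" "y \<in> carrier R"
  shows "x \<otimes> y = y \<otimes> x"
proof (cases "\<one> = \<zero>")
  case True
  then have "carrier R = {\<zero>}" using one_zeroD by blast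
  then show ?thesis using xy by auto
next
  case nontriv: False
  \<comment> \<open>Centralizer of a set; working with sets treats the centre and the centralizers
    of single elements alike.\<close>
  define C where "C = (\<lambda>X. {y \<in> carrier R. \<forall>x\<in>X. x \<otimes> y = y \<otimes> x})"
  define Z where "Z = C (carrier R)"
  have Units: "Units R = carrier R - {\<zero>}"
  proof -
    have "\<zero> \<notin> Units R"
      using nontriv Units_l_inv_ex by force
    then show ?thesis using div Units_closed by blast
  qed
  have card_C': "\<exists>m. card B = card (C X) ^ m"
    if X: "X \<subseteq> carrier R" and B: "B \<subseteq> carrier R" "\<zero> \<in> B"
      "\<And>x y. x \<in> B \<Longrightarrow> y \<in> B \<Longrightarrow> x \<oplus> y \<in> B"
      "\<And>c x. c \<in> C X \<Longrightarrow> x \<in> B \<Longrightarrow> c \<otimes> x \<in> B" for X B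
  proof (rule card_power_of_division_subring)
    show "x \<ominus> y \<in> C X" if "x \<in> C X" "y \<in> C X" for x y
      using that X unfolding C_def by (auto simp: minus_eq l_distr r_distr l_minus r_minus)
    show "x \<otimes> y \<in> C X" if xy: "x \<in> C X" "y \<in> C X" for x y
    proof -
      have "z \<otimes> (x \<otimes> y) = x \<otimes> y \<otimes> z" if "z \<in> X" for z
      proof -
        have z: "x \<in> carrier R" "y \<in> carrier R" "z \<in> carrier R" "z \<otimes> x = x \<otimes> z" "z \<otimes> y = y \<otimes> z"
          using xy that X unfolding C_def by auto
        have "z \<otimes> (x \<otimes> y) = x \<otimes> (z \<otimes> y)" using z by (metis m_assoc)
        then show ?thesis using z by (simp add: m_assoc)
      qed
      then show ?thesis using xy unfolding C_def by auto
    qed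
    show "\<exists>y\<in>C X. y \<otimes> x = \<one>" if x: "x \<in> C X" "x \<noteq> \<zero>" for x
    proof -
      have xU: "x \<in> Units R" using x div unfolding C_def by auto
      have "inv x \<in> C X" unfolding C_def
      proof (clarsimp simp: xU)
        fix z assume "z \<in> X"
        then have z: "z \<in> carrier R" "z \<otimes> x = x \<otimes> z" using x X unfolding C_def by auto
        have "z \<otimes> inv x = inv x \<otimes> (x \<otimes> z) \<otimes> inv x" using z(1) xU by (simp add: m_assoc[symmetric] Units_closed)
        also have "\<dots> = inv x \<otimes> z" using z(1) xU by (simp add: z(2)[symmetric] m_assoc Units_closed)
        finally show "z \<otimes> inv x = inv x \<otimes> z" .
      qed
      then show ?thesis using xU Units_l_inv by blast
    qed
    show "\<zero> \<in> C X" "\<one> \<in> C X" using X unfolding C_def by auto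
    show "C X \<subseteq> carrier R" unfolding C_def by auto
  qed (use fin nontriv B in \<open>blast+\<close>)
  have card_C: "\<exists>m. card (carrier R) = card (C X) ^ m" if "X \<subseteq> carrier R" for X
    by (rule card_C'[OF that]) (auto simp: C_def)
  have C_one_zero: "{\<zero>, \<one>} \<subseteq> C X" if "X \<subseteq> carrier R" for X using that unfolding C_def by auto
  have finC: "finite (C X)" for X unfolding C_def using fin by simp
  have card_C2: "card (C X) \<ge> 2" if "X \<subseteq> carrier R" for X
    using card_mono[OF finC C_one_zero[OF that]] nontriv by simp
  define q where "q = card Z"
  have q2: "q \<ge> 2" unfolding q_def Z_def by (rule card_C2) simp
  obtain n where n: "card (carrier R) = q ^ n" using card_C[of "carrier R"] unfolding q_def Z_def by auto
  have Zsub: "Z \<subseteq> carrier R" unfolding Z_def C_def by auto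
  show ?thesis
  proof (cases "Z = carrier R")
    case True
    then show ?thesis using xy unfolding Z_def C_def by auto
  next
    case False
    then have "card Z < card (carrier R)" using Zsub fin by (simp add: psubset_card_mono psubset_eq)
    then have "q ^ 1 < q ^ n" using n q_def by simp
    then have n2: "n \<ge> 2" using q2 by (subst (asm) power_strict_increasing_iff) auto
    obtain c :: int where c: "c dvd int q ^ n - 1" "\<bar>c\<bar> > int q - 1"
      and cd: "\<And>d m. \<lbrakk>d > 0; d < n; d dvd n; (int q ^ d - 1) * m = int q ^ n - 1\<rbrakk> \<Longrightarrow> c dvd m"
      using cyclotomic_divisor[OF n2 q2] by blast
    define G where "G = units_of R"
    interpret G: group G unfolding G_def by (rule units_group)
    define \<psi> where "\<psi> = (\<lambda>g. \<lambda>h\<in>carrier G. g \<otimes>\<^bsub>G\<^esub> h \<otimes>\<^bsub>G\<^esub> inv\<^bsub>G\<^esub> g)"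
    interpret act: group_action G "carrier G" \<psi>
      unfolding \<psi>_def by (rule G.action_by_conjugation)
    have G_simps: "carrier G = carrier R - {\<zero>}" "\<And>g h. g \<otimes>\<^bsub>G\<^esub> h = g \<otimes> h" "\<one>\<^bsub>G\<^esub> = \<one>"
      unfolding G_def by (simp_all add: units_of_carrier units_of_mult units_of_one Units)
    have finG: "finite (carrier G)" using fin G_simps by simp
    have orderG: "Coset.order G = q ^ n - 1"
      unfolding Coset.order_def G_simps using n fin by (simp add: card_Diff_singleton)
    have stab: "stabilizer G \<psi> g = C {g} - {\<zero>}" if g: "g \<in> carrier G" for g
    proof -
      have "(\<psi> h g = g) = (g \<otimes> h = h \<otimes> g)" if h: "h \<in> carrier G" for h
      proof -
        have "\<psi> h g = g \<longleftrightarrow> h \<otimes>\<^bsub>G\<^esub> g = g \<otimes>\<^bsub>G\<^esub> h"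
          using g h unfolding \<psi>_def by (simp add: G.inv_solve_right')
        then show ?thesis by (auto simp: G_simps)
      qed
      then show ?thesis unfolding stabilizer_def C_def using G_simps(1) by auto
    qed
    have orb: "c dvd int (card (orbit G \<psi> g))" if g: "g \<in> carrier G" "g \<notin> Z" for g
    proof -
      have gR: "{g} \<subseteq> carrier R" using g G_simps by auto
      have "C {g} \<noteq> carrier R"
        using g(2) gR unfolding Z_def C_def by force
      moreover have "C {g} \<subseteq> carrier R" unfolding C_def by auto
      ultimately have lt: "card (C {g}) < card (carrier R)" using fin by (simp add: psubset_card_mono psubset_eq)
      \<comment> \<open>The centralizer is a vector space over the centre, which gives
        \<open>d\<close>. The ring is a vector space over the centralizer, which below makes
        \<open>d\<close> a divisor of \<open>n\<close>.\<close>
      obtain d where d: "card (C {g}) = q ^ d"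
      proof -
        have ZC: "Z \<subseteq> C {g}" unfolding Z_def C_def using gR by auto
        have "\<exists>m. card (C {g}) = card Z ^ m"
          unfolding Z_def
        proof (rule card_C')
          show "c \<otimes> x \<in> C {g}" if cx: "c \<in> C (carrier R)" "x \<in> C {g}" for c x
          proof -
            have z: "x \<in> carrier R" "c \<in> carrier R" "g \<in> carrier R" "g \<otimes> x = x \<otimes> g" "g \<otimes> c = c \<otimes> g"
              using cx gR unfolding C_def by auto
            have "g \<otimes> (c \<otimes> x) = c \<otimes> (g \<otimes> x)" using z by (metis m_assoc)
            then have "g \<otimes> (c \<otimes> x) = c \<otimes> x \<otimes> g" using z by (simp add: m_assoc)
            then show ?thesis using z unfolding C_def by auto
          qed
        qed (use gR in \<open>auto simp: C_def r_distr l_distr\<close>)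
        then show thesis using that unfolding q_def by auto
      qed
      obtain m where m: "card (carrier R) = card (C {g}) ^ m" using card_C[OF gR] by auto
      have "q ^ (d * m) = q ^ n" using m d n by (simp add: power_mult)
      then have dm: "d * m = n" using q2 by (subst (asm) power_inject_exp) auto
      have "d < n" using lt d n q2 by (simp add: power_strict_increasing_iff)
      moreover have "d > 0" using card_C2[OF gR] d by (cases d) auto
      moreover have "(int q ^ d - 1) * int (card (orbit G \<psi> g)) = int q ^ n - 1"
      proof -
        have "card (orbit G \<psi> g) * (q ^ d - 1) = q ^ n - 1"
          using act.orbit_stabilizer_theorem[OF g(1)] orderG stab[OF g(1)] d C_one_zero[OF gR] finC
          by (simp add: card_Diff_singleton)
        then have "int (card (orbit G \<psi> g)) * int (q ^ d - 1) = int (q ^ n - 1)"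
          by (metis of_nat_mult)
        then show ?thesis using q2 by (simp add: of_nat_diff mult.commute)
      qed
      ultimately show ?thesis using cd dm by (metis dvd_triv_left)
    qed
    define M where "M = {g \<in> carrier G. g \<notin> Z}"
    have orbM: "orbit G \<psi> g \<subseteq> M" if g: "g \<in> M" for g
    proof
      fix h assume h: "h \<in> orbit G \<psi> g"
      then have hG: "h \<in> carrier G" using act.element_image g unfolding orbit_def M_def by auto
      have "h \<notin> Z"
      proof
        assume "h \<in> Z"
        have "g \<in> orbit G \<psi> h" using act.orbit_sym g h hG unfolding M_def by auto
        then obtain k where k: "k \<in> carrier G" "g = k \<otimes>\<^bsub>G\<^esub> h \<otimes>\<^bsub>G\<^esub> inv\<^bsub>G\<^esub> k"
          using hG unfolding orbit_def \<psi>_def by auto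
        have "k \<otimes>\<^bsub>G\<^esub> h = h \<otimes>\<^bsub>G\<^esub> k" using \<open>h \<in> Z\<close> k(1) unfolding Z_def C_def by (auto simp: G_simps)
        then have "g = h" using k hG by (simp add: G.m_assoc)
        then show False using g \<open>h \<in> Z\<close> unfolding M_def by auto
      qed
      then show "h \<in> M" using hG unfolding M_def by auto
    qed
    have "nat \<bar>c\<bar> dvd card (\<Union> (orbit G \<psi> ` M))"
    proof (rule dvd_partition)
      have MG: "M \<subseteq> carrier G" unfolding M_def by auto
      show "finite (\<Union> (orbit G \<psi> ` M))" using orbM MG finG by (meson UN_least finite_subset)
      show "\<forall>X\<in>orbit G \<psi> ` M. nat \<bar>c\<bar> dvd card X" using orb unfolding M_def by auto
      show "\<forall>X\<in>orbit G \<psi> ` M. \<forall>Y\<in>orbit G \<psi> ` M. X \<noteq> Y \<longrightarrow> X \<inter> Y = {}"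
        using act.disjoint_union MG unfolding orbits_def by (smt (verit, best) imageE mem_Collect_eq subset_iff)
    qed
    moreover have "\<Union> (orbit G \<psi> ` M) = M"
      using orbM act.orbit_refl unfolding M_def by blast
    moreover have "card M = q ^ n - q"
    proof -
      have "M = carrier R - Z" unfolding M_def G_simps using C_one_zero[of "carrier R"] Z_def by auto
      then show ?thesis using n q_def Zsub fin by (simp add: card_Diff_subset finite_subset)
    qed
    ultimately have "c dvd int (q ^ n - q)" by (simp add: nat_dvd_iff)
    moreover have "q \<le> q ^ n" using n2 q2 by (intro self_le_power) auto
    ultimately have "c dvd int q ^ n - int q" by (simp add: of_nat_diff)
    with c(1) have "c dvd (int q ^ n - 1) - (int q ^ n - int q)" by (rule dvd_diff)
    then have "\<bar>c\<bar> \<le> int q - 1" using q2 by (intro zdvd_imp_le) (auto simp: abs_dvd_iff)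
    then show ?thesis using c(2) by simp
  qed
qed

hide_const (open) Polynomial.order

section \<open>Elementary abelian groups with an action\<close>

lemma hom_finprod:
  assumes "comm_group G" "comm_group H" "f \<in> hom G H" "g \<in> A \<rightarrow> carrier G"
  shows "f (finprod G g A) = finprod H (\<lambda>i. f (g i)) A"
proof -
  interpret G: comm_group G by fact
  interpret H: comm_group H by fact
  interpret group_hom G H f using assms(3) by unfold_locales
  show ?thesis
    using assms(4)
  proof (induction A rule: infinite_finite_induct)
    case (insert x A)
    then have "g x \<in> carrier G" "g \<in> A \<rightarrow> carrier G" "(\<lambda>i. f (g i)) \<in> A \<rightarrow> carrier H"
      using hom_closed by (auto simp: Pi_iff)
    then show ?case using insert by simp
  qed auto
qed

lemma (in comm_group) finprod_comm_closed_subgroup: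
  assumes "subgroup N G" "f \<in> A \<rightarrow> N"
  shows "finprod G f A \<in> N"
proof -
  interpret N: subgroup N G by fact
  show ?thesis
    using assms(2)
  proof (induction A rule: infinite_finite_induct)
    case (insert x A)
    then have "f \<in> A \<rightarrow> carrier G" "f x \<in> carrier G" using N.subset by auto
    then show ?case using insert by simp
  qed auto
qed

lemma (in comm_group) finprod_int_pow:
  assumes "f \<in> A \<rightarrow> carrier G"
  shows "finprod G f A [^] (m::int) = finprod G (\<lambda>i. f i [^] m) A"
proof (rule hom_finprod[where f = "\<lambda>x. x [^] m"])
  show "(\<lambda>x. x [^] m) \<in> hom G G" by (auto simp: hom_def int_pow_distrib)
qed (use assms comm_group_axioms in auto)

section \<open>Coordinates in finite elementary abelian groups\<close>

locale elementary_abelian_group = comm_group V for V (structure) +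
  fixes p :: nat
  assumes prime_p: "Factorial_Ring.prime p"
    and finite_V: "finite (carrier V)"
    and exponent_p: "x \<in> carrier V \<Longrightarrow> x [^] p = \<one>"
begin

lemma int_pow_dvd: "x \<in> carrier V \<Longrightarrow> int p dvd m \<Longrightarrow> x [^] m = \<one>"
  by (auto elim!: dvdE simp: int_pow_pow[symmetric] int_pow_int exponent_p)

lemma int_pow_cong:
  assumes "x \<in> carrier V" "[m = n] (mod int p)"
  shows "x [^] m = x [^] n"
proof -
  have "x [^] (m - n) = \<one>" using assms by (intro int_pow_dvd) (auto simp: cong_iff_dvd_diff)
  then show ?thesis using assms(1) by (simp add: int_pow_diff inv_solve_right')
qed

text \<open>Exponents matter only modulo \<open>p\<close>, so for \<open>m\<close> prime to
  \<open>p\<close> the element \<open>x\<close> is itself a power of \<open>x [^] m\<close>.\<close>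

lemma int_pow_in_subgroup_dvd:
  assumes H: "subgroup H V" and x: "x \<in> carrier V" "x \<notin> H" and m: "x [^] (m::int) \<in> H"
  shows "int p dvd m"
proof (rule ccontr)
  assume "\<not> int p dvd m"
  then have "coprime m (int p)"
    using prime_imp_coprime[of "int p" m] prime_p by (simp add: coprime_commute)
  then obtain n where "[m * n = 1] (mod int p)" using cong_solve_coprime_int by blast
  then have "x [^] (m * n) = x" using int_pow_cong[OF x(1)] x(1) by simp
  then have "(x [^] m) [^] n = x" using x(1) by (simp add: int_pow_pow)
  then show False using x(2) subgroup_int_pow_closed[OF H m] by metis
qed

text \<open>The coordinate functions live on all of \<open>V\<close>, not just on \<open>U\<close>:
  x -> \<Prod> u^(\<chi> u x) is then a projection of \<open>V\<close> onto \<open>U\<close>, which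
  \<open>maschke\<close> averages. They are built along a chain of subgroups \<open>H\<close> from 1
  to \<open>V\<close>, adjoining one element at a time.\<close>

theorem coordinates:
  assumes U: "subgroup U V"
  obtains I \<chi> where "I \<subseteq> U"
    "\<And>u x y. \<lbrakk>u \<in> I; x \<in> carrier V; y \<in> carrier V\<rbrakk> \<Longrightarrow> [\<chi> u (x \<otimes> y) = \<chi> u x + \<chi> u y] (mod int p)"
    "\<And>x. x \<in> U \<Longrightarrow> x = (\<Otimes>u\<in>I. u [^] (\<chi> u x :: int))"
proof -
  interpret U: subgroup U V by fact
  \<comment> \<open>State of the construction at \<open>H\<close>: functionals defined on
    \<open>H\<close> that serve as coordinates for \<open>U \<inter> H\<close>.\<close>
  define Q where "Q = (\<lambda>H I \<chi>. I \<subseteq> U \<inter> H \<and>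
    (\<forall>u\<in>I. \<forall>x\<in>H. \<forall>y\<in>H. [\<chi> u (x \<otimes> y) = \<chi> u x + \<chi> u y] (mod int p)) \<and>
    (\<forall>x\<in>U \<inter> H. x = (\<Otimes>u\<in>I. u [^] (\<chi> u x :: int))))"
  have main: "\<exists>I \<chi>. Q (carrier V) I \<chi>" if "subgroup H V" "Q H I0 \<chi>0" for H I0 \<chi>0
    using that
  proof (induction "card (carrier V) - card H" arbitrary: H I0 \<chi>0 rule: less_induct)
    case less
    interpret H: subgroup H V by (fact less.prems)
    show ?case
    proof (cases "H = carrier V")
      case True then show ?thesis using less.prems by auto
    next
      case False
      \<comment> \<open>New elements are taken from \<open>U\<close> as long as \<open>U\<close> is
        not exhausted. Once \<open>x\<close> lies outside \<open>U\<close>, all of \<open>U\<close>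
        is already in \<open>H\<close>, so the generators stay as they are and only the functionals
        are extended.\<close>
      obtain x where x: "x \<in> carrier V" "x \<notin> H" "x \<in> U \<or> U \<subseteq> H"
      proof (cases "U \<subseteq> H")
        case True then show ?thesis using False that H.subset by auto
      next
        case False then show ?thesis using that U.subset by auto
      qed
      define H' where "H' = {y \<in> carrier V. \<exists>j::int. y \<otimes> x [^] (- j) \<in> H}"
      \<comment> \<open>The exponent of \<open>x\<close> in \<open>y\<close> is determined only
        modulo \<open>p\<close>, which is why it is chosen; the component \<open>r y\<close> in
        \<open>H\<close> is nevertheless unique, as \<open>rep\<close> shows.\<close>
      define ex where "ex = (\<lambda>y. SOME j::int. y \<otimes> x [^] (- j) \<in> H)"
      define r where "r = (\<lambda>y. y \<otimes> x [^] (- ex y))"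
      have r: "r y \<in> H" if "y \<in> H'" for y
        using that someI_ex[of "\<lambda>j::int. y \<otimes> x [^] (- j) \<in> H"] unfolding H'_def r_def ex_def by auto
      have yr: "y = r y \<otimes> x [^] (ex y)" if "y \<in> H'" for y
        using that x(1) unfolding H'_def r_def by (simp add: m_assoc int_pow_neg)
      have rep: "y \<in> H'" "[ex y = j] (mod int p)" "r y = h"
        if "h \<in> H" "y = h \<otimes> x [^] (j::int)" for y h j
      proof -
        have y: "y \<in> carrier V" using that x(1) H.subset by auto
        have hj: "y \<otimes> x [^] (- j) = h"
          using that x(1) H.subset by (simp add: m_assoc int_pow_neg subset_iff)
        then show yH': "y \<in> H'" unfolding H'_def using y that(1) by auto
        have "x [^] (j - ex y) = inv h \<otimes> r y"
        proof -
          have "h \<otimes> x [^] (j - ex y) = r y"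
            unfolding r_def using that x(1) H.subset
            by (simp add: m_assoc int_pow_diff int_pow_neg subset_iff)
          then show ?thesis using that(1) H.subset x(1) 
            by (metis H.mem_carrier int_pow_closed inv_solve_left r_def y m_closed)
        qed
        then have "x [^] (j - ex y) \<in> H" using r[OF yH'] that(1) by simp
        then have "int p dvd j - ex y" by (rule int_pow_in_subgroup_dvd[OF less.prems(1) x(1,2)])
        then show c: "[ex y = j] (mod int p)" by (simp add: cong_iff_dvd_diff dvd_diff_commute)
        then have "[- ex y = - j] (mod int p)" by (simp add: cong_minus_minus_iff)
        then have "x [^] (- ex y) = x [^] (- j)" by (rule int_pow_cong[OF x(1)])
        then show "r y = h" unfolding r_def using hj by simp
      qed
      have Hr: "h \<in> H'" "[ex h = 0] (mod int p)" "r h = h" if "h \<in> H" for h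
        using rep[OF that, of h 0] that H.subset by auto
      have mult: "y \<otimes> z \<in> H'" "[ex (y \<otimes> z) = ex y + ex z] (mod int p)" "r (y \<otimes> z) = r y \<otimes> r z"
        if yz: "y \<in> H'" "z \<in> H'" for y z
      proof -
        have c: "r y \<in> carrier V" "r z \<in> carrier V" using r yz H.subset by auto
        have "y \<otimes> z = (r y \<otimes> x [^] ex y) \<otimes> (r z \<otimes> x [^] ex z)"
          using yr yz by metis
        also have "\<dots> = (r y \<otimes> r z) \<otimes> x [^] (ex y + ex z)"
          using c x(1) by (simp add: int_pow_mult m_ac)
        finally have "y \<otimes> z = (r y \<otimes> r z) \<otimes> x [^] (ex y + ex z)" .
        from rep[OF _ this] r yz
        show "y \<otimes> z \<in> H'" "[ex (y \<otimes> z) = ex y + ex z] (mod int p)" "r (y \<otimes> z) = r y \<otimes> r z" by auto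
      qed
      have H'_sub: "subgroup H' V"
      proof (rule subgroup.intro)
        show "H' \<subseteq> carrier V" unfolding H'_def by auto
        show "\<one> \<in> H'" using Hr by auto
        show "inv y \<in> H'" if y: "y \<in> H'" for y
        proof (rule rep(1))
          have yc: "y \<in> carrier V" using y unfolding H'_def by auto
          show "inv (r y) \<in> H" using r[OF y] by simp
          have "inv y = inv (r y \<otimes> x [^] (ex y))" using yr[OF y] by simp
          then show "inv y = inv (r y) \<otimes> x [^] (- ex y)"
            using r[OF y] x(1) H.subset by (simp add: inv_mult int_pow_neg subset_iff)
        qed
      qed (use mult in auto)
      have xH': "x \<in> H'" "[ex x = 1] (mod int p)" "r x = \<one>"
        using rep[of \<one> x 1] x(1) by auto
      have HH': "H \<subset> H'" using Hr(1) xH'(1) x(2) by auto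
      have finH': "finite H'" unfolding H'_def using finite_V by simp
      have "card H < card H'" using HH' finH' by (rule psubset_card_mono[rotated])
      moreover have "card H' \<le> card (carrier V)"
        using finite_V by (intro card_mono) (auto simp: H'_def)
      ultimately have lt: "card (carrier V) - card H' < card (carrier V) - card H" by linarith
      have I0: "I0 \<subseteq> U" "I0 \<subseteq> H" "finite I0"
        and \<chi>0: "\<And>u y z. \<lbrakk>u \<in> I0; y \<in> H; z \<in> H\<rbrakk> \<Longrightarrow> [\<chi>0 u (y \<otimes> z) = \<chi>0 u y + \<chi>0 u z] (mod int p)"
        and gen0: "\<And>y. \<lbrakk>y \<in> U; y \<in> H\<rbrakk> \<Longrightarrow> y = (\<Otimes>u\<in>I0. u [^] (\<chi>0 u y :: int))"
        using less.prems(2) finite_subset[OF _ finite_subset[OF H.subset finite_V]] unfolding Q_def by auto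
      \<comment> \<open>Old functionals are extended through the projection \<open>r\<close>, so
        they vanish at \<open>x\<close>; the new one is the exponent of \<open>x\<close>.\<close>
      define \<chi> where "\<chi> = (\<lambda>u y. if u = x then ex y else \<chi>0 u (r y))"
      define I where "I = (if x \<in> U then insert x I0 else I0)"
      have I0c: "I0 \<subseteq> carrier V" using I0 H.subset by auto
      have "Q H' I \<chi>"
        unfolding Q_def
      proof (intro conjI ballI)
        show "I \<subseteq> U \<inter> H'" unfolding I_def using I0 Hr(1) xH'(1) by auto
        show "[\<chi> u (y \<otimes> z) = \<chi> u y + \<chi> u z] (mod int p)" if "u \<in> I" "y \<in> H'" "z \<in> H'" for u y z
          unfolding \<chi>_def using that mult \<chi>0 r by (auto simp: I_def split: if_splits)
        fix y assume "y \<in> U \<inter> H'"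
        then have y: "y \<in> U" "y \<in> H'" by auto
        have eqI0: "(\<Otimes>u\<in>I0. u [^] \<chi> u y) = (\<Otimes>u\<in>I0. u [^] \<chi>0 u (r y))"
          unfolding \<chi>_def using I0 x(2) I0c by (intro finprod_cong') auto
        show "y = (\<Otimes>u\<in>I. u [^] \<chi> u y)"
        proof (cases "x \<in> U")
          case True
          have "r y \<in> U" unfolding r_def using True y(1) by (simp add: subgroup_int_pow_closed[OF U])
          then have ry: "r y = (\<Otimes>u\<in>I0. u [^] \<chi> u y)" unfolding eqI0 using gen0 r[OF y(2)] by auto
          have "x \<notin> I0" using I0 x(2) by auto
          then have "(\<Otimes>u\<in>I. u [^] \<chi> u y) = x [^] ex y \<otimes> r y"
            unfolding I_def using True I0(3) x(1) I0c ry by (subst if_P, simp, subst finprod_insert) (auto simp: \<chi>_def)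
          also have "\<dots> = y" using yr[OF y(2)] x(1) r[OF y(2)] H.subset by (simp add: m_comm subset_iff)
          finally show ?thesis ..
        next
          case False
          then have "y \<in> H" using x(3) y(1) by auto
          then show ?thesis using Hr(3) gen0 y(1) eqI0 False unfolding I_def by simp
        qed
      qed
      then show ?thesis using less.hyps[OF lt H'_sub] by blast
    qed
  qed
  have "Q {\<one>} {} (\<lambda>_ _. 0)" unfolding Q_def by auto
  from main[OF triv_subgroup this] obtain I \<chi> where "Q (carrier V) I \<chi>" by blast
  then have "I \<subseteq> U"
    "\<And>u x y. \<lbrakk>u \<in> I; x \<in> carrier V; y \<in> carrier V\<rbrakk> \<Longrightarrow> [\<chi> u (x \<otimes> y) = \<chi> u x + \<chi> u y] (mod int p)"
    "\<And>x. x \<in> U \<Longrightarrow> x = (\<Otimes>u\<in>I. u [^] (\<chi> u x :: int))"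
    unfolding Q_def using U.subset by auto
  then show thesis by (rule that)
qed

end

section \<open>Finite modules over \<F>_p E with E of order prime to p\<close>

locale elementary_abelian_module = elementary_abelian_group V p + E: group E
  for V (structure) and p and E (structure) +
  fixes act
  assumes finite_E: "finite (carrier E)"
    and coprime_E: "coprime (order E) p"
    and act_hom: "e \<in> carrier E \<Longrightarrow> act e \<in> hom V V"
    and act_mult: "\<lbrakk>e \<in> carrier E; f \<in> carrier E; x \<in> carrier V\<rbrakk> \<Longrightarrow> act (e \<otimes>\<^bsub>E\<^esub> f) x = act e (act f x)"
    and act_one: "x \<in> carrier V \<Longrightarrow> act \<one>\<^bsub>E\<^esub> x = x"
begin

definition stable :: "'a set \<Rightarrow> bool" where
  "stable N \<longleftrightarrow> subgroup N V \<and> (\<forall>e\<in>carrier E. \<forall>x\<in>N. act e x \<in> N)"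

definition simple :: "'a set \<Rightarrow> bool" where
  "simple N \<longleftrightarrow> stable N \<and> N \<noteq> {\<one>} \<and> (\<forall>M. stable M \<longrightarrow> M \<subseteq> N \<longrightarrow> M = {\<one>} \<or> M = N)"

text \<open>The elements of D. Linearity over \<F>_p is automatic, as scalars act by powers.\<close>

definition endo :: "('a \<Rightarrow> 'a) \<Rightarrow> bool" where
  "endo \<tau> \<longleftrightarrow> \<tau> \<in> hom V V \<and> (\<forall>e\<in>carrier E. \<forall>x\<in>carrier V. \<tau> (act e x) = act e (\<tau> x))"

definition direct_sum :: "'a set set \<Rightarrow> bool" where
  "direct_sum \<S> \<longleftrightarrow> finite \<S> \<and> bij_betw (\<lambda>f. finprod V f \<S>) (\<Pi>\<^sub>E N\<in>\<S>. N) (carrier V)"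

lemma act_closed [simp, intro]: "\<lbrakk>e \<in> carrier E; x \<in> carrier V\<rbrakk> \<Longrightarrow> act e x \<in> carrier V"
  using act_hom hom_in_carrier by metis

lemma act_dist: "\<lbrakk>e \<in> carrier E; x \<in> carrier V; y \<in> carrier V\<rbrakk> \<Longrightarrow> act e (x \<otimes> y) = act e x \<otimes> act e y"
  using act_hom hom_mult by metis

lemma act_int_pow: "\<lbrakk>e \<in> carrier E; x \<in> carrier V\<rbrakk> \<Longrightarrow> act e (x [^] (m::int)) = act e x [^] m"
  by (rule hom_int_pow[OF act_hom]) (auto intro: group_axioms)

lemma act_finprod:
  "\<lbrakk>e \<in> carrier E; f \<in> A \<rightarrow> carrier V\<rbrakk> \<Longrightarrow> act e (finprod V f A) = (\<Otimes>i\<in>A. act e (f i))"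
  by (rule hom_finprod[OF comm_group_axioms comm_group_axioms act_hom])

lemma stableD:
  assumes "stable N"
  shows "subgroup N V" "N \<subseteq> carrier V" "\<one> \<in> N"
    "\<And>x y. x \<in> N \<Longrightarrow> y \<in> N \<Longrightarrow> x \<otimes> y \<in> N" "\<And>x. x \<in> N \<Longrightarrow> inv x \<in> N"
    "\<And>e x. e \<in> carrier E \<Longrightarrow> x \<in> N \<Longrightarrow> act e x \<in> N"
proof -
  show N: "subgroup N V" using assms unfolding stable_def by auto
  then interpret subgroup N V .
  show "N \<subseteq> carrier V" "\<one> \<in> N" "\<And>x y. x \<in> N \<Longrightarrow> y \<in> N \<Longrightarrow> x \<otimes> y \<in> N" "\<And>x. x \<in> N \<Longrightarrow> inv x \<in> N"
    by (auto simp: subset)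
qed (use assms in \<open>auto simp: stable_def\<close>)

lemma endoD:
  assumes "endo \<tau>"
  shows "\<tau> \<in> hom V V" "\<And>x. x \<in> carrier V \<Longrightarrow> \<tau> x \<in> carrier V"
    "\<And>x y. \<lbrakk>x \<in> carrier V; y \<in> carrier V\<rbrakk> \<Longrightarrow> \<tau> (x \<otimes> y) = \<tau> x \<otimes> \<tau> y"
    "\<And>e x. \<lbrakk>e \<in> carrier E; x \<in> carrier V\<rbrakk> \<Longrightarrow> \<tau> (act e x) = act e (\<tau> x)"
    "\<tau> \<one> = \<one>" "\<And>x. x \<in> carrier V \<Longrightarrow> \<tau> (inv x) = inv (\<tau> x)"
proof -
  show \<tau>: "\<tau> \<in> hom V V" using assms unfolding endo_def by auto
  then interpret group_hom V V \<tau> by unfold_locales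
  show "\<tau> \<one> = \<one>" "\<And>x. x \<in> carrier V \<Longrightarrow> \<tau> (inv x) = inv (\<tau> x)" by auto
qed (use assms in \<open>auto simp: endo_def hom_def\<close>)

lemma endo_comp: "endo \<sigma> \<Longrightarrow> endo \<tau> \<Longrightarrow> endo (\<lambda>x. \<sigma> (\<tau> x))"
  unfolding endo_def hom_def by (auto simp: Pi_iff)

text \<open>Values outside \<open>N\<close> are unconstrained, so a global map serves as a map on a
  submodule without being restricted.\<close>

definition stable_hom :: "('a \<Rightarrow> 'a) \<Rightarrow> 'a set \<Rightarrow> 'a set \<Rightarrow> bool" where
  "stable_hom h N N' \<longleftrightarrow> h \<in> N \<rightarrow> N' \<and> (\<forall>x\<in>N. \<forall>y\<in>N. h (x \<otimes> y) = h x \<otimes> h y) \<and>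
     (\<forall>e\<in>carrier E. \<forall>x\<in>N. h (act e x) = act e (h x))"

lemma stable_carrier: "stable (carrier V)"
  unfolding stable_def by (auto simp: subgroup_self)

lemma endo_stable_hom: "endo \<tau> \<longleftrightarrow> stable_hom \<tau> (carrier V) (carrier V)"
  unfolding endo_def stable_hom_def hom_def by auto

lemma endo_restrict: "\<lbrakk>endo \<tau>; stable N; \<tau> \<in> N \<rightarrow> N'\<rbrakk> \<Longrightarrow> stable_hom \<tau> N N'"
  using stableD(2)[of N] endoD(3,4)[of \<tau>] unfolding stable_hom_def by (simp add: subset_iff)

lemma stable_homD:
  assumes "stable_hom h N N'"
  shows "\<And>x. x \<in> N \<Longrightarrow> h x \<in> N'"
    "\<And>x y. \<lbrakk>x \<in> N; y \<in> N\<rbrakk> \<Longrightarrow> h (x \<otimes> y) = h x \<otimes> h y"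
    "\<And>e x. \<lbrakk>e \<in> carrier E; x \<in> N\<rbrakk> \<Longrightarrow> h (act e x) = act e (h x)"
  using assms unfolding stable_hom_def by auto

lemma stable_hom_one_inv:
  assumes h: "stable_hom h N N'" and N: "stable N" and N': "stable N'"
  shows "h \<one> = \<one>" "x \<in> N \<Longrightarrow> h (inv x) = inv (h x)"
proof -
  note hD = stable_homD[OF h] and ND = stableD[OF N] and N'D = stableD[OF N']
  have "h \<one> \<otimes> h \<one> = h \<one>" using hD(2)[OF ND(3) ND(3)] by simp
  then show one: "h \<one> = \<one>" using subsetD[OF N'D(2) hD(1)[OF ND(3)]] by (simp add: r_cancel_one')
  assume x: "x \<in> N"
  have "h (inv x) \<otimes> h x = \<one>"
    using hD(2)[OF ND(5)[OF x] x] subsetD[OF ND(2) x] one by simp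
  then show "h (inv x) = inv (h x)"
    using inv_equality subsetD[OF N'D(2) hD(1)[OF ND(5)[OF x]]] subsetD[OF N'D(2) hD(1)[OF x]] by metis
qed

lemma act_fix_one: "e \<in> carrier E \<Longrightarrow> act e \<one> = \<one>"
  using hom_one[OF act_hom] group_axioms by blast

lemma stable_hom_image:
  assumes h: "stable_hom h N N'" and N: "stable N" and N': "stable N'"
  shows "stable (h ` N)"
proof -
  note hD = stable_homD[OF h] and ND = stableD[OF N] and N'D = stableD[OF N']
  show ?thesis
    unfolding stable_def
  proof (intro conjI ballI subgroup.intro)
    show "h ` N \<subseteq> carrier V" using hD(1) N'D(2) by auto
    show "\<one> \<in> h ` N" using stable_hom_one_inv(1)[OF h N N'] ND(3) by (metis imageI)
    fix x assume "x \<in> h ` N"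
    then obtain u where u: "u \<in> N" "x = h u" by auto
    show "inv x \<in> h ` N"
      using stable_hom_one_inv(2)[OF h N N' u(1)] ND(5)[OF u(1)] u(2) by (metis imageI)
    show "act e x \<in> h ` N" if "e \<in> carrier E" for e
      using hD(3)[OF that u(1)] ND(6)[OF that u(1)] u(2) by (metis imageI)
    fix y assume "y \<in> h ` N"
    then obtain v where v: "v \<in> N" "y = h v" by auto
    show "x \<otimes> y \<in> h ` N"
      using hD(2)[OF u(1) v(1)] ND(4)[OF u(1) v(1)] u(2) v(2) by (metis imageI)
  qed
qed

lemma stable_hom_kernel:
  assumes h: "stable_hom h N N'" and N: "stable N" and N': "stable N'"
  shows "stable {x \<in> N. h x = \<one>}"
proof -
  note hD = stable_homD[OF h] and ND = stableD[OF N] and N'D = stableD[OF N']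
  show ?thesis
    unfolding stable_def
  proof (intro conjI ballI subgroup.intro)
    show "{x \<in> N. h x = \<one>} \<subseteq> carrier V" using ND(2) by auto
    show "\<one> \<in> {x \<in> N. h x = \<one>}" using stable_hom_one_inv(1)[OF h N N'] ND(3) by simp
  next
    fix x y assume "x \<in> {x \<in> N. h x = \<one>}" "y \<in> {x \<in> N. h x = \<one>}"
    then show "x \<otimes> y \<in> {x \<in> N. h x = \<one>}" using ND(4) hD(2)[of x y] by auto
  next
    fix x assume "x \<in> {x \<in> N. h x = \<one>}"
    then show "inv x \<in> {x \<in> N. h x = \<one>}"
      using ND(5)[of x] stable_hom_one_inv(2)[OF h N N', of x] by auto
  next
    fix e x assume "e \<in> carrier E" "x \<in> {x \<in> N. h x = \<one>}"
    then show "act e x \<in> {x \<in> N. h x = \<one>}" using ND(6)[of e x] hD(3)[of e x] act_fix_one by auto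
  qed
qed

text \<open>The product of all conjugates e q e^-1 is equivariant, because translating the index e
  by f permutes the conjugates. There is no division by |E| here, so the result is |E| times an
  average.\<close>

lemma endo_from_hom_on:
  assumes N: "stable N" and q: "q \<in> hom V V" "\<And>x. x \<in> carrier V \<Longrightarrow> q x \<in> N"
  shows "endo (\<lambda>x. \<Otimes>e\<in>carrier E. act e (q (act (inv\<^bsub>E\<^esub> e) x)))"
    and "x \<in> carrier V \<Longrightarrow> (\<Otimes>e\<in>carrier E. act e (q (act (inv\<^bsub>E\<^esub> e) x))) \<in> N"
proof -
  note ND = stableD[OF N]
  let ?r = "\<lambda>x. \<Otimes>e\<in>carrier E. act e (q (act (inv\<^bsub>E\<^esub> e) x))"
  have qc: "q x \<in> carrier V" if "x \<in> carrier V" for x using subsetD[OF ND(2) q(2)[OF that]] .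
  have fc: "(\<lambda>e. act e (q (act (inv\<^bsub>E\<^esub> e) x))) \<in> carrier E \<rightarrow> carrier V" if "x \<in> carrier V" for x
    using that qc by auto
  show rN: "x \<in> carrier V \<Longrightarrow> ?r x \<in> N" for x
    by (intro finprod_comm_closed_subgroup[OF ND(1)] Pi_I ND(6) q(2) act_closed E.inv_closed)
  have dist: "?r (x \<otimes> y) = ?r x \<otimes> ?r y" if "x \<in> carrier V" "y \<in> carrier V" for x y
  proof -
    have "?r x \<otimes> ?r y =
        (\<Otimes>e\<in>carrier E. act e (q (act (inv\<^bsub>E\<^esub> e) x)) \<otimes> act e (q (act (inv\<^bsub>E\<^esub> e) y)))"
      by (rule finprod_multf[OF fc[OF that(1)] fc[OF that(2)], symmetric])
    also have "\<dots> = ?r (x \<otimes> y)"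
      using that by (intro finprod_cong') (auto simp: act_dist hom_mult[OF q(1)] qc)
    finally show ?thesis ..
  qed
  have equi: "?r (act f x) = act f (?r x)" if f: "f \<in> carrier E" and x: "x \<in> carrier V" for f x
  proof -
    have fim: "(\<lambda>e. f \<otimes>\<^bsub>E\<^esub> e) ` carrier E = carrier E" using f by (rule E.surj_const_mult)
    have "?r (act f x) = (\<Otimes>e\<in>(\<lambda>e. f \<otimes>\<^bsub>E\<^esub> e) ` carrier E. act e (q (act (inv\<^bsub>E\<^esub> e) (act f x))))"
      unfolding fim ..
    also have "\<dots> = (\<Otimes>e\<in>carrier E. act (f \<otimes>\<^bsub>E\<^esub> e) (q (act (inv\<^bsub>E\<^esub> (f \<otimes>\<^bsub>E\<^esub> e)) (act f x))))"
      using f x by (intro finprod_reindex) (auto simp: E.inj_on_cmult qc)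
    also have "\<dots> = (\<Otimes>e\<in>carrier E. act f (act e (q (act (inv\<^bsub>E\<^esub> e) x))))"
    proof (rule finprod_cong')
      fix e assume e: "e \<in> carrier E"
      have "inv\<^bsub>E\<^esub> (f \<otimes>\<^bsub>E\<^esub> e) \<otimes>\<^bsub>E\<^esub> f = inv\<^bsub>E\<^esub> e"
        using e f by (simp add: E.inv_mult_group E.m_assoc)
      then have "act (inv\<^bsub>E\<^esub> (f \<otimes>\<^bsub>E\<^esub> e)) (act f x) = act (inv\<^bsub>E\<^esub> e) x"
        using act_mult[of "inv\<^bsub>E\<^esub> (f \<otimes>\<^bsub>E\<^esub> e)" f x] e f x by simp
      then show "act (f \<otimes>\<^bsub>E\<^esub> e) (q (act (inv\<^bsub>E\<^esub> (f \<otimes>\<^bsub>E\<^esub> e)) (act f x))) =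
          act f (act e (q (act (inv\<^bsub>E\<^esub> e) x)))"
        using act_mult[OF f e qc] e x by simp
    qed (use f x in \<open>auto simp: qc\<close>)
    also have "\<dots> = act f (?r x)" by (rule act_finprod[OF f fc[OF x], symmetric])
    finally show ?thesis .
  qed
  show "endo ?r" unfolding endo_def hom_def using subsetD[OF ND(2) rN] dist equi by simp
qed

text \<open>A linear projection \<open>q\<close> onto \<open>N\<close>, taken from
  \<open>coordinates\<close>, is averaged. On \<open>N\<close> every conjugate of \<open>q\<close>
  is the identity, so the sum of the conjugates acts as |E|; the exponent \<open>m\<close>, an
  inverse of |E| modulo p, corrects this.\<close>

theorem maschke:
  assumes N: "stable N"
  obtains \<tau> where "endo \<tau>" "\<And>x. x \<in> carrier V \<Longrightarrow> \<tau> x \<in> N" "\<And>x. x \<in> N \<Longrightarrow> \<tau> x = x"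
proof -
  note ND = stableD[OF N]
  obtain I \<chi> where I: "I \<subseteq> N"
    and \<chi>: "\<And>u x y. \<lbrakk>u \<in> I; x \<in> carrier V; y \<in> carrier V\<rbrakk> \<Longrightarrow> [\<chi> u (x \<otimes> y) = \<chi> u x + \<chi> u y] (mod int p)"
    and gen: "\<And>x. x \<in> N \<Longrightarrow> x = (\<Otimes>u\<in>I. u [^] (\<chi> u x :: int))"
    using coordinates[OF ND(1)] by blast
  have Ic: "I \<subseteq> carrier V" using I ND by auto
  define q where "q = (\<lambda>x. \<Otimes>u\<in>I. u [^] \<chi> u x)"
  have qN: "q x \<in> N" for x
    unfolding q_def using I by (intro finprod_comm_closed_subgroup[OF ND(1)] Pi_I subgroup_int_pow_closed[OF ND(1)]) blast
  have qh: "q \<in> hom V V"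
  proof (rule homI)
    fix x y assume xy: "x \<in> carrier V" "y \<in> carrier V"
    have "q x \<otimes> q y = (\<Otimes>u\<in>I. u [^] \<chi> u x \<otimes> u [^] \<chi> u y)"
      unfolding q_def using Ic by (intro finprod_multf[symmetric]) auto
    also have "\<dots> = q (x \<otimes> y)"
      unfolding q_def
    proof (rule finprod_cong')
      fix u assume u: "u \<in> I"
      then have uc: "u \<in> carrier V" using Ic by auto
      show "u [^] \<chi> u x \<otimes> u [^] \<chi> u y = u [^] \<chi> u (x \<otimes> y)"
        using int_pow_cong[OF uc \<chi>[OF u xy]] uc by (simp add: int_pow_mult)
    qed (use Ic in auto)
    finally show "q (x \<otimes> y) = q x \<otimes> q y" ..
  qed (use subsetD[OF ND(2) qN] in blast)
  let ?r = "\<lambda>x. \<Otimes>e\<in>carrier E. act e (q (act (inv\<^bsub>E\<^esub> e) x))"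
  note r = endo_from_hom_on[OF N qh qN]
  have r_id: "?r x = x [^] int (order E)" if x: "x \<in> N" for x
  proof -
    have "?r x = (\<Otimes>e\<in>carrier E. x)"
    proof (rule finprod_cong')
      fix e assume e: "e \<in> carrier E"
      have xc: "x \<in> carrier V" using subsetD[OF ND(2) x] by simp
      have "q (act (inv\<^bsub>E\<^esub> e) x) = act (inv\<^bsub>E\<^esub> e) x"
        unfolding q_def using gen[OF ND(6)[OF E.inv_closed[OF e] x]] by (rule sym)
      then show "act e (q (act (inv\<^bsub>E\<^esub> e) x)) = x" using e xc by (simp add: act_mult[symmetric] act_one)
    qed (use subsetD[OF ND(2) x] in auto)
    also have "\<dots> = x [^] card (carrier E)" using subsetD[OF ND(2) x] by (rule finprod_const)
    finally show ?thesis by (simp add: Coset.order_def int_pow_int)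
  qed
  have "coprime (int (order E)) (int p)" using coprime_E by (simp add: coprime_int_iff)
  then obtain m where m: "[int (order E) * m = 1] (mod int p)" using cong_solve_coprime_int by blast
  show thesis
  proof (rule that[of "\<lambda>x. ?r x [^] m"])
    show "endo (\<lambda>x. ?r x [^] m)"
      using endoD[OF r(1)] unfolding endo_def hom_def
      by (auto simp: int_pow_distrib act_int_pow)
    show "?r x [^] m \<in> N" if "x \<in> carrier V" for x
      using r(2)[OF that] subgroup_int_pow_closed[OF ND(1)] by auto
    show "?r x [^] m = x" if x: "x \<in> N" for x
    proof -
      have xc: "x \<in> carrier V" using subsetD[OF ND(2) x] by simp
      have "?r x [^] m = x [^] (int (order E) * m)" using r_id[OF x] xc by (simp add: int_pow_pow)
      also have "\<dots> = x" using int_pow_cong[OF xc m] xc by simp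
      finally show ?thesis .
    qed
  qed
qed

text \<open>Kernel and image are stable, so simplicity leaves only the trivial and the full choice
  for each.\<close>

lemma schur:
  assumes N: "simple N" and N': "simple N'" and h: "stable_hom h N N'"
  shows "(\<forall>x\<in>N. h x = \<one>) \<or> bij_betw h N N'"
proof (rule disjCI)
  assume nb: "\<not> bij_betw h N N'"
  have sN: "stable N" and sN': "stable N'" using N N' unfolding simple_def by auto
  note hD = stable_homD[OF h] and ND = stableD[OF sN] and N'D = stableD[OF sN']
  consider "{x \<in> N. h x = \<one>} = N" | "{x \<in> N. h x = \<one>} = {\<one>}"
    using N stable_hom_kernel[OF h sN sN'] unfolding simple_def by blast
  then show "\<forall>x\<in>N. h x = \<one>"
  proof cases
    case 2
    have inj: "inj_on h N"
    proof (rule inj_onI)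
      fix x y assume xy: "x \<in> N" "y \<in> N" "h x = h y"
      have c: "x \<in> carrier V" "y \<in> carrier V" "h y \<in> carrier V" using xy ND(2) hD(1) N'D(2) by auto
      have "h (x \<otimes> inv y) = \<one>"
        using hD(2)[OF xy(1) ND(5)[OF xy(2)]] stable_hom_one_inv(2)[OF h sN sN' xy(2)] xy(3) c by simp
      then have "x \<otimes> inv y = \<one>" using 2 ND(4)[OF xy(1) ND(5)[OF xy(2)]] by blast
      then show "x = y" using c by (metis inv_equality inv_inv inv_closed)
    qed
    have im: "h ` N \<subseteq> N'" using hD(1) by auto
    then have "h ` N = {\<one>}"
      using N' stable_hom_image[OF h sN sN'] nb inj unfolding simple_def bij_betw_def by blast
    then show ?thesis by blast
  qed blast
qed

lemma stable_hom_compose: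
  "\<lbrakk>stable_hom h N N'; stable_hom g M N; stable M\<rbrakk> \<Longrightarrow> stable_hom (\<lambda>x. h (g x)) M N'"
  unfolding stable_hom_def by (auto simp: Pi_iff)

lemma stable_hom_inv_into:
  assumes h: "stable_hom h N N'" and N: "stable N" and bij: "bij_betw h N N'"
  shows "stable_hom (inv_into N h) N' N"
proof -
  note hD = stable_homD[OF h] and ND = stableD[OF N]
  have inj: "inj_on h N" and im: "h ` N = N'" using bij by (auto simp: bij_betw_def)
  have g: "inv_into N h x \<in> N" "h (inv_into N h x) = x" if "x \<in> N'" for x
    using that im by (auto intro: inv_into_into f_inv_into_f)
  show ?thesis
    unfolding stable_hom_def
  proof (intro conjI ballI Pi_I)
    fix x assume x: "x \<in> N'"
    show "inv_into N h x \<in> N" using g[OF x] by simp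
    show "inv_into N h (act e x) = act e (inv_into N h x)" if e: "e \<in> carrier E" for e
      using hD(3)[OF e g(1)[OF x]] g(2)[OF x] inv_into_f_f[OF inj ND(6)[OF e g(1)[OF x]]] by simp
    fix y assume y: "y \<in> N'"
    show "inv_into N h (x \<otimes> y) = inv_into N h x \<otimes> inv_into N h y"
      using hD(2)[OF g(1)[OF x] g(1)[OF y]] g(2)[OF x] g(2)[OF y]
        inv_into_f_f[OF inj ND(4)[OF g(1)[OF x] g(1)[OF y]]] by simp
  qed
qed

text \<open>By Schur's lemma the endomorphisms of a simple module form a division ring; it is
  finite, so Wedderburn's theorem applies.\<close>

theorem simple_stable_hom_commute:
  assumes N: "simple N" and \<sigma>: "stable_hom \<sigma> N N" and \<tau>: "stable_hom \<tau> N N" and x: "x \<in> N"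
  shows "\<sigma> (\<tau> x) = \<tau> (\<sigma> x)"
proof -
  have sN: "stable N" using N unfolding simple_def by auto
  note ND = stableD[OF sN]
  have cV: "x \<in> N \<Longrightarrow> x \<in> carrier V" for x using ND(2) by auto
  \<comment> \<open>Maps are made extensional on \<open>N\<close>, so that equality in the ring is
    equality on \<open>N\<close> and the ring is finite.\<close>
  define D where "D = \<lparr>carrier = {f \<in> extensional N. stable_hom f N N},
    monoid.mult = (\<lambda>f g. \<lambda>x\<in>N. f (g x)), one = (\<lambda>x\<in>N. x), zero = (\<lambda>x\<in>N. \<one>),
    add = (\<lambda>f g. \<lambda>x\<in>N. f x \<otimes> g x)\<rparr>"
  have DI: "(\<lambda>x\<in>N. f x) \<in> carrier D" if "stable_hom f N N" for f
    using that ND unfolding D_def stable_hom_def by (auto simp: Pi_iff)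
  have DD: "stable_hom f N N" "f \<in> extensional N" if "f \<in> carrier D" for f
    using that unfolding D_def by auto
  have ext: "f = g" if "f \<in> carrier D" "g \<in> carrier D" "\<And>x. x \<in> N \<Longrightarrow> f x = g x" for f g
    using that DD by (metis extensionalityI)
  have val: "(f \<otimes>\<^bsub>D\<^esub> g) x = f (g x)" "(f \<oplus>\<^bsub>D\<^esub> g) x = f x \<otimes> g x" "\<zero>\<^bsub>D\<^esub> x = \<one>" "\<one>\<^bsub>D\<^esub> x = x"
    if "x \<in> N" for f g x using that unfolding D_def by auto
  have hin: "f x \<in> N" if "f \<in> carrier D" "x \<in> N" for f x using stable_homD(1)[OF DD(1)] that by blast
  have hmul: "f (x \<otimes> y) = f x \<otimes> f y" if "f \<in> carrier D" "x \<in> N" "y \<in> N" for f x y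
    using stable_homD(2)[OF DD(1)] that by blast
  have cl: "f \<otimes>\<^bsub>D\<^esub> g \<in> carrier D" "f \<oplus>\<^bsub>D\<^esub> g \<in> carrier D" if fg: "f \<in> carrier D" "g \<in> carrier D" for f g
  proof -
    have "stable_hom (\<lambda>x. f (g x)) N N" using stable_hom_compose DD fg sN by blast
    from DI[OF this] show "f \<otimes>\<^bsub>D\<^esub> g \<in> carrier D" unfolding D_def by simp
    note fD = stable_homD[OF DD(1)[OF fg(1)]] and gD = stable_homD[OF DD(1)[OF fg(2)]]
    have "stable_hom (\<lambda>x. f x \<otimes> g x) N N"
      unfolding stable_hom_def
    proof (intro conjI ballI Pi_I)
      fix x y assume xy: "x \<in> N" "y \<in> N"
      show "f (x \<otimes> y) \<otimes> g (x \<otimes> y) = f x \<otimes> g x \<otimes> (f y \<otimes> g y)"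
        using fD(2)[OF xy] gD(2)[OF xy] cV[OF fD(1)[OF xy(1)]] cV[OF fD(1)[OF xy(2)]]
          cV[OF gD(1)[OF xy(1)]] cV[OF gD(1)[OF xy(2)]] by (simp add: m_ac)
    next
      fix e x assume ex: "e \<in> carrier E" "x \<in> N"
      show "f (act e x) \<otimes> g (act e x) = act e (f x \<otimes> g x)"
        using fD(3)[OF ex] gD(3)[OF ex] cV[OF fD(1)[OF ex(2)]] cV[OF gD(1)[OF ex(2)]] ex(1)
        by (simp add: act_dist)
    qed (use ND(4)[OF fD(1) gD(1)] in blast)
    from DI[OF this] show "f \<oplus>\<^bsub>D\<^esub> g \<in> carrier D" unfolding D_def by simp
  qed
  have zero: "\<zero>\<^bsub>D\<^esub> \<in> carrier D"
    using DI[of "\<lambda>x. \<one>"] ND(3) act_fix_one unfolding D_def stable_hom_def by simp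
  have one: "\<one>\<^bsub>D\<^esub> \<in> carrier D"
    using DI[of "\<lambda>x. x"] unfolding D_def stable_hom_def by simp
  have ab: "abelian_group D"
  proof (rule abelian_groupI)
    fix f g h assume f: "f \<in> carrier D"
    show "\<zero>\<^bsub>D\<^esub> \<oplus>\<^bsub>D\<^esub> f = f" by (rule ext) (use f cl zero in \<open>auto simp: val cV hin\<close>)
    show "\<exists>g\<in>carrier D. g \<oplus>\<^bsub>D\<^esub> f = \<zero>\<^bsub>D\<^esub>"
    proof
      note fD = stable_homD[OF DD(1)[OF f]]
      have "stable_hom (\<lambda>x. inv (f x)) N N"
        unfolding stable_hom_def
      proof (intro conjI ballI Pi_I)
        fix x y assume xy: "x \<in> N" "y \<in> N"
        show "inv (f (x \<otimes> y)) = inv (f x) \<otimes> inv (f y)"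
          using fD(2)[OF xy] cV[OF fD(1)[OF xy(1)]] cV[OF fD(1)[OF xy(2)]] by (simp add: inv_mult)
      next
        fix e x assume ex: "e \<in> carrier E" "x \<in> N"
        have "act e (inv (f x)) = inv (act e (f x))"
          using hom_one[OF act_hom[OF ex(1)]] cV[OF fD(1)[OF ex(2)]] group_hom.hom_inv[of V V "act e"]
            act_hom[OF ex(1)] group_hom.intro[OF group_axioms group_axioms] group_hom_axioms.intro by blast
        then show "inv (f (act e x)) = act e (inv (f x))"
          using fD(3)[OF ex] by simp
      qed (use ND(5)[OF fD(1)] in blast)
      from DI[OF this] show gD: "(\<lambda>x\<in>N. inv (f x)) \<in> carrier D" .
      show "(\<lambda>x\<in>N. inv (f x)) \<oplus>\<^bsub>D\<^esub> f = \<zero>\<^bsub>D\<^esub>"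
        by (rule ext) (use f gD cl zero in \<open>auto simp: val cV hin\<close>)
    qed
    assume g: "g \<in> carrier D"
    show "f \<oplus>\<^bsub>D\<^esub> g \<in> carrier D" using f g cl by blast
    show "f \<oplus>\<^bsub>D\<^esub> g = g \<oplus>\<^bsub>D\<^esub> f" by (rule ext) (use f g cl in \<open>auto simp: val cV hin m_comm\<close>)
    assume h: "h \<in> carrier D"
    show "f \<oplus>\<^bsub>D\<^esub> g \<oplus>\<^bsub>D\<^esub> h = f \<oplus>\<^bsub>D\<^esub> (g \<oplus>\<^bsub>D\<^esub> h)"
      by (rule ext) (use f g h cl in \<open>auto simp: val cV hin m_assoc\<close>)
  qed (rule zero)
  interpret D: ring D
  proof (rule ringI[OF ab])
    show "monoid D"
    proof (rule monoidI)
      fix f g h assume f: "f \<in> carrier D"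
      show "\<one>\<^bsub>D\<^esub> \<otimes>\<^bsub>D\<^esub> f = f" by (rule ext) (use f cl one in \<open>auto simp: val hin\<close>)
      show "f \<otimes>\<^bsub>D\<^esub> \<one>\<^bsub>D\<^esub> = f" by (rule ext) (use f cl one in \<open>auto simp: val hin\<close>)
      assume g: "g \<in> carrier D"
      show "f \<otimes>\<^bsub>D\<^esub> g \<in> carrier D" using f g cl by blast
      assume h: "h \<in> carrier D"
      show "f \<otimes>\<^bsub>D\<^esub> g \<otimes>\<^bsub>D\<^esub> h = f \<otimes>\<^bsub>D\<^esub> (g \<otimes>\<^bsub>D\<^esub> h)"
        by (rule ext) (use f g h cl in \<open>auto simp: val hin\<close>)
    qed (rule one)
    fix f g h assume f: "f \<in> carrier D" and g: "g \<in> carrier D" and h: "h \<in> carrier D"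
    show "(f \<oplus>\<^bsub>D\<^esub> g) \<otimes>\<^bsub>D\<^esub> h = f \<otimes>\<^bsub>D\<^esub> h \<oplus>\<^bsub>D\<^esub> g \<otimes>\<^bsub>D\<^esub> h"
      by (rule ext) (use f g h cl in \<open>auto simp: val hin\<close>)
    show "h \<otimes>\<^bsub>D\<^esub> (f \<oplus>\<^bsub>D\<^esub> g) = h \<otimes>\<^bsub>D\<^esub> f \<oplus>\<^bsub>D\<^esub> h \<otimes>\<^bsub>D\<^esub> g"
      by (rule ext) (use f g h cl in \<open>auto simp: val hin hmul\<close>)
  qed
  have "(\<lambda>x\<in>N. \<sigma> x) \<otimes>\<^bsub>D\<^esub> (\<lambda>x\<in>N. \<tau> x) = (\<lambda>x\<in>N. \<tau> x) \<otimes>\<^bsub>D\<^esub> (\<lambda>x\<in>N. \<sigma> x)"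
  proof (rule D.wedderburn)
    have "carrier D \<subseteq> N \<rightarrow>\<^sub>E N" unfolding D_def stable_hom_def by (auto simp: PiE_def)
    moreover have "finite N" using ND(2) finite_V by (rule finite_subset)
    ultimately show "finite (carrier D)" using finite_PiE finite_subset by metis
    show "(\<lambda>x\<in>N. \<sigma> x) \<in> carrier D" "(\<lambda>x\<in>N. \<tau> x) \<in> carrier D" using DI \<sigma> \<tau> by auto
    fix f assume f: "f \<in> carrier D" "f \<noteq> \<zero>\<^bsub>D\<^esub>"
    note fh = DD(1)[OF f(1)]
    have "bij_betw f N N"
    proof (rule ccontr)
      assume "\<not> bij_betw f N N"
      then have "\<forall>x\<in>N. f x = \<one>" using schur[OF N N fh] by blast
      then have "f x = \<zero>\<^bsub>D\<^esub> x" if "x \<in> N" for x using val(3)[OF that] that by simp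
      then show False using f(2) ext[OF f(1) zero] by blast
    qed
    then have inj: "inj_on f N" and im: "f ` N = N" and bij: "bij_betw f N N" by (auto simp: bij_betw_def)
    have g: "(\<lambda>x\<in>N. inv_into N f x) \<in> carrier D" (is "?g \<in> _")
      using DI[OF stable_hom_inv_into[OF fh sN bij]] .
    have "?g \<otimes>\<^bsub>D\<^esub> f = \<one>\<^bsub>D\<^esub>"
      by (rule ext) (use f g cl one in \<open>auto simp: val hin inj\<close>)
    moreover have "f \<otimes>\<^bsub>D\<^esub> ?g = \<one>\<^bsub>D\<^esub>"
      by (rule ext) (use f g cl one in \<open>auto simp: val hin f_inv_into_f im\<close>)
    ultimately show "f \<in> Units D" using f g unfolding Units_def by blast
  qed
  then have "((\<lambda>x\<in>N. \<sigma> x) \<otimes>\<^bsub>D\<^esub> (\<lambda>x\<in>N. \<tau> x)) x = ((\<lambda>x\<in>N. \<tau> x) \<otimes>\<^bsub>D\<^esub> (\<lambda>x\<in>N. \<sigma> x)) x" by simp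
  then show ?thesis using x stable_homD(1)[OF \<sigma> x] stable_homD(1)[OF \<tau> x] by (simp add: val)
qed

text \<open>The projections are the components of the inverse of the summation map. That they are
  equivariant endomorphisms follows from uniqueness of components: the component-wise product, or
  the component-wise translate, is a decomposition of the right element.\<close>

lemma direct_sum_projections:
  assumes ds: "direct_sum \<S>" and st: "\<And>N. N \<in> \<S> \<Longrightarrow> stable N"
  obtains c where "\<And>N. N \<in> \<S> \<Longrightarrow> endo (c N)" "\<And>N x. \<lbrakk>N \<in> \<S>; x \<in> carrier V\<rbrakk> \<Longrightarrow> c N x \<in> N"
    "\<And>N x. \<lbrakk>N \<in> \<S>; x \<in> N\<rbrakk> \<Longrightarrow> c N x = x"
    "\<And>N N' x. \<lbrakk>N \<in> \<S>; N' \<in> \<S>; N \<noteq> N'; x \<in> N'\<rbrakk> \<Longrightarrow> c N x = \<one>"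
    "\<And>x. x \<in> carrier V \<Longrightarrow> (\<Otimes>N\<in>\<S>. c N x) = x"
proof -
  let ?F = "\<lambda>f. finprod V f \<S>" and ?X = "\<Pi>\<^sub>E N\<in>\<S>. N"
  have fin: "finite \<S>" and bij: "bij_betw ?F ?X (carrier V)" using ds unfolding direct_sum_def by auto
  define comp where "comp = inv_into ?X ?F"
  have im: "?F ` ?X = carrier V" and inj: "inj_on ?F ?X" using bij by (auto simp: bij_betw_def)
  have SV: "x \<in> carrier V" if "N \<in> \<S>" "x \<in> N" for N x using stableD(2)[OF st[OF that(1)]] that(2) by auto
  have comp: "comp x \<in> ?X" "?F (comp x) = x" if "x \<in> carrier V" for x
    unfolding comp_def using that inv_into_into[of x ?F ?X] f_inv_into_f[of x ?F ?X] im by auto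
  have compN: "comp x N \<in> N" if "x \<in> carrier V" "N \<in> \<S>" for x N
    using PiE_mem[OF comp(1)[OF that(1)] that(2)] .
  have uniq: "comp x N = f N" if f: "\<And>N. N \<in> \<S> \<Longrightarrow> f N \<in> N" "?F f = x" and N: "N \<in> \<S>" for x f N
  proof -
    have "?F (restrict f \<S>) = ?F f" using f(1) SV by (intro finprod_cong') auto
    then have "comp x = restrict f \<S>"
      unfolding comp_def using inv_into_f_f[OF inj, of "restrict f \<S>"] f by auto
    then show ?thesis using N by simp
  qed
  show thesis
  proof (rule that[of "\<lambda>N x. comp x N"])
    fix N assume N: "N \<in> \<S>"
    show "endo (\<lambda>x. comp x N)"
      unfolding endo_def
    proof (intro conjI ballI homI)
      fix x assume x: "x \<in> carrier V"
      show "comp x N \<in> carrier V" using SV[OF N compN[OF x N]] .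
      show "comp (x \<otimes> y) N = comp x N \<otimes> comp y N" if y: "y \<in> carrier V" for y
      proof (rule uniq[OF _ _ N])
        show "comp x N \<otimes> comp y N \<in> N" if "N \<in> \<S>" for N
          using stableD(4)[OF st[OF that]] compN that x y by blast
        have "(\<Otimes>N\<in>\<S>. comp x N \<otimes> comp y N) = ?F (comp x) \<otimes> ?F (comp y)"
          using SV compN x y by (intro finprod_multf) blast+
        then show "(\<Otimes>N\<in>\<S>. comp x N \<otimes> comp y N) = x \<otimes> y" using comp(2) x y by simp
      qed
      show "comp (act e x) N = act e (comp x N)" if e: "e \<in> carrier E" for e
      proof (rule uniq[OF _ _ N])
        show "act e (comp x N) \<in> N" if "N \<in> \<S>" for N
          using stableD(6)[OF st[OF that]] compN that x e by blast
        have "act e (?F (comp x)) = (\<Otimes>N\<in>\<S>. act e (comp x N))"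
          using SV compN x by (intro act_finprod[OF e]) blast
        then show "(\<Otimes>N\<in>\<S>. act e (comp x N)) = act e x" using comp(2)[OF x] by simp
      qed
    qed
    show "comp x N \<in> N" if "x \<in> carrier V" for x using compN that N by blast
    have single: "comp x M = (if N = M then x else \<one>)" if "x \<in> N" "M \<in> \<S>" for x M
    proof (rule uniq[OF _ _ that(2)])
      show "(if N = M then x else \<one>) \<in> M" if "M \<in> \<S>" for M
        using stableD(3)[OF st[OF that]] \<open>x \<in> N\<close> by auto
      show "(\<Otimes>M\<in>\<S>. if N = M then x else \<one>) = x"
        using finprod_singleton[OF N fin, of "\<lambda>_. x"] SV[OF N that(1)] by simp
    qed
    show "comp x N = x" if "x \<in> N" for x using single[OF that N] by simp
    show "comp x N' = \<one>" if "N' \<in> \<S>" "N' \<noteq> N" "x \<in> N" for x N' using single[OF that(3,1)] that(2) by simp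
  next
    show "(\<Otimes>N\<in>\<S>. comp x N) = x" if "x \<in> carrier V" for x using comp(2)[OF that] .
  qed
qed

text \<open>An endomorphism preserves each summand \<open>N\<close>: its component from
  \<open>N\<close> to another summand is a map between non-isomorphic simple modules, hence trivial
  by \<open>schur\<close>. The question is thereby reduced to one simple module at a time.\<close>

theorem endo_commute_if_multiplicity_free:
  assumes ds: "direct_sum \<S>" and simp: "\<And>N. N \<in> \<S> \<Longrightarrow> simple N"
    and noniso: "\<And>N N' h. \<lbrakk>N \<in> \<S>; N' \<in> \<S>; N \<noteq> N'; stable_hom h N N'\<rbrakk> \<Longrightarrow> \<not> bij_betw h N N'"
    and \<sigma>: "endo \<sigma>" and \<tau>: "endo \<tau>" and x: "x \<in> carrier V"
  shows "\<sigma> (\<tau> x) = \<tau> (\<sigma> x)"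
proof -
  have st: "stable N" if "N \<in> \<S>" for N using simp[OF that] unfolding simple_def by auto
  have SV: "x \<in> carrier V" if "N \<in> \<S>" "x \<in> N" for N x using stableD(2)[OF st[OF that(1)]] that(2) by auto
  obtain c where c: "\<And>N. N \<in> \<S> \<Longrightarrow> endo (c N)" "\<And>N x. \<lbrakk>N \<in> \<S>; x \<in> carrier V\<rbrakk> \<Longrightarrow> c N x \<in> N"
    and gen: "\<And>x. x \<in> carrier V \<Longrightarrow> (\<Otimes>N\<in>\<S>. c N x) = x"
    by (rule direct_sum_projections[OF ds], erule st, rule that)
  have fin: "finite \<S>" using ds unfolding direct_sum_def by auto
  have pres: "stable_hom \<rho> N N" if \<rho>: "endo \<rho>" and N: "N \<in> \<S>" for \<rho> N
  proof (rule endo_restrict[OF \<rho> st[OF N]], rule Pi_I)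
    fix x assume x: "x \<in> N"
    note xV = SV[OF N x]
    have "c M (\<rho> x) = \<one>" if M: "M \<in> \<S>" "M \<noteq> N" for M
    proof -
      have "stable_hom (\<lambda>x. c M (\<rho> x)) N M"
        using endo_comp[OF c(1)[OF M(1)] \<rho>] st[OF N]
        by (rule endo_restrict) (use c(2)[OF M(1)] endoD(2)[OF \<rho>] SV[OF N] in blast)
      then show ?thesis
        using schur[OF simp[OF N] simp[OF M(1)]] noniso[OF N M(1)] M(2) x by blast
    qed
    then have "(\<Otimes>M\<in>\<S>. c M (\<rho> x)) = (\<Otimes>M\<in>\<S>. if N = M then c N (\<rho> x) else \<one>)"
      using SV[OF N c(2)[OF N endoD(2)[OF \<rho> xV]]] by (intro finprod_cong') auto
    also have "\<dots> = c N (\<rho> x)"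
      using finprod_singleton[OF N fin, of "\<lambda>_. c N (\<rho> x)"] SV[OF N c(2)[OF N endoD(2)[OF \<rho> xV]]] by simp
    finally have "\<rho> x = c N (\<rho> x)" using gen[OF endoD(2)[OF \<rho> xV]] by simp
    then show "\<rho> x \<in> N" using c(2)[OF N endoD(2)[OF \<rho> xV]] by simp
  qed
  have hf: "\<rho> (\<Otimes>N\<in>\<S>. c N x) = (\<Otimes>N\<in>\<S>. \<rho> (c N x))" if "endo \<rho>" for \<rho>
    by (rule hom_finprod[OF comm_group_axioms comm_group_axioms endoD(1)[OF that]])
       (use SV c(2) x in blast)
  have "\<sigma> (\<tau> x) = (\<Otimes>N\<in>\<S>. \<sigma> (\<tau> (c N x)))"
    using hf[OF endo_comp[OF \<sigma> \<tau>]] gen[OF x] by simp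
  also have "\<dots> = (\<Otimes>N\<in>\<S>. \<tau> (\<sigma> (c N x)))"
  proof (rule finprod_cong')
    fix N assume N: "N \<in> \<S>"
    show "\<sigma> (\<tau> (c N x)) = \<tau> (\<sigma> (c N x))"
      using simple_stable_hom_commute[OF simp[OF N] pres[OF \<sigma> N] pres[OF \<tau> N] c(2)[OF N x]] .
  next
    show "(\<lambda>N. \<tau> (\<sigma> (c N x))) \<in> \<S> \<rightarrow> carrier V"
      using endoD(2)[OF \<tau> endoD(2)[OF \<sigma> SV[OF _ c(2)[OF _ x]]]] by blast
  qed simp
  also have "\<dots> = \<tau> (\<sigma> x)"
    using hf[OF endo_comp[OF \<tau> \<sigma>]] gen[OF x] by simp
  finally show ?thesis .
qed

text \<open>A nontrivial stable subgroup of least order in \<open>K\<close> is simple.\<close>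

lemma simple_exists:
  assumes "stable K" "K \<noteq> {\<one>}"
  obtains N where "simple N" "N \<subseteq> K"
proof -
  define M where "M = (ARG_MIN card M. stable M \<and> M \<noteq> {\<one>} \<and> M \<subseteq> K)"
  have M: "stable M \<and> M \<noteq> {\<one>} \<and> M \<subseteq> K"
    and min: "\<And>M'. stable M' \<and> M' \<noteq> {\<one>} \<and> M' \<subseteq> K \<Longrightarrow> card M \<le> card M'"
    unfolding M_def using arg_min_nat_lemma[of "\<lambda>M. stable M \<and> M \<noteq> {\<one>} \<and> M \<subseteq> K" K card] assms by auto
  have "finite M" using M stableD(2) finite_V finite_subset by metis
  then have "M' = M" if "stable M'" "M' \<noteq> {\<one>}" "M' \<subseteq> M" for M'
    using card_seteq[of M M'] min[of M'] that M by auto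
  then have "simple M" unfolding simple_def using M by blast
  then show thesis using that M by blast
qed

text \<open>Take a largest set of simple submodules whose sum \<open>W\<close> is direct. If
  \<open>W\<close> were proper, the kernel of a Maschke projection onto \<open>W\<close> would
  contain a simple submodule that could be added.\<close>

theorem semisimple:
  obtains \<S> where "direct_sum \<S>" "\<And>N. N \<in> \<S> \<Longrightarrow> simple N"
proof -
  define ok where "ok = (\<lambda>\<S>. (\<forall>N\<in>\<S>. simple N) \<and> inj_on (\<lambda>f. finprod V f \<S>) (\<Pi>\<^sub>E N\<in>\<S>. N))"
  have simple_sub: "{N. simple N} \<subseteq> Pow (carrier V)" unfolding simple_def using stableD(2) by blast
  have fin_simple: "finite {N. simple N}" using finite_V simple_sub finite_subset finite_Pow_iff by metis
  have bound: "card \<S> \<le> card {N. simple N}" "finite \<S>" if "ok \<S>" for \<S>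
  proof -
    have "\<S> \<subseteq> {N. simple N}" using that unfolding ok_def by auto
    then show "card \<S> \<le> card {N. simple N}" "finite \<S>"
      using fin_simple by (auto intro: card_mono finite_subset)
  qed
  have "ok {}" unfolding ok_def by auto
  then obtain \<S> where ok: "ok \<S>" and max: "\<And>\<T>. ok \<T> \<Longrightarrow> card \<T> \<le> card \<S>"
    using ex_has_greatest_nat[of ok "{}" card "Suc (card {N. simple N})"] bound(1) le_imp_less_Suc by blast
  have fin: "finite \<S>" using bound ok by blast
  have simp: "simple N" if "N \<in> \<S>" for N using ok that unfolding ok_def by auto
  have st: "stable N" if "N \<in> \<S>" for N using simp[OF that] unfolding simple_def by auto
  have SV: "x \<in> carrier V" if "N \<in> \<S>" "x \<in> N" for N x using stableD(2)[OF st[OF that(1)]] that(2) by auto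
  let ?F = "\<lambda>f. finprod V f \<S>" and ?X = "\<Pi>\<^sub>E N\<in>\<S>. N"
  have inj: "inj_on ?F ?X" using ok unfolding ok_def by auto
  define W where "W = ?F ` ?X"
  have XV: "f \<in> \<S> \<rightarrow> carrier V" if "f \<in> ?X" for f
    by (rule Pi_I) (rule SV[OF _ PiE_mem[OF that]])
  have Fr: "?F (restrict f \<S>) = ?F f" if "f \<in> \<S> \<rightarrow> carrier V" for f
    using that by (intro finprod_cong') auto
  have WI: "?F f \<in> W" if f: "\<And>N. N \<in> \<S> \<Longrightarrow> f N \<in> N" for f
  proof -
    have "?F f = ?F (restrict f \<S>)" by (rule Fr[symmetric]) (rule Pi_I, rule SV[OF _ f])
    moreover have "restrict f \<S> \<in> ?X" by (rule restrict_PiE_iff[THEN iffD2]) (simp add: f)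
    ultimately show ?thesis unfolding W_def by blast
  qed
  have stW: "stable W"
    unfolding stable_def
  proof (intro conjI ballI subgroup.intro)
    show "W \<subseteq> carrier V" unfolding W_def by (rule image_subsetI) (rule finprod_closed[OF XV])
    have "?F (\<lambda>_. \<one>) \<in> W" by (rule WI) (rule stableD(3)[OF st])
    then show "\<one> \<in> W" by simp
    fix x assume "x \<in> W"
    then obtain f where f: "f \<in> ?X" "x = ?F f" unfolding W_def by auto
    have fN: "f N \<in> N" if "N \<in> \<S>" for N using PiE_mem[OF f(1) that] .
    show "act e x \<in> W" if e: "e \<in> carrier E" for e
      unfolding f(2) act_finprod[OF e XV[OF f(1)]] by (rule WI) (rule stableD(6)[OF st e fN])
    show "inv x \<in> W"
    proof -
      have "inv x = x [^] (- 1 :: int)" using finprod_closed[OF XV[OF f(1)]] f(2) by (simp add: int_pow_neg)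
      also have "\<dots> = (\<Otimes>N\<in>\<S>. f N [^] (-1::int))" unfolding f(2) using XV[OF f(1)] by (rule finprod_int_pow)
      also have "\<dots> \<in> W" by (rule WI) (rule subgroup_int_pow_closed[OF stableD(1)[OF st] fN])
      finally show ?thesis .
    qed
    fix y assume "y \<in> W"
    then obtain g where g: "g \<in> ?X" "y = ?F g" unfolding W_def by auto
    have gN: "g N \<in> N" if "N \<in> \<S>" for N using PiE_mem[OF g(1) that] .
    show "x \<otimes> y \<in> W"
      unfolding f(2) g(2) finprod_multf[OF XV[OF f(1)] XV[OF g(1)], symmetric]
      by (rule WI) (rule stableD(4)[OF st fN gN])
  qed
  have "W = carrier V"
  proof (rule ccontr)
    assume "W \<noteq> carrier V"
    then obtain x where x: "x \<in> carrier V" "x \<notin> W" using stableD(2)[OF stW] by auto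
    obtain \<tau> where \<tau>: "endo \<tau>" "\<And>x. x \<in> carrier V \<Longrightarrow> \<tau> x \<in> W" "\<And>x. x \<in> W \<Longrightarrow> \<tau> x = x"
      using maschke[OF stW] by blast
    define K where "K = {x \<in> carrier V. \<tau> x = \<one>}"
    have stK: "stable K"
      unfolding K_def using stable_hom_kernel[OF _ stable_carrier stable_carrier] \<tau>(1) endo_stable_hom by blast
    have \<tau>x: "\<tau> x \<in> carrier V" using endoD(2)[OF \<tau>(1) x(1)] .
    have "\<tau> (x \<otimes> inv (\<tau> x)) = \<one>"
      using endoD(3)[OF \<tau>(1) x(1) inv_closed[OF \<tau>x]] endoD(6)[OF \<tau>(1) \<tau>x] \<tau>(3)[OF \<tau>(2)[OF x(1)]] \<tau>x by simp
    then have "x \<otimes> inv (\<tau> x) \<in> K" unfolding K_def using x \<tau>x by simp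
    moreover have "x \<otimes> inv (\<tau> x) \<noteq> \<one>"
      using x \<tau>x \<tau>(2)[OF x(1)] by (metis inv_closed inv_equality inv_inv)
    ultimately have "K \<noteq> {\<one>}" by auto
    then obtain N where N: "simple N" "N \<subseteq> K" using simple_exists[OF stK] by blast
    have stN: "stable N" using N unfolding simple_def by auto
    have NV: "x \<in> carrier V" if "x \<in> N" for x using stableD(2)[OF stN] that by auto
    have "N \<notin> \<S>"
    proof
      assume NS: "N \<in> \<S>"
      have "x = \<one>" if xN: "x \<in> N" for x
      proof -
        have "?F (\<lambda>M. if N = M then x else \<one>) \<in> W"
          using xN stableD(3)[OF st] by (intro WI) auto
        then have "x \<in> W" using finprod_singleton[OF NS fin, of "\<lambda>_. x"] NV[OF xN] by simp
        then have "\<tau> x = x" by (rule \<tau>(3))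
        moreover have "\<tau> x = \<one>" using N(2) xN unfolding K_def by auto
        ultimately show ?thesis by simp
      qed
      then show False using N(1) stableD(3)[OF stN] unfolding simple_def by blast
    qed
    have "ok (insert N \<S>)"
      unfolding ok_def
    proof (intro conjI)
      show "\<forall>N\<in>insert N \<S>. simple N" using simp N by auto
      show "inj_on (\<lambda>f. finprod V f (insert N \<S>)) (\<Pi>\<^sub>E N\<in>insert N \<S>. N)"
      proof (rule inj_onI)
        fix f g assume fg: "f \<in> (\<Pi>\<^sub>E N\<in>insert N \<S>. N)" "g \<in> (\<Pi>\<^sub>E N\<in>insert N \<S>. N)"
          and eq: "finprod V f (insert N \<S>) = finprod V g (insert N \<S>)"
        \<comment> \<open>\<open>\<tau>\<close> kills the component in \<open>N\<close>, which lies
          in its kernel, and fixes the part in \<open>W\<close>; it therefore recovers the latter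
          from the sum, and the component in \<open>N\<close> follows by cancellation.\<close>
        have aux: "f N \<in> N" "f \<in> \<S> \<rightarrow> carrier V" "?F f \<in> W" "finprod V f (insert N \<S>) = f N \<otimes> ?F f"
          "\<tau> (finprod V f (insert N \<S>)) = ?F f" "restrict f \<S> \<in> ?X" 
          if f: "f \<in> (\<Pi>\<^sub>E N\<in>insert N \<S>. N)" for f
        proof -
          have fM: "f M \<in> M" if "M \<in> insert N \<S>" for M using PiE_mem[OF f that] .
          show fN: "f N \<in> N" using fM by blast
          show fS: "f \<in> \<S> \<rightarrow> carrier V" using fM SV by blast
          show FW: "?F f \<in> W" by (rule WI) (simp add: fM)
          show e: "finprod V f (insert N \<S>) = f N \<otimes> ?F f"
            using fin \<open>N \<notin> \<S>\<close> fS NV[OF fN] by (rule finprod_insert)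
          have "\<tau> (f N) = \<one>" using fN N(2) unfolding K_def by auto
          then show "\<tau> (finprod V f (insert N \<S>)) = ?F f"
            unfolding e using endoD(3)[OF \<tau>(1) NV[OF fN] finprod_closed[OF fS]] \<tau>(3)[OF FW] finprod_closed[OF fS] by simp
          show "restrict f \<S> \<in> ?X" using fM by auto
        qed
        have F: "?F f = ?F g" using aux(5)[OF fg(1)] aux(5)[OF fg(2)] eq by simp
        then have "?F (restrict f \<S>) = ?F (restrict g \<S>)" using Fr aux(2) fg by simp
        then have r: "restrict f \<S> = restrict g \<S>"
          using inj_onD[OF inj _ aux(6)[OF fg(1)] aux(6)[OF fg(2)]] by blast
        have "f N \<otimes> ?F f = g N \<otimes> ?F f" using aux(4)[OF fg(1)] aux(4)[OF fg(2)] eq F by simp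
        then have fgN: "f N = g N"
          using NV aux(1)[OF fg(1)] aux(1)[OF fg(2)] finprod_closed[OF aux(2)[OF fg(1)]] right_cancel by metis
        show "f = g"
        proof (rule PiE_ext[OF fg])
          fix M assume "M \<in> insert N \<S>"
          then show "f M = g M" using fgN fun_cong[OF r, of M] by auto
        qed
      qed
    qed
    then have "card (insert N \<S>) \<le> card \<S>" by (rule max)
    then show False using fin \<open>N \<notin> \<S>\<close> by simp
  qed
  then have "direct_sum \<S>" unfolding direct_sum_def bij_betw_def W_def using fin inj by auto
  then show thesis using that simp by blast
qed

text \<open>\<alpha> projects to \<open>N\<close> and applies \<open>h\<close>; \<beta> projects to
  \<open>N'\<close> and applies the inverse of \<open>h\<close>. On \<open>N\<close> +
  \<open>N'\<close> they are the two off-diagonal matrix units, and they vanish on the other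
  summands. The element \<open>x\<close> witnesses \<alpha> being nonzero.\<close>

theorem matrix_units_if_not_multiplicity_free:
  assumes ds: "direct_sum \<S>" and simp: "\<And>N. N \<in> \<S> \<Longrightarrow> simple N"
    and N: "N \<in> \<S>" "N' \<in> \<S>" "N \<noteq> N'" and h: "stable_hom h N N'" "bij_betw h N N'"
  obtains \<alpha> \<beta> x where "endo \<alpha>" "endo \<beta>"
    "\<And>x. x \<in> carrier V \<Longrightarrow> \<alpha> (\<alpha> x) = \<one>" "\<And>x. x \<in> carrier V \<Longrightarrow> \<beta> (\<beta> x) = \<one>"
    "\<And>x. x \<in> carrier V \<Longrightarrow> \<alpha> (\<beta> (\<alpha> x)) = \<alpha> x" "\<And>x. x \<in> carrier V \<Longrightarrow> \<beta> (\<alpha> (\<beta> x)) = \<beta> x"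
    "x \<in> carrier V" "\<alpha> x \<noteq> \<one>"
proof -
  have st: "stable N" if "N \<in> \<S>" for N using simp[OF that] unfolding simple_def by auto
  have SV: "x \<in> carrier V" if "N \<in> \<S>" "x \<in> N" for N x using stableD(2)[OF st[OF that(1)]] that(2) by auto
  obtain c where c: "\<And>N. N \<in> \<S> \<Longrightarrow> endo (c N)" "\<And>N x. \<lbrakk>N \<in> \<S>; x \<in> carrier V\<rbrakk> \<Longrightarrow> c N x \<in> N"
    "\<And>N x. \<lbrakk>N \<in> \<S>; x \<in> N\<rbrakk> \<Longrightarrow> c N x = x"
    "\<And>N N' x. \<lbrakk>N \<in> \<S>; N' \<in> \<S>; N \<noteq> N'; x \<in> N'\<rbrakk> \<Longrightarrow> c N x = \<one>"
    by (rule direct_sum_projections[OF ds], erule st, rule that)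
  define g where "g = inv_into N h"
  have inj: "inj_on h N" and im: "h ` N = N'" using h(2) by (auto simp: bij_betw_def)
  have hg: "stable_hom g N' N" unfolding g_def using stable_hom_inv_into[OF h(1) st[OF N(1)] h(2)] .
  have gh: "g (h x) = x" if "x \<in> N" for x unfolding g_def using inj that by simp
  have hg': "h (g x) = x" if "x \<in> N'" for x unfolding g_def using im that by (simp add: f_inv_into_f)
  have hN: "h x \<in> N'" if "x \<in> N" for x using stable_homD(1)[OF h(1) that] .
  have gN: "g x \<in> N" if "x \<in> N'" for x using stable_homD(1)[OF hg that] .
  have h1: "h \<one> = \<one>" and g1: "g \<one> = \<one>"
    using stable_hom_one_inv(1)[OF h(1) st[OF N(1)] st[OF N(2)]]
      stable_hom_one_inv(1)[OF hg st[OF N(2)] st[OF N(1)]] by auto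
  have endo: "endo (\<lambda>x. k (c M x))" if k: "stable_hom k M M'" "M \<in> \<S>" "M' \<in> \<S>" for k M M'
  proof -
    note kD = stable_homD[OF k(1)] and cM = c(2)[OF k(2)] and cE = endoD[OF c(1)[OF k(2)]]
    show ?thesis
      unfolding endo_def
    proof (intro conjI ballI homI)
      fix x assume x: "x \<in> carrier V"
      show "k (c M x) \<in> carrier V" using SV[OF k(3) kD(1)[OF cM[OF x]]] .
      show "k (c M (x \<otimes> y)) = k (c M x) \<otimes> k (c M y)" if y: "y \<in> carrier V" for y
        using cE(3)[OF x y] kD(2)[OF cM[OF x] cM[OF y]] by simp
      show "k (c M (act e x)) = act e (k (c M x))" if e: "e \<in> carrier E" for e
        using cE(4)[OF e x] kD(3)[OF e cM[OF x]] by simp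
    qed
  qed
  have "N \<noteq> {\<one>}" using simp[OF N(1)] unfolding simple_def by auto
  then obtain x where x: "x \<in> N" "x \<noteq> \<one>" using stableD(3)[OF st[OF N(1)]] by auto
  note N'neq = N(3)[symmetric]
  show thesis
  proof (rule that[of "\<lambda>x. h (c N x)" "\<lambda>x. g (c N' x)" x])
    show "endo (\<lambda>x. h (c N x))" "endo (\<lambda>x. g (c N' x))" using endo h(1) hg N by auto
    show "x \<in> carrier V" using SV N x by blast
    show "h (c N x) \<noteq> \<one>"
      using c(3)[OF N(1) x(1)] x h1 inj_onD[OF inj, of x \<one>] stableD(3)[OF st[OF N(1)]] by auto
  next
    fix x assume x: "x \<in> carrier V"
    have cN: "c N x \<in> N" "c N' x \<in> N'" using c(2) N x by auto
    show "h (c N (h (c N x))) = \<one>" using c(4)[OF N hN[OF cN(1)]] h1 by simp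
    show "g (c N' (g (c N' x))) = \<one>" using c(4)[OF N(2,1) N'neq gN[OF cN(2)]] g1 by simp
    show "h (c N (g (c N' (h (c N x))))) = h (c N x)"
      using c(3)[OF N(2) hN[OF cN(1)]] gh[OF cN(1)] c(3)[OF N(1) cN(1)] by simp
    show "g (c N' (h (c N (g (c N' x))))) = g (c N' x)"
      using c(3)[OF N(1) gN[OF cN(2)]] hg'[OF cN(2)] c(3)[OF N(2) cN(2)] by simp
  qed
qed

end

section \<open>The group algebra of a finite abelian group\<close>

lemma (in comm_monoid) finprod_swap:
  assumes "\<And>i j. \<lbrakk>i \<in> A; j \<in> B\<rbrakk> \<Longrightarrow> f i j \<in> carrier G"
  shows "(\<Otimes>i\<in>A. \<Otimes>j\<in>B. f i j) = (\<Otimes>j\<in>B. \<Otimes>i\<in>A. f i j)"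
  using assms
proof (induction A rule: infinite_finite_induct)
  case (insert a A)
  have "(\<Otimes>j\<in>B. \<Otimes>i\<in>insert a A. f i j) = (\<Otimes>j\<in>B. f a j \<otimes> (\<Otimes>i\<in>A. f i j))"
    using insert.hyps insert.prems by (intro finprod_cong') (auto intro!: finprod_insert)
  also have "\<dots> = (\<Otimes>j\<in>B. f a j) \<otimes> (\<Otimes>j\<in>B. \<Otimes>i\<in>A. f i j)"
    using insert.prems by (intro finprod_multf) auto
  also have "(\<Otimes>j\<in>B. \<Otimes>i\<in>A. f i j) = (\<Otimes>i\<in>A. \<Otimes>j\<in>B. f i j)"
    using insert.IH insert.prems by simp
  finally show ?case
    using insert.hyps insert.prems by simp
qed auto

lemmas (in abelian_monoid) finsum_swap = add.finprod_swap

section \<open>The group algebra as a commutative algebra\<close>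

locale finite_group_algebra = K: field K + P: comm_group P
  for K :: "('k, 'm) ring_scheme" and P :: "('g, 'n) monoid_scheme" +
  assumes finite_P: "finite (carrier P)"
begin

abbreviation A where "A \<equiv> group_algebra K P"

lemma A_simps:
  "carrier A = carrier P \<rightarrow>\<^sub>E carrier K"
  "a \<otimes>\<^bsub>A\<^esub> b = (\<lambda>u\<in>carrier P. finsum K (\<lambda>v. a v \<otimes>\<^bsub>K\<^esub> b (inv\<^bsub>P\<^esub> v \<otimes>\<^bsub>P\<^esub> u)) (carrier P))"
  "\<one>\<^bsub>A\<^esub> = (\<lambda>u\<in>carrier P. if u = \<one>\<^bsub>P\<^esub> then \<one>\<^bsub>K\<^esub> else \<zero>\<^bsub>K\<^esub>)"
  "\<zero>\<^bsub>A\<^esub> = (\<lambda>u\<in>carrier P. \<zero>\<^bsub>K\<^esub>)"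
  "a \<oplus>\<^bsub>A\<^esub> b = (\<lambda>u\<in>carrier P. a u \<oplus>\<^bsub>K\<^esub> b u)"
  "c \<odot>\<^bsub>A\<^esub> a = (\<lambda>u\<in>carrier P. c \<otimes>\<^bsub>K\<^esub> a u)"
  unfolding group_algebra_def by simp_all

lemma A_ext: "\<lbrakk>a \<in> carrier A; b \<in> carrier A; \<And>u. u \<in> carrier P \<Longrightarrow> a u = b u\<rbrakk> \<Longrightarrow> a = b"
  unfolding A_simps by (rule PiE_ext)

lemma A_val [simp]: "a \<in> carrier A \<Longrightarrow> u \<in> carrier P \<Longrightarrow> a u \<in> carrier K"
  unfolding A_simps by auto

lemma A_closed:
  "a \<in> carrier A \<Longrightarrow> b \<in> carrier A \<Longrightarrow> a \<otimes>\<^bsub>A\<^esub> b \<in> carrier A"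
  "\<one>\<^bsub>A\<^esub> \<in> carrier A" "\<zero>\<^bsub>A\<^esub> \<in> carrier A"
  "a \<in> carrier A \<Longrightarrow> b \<in> carrier A \<Longrightarrow> a \<oplus>\<^bsub>A\<^esub> b \<in> carrier A"
  "c \<in> carrier K \<Longrightarrow> a \<in> carrier A \<Longrightarrow> c \<odot>\<^bsub>A\<^esub> a \<in> carrier A"
proof -
  show "a \<otimes>\<^bsub>A\<^esub> b \<in> carrier A" if "a \<in> carrier A" "b \<in> carrier A"
    unfolding A_simps(1,2) restrict_PiE using that by (intro Pi_I K.finsum_closed) auto
qed (unfold A_simps, auto)

lemma A_mult_val: "u \<in> carrier P \<Longrightarrow>
   (a \<otimes>\<^bsub>A\<^esub> b) u = finsum K (\<lambda>v. a v \<otimes>\<^bsub>K\<^esub> b (inv\<^bsub>P\<^esub> v \<otimes>\<^bsub>P\<^esub> u)) (carrier P)"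
  by (simp add: A_simps)

lemma A_mult_assoc:
  assumes abc: "a \<in> carrier A" "b \<in> carrier A" "c \<in> carrier A"
  shows "a \<otimes>\<^bsub>A\<^esub> b \<otimes>\<^bsub>A\<^esub> c = a \<otimes>\<^bsub>A\<^esub> (b \<otimes>\<^bsub>A\<^esub> c)"
proof (rule A_ext)
  fix u assume u: "u \<in> carrier P"
  let ?i = "\<lambda>v. inv\<^bsub>P\<^esub> v"
  have "(a \<otimes>\<^bsub>A\<^esub> b \<otimes>\<^bsub>A\<^esub> c) u = finsum K (\<lambda>w. finsum K (\<lambda>v. a v \<otimes>\<^bsub>K\<^esub> b (?i v \<otimes>\<^bsub>P\<^esub> w) \<otimes>\<^bsub>K\<^esub> c (?i w \<otimes>\<^bsub>P\<^esub> u)) (carrier P)) (carrier P)"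
    unfolding A_mult_val[OF u]
  proof (rule K.finsum_cong')
    fix w assume w: "w \<in> carrier P"
    show "(a \<otimes>\<^bsub>A\<^esub> b) w \<otimes>\<^bsub>K\<^esub> c (?i w \<otimes>\<^bsub>P\<^esub> u) =
      finsum K (\<lambda>v. a v \<otimes>\<^bsub>K\<^esub> b (?i v \<otimes>\<^bsub>P\<^esub> w) \<otimes>\<^bsub>K\<^esub> c (?i w \<otimes>\<^bsub>P\<^esub> u)) (carrier P)"
      unfolding A_mult_val[OF w] using abc u w finite_P by (intro K.finsum_ldistr) auto
  qed (use abc u in \<open>auto intro!: K.finsum_closed\<close>)
  also have "\<dots> = finsum K (\<lambda>v. finsum K (\<lambda>w. a v \<otimes>\<^bsub>K\<^esub> b (?i v \<otimes>\<^bsub>P\<^esub> w) \<otimes>\<^bsub>K\<^esub> c (?i w \<otimes>\<^bsub>P\<^esub> u)) (carrier P)) (carrier P)"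
    using abc u by (intro K.finsum_swap) auto
  also have "\<dots> = (a \<otimes>\<^bsub>A\<^esub> (b \<otimes>\<^bsub>A\<^esub> c)) u"
    unfolding A_mult_val[OF u]
  proof (rule K.finsum_cong')
    fix v assume v: "v \<in> carrier P"
    \<comment> \<open>Substitution w = v x in the inner sum; left translation permutes the
      group.\<close>
    have im: "(\<lambda>x. v \<otimes>\<^bsub>P\<^esub> x) ` carrier P = carrier P" using v by (rule P.surj_const_mult)
    have "finsum K (\<lambda>w. a v \<otimes>\<^bsub>K\<^esub> b (?i v \<otimes>\<^bsub>P\<^esub> w) \<otimes>\<^bsub>K\<^esub> c (?i w \<otimes>\<^bsub>P\<^esub> u)) ((\<lambda>x. v \<otimes>\<^bsub>P\<^esub> x) ` carrier P) =
      finsum K (\<lambda>x. a v \<otimes>\<^bsub>K\<^esub> b (?i v \<otimes>\<^bsub>P\<^esub> (v \<otimes>\<^bsub>P\<^esub> x)) \<otimes>\<^bsub>K\<^esub> c (?i (v \<otimes>\<^bsub>P\<^esub> x) \<otimes>\<^bsub>P\<^esub> u)) (carrier P)"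
      using abc u v by (intro K.finsum_reindex) (auto simp: P.inj_on_cmult)
    also have "\<dots> = finsum K (\<lambda>x. a v \<otimes>\<^bsub>K\<^esub> (b x \<otimes>\<^bsub>K\<^esub> c (?i x \<otimes>\<^bsub>P\<^esub> (?i v \<otimes>\<^bsub>P\<^esub> u)))) (carrier P)"
    proof (rule K.finsum_cong')
      fix x assume x: "x \<in> carrier P"
      have "?i v \<otimes>\<^bsub>P\<^esub> (v \<otimes>\<^bsub>P\<^esub> x) = x" "?i (v \<otimes>\<^bsub>P\<^esub> x) \<otimes>\<^bsub>P\<^esub> u = ?i x \<otimes>\<^bsub>P\<^esub> (?i v \<otimes>\<^bsub>P\<^esub> u)"
        using u v x by (simp_all add: P.m_assoc[symmetric] P.inv_mult_group)
      then show "a v \<otimes>\<^bsub>K\<^esub> b (?i v \<otimes>\<^bsub>P\<^esub> (v \<otimes>\<^bsub>P\<^esub> x)) \<otimes>\<^bsub>K\<^esub> c (?i (v \<otimes>\<^bsub>P\<^esub> x) \<otimes>\<^bsub>P\<^esub> u) =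
        a v \<otimes>\<^bsub>K\<^esub> (b x \<otimes>\<^bsub>K\<^esub> c (?i x \<otimes>\<^bsub>P\<^esub> (?i v \<otimes>\<^bsub>P\<^esub> u)))"
        using abc u v x by (simp add: K.m_assoc)
    qed (use abc u v in auto)
    also have "\<dots> = a v \<otimes>\<^bsub>K\<^esub> (b \<otimes>\<^bsub>A\<^esub> c) (?i v \<otimes>\<^bsub>P\<^esub> u)"
      using abc u v finite_P by (subst A_mult_val) (auto intro!: K.finsum_rdistr[symmetric])
    finally show "finsum K (\<lambda>w. a v \<otimes>\<^bsub>K\<^esub> b (?i v \<otimes>\<^bsub>P\<^esub> w) \<otimes>\<^bsub>K\<^esub> c (?i w \<otimes>\<^bsub>P\<^esub> u)) (carrier P) =
      a v \<otimes>\<^bsub>K\<^esub> (b \<otimes>\<^bsub>A\<^esub> c) (?i v \<otimes>\<^bsub>P\<^esub> u)" unfolding im .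
  qed (use abc u A_closed in auto)
  finally show "(a \<otimes>\<^bsub>A\<^esub> b \<otimes>\<^bsub>A\<^esub> c) u = (a \<otimes>\<^bsub>A\<^esub> (b \<otimes>\<^bsub>A\<^esub> c)) u" .
qed (use abc A_closed in auto)

text \<open>The substitution v -> v^-1 u is an involution of \<open>P\<close> because
  \<open>P\<close> is commutative, and it exchanges the two factors of each term of the
  convolution.\<close>

lemma A_mult_comm:
  assumes ab: "a \<in> carrier A" "b \<in> carrier A"
  shows "a \<otimes>\<^bsub>A\<^esub> b = b \<otimes>\<^bsub>A\<^esub> a"
proof (rule A_ext)
  fix u assume u: "u \<in> carrier P"
  let ?i = "\<lambda>v. inv\<^bsub>P\<^esub> v \<otimes>\<^bsub>P\<^esub> u"
  have ii: "?i (?i v) = v" if "v \<in> carrier P" for v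
    using that u by (simp add: P.inv_mult_group P.m_assoc P.m_comm P.inv_mult) (simp add: P.m_assoc[symmetric] P.m_comm)
  have im: "?i ` carrier P = carrier P" 
  proof
    show "carrier P \<subseteq> ?i ` carrier P"
      
    proof
      fix v assume v: "v \<in> carrier P"
      then have "v = ?i (?i v)" "?i v \<in> carrier P" using ii[OF v] u by auto
      then show "v \<in> ?i ` carrier P" by (rule image_eqI)
    qed
  qed (use u in auto)
  have inj: "inj_on ?i (carrier P)" using ii by (rule inj_on_inverseI)
  have "(a \<otimes>\<^bsub>A\<^esub> b) u = finsum K (\<lambda>v. a v \<otimes>\<^bsub>K\<^esub> b (?i v)) (?i ` carrier P)"
    unfolding im A_mult_val[OF u] ..
  also have "\<dots> = finsum K (\<lambda>v. a (?i v) \<otimes>\<^bsub>K\<^esub> b (?i (?i v))) (carrier P)"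
    using ab u inj by (intro K.finsum_reindex) auto
  also have "\<dots> = (b \<otimes>\<^bsub>A\<^esub> a) u"
    unfolding A_mult_val[OF u] using ab u ii by (intro K.finsum_cong') (auto simp: K.m_comm)
  finally show "(a \<otimes>\<^bsub>A\<^esub> b) u = (b \<otimes>\<^bsub>A\<^esub> a) u" .
qed (use ab A_closed in auto)

sublocale A: cring A
  proof (rule cringI)
    show "abelian_group A"
    proof (rule abelian_groupI)
      fix a assume a: "a \<in> carrier A"
      show "\<exists>b\<in>carrier A. b \<oplus>\<^bsub>A\<^esub> a = \<zero>\<^bsub>A\<^esub>"
        using a by (intro bexI[of _ "\<lambda>u\<in>carrier P. \<ominus>\<^bsub>K\<^esub> a u"]) (auto simp: A_simps K.l_neg PiE_mem)
    next
      fix a assume "a \<in> carrier A" then show "\<zero>\<^bsub>A\<^esub> \<oplus>\<^bsub>A\<^esub> a = a"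
        using A_closed by (intro A_ext) (auto simp: A_simps PiE_mem)
    next
      fix a b c assume "a \<in> carrier A" "b \<in> carrier A" "c \<in> carrier A"
      then show "a \<oplus>\<^bsub>A\<^esub> b \<oplus>\<^bsub>A\<^esub> c = a \<oplus>\<^bsub>A\<^esub> (b \<oplus>\<^bsub>A\<^esub> c)"
        using A_closed by (intro A_ext) (auto simp: A_simps PiE_mem K.a_assoc)
    next
      fix a b assume "a \<in> carrier A" "b \<in> carrier A"
      then show "a \<oplus>\<^bsub>A\<^esub> b = b \<oplus>\<^bsub>A\<^esub> a"
        using A_closed by (intro A_ext) (auto simp: A_simps PiE_mem K.a_comm)
    qed (rule A_closed; assumption)+
    show "Group.comm_monoid A"
    proof (rule comm_monoidI)
      fix a assume a: "a \<in> carrier A"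
      show "\<one>\<^bsub>A\<^esub> \<otimes>\<^bsub>A\<^esub> a = a"
      proof (rule A_ext)
        fix u assume u: "u \<in> carrier P"
        have "(\<one>\<^bsub>A\<^esub> \<otimes>\<^bsub>A\<^esub> a) u = finsum K (\<lambda>v. if \<one>\<^bsub>P\<^esub> = v then a u else \<zero>\<^bsub>K\<^esub>) (carrier P)"
          unfolding A_mult_val[OF u] using a u by (intro K.finsum_cong') (auto simp: A_simps PiE_mem)
        also have "\<dots> = a u" using a u finite_P by (intro K.finsum_singleton) auto
        finally show "(\<one>\<^bsub>A\<^esub> \<otimes>\<^bsub>A\<^esub> a) u = a u" .
      qed (use a A_closed in auto)
    qed (use A_closed A_mult_assoc A_mult_comm in auto)
    fix a b c assume abc: "a \<in> carrier A" "b \<in> carrier A" "c \<in> carrier A"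
    show "(a \<oplus>\<^bsub>A\<^esub> b) \<otimes>\<^bsub>A\<^esub> c = a \<otimes>\<^bsub>A\<^esub> c \<oplus>\<^bsub>A\<^esub> b \<otimes>\<^bsub>A\<^esub> c"
    proof (rule A_ext)
      fix u assume u: "u \<in> carrier P"
      have "((a \<oplus>\<^bsub>A\<^esub> b) \<otimes>\<^bsub>A\<^esub> c) u = finsum K (\<lambda>v. a v \<otimes>\<^bsub>K\<^esub> c (inv\<^bsub>P\<^esub> v \<otimes>\<^bsub>P\<^esub> u) \<oplus>\<^bsub>K\<^esub> b v \<otimes>\<^bsub>K\<^esub> c (inv\<^bsub>P\<^esub> v \<otimes>\<^bsub>P\<^esub> u)) (carrier P)"
        unfolding A_mult_val[OF u] using abc u by (intro K.finsum_cong') (auto simp: A_simps PiE_mem K.l_distr)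
      also have "\<dots> = (a \<otimes>\<^bsub>A\<^esub> c) u \<oplus>\<^bsub>K\<^esub> (b \<otimes>\<^bsub>A\<^esub> c) u"
        unfolding A_mult_val[OF u] using abc u by (intro K.finsum_addf) auto
      finally show "((a \<oplus>\<^bsub>A\<^esub> b) \<otimes>\<^bsub>A\<^esub> c) u = (a \<otimes>\<^bsub>A\<^esub> c \<oplus>\<^bsub>A\<^esub> b \<otimes>\<^bsub>A\<^esub> c) u"
        using u by (simp add: A_simps(5))
    qed (use abc A_closed in auto)
  qed

sublocale M: algebra K A
proof (rule algebraI)
  show "cring K" ..
  show "cring A" ..
  show "c \<odot>\<^bsub>A\<^esub> a \<in> carrier A" if "c \<in> carrier K" "a \<in> carrier A" for c a
    using A_closed that by blast
  show "\<one>\<^bsub>K\<^esub> \<odot>\<^bsub>A\<^esub> a = a" if "a \<in> carrier A" for a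
    using that A_closed by (intro A_ext) (auto simp: A_simps PiE_mem)
  show "(c \<oplus>\<^bsub>K\<^esub> d) \<odot>\<^bsub>A\<^esub> a = c \<odot>\<^bsub>A\<^esub> a \<oplus>\<^bsub>A\<^esub> d \<odot>\<^bsub>A\<^esub> a" if "c \<in> carrier K" "d \<in> carrier K" "a \<in> carrier A" for c d a
    using that A_closed by (intro A_ext) (auto simp: A_simps PiE_mem K.l_distr)
  show "(c \<otimes>\<^bsub>K\<^esub> d) \<odot>\<^bsub>A\<^esub> a = c \<odot>\<^bsub>A\<^esub> (d \<odot>\<^bsub>A\<^esub> a)" if "c \<in> carrier K" "d \<in> carrier K" "a \<in> carrier A" for c d a
    using that A_closed by (intro A_ext) (auto simp: A_simps PiE_mem K.m_assoc)
  fix c a b assume c: "c \<in> carrier K" and a: "a \<in> carrier A" and b: "b \<in> carrier A"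
  show "c \<odot>\<^bsub>A\<^esub> (a \<oplus>\<^bsub>A\<^esub> b) = c \<odot>\<^bsub>A\<^esub> a \<oplus>\<^bsub>A\<^esub> c \<odot>\<^bsub>A\<^esub> b"
    using a b c A_closed by (intro A_ext) (auto simp: A_simps PiE_mem K.r_distr)
  show "(c \<odot>\<^bsub>A\<^esub> a) \<otimes>\<^bsub>A\<^esub> b = c \<odot>\<^bsub>A\<^esub> (a \<otimes>\<^bsub>A\<^esub> b)"
  proof (rule A_ext)
    fix u assume u: "u \<in> carrier P"
    have "((c \<odot>\<^bsub>A\<^esub> a) \<otimes>\<^bsub>A\<^esub> b) u = finsum K (\<lambda>v. c \<otimes>\<^bsub>K\<^esub> (a v \<otimes>\<^bsub>K\<^esub> b (inv\<^bsub>P\<^esub> v \<otimes>\<^bsub>P\<^esub> u))) (carrier P)"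
      unfolding A_mult_val[OF u] using a b c u by (intro K.finsum_cong') (auto simp: A_simps PiE_mem K.m_assoc)
    also have "\<dots> = c \<otimes>\<^bsub>K\<^esub> (a \<otimes>\<^bsub>A\<^esub> b) u"
      unfolding A_mult_val[OF u] using a b c u finite_P by (intro K.finsum_rdistr[symmetric]) auto
    finally show "((c \<odot>\<^bsub>A\<^esub> a) \<otimes>\<^bsub>A\<^esub> b) u = (c \<odot>\<^bsub>A\<^esub> (a \<otimes>\<^bsub>A\<^esub> b)) u"
      using u by (simp add: A_simps(6))
  qed (use a b c A_closed in auto)
qed

end

section \<open>The Frobenius map in prime characteristic\<close>

lemma (in cring) binomial:
  assumes [simp]: "x \<in> carrier R" "y \<in> carrier R"
  shows "(x \<oplus> y) [^] n = (\<Oplus>k\<in>{..n}. [(n choose k)] \<cdot> (x [^] k \<otimes> y [^] (n - k)))"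
proof (induction n)
  case (Suc n)
  let ?t = "\<lambda>n k. [(n choose k)] \<cdot> (x [^] k \<otimes> y [^] (n - k))"
  have c [simp]: "?t n k \<in> carrier R" for n k by simp
  have "(x \<oplus> y) [^] Suc n = (\<Oplus>k\<in>{..n}. ?t n k) \<otimes> x \<oplus> (\<Oplus>k\<in>{..n}. ?t n k) \<otimes> y"
    using Suc by (simp add: r_distr)
  also have "(\<Oplus>k\<in>{..n}. ?t n k) \<otimes> x = (\<Oplus>k\<in>{..n}. [(n choose k)] \<cdot> (x [^] Suc k \<otimes> y [^] (n - k)))"
    by (subst finsum_ldistr) (auto intro!: finsum_cong' simp: add_pow_ldistr add_pow_rdistr m_ac)
  also have "(\<Oplus>k\<in>{..n}. ?t n k) \<otimes> y = (\<Oplus>k\<in>{..n}. [(n choose k)] \<cdot> (x [^] k \<otimes> y [^] (Suc n - k)))"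
    by (subst finsum_ldistr) (auto intro!: finsum_cong' simp: add_pow_ldistr add_pow_rdistr m_ac Suc_diff_le)
  \<comment> \<open>The added term has coefficient \<open>n choose Suc n\<close>, which is 0.
    Splitting off k = 0 next brings both sums to the same monomials, ready for Pascal's
    rule.\<close>
  also have "\<dots> = (\<Oplus>k\<in>{..Suc n}. [(n choose k)] \<cdot> (x [^] k \<otimes> y [^] (Suc n - k)))"
    using finsum_Suc[of "\<lambda>k. [(n choose k)] \<cdot> (x [^] k \<otimes> y [^] (Suc n - k))" n] by (auto simp: binomial_eq_0)
  also have "\<dots> = (\<Oplus>k\<in>{..n}. [(n choose Suc k)] \<cdot> (x [^] Suc k \<otimes> y [^] (n - k))) \<oplus> y [^] Suc n"
    by (subst finsum_Suc2) auto
  also have "(\<Oplus>k\<in>{..n}. [(n choose k)] \<cdot> (x [^] Suc k \<otimes> y [^] (n - k))) \<oplus> \<dots> =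
      (\<Oplus>k\<in>{..n}. [(n choose k)] \<cdot> (x [^] Suc k \<otimes> y [^] (n - k))) \<oplus>
      (\<Oplus>k\<in>{..n}. [(n choose Suc k)] \<cdot> (x [^] Suc k \<otimes> y [^] (n - k))) \<oplus> y [^] Suc n"
    by (intro a_assoc[symmetric] finsum_closed) auto
  also have "\<dots> = (\<Oplus>k\<in>{..n}. [(n choose k)] \<cdot> (x [^] Suc k \<otimes> y [^] (n - k)) \<oplus>
      [(n choose Suc k)] \<cdot> (x [^] Suc k \<otimes> y [^] (n - k))) \<oplus> y [^] Suc n"
    by (subst finsum_addf) auto
  also have "\<dots> = (\<Oplus>k\<in>{..n}. ?t (Suc n) (Suc k)) \<oplus> y [^] Suc n"
    by (intro arg_cong[of _ _ "\<lambda>z. z \<oplus> _"] finsum_cong') (auto simp: add.nat_pow_mult)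
  also have "\<dots> = (\<Oplus>k\<in>{..Suc n}. ?t (Suc n) k)"
    by (subst finsum_Suc2) auto
  finally show ?case .
qed simp

lemma (in cring) char_add_pow:
  fixes p n :: nat
  assumes "[p] \<cdot> \<one> = \<zero>" "x \<in> carrier R" "p dvd n"
  shows "[n] \<cdot> x = \<zero>"
proof -
  have "[p] \<cdot> x = \<zero>" using assms add_pow_ldistr[of \<one> x p] by simp
  then show ?thesis using assms by (auto elim!: dvdE simp: add.nat_pow_pow[symmetric])
qed

lemma (in cring) frobenius_add:
  fixes p :: nat
  assumes p: "Factorial_Ring.prime p" "[p] \<cdot> \<one> = \<zero>" and x: "x \<in> carrier R" "y \<in> carrier R"
  shows "(x \<oplus> y) [^] p = x [^] p \<oplus> y [^] p"
proof -
  let ?t = "\<lambda>k. [(p choose k)] \<cdot> (x [^] k \<otimes> y [^] (p - k))"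
  obtain n where n: "p = Suc n" "n > 0" using prime_gt_1_nat[OF p(1)] by (metis Suc_lessE One_nat_def)
  have c [simp]: "?t k \<in> carrier R" for k using x by simp
  have "(x \<oplus> y) [^] p = (\<Oplus>k\<in>{..p}. ?t k)" using binomial x by blast
  also have "\<dots> = ?t p \<oplus> (\<Oplus>k\<in>{..n}. ?t k)" using finsum_Suc[of ?t n] c n(1) by auto
  \<comment> \<open>The term k = p has been split off, so p divides every remaining coefficient with
    k > 0.\<close>
  also have "(\<Oplus>k\<in>{..n}. ?t k) = (\<Oplus>k\<in>{..n}. if 0 = k then ?t k else \<zero>)"
  proof (rule finsum_cong')
    fix k assume k: "k \<in> {..n}"
    show "?t k = (if 0 = k then ?t k else \<zero>)"
    proof (cases "k = 0")
      case False
      then have "p dvd p choose k" using k n p(1) by (intro dvd_choose_prime) auto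
      then show ?thesis using False char_add_pow[OF p(2)] x by simp
    qed simp
  qed (use x in auto)
  also have "\<dots> = ?t 0" by (rule finsum_singleton) (use x in auto)
  finally show ?thesis using x by simp
qed

lemma (in cring) frobenius_minus:
  fixes p :: nat
  assumes p: "Factorial_Ring.prime p" "[p] \<cdot> \<one> = \<zero>" and x: "x \<in> carrier R" "y \<in> carrier R"
  shows "(x \<ominus> y) [^] (p ^ n) = x [^] (p ^ n) \<ominus> y [^] (p ^ n)"
proof (induction n)
  case (Suc n)
  \<comment> \<open>Additivity is applied to (a - b) + b, which avoids evaluating (-1)^p separately
    for p = 2.\<close>
  have one: "(a \<ominus> b) [^] p = a [^] p \<ominus> b [^] p" if "a \<in> carrier R" "b \<in> carrier R" for a b
  proof -
    have "a [^] p = ((a \<ominus> b) \<oplus> b) [^] p" using that by (simp add: minus_eq a_assoc l_neg)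
    also have "\<dots> = (a \<ominus> b) [^] p \<oplus> b [^] p" using that by (intro frobenius_add[OF p]) auto
    finally have eq: "a [^] p = (a \<ominus> b) [^] p \<oplus> b [^] p" .
    show ?thesis unfolding eq using that by (simp add: minus_eq a_assoc r_neg)
  qed
  have "(x \<ominus> y) [^] (p ^ Suc n) = ((x \<ominus> y) [^] (p ^ n)) [^] p"
    using x by (simp add: nat_pow_pow mult.commute)
  also have "\<dots> = (x [^] (p ^ n) \<ominus> y [^] (p ^ n)) [^] p" using Suc by simp
  also have "\<dots> = x [^] (p ^ Suc n) \<ominus> y [^] (p ^ Suc n)"
    using x by (simp add: one nat_pow_pow mult.commute)
  finally show ?case .
qed (use x in auto)

text \<open>\<open>ring_char\<close> is a definite description, so a unique solution has to be
  exhibited: the least positive \<open>n\<close> annihilating 1, or 0 if there is none.\<close>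

lemma (in ring) ring_char_add_pow: "[ring_char R] \<cdot> \<one> = \<zero>"
proof -
  define n where "n = (LEAST m::nat. m > 0 \<and> [m] \<cdot> \<one> = \<zero>)"
  have "\<exists>n. \<forall>m::nat. [m] \<cdot> \<one> = \<zero> \<longleftrightarrow> n dvd m"
  proof (cases "\<exists>m>0::nat. [m] \<cdot> \<one> = \<zero>")
    case True
    then have n: "n > 0" "[n] \<cdot> \<one> = \<zero>"
      unfolding n_def using LeastI_ex[OF True] by simp_all
    have min: "n \<le> m" if "m > 0" "[m] \<cdot> \<one> = \<zero>" for m
      unfolding n_def using that by (intro Least_le) auto
    have "[m] \<cdot> \<one> = [(m mod n)] \<cdot> \<one>" for m
    proof -
      have "[m] \<cdot> \<one> = [(n * (m div n) + m mod n)] \<cdot> \<one>" by simp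
      also have "\<dots> = [(n * (m div n))] \<cdot> \<one> \<oplus> [(m mod n)] \<cdot> \<one>"
        by (rule add.nat_pow_mult[symmetric]) simp
      also have "[(n * (m div n))] \<cdot> \<one> = [(m div n)] \<cdot> ([n] \<cdot> \<one>)"
        by (rule add.nat_pow_pow[symmetric]) simp
      finally show ?thesis using n by simp
    qed
    then have "[m] \<cdot> \<one> = \<zero> \<longleftrightarrow> n dvd m" for m
      using min[of "m mod n"] n mod_less_divisor[OF n(1), of m] by (metis dvd_eq_mod_eq_0 gr0I leD add.nat_pow_0)
    then show ?thesis by blast
  next
    case False
    then have "\<forall>m::nat. [m] \<cdot> \<one> = \<zero> \<longleftrightarrow> 0 dvd m" by (metis add.nat_pow_0 dvd_0_left_iff gr0I)
    then show ?thesis by blast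
  qed
  then obtain n where n: "\<forall>m::nat. [m] \<cdot> \<one> = \<zero> \<longleftrightarrow> n dvd m" by blast
  have "ring_char R = n"
    unfolding ring_char_def
  proof (rule the_equality)
    fix n' assume "\<forall>m::nat. [m] \<cdot> \<one> = \<zero> \<longleftrightarrow> n' dvd m"
    then show "n' = n" using n by (metis dvd_antisym dvd_refl)
  qed (rule n)
  then show ?thesis using n by auto
qed

section \<open>Linear extension from the group basis, and the augmentation\<close>

context finite_group_algebra
begin

text \<open>The group element \<open>u\<close> regarded as a basis vector of kP.\<close>

definition g :: "'g \<Rightarrow> 'g \<Rightarrow> 'k" where
  "g u = (\<lambda>w\<in>carrier P. if w = u then \<one>\<^bsub>K\<^esub> else \<zero>\<^bsub>K\<^esub>)"

lemma g_closed [simp, intro]: "g u \<in> carrier A"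
  unfolding g_def A_simps by auto

lemma g_one [simp]: "g \<one>\<^bsub>P\<^esub> = \<one>\<^bsub>A\<^esub>"
  unfolding g_def A_simps ..

lemma g_mult:
  assumes u: "u \<in> carrier P" and v: "v \<in> carrier P"
  shows "g u \<otimes>\<^bsub>A\<^esub> g v = g (u \<otimes>\<^bsub>P\<^esub> v)"
proof (rule A_ext)
  fix w assume w: "w \<in> carrier P"
  have "(g u \<otimes>\<^bsub>A\<^esub> g v) w = finsum K (\<lambda>x. if u = x then g v (inv\<^bsub>P\<^esub> u \<otimes>\<^bsub>P\<^esub> w) else \<zero>\<^bsub>K\<^esub>) (carrier P)"
    unfolding A_mult_val[OF w] using u v w by (intro K.finsum_cong') (auto simp: g_def)
  also have "\<dots> = g v (inv\<^bsub>P\<^esub> u \<otimes>\<^bsub>P\<^esub> w)"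
    using u v w finite_P by (intro K.finsum_singleton) auto
  also have "\<dots> = g (u \<otimes>\<^bsub>P\<^esub> v) w"
    unfolding g_def using u v w by (auto simp: P.inv_solve_left P.m_assoc[symmetric])
  finally show "(g u \<otimes>\<^bsub>A\<^esub> g v) w = g (u \<otimes>\<^bsub>P\<^esub> v) w" .
qed (use A_closed in auto)

lemma g_pow: "u \<in> carrier P \<Longrightarrow> g u [^]\<^bsub>A\<^esub> (n::nat) = g (u [^]\<^bsub>P\<^esub> n)"
  by (induction n) (auto simp: g_mult)

lemma finsum_val:
  assumes "f \<in> I \<rightarrow> carrier A" "w \<in> carrier P"
  shows "finsum A f I w = finsum K (\<lambda>i. f i w) I"
  using assms(1)
proof (induction I rule: infinite_finite_induct)
  case (insert i I)
  then show ?case using assms(2) by (simp add: A_simps(5) Pi_iff)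
qed (use assms(2) in \<open>simp_all add: A_simps(4)\<close>)

text \<open>The k-linear map with prescribed values \<open>h u\<close> on the basis, see
  \<open>lin_g\<close>.\<close>

definition lin :: "('g \<Rightarrow> 'g \<Rightarrow> 'k) \<Rightarrow> ('g \<Rightarrow> 'k) \<Rightarrow> 'g \<Rightarrow> 'k" where
  "lin h x = finsum A (\<lambda>u. x u \<odot>\<^bsub>A\<^esub> h u) (carrier P)"

lemma expand: "x \<in> carrier A \<Longrightarrow> lin g x = x"
proof (rule A_ext)
  fix w assume x: "x \<in> carrier A" and w: "w \<in> carrier P"
  have "lin g x w = finsum K (\<lambda>u. (x u \<odot>\<^bsub>A\<^esub> g u) w) (carrier P)"
    unfolding lin_def using x w by (intro finsum_val) auto
  also have "\<dots> = finsum K (\<lambda>u. if w = u then x u else \<zero>\<^bsub>K\<^esub>) (carrier P)"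
    using x w by (intro K.finsum_cong') (auto simp: A_simps(6) g_def)
  also have "\<dots> = x w" using x w finite_P by (intro K.finsum_singleton) auto
  finally show "lin g x w = x w" .
qed (auto simp: lin_def intro!: A.finsum_closed)

text \<open>Lets identities between linear maps be checked on multiples of group elements, without
  expanding coefficient sums each time.\<close>

lemma A_induct [consumes 1, case_names zero add smult]:
  assumes x: "x \<in> carrier A" and zero: "Q \<zero>\<^bsub>A\<^esub>"
    and add: "\<And>x y. \<lbrakk>x \<in> carrier A; y \<in> carrier A; Q x; Q y\<rbrakk> \<Longrightarrow> Q (x \<oplus>\<^bsub>A\<^esub> y)"
    and smult: "\<And>c u. \<lbrakk>c \<in> carrier K; u \<in> carrier P\<rbrakk> \<Longrightarrow> Q (c \<odot>\<^bsub>A\<^esub> g u)"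
  shows "Q x"
proof -
  have "I \<subseteq> carrier P \<Longrightarrow> Q (finsum A (\<lambda>u. x u \<odot>\<^bsub>A\<^esub> g u) I)" for I
  proof (induction I rule: infinite_finite_induct)
    case (insert i I)
    have "finsum A (\<lambda>u. x u \<odot>\<^bsub>A\<^esub> g u) (insert i I) = x i \<odot>\<^bsub>A\<^esub> g i \<oplus>\<^bsub>A\<^esub> finsum A (\<lambda>u. x u \<odot>\<^bsub>A\<^esub> g u) I"
      using insert x by (intro A.finsum_insert) auto
    then show ?case using insert x by (auto intro!: add smult A.finsum_closed)
  qed (simp_all add: zero)
  from this[of "carrier P"] show ?thesis using expand[OF x] unfolding lin_def by simp
qed

lemma lin_closed [simp]: "\<lbrakk>h \<in> carrier P \<rightarrow> carrier A; x \<in> carrier A\<rbrakk> \<Longrightarrow> lin h x \<in> carrier A"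
  unfolding lin_def by (auto intro!: A.finsum_closed)

lemma lin_add:
  assumes "h \<in> carrier P \<rightarrow> carrier A" "x \<in> carrier A" "y \<in> carrier A"
  shows "lin h (x \<oplus>\<^bsub>A\<^esub> y) = lin h x \<oplus>\<^bsub>A\<^esub> lin h y"
proof -
  have h: "h u \<in> carrier A" if "u \<in> carrier P" for u using that assms by auto
  have "lin h (x \<oplus>\<^bsub>A\<^esub> y) = finsum A (\<lambda>u. x u \<odot>\<^bsub>A\<^esub> h u \<oplus>\<^bsub>A\<^esub> y u \<odot>\<^bsub>A\<^esub> h u) (carrier P)"
    unfolding lin_def using assms(2,3) h
    by (intro A.finsum_cong') (auto simp: A_simps(5)[of x y] M.smult_l_distr)
  also have "\<dots> = lin h x \<oplus>\<^bsub>A\<^esub> lin h y"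
    unfolding lin_def using assms(2,3) h by (intro A.finsum_addf) auto
  finally show ?thesis .
qed

lemma lin_smult:
  assumes "h \<in> carrier P \<rightarrow> carrier A" "x \<in> carrier A" "c \<in> carrier K"
  shows "lin h (c \<odot>\<^bsub>A\<^esub> x) = c \<odot>\<^bsub>A\<^esub> lin h x"
proof -
  have h: "h u \<in> carrier A" if "u \<in> carrier P" for u using that assms by auto
  have "lin h (c \<odot>\<^bsub>A\<^esub> x) = finsum A (\<lambda>u. c \<odot>\<^bsub>A\<^esub> (x u \<odot>\<^bsub>A\<^esub> h u)) (carrier P)"
    unfolding lin_def using assms(2,3) h
    by (intro A.finsum_cong') (auto simp: A_simps(6)[of c x] M.smult_assoc1)
  also have "\<dots> = c \<odot>\<^bsub>A\<^esub> lin h x"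
    unfolding lin_def using assms(2,3) h finite_P by (intro M.finsum_smult_ldistr[symmetric]) auto
  finally show ?thesis .
qed

lemma lin_g:
  assumes "h \<in> carrier P \<rightarrow> carrier A" "u \<in> carrier P"
  shows "lin h (g u) = h u"
proof -
  have h: "h u \<in> carrier A" if "u \<in> carrier P" for u using that assms by auto
  have "lin h (g u) = finsum A (\<lambda>v. if u = v then h v else \<zero>\<^bsub>A\<^esub>) (carrier P)"
    unfolding lin_def using assms(2) h by (intro A.finsum_cong') (auto simp: g_def)
  also have "\<dots> = h u" using assms(2) h finite_P by (intro A.finsum_singleton) auto
  finally show ?thesis .
qed

definition aug :: "('g \<Rightarrow> 'k) \<Rightarrow> 'k" where
  "aug x = finsum K x (carrier P)"

lemma aug_closed [simp]: "x \<in> carrier A \<Longrightarrow> aug x \<in> carrier K"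
  unfolding aug_def by (auto intro!: K.finsum_closed)

lemma aug_add: "\<lbrakk>x \<in> carrier A; y \<in> carrier A\<rbrakk> \<Longrightarrow> aug (x \<oplus>\<^bsub>A\<^esub> y) = aug x \<oplus>\<^bsub>K\<^esub> aug y"
  unfolding aug_def
  by (subst K.finsum_addf[symmetric]) (auto intro!: K.finsum_cong' simp: A_simps(5)[of x y] simp del: K.finsum_addf)

lemma aug_smult: "\<lbrakk>c \<in> carrier K; x \<in> carrier A\<rbrakk> \<Longrightarrow> aug (c \<odot>\<^bsub>A\<^esub> x) = c \<otimes>\<^bsub>K\<^esub> aug x"
  unfolding aug_def using finite_P
  by (subst K.finsum_rdistr) (auto intro!: K.finsum_cong' simp: A_simps(6)[of c x])

lemma aug_zero [simp]: "aug \<zero>\<^bsub>A\<^esub> = \<zero>\<^bsub>K\<^esub>"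
  unfolding aug_def by (rule K.add.finprod_one_eqI) (simp add: A_simps(4))

lemma aug_g: "u \<in> carrier P \<Longrightarrow> aug (g u) = \<one>\<^bsub>K\<^esub>"
proof -
  assume u: "u \<in> carrier P"
  have "aug (g u) = finsum K (\<lambda>v. if u = v then \<one>\<^bsub>K\<^esub> else \<zero>\<^bsub>K\<^esub>) (carrier P)"
    unfolding aug_def by (intro K.finsum_cong') (auto simp: g_def)
  also have "\<dots> = \<one>\<^bsub>K\<^esub>" using u finite_P by (intro K.finsum_singleton) auto
  finally show ?thesis .
qed

lemma aug_mult_g: "\<lbrakk>x \<in> carrier A; u \<in> carrier P\<rbrakk> \<Longrightarrow> aug (x \<otimes>\<^bsub>A\<^esub> g u) = aug x"
proof (induction x rule: A_induct)
  case (smult c v)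
  then show ?case by (simp add: M.smult_assoc2 g_mult aug_smult aug_g)
qed (auto simp: A.l_distr aug_add)

end

section \<open>Powers of the augmentation ideal\<close>

locale p_group_algebra = finite_group_algebra K P
  for K :: "('k, 'm) ring_scheme" and P :: "('g, 'n) monoid_scheme" +
  fixes p :: nat and q :: nat
  assumes prime_p: "Factorial_Ring.prime p" and char_K: "ring_char K = p"
    and order_P: "order P = q" "\<exists>n. q = p ^ n"
begin

lemma p_one: "[p] \<cdot>\<^bsub>A\<^esub> \<one>\<^bsub>A\<^esub> = \<zero>\<^bsub>A\<^esub>"
proof -
  have *: "[n] \<cdot>\<^bsub>A\<^esub> \<one>\<^bsub>A\<^esub> = ([n] \<cdot>\<^bsub>K\<^esub> \<one>\<^bsub>K\<^esub>) \<odot>\<^bsub>A\<^esub> \<one>\<^bsub>A\<^esub>" for n :: nat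
    by (induction n) (auto simp: M.smult_l_distr)
  show ?thesis using *[of p] K.ring_char_add_pow char_K by simp
qed

text \<open>As \<open>q\<close> is a power of p, Frobenius gives (u - 1)^q = u^q - 1, and
  \<open>q\<close> is the group order.\<close>

lemma g_minus_one_pow: "u \<in> carrier P \<Longrightarrow> (g u \<ominus>\<^bsub>A\<^esub> \<one>\<^bsub>A\<^esub>) [^]\<^bsub>A\<^esub> q = \<zero>\<^bsub>A\<^esub>"
proof -
  assume u: "u \<in> carrier P"
  obtain n where n: "q = p ^ n" using order_P by auto
  have "(g u \<ominus>\<^bsub>A\<^esub> \<one>\<^bsub>A\<^esub>) [^]\<^bsub>A\<^esub> q = g u [^]\<^bsub>A\<^esub> q \<ominus>\<^bsub>A\<^esub> \<one>\<^bsub>A\<^esub> [^]\<^bsub>A\<^esub> q"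
    unfolding n by (intro A.frobenius_minus[OF prime_p p_one]) auto
  also have "g u [^]\<^bsub>A\<^esub> q = \<one>\<^bsub>A\<^esub>"
    using g_pow[OF u] P.pow_order_eq_1[OF u] order_P(1) by simp
  finally show ?thesis by (simp add: A.minus_eq A.r_neg)
qed

definition mon :: "'g list \<Rightarrow> 'g \<Rightarrow> 'k" where
  "mon us = foldr (\<lambda>u x. (g u \<ominus>\<^bsub>A\<^esub> \<one>\<^bsub>A\<^esub>) \<otimes>\<^bsub>A\<^esub> x) us \<one>\<^bsub>A\<^esub>"

lemma mon_simps [simp]: "mon [] = \<one>\<^bsub>A\<^esub>" "mon (u # us) = (g u \<ominus>\<^bsub>A\<^esub> \<one>\<^bsub>A\<^esub>) \<otimes>\<^bsub>A\<^esub> mon us"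
  unfolding mon_def by simp_all

lemma mon_closed [simp, intro]: "mon us \<in> carrier A"
  by (induction us) auto

lemma mon_append: "mon (us @ vs) = mon us \<otimes>\<^bsub>A\<^esub> mon vs"
  by (induction us) (auto simp: A.m_assoc)

text \<open>Collects the equal factors, as the pigeonhole argument of \<open>J_nilpotent\<close>
  requires.\<close>

lemma mon_removeAll:
  "mon us = (g u \<ominus>\<^bsub>A\<^esub> \<one>\<^bsub>A\<^esub>) [^]\<^bsub>A\<^esub> (count_list us u) \<otimes>\<^bsub>A\<^esub> mon (removeAll u us)"
  by (induction us) (auto simp: A.m_ac)

text \<open>The m-th power of the augmentation ideal, generated by m-fold products of elements u -
  1; \<open>J 0\<close> is the whole algebra. In inductive form, claims about an ideal power are
  checked on these products and on sums.\<close>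

inductive_set J :: "nat \<Rightarrow> ('g \<Rightarrow> 'k) set" for m :: nat where
  J_zero [simp, intro]: "\<zero>\<^bsub>A\<^esub> \<in> J m"
| J_add [intro]: "\<lbrakk>x \<in> J m; y \<in> J m\<rbrakk> \<Longrightarrow> x \<oplus>\<^bsub>A\<^esub> y \<in> J m"
| J_mon: "\<lbrakk>a \<in> carrier A; us \<in> lists (carrier P); length us = m\<rbrakk> \<Longrightarrow> a \<otimes>\<^bsub>A\<^esub> mon us \<in> J m"

lemma J_closed: "x \<in> J m \<Longrightarrow> x \<in> carrier A"
  by (induction rule: J.induct) auto

lemma J_mult: "\<lbrakk>x \<in> J m; b \<in> carrier A\<rbrakk> \<Longrightarrow> b \<otimes>\<^bsub>A\<^esub> x \<in> J m"
proof (induction rule: J.induct)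
  case (J_add x y)
  then show ?case using J_closed by (simp add: A.r_distr J.J_add)
next
  case (J_mon a us)
  then have "b \<otimes>\<^bsub>A\<^esub> (a \<otimes>\<^bsub>A\<^esub> mon us) = (b \<otimes>\<^bsub>A\<^esub> a) \<otimes>\<^bsub>A\<^esub> mon us" by (simp add: A.m_assoc)
  then show ?case using J_mon by (simp add: J.J_mon)
qed auto

lemma J_neg: "x \<in> J m \<Longrightarrow> \<ominus>\<^bsub>A\<^esub> x \<in> J m"
  using J_mult[of x m "\<ominus>\<^bsub>A\<^esub> \<one>\<^bsub>A\<^esub>"] J_closed[of x m] by (simp add: A.l_minus)

lemma J_minus: "\<lbrakk>x \<in> J m; y \<in> J m\<rbrakk> \<Longrightarrow> x \<ominus>\<^bsub>A\<^esub> y \<in> J m"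
  unfolding A.minus_eq by (intro J_add J_neg)

lemma J_smult: "\<lbrakk>x \<in> J m; c \<in> carrier K\<rbrakk> \<Longrightarrow> c \<odot>\<^bsub>A\<^esub> x \<in> J m"
  using J_mult[of x m "c \<odot>\<^bsub>A\<^esub> \<one>\<^bsub>A\<^esub>"] J_closed[of x m] by (simp add: M.smult_assoc2)

lemma J_finsum: "(\<And>i. i \<in> I \<Longrightarrow> f i \<in> J m) \<Longrightarrow> finsum A f I \<in> J m"
proof (induction I rule: infinite_finite_induct)
  case (insert i I)
  have "finsum A f (insert i I) = f i \<oplus>\<^bsub>A\<^esub> finsum A f I"
    using insert J_closed by (intro A.finsum_insert) auto
  then show ?case using insert by auto
qed auto

lemma J_mult_J: "\<lbrakk>x \<in> J i; y \<in> J j\<rbrakk> \<Longrightarrow> x \<otimes>\<^bsub>A\<^esub> y \<in> J (i + j)"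
proof (induction rule: J.induct)
  case J_zero
  then show ?case using J_closed by auto
next
  case (J_add x x')
  then show ?case using J_closed by (simp add: A.l_distr J.J_add)
next
  case (J_mon a us)
  have "mon us \<otimes>\<^bsub>A\<^esub> y \<in> J (i + j)"
    using J_mon(4)
  proof (induction rule: J.induct)
    case J_zero
    then show ?case by auto
  next
    case (J_add x x')
    then show ?case using J_closed by (simp add: A.r_distr J.J_add)
  next
    case (J_mon b vs)
    then have "mon us \<otimes>\<^bsub>A\<^esub> (b \<otimes>\<^bsub>A\<^esub> mon vs) = b \<otimes>\<^bsub>A\<^esub> mon (us @ vs)"
      by (simp add: mon_append A.m_ac)
    then show ?case using J_mon \<open>us \<in> _\<close> \<open>length us = i\<close> by (auto intro!: J.J_mon)
  qed
  then have "a \<otimes>\<^bsub>A\<^esub> (mon us \<otimes>\<^bsub>A\<^esub> y) \<in> J (i + j)" using J_mon(1) by (rule J_mult)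
  then show ?case using J_mon J_closed by (simp add: A.m_assoc)
qed

lemma J_0: "J 0 = carrier A"
proof -
  have "x \<in> J 0" if "x \<in> carrier A" for x
    using J_mon[OF that, of "[]" 0] that by simp
  then show ?thesis using J_closed by auto
qed

lemma J_Suc_subset: "J (Suc m) \<subseteq> J m"
proof
  fix x assume "x \<in> J (Suc m)"
  then show "x \<in> J m"
  proof (induction rule: J.induct)
    case (J_mon a us)
    then obtain u vs where us: "us = u # vs" by (cases us) auto
    have "a \<otimes>\<^bsub>A\<^esub> mon us = (a \<otimes>\<^bsub>A\<^esub> (g u \<ominus>\<^bsub>A\<^esub> \<one>\<^bsub>A\<^esub>)) \<otimes>\<^bsub>A\<^esub> mon vs"
      using J_mon us by (simp add: A.m_assoc)
    then show ?case using J_mon us by (auto intro!: J.J_mon)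
  qed auto
qed

lemma J_antimono: "m \<le> n \<Longrightarrow> J n \<subseteq> J m"
  using lift_Suc_antimono_le[of J] J_Suc_subset by auto

lemma g_minus_one_J: "u \<in> carrier P \<Longrightarrow> g u \<ominus>\<^bsub>A\<^esub> \<one>\<^bsub>A\<^esub> \<in> J 1"
  using J_mon[of "\<one>\<^bsub>A\<^esub>" "[u]" 1] by simp

text \<open>Pigeonhole: among at least q * q factors u - 1, with only \<open>q\<close> choices of
  \<open>u\<close>, one occurs at least \<open>q\<close> times, and its \<open>q\<close>-th power is
  0.\<close>

lemma J_nilpotent:
  assumes "m \<ge> q * q"
  shows "J m = {\<zero>\<^bsub>A\<^esub>}"
proof -
  have q: "q = card (carrier P)" "q > 0"
    using order_P(1) finite_P P.carrier_not_empty by (auto simp: Coset.order_def card_gt_0_iff)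
  have mon_zero: "mon us = \<zero>\<^bsub>A\<^esub>" if us: "us \<in> lists (carrier P)" "length us = m" for us
  proof -
    have "\<exists>u\<in>carrier P. count_list us u \<ge> q"
    proof (rule ccontr)
      assume "\<not> ?thesis"
      then have lt: "count_list us u < q" if "u \<in> carrier P" for u using that by (meson not_less)
      have "length us = (\<Sum>u\<in>carrier P. count_list us u)"
        using sum_count_set[of us "carrier P"] us finite_P by (simp add: in_lists_conv_set subset_iff)
      also have "\<dots> < (\<Sum>u\<in>carrier P. q)"
        using finite_P P.one_closed by (intro sum_strict_mono lt) auto
      also have "\<dots> = q * q" using q by simp
      finally show False using assms us by simp
    qed
    then obtain u where u: "u \<in> carrier P" "count_list us u \<ge> q" by auto
    let ?d = "g u \<ominus>\<^bsub>A\<^esub> \<one>\<^bsub>A\<^esub>"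
    have "?d [^]\<^bsub>A\<^esub> (count_list us u) = ?d [^]\<^bsub>A\<^esub> q \<otimes>\<^bsub>A\<^esub> ?d [^]\<^bsub>A\<^esub> (count_list us u - q)"
      using u by (subst A.nat_pow_mult) auto
    also have "\<dots> = \<zero>\<^bsub>A\<^esub>" using g_minus_one_pow[OF u(1)] by simp
    finally show ?thesis using mon_removeAll[of us u] by simp
  qed
  have "x = \<zero>\<^bsub>A\<^esub>" if "x \<in> J m" for x
    using that
  proof (induction rule: J.induct)
    case (J_mon a us)
    then show ?case using mon_zero[OF J_mon(2,3)] by simp
  qed simp_all
  then show ?thesis by auto
qed

lemma aug_decompose: "x \<in> carrier A \<Longrightarrow> x \<ominus>\<^bsub>A\<^esub> aug x \<odot>\<^bsub>A\<^esub> \<one>\<^bsub>A\<^esub> \<in> J 1"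
proof (induction x rule: A_induct)
  case zero
  then show ?case by (simp add: A.minus_eq)
next
  case (add x y)
  have "x \<oplus>\<^bsub>A\<^esub> y \<ominus>\<^bsub>A\<^esub> aug (x \<oplus>\<^bsub>A\<^esub> y) \<odot>\<^bsub>A\<^esub> \<one>\<^bsub>A\<^esub> =
    (x \<ominus>\<^bsub>A\<^esub> aug x \<odot>\<^bsub>A\<^esub> \<one>\<^bsub>A\<^esub>) \<oplus>\<^bsub>A\<^esub> (y \<ominus>\<^bsub>A\<^esub> aug y \<odot>\<^bsub>A\<^esub> \<one>\<^bsub>A\<^esub>)"
    using add by (simp add: aug_add M.smult_l_distr A.minus_eq A.minus_add A.a_ac)
  then show ?case using J_add[OF add(3,4)] by simp
next
  case (smult c u)
  have "c \<odot>\<^bsub>A\<^esub> g u \<ominus>\<^bsub>A\<^esub> aug (c \<odot>\<^bsub>A\<^esub> g u) \<odot>\<^bsub>A\<^esub> \<one>\<^bsub>A\<^esub> = c \<odot>\<^bsub>A\<^esub> (g u \<ominus>\<^bsub>A\<^esub> \<one>\<^bsub>A\<^esub>)"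
    using smult by (simp add: aug_smult aug_g A.minus_eq M.smult_r_distr M.smult_r_minus)
  then show ?case using J_smult[OF g_minus_one_J[OF smult(2)] smult(1)] by simp
qed

text \<open>A generator a(u - 1) has augmentation 0 because multiplication by \<open>u\<close> only
  permutes the coefficients of \<open>a\<close>; the converse is
  \<open>aug_decompose\<close>.\<close>

lemma J_1: "x \<in> J 1 \<longleftrightarrow> x \<in> carrier A \<and> aug x = \<zero>\<^bsub>K\<^esub>"
proof
  assume "x \<in> J 1"
  then show "x \<in> carrier A \<and> aug x = \<zero>\<^bsub>K\<^esub>"
  proof (induction rule: J.induct)
    case (J_mon a us)
    then obtain u where u: "us = [u]" "u \<in> carrier P" by (auto simp: length_Suc_conv)
    have "a \<otimes>\<^bsub>A\<^esub> mon us = a \<otimes>\<^bsub>A\<^esub> g u \<oplus>\<^bsub>A\<^esub> (\<ominus>\<^bsub>K\<^esub> \<one>\<^bsub>K\<^esub>) \<odot>\<^bsub>A\<^esub> a"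
      using J_mon(1) u by (simp add: A.minus_eq A.r_distr A.r_minus M.smult_l_minus)
    then have "aug (a \<otimes>\<^bsub>A\<^esub> mon us) = aug a \<oplus>\<^bsub>K\<^esub> (\<ominus>\<^bsub>K\<^esub> \<one>\<^bsub>K\<^esub>) \<otimes>\<^bsub>K\<^esub> aug a"
      using J_mon(1) u by (simp add: aug_add aug_mult_g aug_smult)
    then show ?case using J_mon by (simp add: K.l_minus K.r_neg)
  qed (auto simp: aug_add)
next
  assume "x \<in> carrier A \<and> aug x = \<zero>\<^bsub>K\<^esub>"
  then show "x \<in> J 1" using aug_decompose[of x] by (simp add: A.minus_eq)
qed

text \<open>A maximal ideal of a commutative ring is prime, so it contains the nilpotent elements u
  - 1 and with them the ideal they generate.\<close>

lemma J_1_jacobson: "J 1 \<subseteq> jacobson_radical A"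
proof
  fix x assume x: "x \<in> J 1"
  have "x \<in> I" if I: "maximalideal I A" for I
  proof -
    interpret primeideal I A using A.maximalideal_prime[OF I] .
    have pow: "y [^]\<^bsub>A\<^esub> n \<in> I \<Longrightarrow> y \<in> I" if "y \<in> carrier A" for y and n :: nat
    proof (induction n)
      case 0
      then have "\<one>\<^bsub>A\<^esub> \<in> I" by simp
      then show ?case using one_imp_carrier I_notcarr by blast
    next
      case (Suc n)
      then show ?case using I_prime[of "y [^]\<^bsub>A\<^esub> n" y] that by auto
    qed
    have d: "g u \<ominus>\<^bsub>A\<^esub> \<one>\<^bsub>A\<^esub> \<in> I" if "u \<in> carrier P" for u
      using pow[of "g u \<ominus>\<^bsub>A\<^esub> \<one>\<^bsub>A\<^esub>" q] g_minus_one_pow[OF that] by simp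
    show ?thesis
      using x
    proof (induction rule: J.induct)
      case (J_mon a us)
      then obtain u where u: "us = [u]" "u \<in> carrier P" by (auto simp: length_Suc_conv)
      then show ?case using J_mon(1) d[OF u(2)] by (simp add: I_l_closed)
    qed auto
  qed
  then show "x \<in> jacobson_radical A" unfolding jacobson_radical_def using J_closed[OF x] by auto
qed

section \<open>Derivations and the filtration by ideal powers\<close>

lemma derD:
  assumes "f \<in> derivations K A"
  shows "\<And>x. x \<in> carrier A \<Longrightarrow> f x \<in> carrier A"
    "\<And>x y. \<lbrakk>x \<in> carrier A; y \<in> carrier A\<rbrakk> \<Longrightarrow> f (x \<oplus>\<^bsub>A\<^esub> y) = f x \<oplus>\<^bsub>A\<^esub> f y"
    "\<And>c x. \<lbrakk>c \<in> carrier K; x \<in> carrier A\<rbrakk> \<Longrightarrow> f (c \<odot>\<^bsub>A\<^esub> x) = c \<odot>\<^bsub>A\<^esub> f x"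
    "\<And>x y. \<lbrakk>x \<in> carrier A; y \<in> carrier A\<rbrakk> \<Longrightarrow> f (x \<otimes>\<^bsub>A\<^esub> y) = f x \<otimes>\<^bsub>A\<^esub> y \<oplus>\<^bsub>A\<^esub> x \<otimes>\<^bsub>A\<^esub> f y"
    "f \<in> extensional (carrier A)"
  using assms unfolding derivations_def PiE_def by auto

lemma der_zero: "f \<in> derivations K A \<Longrightarrow> f \<zero>\<^bsub>A\<^esub> = \<zero>\<^bsub>A\<^esub>"
  using derD(3)[of f "\<zero>\<^bsub>K\<^esub>" "\<zero>\<^bsub>A\<^esub>"] derD(1)[of f "\<zero>\<^bsub>A\<^esub>"] by simp

lemma der_one: "f \<in> derivations K A \<Longrightarrow> f \<one>\<^bsub>A\<^esub> = \<zero>\<^bsub>A\<^esub>"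
  using derD(4)[of f "\<one>\<^bsub>A\<^esub>" "\<one>\<^bsub>A\<^esub>"] derD(1)[of f "\<one>\<^bsub>A\<^esub>"] by simp

lemma der_neg: "f \<in> derivations K A \<Longrightarrow> x \<in> carrier A \<Longrightarrow> f (\<ominus>\<^bsub>A\<^esub> x) = \<ominus>\<^bsub>A\<^esub> f x"
  using derD(3)[of f "\<ominus>\<^bsub>K\<^esub> \<one>\<^bsub>K\<^esub>" x] derD(1)[of f x] by (simp add: M.smult_l_minus)

lemma der_minus: "f \<in> derivations K A \<Longrightarrow> x \<in> carrier A \<Longrightarrow> y \<in> carrier A \<Longrightarrow>
    f (x \<ominus>\<^bsub>A\<^esub> y) = f x \<ominus>\<^bsub>A\<^esub> f y"
  by (simp add: A.minus_eq derD(2) der_neg)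

lemma der_lin: "f \<in> derivations K A \<Longrightarrow> x \<in> carrier A \<Longrightarrow> f x = lin (\<lambda>u. f (g u)) x"
proof -
  assume f: "f \<in> derivations K A" and x: "x \<in> carrier A"
  have h: "(\<lambda>u. f (g u)) \<in> carrier P \<rightarrow> carrier A" using derD(1)[OF f] by auto
  show ?thesis
    using x
  proof (induction x rule: A_induct)
    case zero
    then show ?case using lin_smult[OF h, of "\<zero>\<^bsub>A\<^esub>" "\<zero>\<^bsub>K\<^esub>"] lin_closed[OF h, of "\<zero>\<^bsub>A\<^esub>"] der_zero[OF f] by simp
  qed (simp_all add: derD[OF f] lin_add[OF h] lin_smult[OF h] lin_g[OF h])
qed

text \<open>The Leibniz rule trades one of the i + 1 factors u - 1 for a value of \<open>f\<close>,
  leaving i + m. With m = 0 a derivation lowers the filtration by one, with m = 1 it preserves it,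
  and from m = 2 on it raises it.\<close>

lemma der_J:
  assumes f: "f \<in> derivations K A" and fJ: "\<And>x. x \<in> carrier A \<Longrightarrow> f x \<in> J m" and x: "x \<in> J (Suc i)"
  shows "f x \<in> J (i + m)"
proof -
  \<comment> \<open>Truncated subtraction does no harm for the empty list, since \<open>f\<close>
    vanishes at 1.\<close>
  have mon: "f (mon us) \<in> J (length us - 1 + m)" if "us \<in> lists (carrier P)" for us
    using that
  proof (induction us)
    case Nil
    then show ?case using der_one[OF f] by auto
  next
    case (Cons u us)
    let ?d = "g u \<ominus>\<^bsub>A\<^esub> \<one>\<^bsub>A\<^esub>"
    have "f ?d \<otimes>\<^bsub>A\<^esub> mon us \<in> J (m + length us)"
      using fJ[of ?d] J_mon[of "\<one>\<^bsub>A\<^esub>" us "length us"] Cons by (intro J_mult_J) auto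
    moreover have "?d \<otimes>\<^bsub>A\<^esub> f (mon us) \<in> J (m + length us)"
    proof (cases us)
      case Nil
      then show ?thesis using der_one[OF f] by simp
    next
      case Cons2: (Cons v vs)
      have "?d \<otimes>\<^bsub>A\<^esub> f (mon us) \<in> J (1 + (length us - 1 + m))"
        using g_minus_one_J[of u] Cons by (intro J_mult_J) auto
      then show ?thesis using Cons2 by (simp add: add.commute)
    qed
    ultimately show ?case
      using derD(4)[OF f, of ?d "mon us"] by (simp add: J_add add.commute)
  qed
  show ?thesis
    using x
  proof (induction rule: J.induct)
    case J_zero
    then show ?case using der_zero[OF f] by simp
  next
    case (J_add x y)
    then show ?case using derD(2)[OF f] J_closed by (simp add: J.J_add)
  next
    case (J_mon a us)
    have "f a \<otimes>\<^bsub>A\<^esub> mon us \<in> J (m + Suc i)"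
      using fJ[of a] J.J_mon[of "\<one>\<^bsub>A\<^esub>" us "Suc i"] J_mon by (intro J_mult_J) auto
    then have "f a \<otimes>\<^bsub>A\<^esub> mon us \<in> J (i + m)" using J_Suc_subset[of "i + m"] by (auto simp: add.commute)
    moreover have "a \<otimes>\<^bsub>A\<^esub> f (mon us) \<in> J (i + m)" using mon[of us] J_mon by (intro J_mult) auto
    ultimately show ?case using derD(4)[OF f, of a "mon us"] J_mon by (simp add: J.J_add)
  qed
qed

definition der_of :: "('g \<Rightarrow> 'g \<Rightarrow> 'k) \<Rightarrow> ('g \<Rightarrow> 'k) \<Rightarrow> 'g \<Rightarrow> 'k" where
  "der_of \<delta> = (\<lambda>x\<in>carrier A. lin (\<lambda>u. g u \<otimes>\<^bsub>A\<^esub> \<delta> u) x)"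

lemma smult_assoc_right: "\<lbrakk>c \<in> carrier K; x \<in> carrier A; y \<in> carrier A\<rbrakk> \<Longrightarrow> x \<otimes>\<^bsub>A\<^esub> (c \<odot>\<^bsub>A\<^esub> y) = c \<odot>\<^bsub>A\<^esub> (x \<otimes>\<^bsub>A\<^esub> y)"
  using M.smult_assoc2[of c y x] A.m_comm[of x "c \<odot>\<^bsub>A\<^esub> y"] A.m_comm[of x y] by simp

text \<open>The Leibniz rule on group elements is uv(\<delta> u + \<delta> v) = (u \<delta> u)v +
  u(v \<delta> v); bilinearity extends it to the algebra. So every homomorphism from
  \<open>P\<close> to the additive group of kP gives a derivation.\<close>

lemma der_of:
  assumes \<delta>: "\<And>u. u \<in> carrier P \<Longrightarrow> \<delta> u \<in> carrier A"
    and hom: "\<And>u v. \<lbrakk>u \<in> carrier P; v \<in> carrier P\<rbrakk> \<Longrightarrow> \<delta> (u \<otimes>\<^bsub>P\<^esub> v) = \<delta> u \<oplus>\<^bsub>A\<^esub> \<delta> v"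
  shows "der_of \<delta> \<in> derivations K A" "u \<in> carrier P \<Longrightarrow> der_of \<delta> (g u) = g u \<otimes>\<^bsub>A\<^esub> \<delta> u"
proof -
  let ?L = "lin (\<lambda>u. g u \<otimes>\<^bsub>A\<^esub> \<delta> u)"
  have h: "(\<lambda>u. g u \<otimes>\<^bsub>A\<^esub> \<delta> u) \<in> carrier P \<rightarrow> carrier A" using \<delta> by auto
  note L = lin_closed[OF h] lin_add[OF h] lin_smult[OF h] lin_g[OF h]
  have L0: "?L \<zero>\<^bsub>A\<^esub> = \<zero>\<^bsub>A\<^esub>" using L(3)[of "\<zero>\<^bsub>A\<^esub>" "\<zero>\<^bsub>K\<^esub>"] L(1)[of "\<zero>\<^bsub>A\<^esub>"] by simp
  show "u \<in> carrier P \<Longrightarrow> der_of \<delta> (g u) = g u \<otimes>\<^bsub>A\<^esub> \<delta> u" unfolding der_of_def using L(4) by simp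
  have leib: "?L (x \<otimes>\<^bsub>A\<^esub> y) = ?L x \<otimes>\<^bsub>A\<^esub> y \<oplus>\<^bsub>A\<^esub> x \<otimes>\<^bsub>A\<^esub> ?L y"
    if x: "x \<in> carrier A" and y: "y \<in> carrier A" for x y
    using x
  proof (induction x rule: A_induct)
    case zero
    then show ?case using y L L0 by simp
  next
    case (add x x')
    then show ?case using y L(1) by (simp add: L(2) A.l_distr A.a_ac)
  next
    case (smult c u)
    have "?L (g u \<otimes>\<^bsub>A\<^esub> y) = ?L (g u) \<otimes>\<^bsub>A\<^esub> y \<oplus>\<^bsub>A\<^esub> g u \<otimes>\<^bsub>A\<^esub> ?L y"
      using y
    proof (induction y rule: A_induct)
      case zero
      then show ?case using L L0 by simp
    next
      case (add y y')
      then show ?case using L(1) by (simp add: L(2) A.r_distr A.a_ac)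
    next
      case (smult d v)
      have "?L (g u \<otimes>\<^bsub>A\<^esub> g v) = ?L (g u) \<otimes>\<^bsub>A\<^esub> g v \<oplus>\<^bsub>A\<^esub> g u \<otimes>\<^bsub>A\<^esub> ?L (g v)"
      proof -
        note c = \<delta>[OF \<open>u \<in> carrier P\<close>] \<delta>[OF smult(2)]
        have "?L (g u \<otimes>\<^bsub>A\<^esub> g v) = (g u \<otimes>\<^bsub>A\<^esub> g v) \<otimes>\<^bsub>A\<^esub> (\<delta> u \<oplus>\<^bsub>A\<^esub> \<delta> v)"
          using \<open>u \<in> carrier P\<close> smult hom by (simp add: g_mult L(4))
        also have "\<dots> = (g u \<otimes>\<^bsub>A\<^esub> \<delta> u) \<otimes>\<^bsub>A\<^esub> g v \<oplus>\<^bsub>A\<^esub> g u \<otimes>\<^bsub>A\<^esub> (g v \<otimes>\<^bsub>A\<^esub> \<delta> v)"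
          using c by (simp add: A.r_distr A.m_ac)
        finally show ?thesis using \<open>u \<in> carrier P\<close> smult by (simp add: L(4))
      qed
      then show ?case using smult L(1) by (simp add: smult_assoc_right L(3) M.smult_r_distr)
    qed
    then show ?case using smult y L(1) by (simp add: M.smult_assoc2 L(3) M.smult_r_distr)
  qed
  show "der_of \<delta> \<in> derivations K A"
    unfolding derivations_def der_of_def using L(1,2,3) leib by simp
qed

end

section \<open>Stable derivations\<close>

lemma (in comm_group) p_powers_subgroup:
  "subgroup {x [^] (p::nat) | x. x \<in> carrier G} G"
proof (rule subgroup.intro)
  have "\<one> = \<one> [^] p" by simp
  then show "\<one> \<in> {x [^] p | x. x \<in> carrier G}" by blast
  fix x y assume "x \<in> {x [^] p | x. x \<in> carrier G}" "y \<in> {x [^] p | x. x \<in> carrier G}"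
  then obtain a b where ab: "a \<in> carrier G" "b \<in> carrier G" "x = a [^] p" "y = b [^] p" by auto
  then have "x \<otimes> y = (a \<otimes> b) [^] p" by (simp add: nat_pow_distrib)
  then show "x \<otimes> y \<in> {x [^] p | x. x \<in> carrier G}" using ab by blast
next
  fix x assume "x \<in> {x [^] p | x. x \<in> carrier G}"
  then obtain a where a: "a \<in> carrier G" "x = a [^] p" by auto
  then have "inv x = (inv a) [^] p" by (simp add: nat_pow_inv)
  then show "inv x \<in> {x [^] p | x. x \<in> carrier G}" using a by blast
qed auto

text \<open>In an abelian group the quotient by \<open>N\<close> is elementary abelian exactly when
  \<open>N\<close> contains all p-th powers, and these already form a subgroup, the least
  candidate.\<close>

lemma (in comm_group) frattini_eq_p_powers: "frattini p G = {x [^] p | x. x \<in> carrier G}"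
proof -
  let ?N = "{x [^] p | x. x \<in> carrier G}"
  have mem: "N \<lhd> G \<and> elementary_abelian p (G Mod N) \<longleftrightarrow> subgroup N G \<and> ?N \<subseteq> N" for N
  proof (cases "subgroup N G")
    case True
    then interpret normal N G by (simp add: normal_iff_subgroup)
    have com: "comm_group (G Mod N)" using True by (rule abelian_FactGroup)
    have pow: "(N #> x) [^]\<^bsub>G Mod N\<^esub> p = \<one>\<^bsub>G Mod N\<^esub> \<longleftrightarrow> x [^] p \<in> N" if "x \<in> carrier G" for x
      using FactGroup_pow[OF that, of p] coset_join1[OF _ nat_pow_closed[OF that] True, of p]
        coset_join2[OF nat_pow_closed[OF that] True, of p] by auto
    have "elementary_abelian p (G Mod N) \<longleftrightarrow> (\<forall>x\<in>carrier G. x [^] p \<in> N)"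
      unfolding elementary_abelian_def carrier_FactGroup using com pow by auto
    then show ?thesis using True normal_axioms by auto
  next
    case False
    then show ?thesis using normal_imp_subgroup by blast
  qed
  show ?thesis unfolding frattini_def mem using p_powers_subgroup[of p] by blast
qed

locale p_group_action = p_group_algebra K P p q + E: group E
  for K :: "('k, 'm) ring_scheme" and P :: "('g, 'n) monoid_scheme" and p q
    and E :: "('e, 'l) monoid_scheme" +
  fixes \<phi> :: "'e \<Rightarrow> 'g \<Rightarrow> 'g"
  assumes finite_E: "finite (carrier E)" and coprime_E: "coprime (order E) p"
    and \<phi>: "\<phi> \<in> hom E (AutoGroup P)"
begin

lemma \<phi>_auto: "e \<in> carrier E \<Longrightarrow> \<phi> e \<in> hom P P" "e \<in> carrier E \<Longrightarrow> bij_betw (\<phi> e) (carrier P) (carrier P)"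
  using hom_in_carrier[OF \<phi>, of e] by (auto simp: AutoGroup_def auto_def Bij_def)

lemma \<phi>_closed [simp, intro]: "e \<in> carrier E \<Longrightarrow> u \<in> carrier P \<Longrightarrow> \<phi> e u \<in> carrier P"
  using \<phi>_auto(1) hom_in_carrier by metis

lemma \<phi>_dist: "\<lbrakk>e \<in> carrier E; u \<in> carrier P; v \<in> carrier P\<rbrakk> \<Longrightarrow> \<phi> e (u \<otimes>\<^bsub>P\<^esub> v) = \<phi> e u \<otimes>\<^bsub>P\<^esub> \<phi> e v"
  using \<phi>_auto(1) hom_mult by metis

lemma \<phi>_mult: "\<lbrakk>e \<in> carrier E; f \<in> carrier E; u \<in> carrier P\<rbrakk> \<Longrightarrow> \<phi> (e \<otimes>\<^bsub>E\<^esub> f) u = \<phi> e (\<phi> f u)"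
proof -
  assume ef: "e \<in> carrier E" "f \<in> carrier E" and u: "u \<in> carrier P"
  have "\<phi> e \<in> Bij (carrier P)" "\<phi> f \<in> Bij (carrier P)"
    using ef hom_in_carrier[OF \<phi>] by (auto simp: AutoGroup_def auto_def)
  then show ?thesis
    using hom_mult[OF \<phi> ef] u by (simp add: AutoGroup_def BijGroup_def compose_def)
qed

lemma \<phi>_one: "u \<in> carrier P \<Longrightarrow> \<phi> \<one>\<^bsub>E\<^esub> u = u"
  using hom_one[OF \<phi> E.group_axioms P.AutoGroup] by (simp add: AutoGroup_def BijGroup_def)

lemma \<phi>_inv: "\<lbrakk>e \<in> carrier E; u \<in> carrier P\<rbrakk> \<Longrightarrow> \<phi> e (\<phi> (inv\<^bsub>E\<^esub> e) u) = u"
  "\<lbrakk>e \<in> carrier E; u \<in> carrier P\<rbrakk> \<Longrightarrow> \<phi> (inv\<^bsub>E\<^esub> e) (\<phi> e u) = u"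
  using \<phi>_mult[of e "inv\<^bsub>E\<^esub> e" u] \<phi>_mult[of "inv\<^bsub>E\<^esub> e" e u] \<phi>_one by auto

abbreviation \<Phi> where "\<Phi> \<equiv> frattini p P"
abbreviation V where "V \<equiv> P Mod \<Phi>"
abbreviation \<pi> where "\<pi> u \<equiv> \<Phi> #>\<^bsub>P\<^esub> u"

lemma \<Phi>_subgroup: "subgroup \<Phi> P"
  using P.p_powers_subgroup[of p] P.frattini_eq_p_powers[of p] by simp

sublocale \<Phi>: normal \<Phi> P
  using \<Phi>_subgroup P.normal_iff_subgroup by blast

lemma \<pi>_closed [simp, intro]: "u \<in> carrier P \<Longrightarrow> \<pi> u \<in> carrier V"
  by (auto simp: carrier_FactGroup)

lemma \<pi>_surj: assumes "S \<in> carrier V" obtains u where "u \<in> carrier P" "S = \<pi> u"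
  using assms unfolding carrier_FactGroup by (elim imageE) (rule that)

lemma \<pi>_mult: "\<lbrakk>u \<in> carrier P; v \<in> carrier P\<rbrakk> \<Longrightarrow> \<pi> (u \<otimes>\<^bsub>P\<^esub> v) = \<pi> u \<otimes>\<^bsub>V\<^esub> \<pi> v"
  using \<Phi>.rcos_sum by simp

lemma \<pi>_hom: "(\<lambda>u. \<pi> u) \<in> hom P V"
  by (rule \<Phi>.r_coset_hom_Mod)

lemma \<pi>_eq_one: "u \<in> carrier P \<Longrightarrow> \<pi> u = \<one>\<^bsub>V\<^esub> \<longleftrightarrow> u \<in> \<Phi>"
  using P.coset_join1[OF _ _ \<Phi>_subgroup] P.coset_join2[OF _ \<Phi>_subgroup] by auto

lemma \<pi>_int_pow: "u \<in> carrier P \<Longrightarrow> \<pi> (u [^]\<^bsub>P\<^esub> (k::int)) = \<pi> u [^]\<^bsub>V\<^esub> k"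
  by (rule \<Phi>.FactGroup_int_pow[symmetric])

lemma V_comm_group: "comm_group V"
  by (rule P.abelian_FactGroup[OF \<Phi>_subgroup])

text \<open>Automorphisms carry p-th powers to p-th powers; applied to e and its inverse, this shows
  that \<Phi> is mapped onto itself, so images of cosets are cosets.\<close>

lemma \<pi>_action: "e \<in> carrier E \<Longrightarrow> u \<in> carrier P \<Longrightarrow> \<phi> e ` \<pi> u = \<pi> (\<phi> e u)"
proof -
  assume e: "e \<in> carrier E" and u: "u \<in> carrier P"
  have pow: "\<phi> f (w [^]\<^bsub>P\<^esub> p) = (\<phi> f w) [^]\<^bsub>P\<^esub> p" if "f \<in> carrier E" "w \<in> carrier P" for f w
    using hom_nat_pow[OF \<phi>_auto(1)[OF that(1)] that(2) P.group_axioms P.group_axioms] .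
  have sub: "\<phi> f x \<in> \<Phi>" if "f \<in> carrier E" "x \<in> \<Phi>" for f x
    using that pow unfolding P.frattini_eq_p_powers by auto
  have "\<phi> e (x \<otimes>\<^bsub>P\<^esub> u) = \<phi> e x \<otimes>\<^bsub>P\<^esub> \<phi> e u" if "x \<in> \<Phi>" for x
    using e u \<Phi>.mem_carrier[OF that] by (simp add: \<phi>_dist)
  moreover have "\<exists>y\<in>\<Phi>. \<phi> e y = x" if "x \<in> \<Phi>" for x
    using sub[OF E.inv_closed[OF e] that] \<phi>_inv(1)[OF e \<Phi>.mem_carrier[OF that]] by (metis)
  ultimately have "(\<lambda>x. \<phi> e (x \<otimes>\<^bsub>P\<^esub> u)) ` \<Phi> = (\<lambda>y. y \<otimes>\<^bsub>P\<^esub> \<phi> e u) ` \<Phi>"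
    using sub[OF e] by (intro equalityI subsetI) (auto simp: image_iff)
  then show ?thesis unfolding r_coset_def by (simp add: image_UN image_image UNION_singleton_eq_range)
qed

sublocale V: elementary_abelian_module V p E "\<lambda>e S. \<phi> e ` S"
proof -
  interpret V: comm_group V by (rule V_comm_group)
  show "elementary_abelian_module V p E (\<lambda>e S. \<phi> e ` S)"
  proof (unfold_locales)
    show "Factorial_Ring.prime p" by (rule prime_p)
    show "finite (carrier V)" unfolding carrier_FactGroup using finite_P by simp
    show "S [^]\<^bsub>V\<^esub> p = \<one>\<^bsub>V\<^esub>" if "S \<in> carrier V" for S
    proof -
      obtain u where u: "u \<in> carrier P" "S = \<pi> u" using \<pi>_surj[OF \<open>S \<in> carrier V\<close>] .
      have "S [^]\<^bsub>V\<^esub> p = \<pi> (u [^]\<^bsub>P\<^esub> p)" unfolding u(2) by (rule \<Phi>.FactGroup_pow[OF u(1)])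
      moreover have "u [^]\<^bsub>P\<^esub> p \<in> \<Phi>" using u(1) unfolding P.frattini_eq_p_powers by auto
      ultimately show ?thesis using \<pi>_eq_one u(1) by simp
    qed
    show "(\<lambda>S. \<phi> e ` S) \<in> hom V V" if e: "e \<in> carrier E" for e
    proof (rule homI)
      fix S assume "S \<in> carrier V"
      then obtain u where u: "u \<in> carrier P" "S = \<pi> u" by (rule \<pi>_surj)
      then show "\<phi> e ` S \<in> carrier V" using e by (simp add: \<pi>_action del: mult_FactGroup)
      fix T assume "T \<in> carrier V"
      then obtain v where v: "v \<in> carrier P" "T = \<pi> v" by (rule \<pi>_surj)
      show "\<phi> e ` (S \<otimes>\<^bsub>V\<^esub> T) = \<phi> e ` S \<otimes>\<^bsub>V\<^esub> \<phi> e ` T"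
        unfolding u(2) v(2) using e u(1) v(1)
        by (simp only: \<pi>_mult[symmetric] \<pi>_action P.m_closed \<phi>_closed \<phi>_dist)
    qed
    show "\<phi> (e \<otimes>\<^bsub>E\<^esub> f) ` S = \<phi> e ` \<phi> f ` S" if ef: "e \<in> carrier E" "f \<in> carrier E" "S \<in> carrier V" for e f S
    proof -
      obtain u where u: "u \<in> carrier P" "S = \<pi> u" using \<pi>_surj[OF ef(3)] .
      show ?thesis unfolding u(2) using ef u(1) by (simp add: \<pi>_action \<phi>_mult)
    qed
    show "\<phi> \<one>\<^bsub>E\<^esub> ` S = S" if S: "S \<in> carrier V" for S
    proof -
      obtain u where u: "u \<in> carrier P" "S = \<pi> u" using \<pi>_surj[OF S] .
      show ?thesis unfolding u(2) using u(1) by (simp add: \<pi>_action \<phi>_one)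
    qed
  qed (use finite_E coprime_E in auto)
qed

declare mult_FactGroup [simp del] one_FactGroup [simp del]

text \<open>The canonical map from the integers to k. It embeds the prime field, whose elements
  appear as integer exponents in \<open>V\<close>.\<close>

definition \<kappa> :: "int \<Rightarrow> 'k" where "\<kappa> k = [k] \<cdot>\<^bsub>K\<^esub> \<one>\<^bsub>K\<^esub>"

lemma \<kappa>_closed [simp, intro]: "\<kappa> k \<in> carrier K"
  unfolding \<kappa>_def by simp

lemma \<kappa>_add: "\<kappa> (k + l) = \<kappa> k \<oplus>\<^bsub>K\<^esub> \<kappa> l"
  unfolding \<kappa>_def using K.add.int_pow_mult[of "\<one>\<^bsub>K\<^esub>" k l] by simp

lemma \<kappa>_zero [simp]: "\<kappa> 0 = \<zero>\<^bsub>K\<^esub>" and \<kappa>_one [simp]: "\<kappa> 1 = \<one>\<^bsub>K\<^esub>"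
  unfolding \<kappa>_def by (simp add: add_pow_def, simp)

lemma \<kappa>_minus: "\<kappa> (- k) = \<ominus>\<^bsub>K\<^esub> \<kappa> k"
  using \<kappa>_add[of "-k" k] K.minus_equality[of "\<kappa> (-k)" "\<kappa> k"] by simp

text \<open>The map is multiplicative and kills p. If k is prime to p, a Bezout relation between p
  and k shows that it cannot kill k as well.\<close>

lemma \<kappa>_eq_zero: "\<kappa> k = \<zero>\<^bsub>K\<^esub> \<longleftrightarrow> int p dvd k"
proof -
  have nat: "\<kappa> (int n) = [n] \<cdot>\<^bsub>K\<^esub> \<one>\<^bsub>K\<^esub>" for n
    unfolding \<kappa>_def by (simp add: add_pow_def int_pow_int)
  have p0: "\<kappa> (int p) = \<zero>\<^bsub>K\<^esub>" using K.ring_char_add_pow char_K nat by simp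
  have mult: "\<kappa> (k * l) = \<kappa> k \<otimes>\<^bsub>K\<^esub> \<kappa> l" for k l
  proof -
    have "\<kappa> (k * l) = [l] \<cdot>\<^bsub>K\<^esub> ([k] \<cdot>\<^bsub>K\<^esub> \<one>\<^bsub>K\<^esub>)"
      unfolding \<kappa>_def by (simp add: K.add.int_pow_pow)
    also have "\<dots> = \<kappa> k \<otimes>\<^bsub>K\<^esub> \<kappa> l" unfolding \<kappa>_def using K.add_pow_rdistr_int[of "[k] \<cdot>\<^bsub>K\<^esub> \<one>\<^bsub>K\<^esub>" "\<one>\<^bsub>K\<^esub>" l] by simp
    finally show ?thesis .
  qed
  show ?thesis
  proof
    assume "int p dvd k"
    then show "\<kappa> k = \<zero>\<^bsub>K\<^esub>" using p0 by (auto elim!: dvdE simp: mult)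
  next
    assume k: "\<kappa> k = \<zero>\<^bsub>K\<^esub>"
    show "int p dvd k"
    proof (rule ccontr)
      assume "\<not> int p dvd k"
      then have "coprime (int p) k" using prime_p by (simp add: prime_imp_coprime)
      then obtain a b where "a * int p + b * k = 1" using bezout_int[of "int p" k] by auto
      then have "\<one>\<^bsub>K\<^esub> = \<kappa> (a * int p) \<oplus>\<^bsub>K\<^esub> \<kappa> (b * k)" using \<kappa>_add[of "a * int p" "b * k"] by simp
      then show False using p0 k by (simp add: mult)
    qed
  qed
qed

lemma \<kappa>_cong: "[k = l] (mod int p) \<Longrightarrow> \<kappa> k = \<kappa> l"
proof -
  assume "[k = l] (mod int p)"
  then have "\<kappa> (k - l) = \<zero>\<^bsub>K\<^esub>" by (simp add: \<kappa>_eq_zero cong_iff_dvd_diff)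
  then show ?thesis using \<kappa>_add[of "k - l" l] by simp
qed

section \<open>The action of E on the group algebra, and stable derivations\<close>

abbreviation \<epsilon> where "\<epsilon> e \<equiv> group_algebra_map P (\<phi> e)"

lemma \<epsilon>_closed [simp, intro]: "e \<in> carrier E \<Longrightarrow> x \<in> carrier A \<Longrightarrow> \<epsilon> e x \<in> carrier A"
proof -
  assume e: "e \<in> carrier E" and x: "x \<in> carrier A"
  have "inv_into (carrier P) (\<phi> e) u \<in> carrier P" if "u \<in> carrier P" for u
    using \<phi>_auto(2)[OF e] that by (metis bij_betw_def inv_into_into)
  then show ?thesis using x unfolding group_algebra_map_def A_simps(1) by auto
qed

lemma \<epsilon>_add: "\<lbrakk>e \<in> carrier E; x \<in> carrier A; y \<in> carrier A\<rbrakk> \<Longrightarrow> \<epsilon> e (x \<oplus>\<^bsub>A\<^esub> y) = \<epsilon> e x \<oplus>\<^bsub>A\<^esub> \<epsilon> e y"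
  and \<epsilon>_smult: "\<lbrakk>e \<in> carrier E; c \<in> carrier K; x \<in> carrier A\<rbrakk> \<Longrightarrow> \<epsilon> e (c \<odot>\<^bsub>A\<^esub> x) = c \<odot>\<^bsub>A\<^esub> \<epsilon> e x"
proof -
  have i: "inv_into (carrier P) (\<phi> e) u \<in> carrier P" if "e \<in> carrier E" "u \<in> carrier P" for e u
    using \<phi>_auto(2)[OF that(1)] that(2) by (metis bij_betw_def inv_into_into)
  show "\<epsilon> e (x \<oplus>\<^bsub>A\<^esub> y) = \<epsilon> e x \<oplus>\<^bsub>A\<^esub> \<epsilon> e y" if "e \<in> carrier E" "x \<in> carrier A" "y \<in> carrier A"
    unfolding group_algebra_map_def A_simps(5) using i[OF that(1)] by (auto simp: fun_eq_iff)
  show "\<epsilon> e (c \<odot>\<^bsub>A\<^esub> x) = c \<odot>\<^bsub>A\<^esub> \<epsilon> e x" if "e \<in> carrier E" "c \<in> carrier K" "x \<in> carrier A"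
    unfolding group_algebra_map_def A_simps(6) using i[OF that(1)] by (auto simp: fun_eq_iff)
qed

lemma \<epsilon>_g: "\<lbrakk>e \<in> carrier E; u \<in> carrier P\<rbrakk> \<Longrightarrow> \<epsilon> e (g u) = g (\<phi> e u)"
proof (rule A_ext)
  fix w assume e: "e \<in> carrier E" and u: "u \<in> carrier P" and w: "w \<in> carrier P"
  have inj: "inj_on (\<phi> e) (carrier P)" and im: "\<phi> e ` carrier P = carrier P"
    using \<phi>_auto(2)[OF e] by (auto simp: bij_betw_def)
  have "inv_into (carrier P) (\<phi> e) w \<in> carrier P" "\<phi> e (inv_into (carrier P) (\<phi> e) w) = w"
    using w im inv_into_into[of w "\<phi> e" "carrier P"] f_inv_into_f[of w "\<phi> e" "carrier P"] by auto
  then have "inv_into (carrier P) (\<phi> e) w = u \<longleftrightarrow> w = \<phi> e u" "inv_into (carrier P) (\<phi> e) w \<in> carrier P"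
    using inv_into_f_f[OF inj u] by auto
  then show "\<epsilon> e (g u) w = g (\<phi> e u) w"
    unfolding group_algebra_map_def g_def using w by auto
qed auto

lemma additive_finsum:
  assumes F: "\<And>x. x \<in> carrier A \<Longrightarrow> F x \<in> carrier A"
    "\<And>x y. \<lbrakk>x \<in> carrier A; y \<in> carrier A\<rbrakk> \<Longrightarrow> F (x \<oplus>\<^bsub>A\<^esub> y) = F x \<oplus>\<^bsub>A\<^esub> F y"
    and f: "f \<in> I \<rightarrow> carrier A"
  shows "F (finsum A f I) = finsum A (\<lambda>i. F (f i)) I"
proof -
  have "F \<in> hom (add_monoid A) (add_monoid A)" using F by (auto simp: hom_def)
  then show ?thesis
    using hom_finprod[OF A.a_comm_group A.a_comm_group, of F f I] f by (simp add: finsum_def)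
qed

lemma \<epsilon>_inverse: "\<lbrakk>e \<in> carrier E; x \<in> carrier A\<rbrakk> \<Longrightarrow> \<epsilon> (inv\<^bsub>E\<^esub> e) (\<epsilon> e x) = x"
proof -
  assume e: "e \<in> carrier E" and x: "x \<in> carrier A"
  show ?thesis
    using x
  proof (induction x rule: A_induct)
    case zero
    have "\<epsilon> f \<zero>\<^bsub>A\<^esub> = \<zero>\<^bsub>A\<^esub>" if "f \<in> carrier E" for f
      using \<epsilon>_smult[OF that, of "\<zero>\<^bsub>K\<^esub>" "\<zero>\<^bsub>A\<^esub>"] \<epsilon>_closed[OF that, of "\<zero>\<^bsub>A\<^esub>"] by simp
    then show ?case using e by simp
  qed (use e in \<open>simp_all add: \<epsilon>_add \<epsilon>_smult \<epsilon>_g \<phi>_inv\<close>)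
qed

text \<open>Makes stability testable on group elements. Conjugation is defined through
  \<open>inv_into\<close>, so the first half turns it into commutation with
  \<open>\<epsilon> e\<close>; linearity of both sides does the rest.\<close>

lemma stable_iff:
  "f \<in> stable_derivations K P E \<phi> \<longleftrightarrow> f \<in> derivations K A \<and>
     (\<forall>e\<in>carrier E. \<forall>u\<in>carrier P. f (g (\<phi> e u)) = \<epsilon> e (f (g u)))"
proof -
  have "(\<forall>e\<in>carrier E. conj_by A (\<epsilon> e) f = f) \<longleftrightarrow>
     (\<forall>e\<in>carrier E. \<forall>u\<in>carrier P. f (g (\<phi> e u)) = \<epsilon> e (f (g u)))" if f: "f \<in> derivations K A"
  proof (rule ball_cong[OF refl])
    fix e assume e: "e \<in> carrier E"
    have inj: "inj_on (\<epsilon> e) (carrier A)" by (rule inj_on_inverseI[where g = "\<epsilon> (inv\<^bsub>E\<^esub> e)"]) (rule \<epsilon>_inverse[OF e])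
    have inv: "inv_into (carrier A) (\<epsilon> e) (\<epsilon> e x) = x" if "x \<in> carrier A" for x
      using inj that by simp
    have surj: "\<epsilon> e (\<epsilon> (inv\<^bsub>E\<^esub> e) x) = x" if "x \<in> carrier A" for x
      using \<epsilon>_inverse[OF E.inv_closed[OF e] that] e by simp
    have "conj_by A (\<epsilon> e) f = f \<longleftrightarrow> (\<forall>x\<in>carrier A. f (\<epsilon> e x) = \<epsilon> e (f x))"
    proof
      assume c: "conj_by A (\<epsilon> e) f = f"
      show "\<forall>x\<in>carrier A. f (\<epsilon> e x) = \<epsilon> e (f x)"
      proof
        fix x assume x: "x \<in> carrier A"
        have "conj_by A (\<epsilon> e) f (\<epsilon> e x) = \<epsilon> e (f x)"
          unfolding conj_by_def using \<epsilon>_closed[OF e x] inv[OF x] by simp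
        then show "f (\<epsilon> e x) = \<epsilon> e (f x)" unfolding c .
      qed
    next
      assume c: "\<forall>x\<in>carrier A. f (\<epsilon> e x) = \<epsilon> e (f x)"
      show "conj_by A (\<epsilon> e) f = f"
      proof (rule extensionalityI)
        show "conj_by A (\<epsilon> e) f \<in> extensional (carrier A)" unfolding conj_by_def by simp
        show "f \<in> extensional (carrier A)" by (rule derD(5)[OF f])
        fix x assume x: "x \<in> carrier A"
        have y: "\<epsilon> (inv\<^bsub>E\<^esub> e) x \<in> carrier A" using e x by auto
        have "conj_by A (\<epsilon> e) f x = \<epsilon> e (f (inv_into (carrier A) (\<epsilon> e) (\<epsilon> e (\<epsilon> (inv\<^bsub>E\<^esub> e) x))))"
          unfolding conj_by_def using x surj[OF x] by simp
        also have "\<dots> = f (\<epsilon> e (\<epsilon> (inv\<^bsub>E\<^esub> e) x))" unfolding inv[OF y] using c y by simp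
        finally show "conj_by A (\<epsilon> e) f x = f x" unfolding surj[OF x] .
      qed
    qed
    also have "\<dots> \<longleftrightarrow> (\<forall>u\<in>carrier P. f (g (\<phi> e u)) = \<epsilon> e (f (g u)))"
    proof
      assume "\<forall>x\<in>carrier A. f (\<epsilon> e x) = \<epsilon> e (f x)"
      then show "\<forall>u\<in>carrier P. f (g (\<phi> e u)) = \<epsilon> e (f (g u))"
        using e by (metis \<epsilon>_g g_closed)
    next
      assume c: "\<forall>u\<in>carrier P. f (g (\<phi> e u)) = \<epsilon> e (f (g u))"
      show "\<forall>x\<in>carrier A. f (\<epsilon> e x) = \<epsilon> e (f x)"
      proof
        fix x assume "x \<in> carrier A"
        then show "f (\<epsilon> e x) = \<epsilon> e (f x)"
        proof (induction x rule: A_induct)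
          case zero
          have "\<epsilon> e \<zero>\<^bsub>A\<^esub> = \<zero>\<^bsub>A\<^esub>"
            using \<epsilon>_smult[OF e, of "\<zero>\<^bsub>K\<^esub>" "\<zero>\<^bsub>A\<^esub>"] \<epsilon>_closed[OF e, of "\<zero>\<^bsub>A\<^esub>"] by simp
          then show ?case using der_zero[OF f] by simp
        qed (use e c in \<open>simp_all add: \<epsilon>_add \<epsilon>_smult \<epsilon>_g derD[OF f]\<close>)
      qed
    qed
    finally show "conj_by A (\<epsilon> e) f = f \<longleftrightarrow> (\<forall>u\<in>carrier P. f (g (\<phi> e u)) = \<epsilon> e (f (g u)))" .
  qed
  then show ?thesis unfolding stable_derivations_def by auto
qed

lemma stable_\<epsilon>:
  assumes f: "f \<in> stable_derivations K P E \<phi>" and e: "e \<in> carrier E" and x: "x \<in> carrier A"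
  shows "f (\<epsilon> e x) = \<epsilon> e (f x)"
proof -
  have fd: "f \<in> derivations K A" and c: "\<And>u. u \<in> carrier P \<Longrightarrow> f (g (\<phi> e u)) = \<epsilon> e (f (g u))"
    using f e unfolding stable_iff by auto
  show ?thesis
    using x
  proof (induction x rule: A_induct)
    case zero
    have "\<epsilon> e \<zero>\<^bsub>A\<^esub> = \<zero>\<^bsub>A\<^esub>"
      using \<epsilon>_smult[OF e, of "\<zero>\<^bsub>K\<^esub>" "\<zero>\<^bsub>A\<^esub>"] \<epsilon>_closed[OF e, of "\<zero>\<^bsub>A\<^esub>"] by simp
    then show ?case using der_zero[OF fd] by simp
  qed (use e c in \<open>simp_all add: \<epsilon>_add \<epsilon>_smult \<epsilon>_g derD[OF fd]\<close>)
qed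

text \<open>For a derivation \<open>f\<close> the map \<open>u \<mapsto> u\<^sup>-\<^sup>1 \<cdot> f u\<close> is a homomorphism from \<open>P\<close> to the additive group
  of the group algebra, and it determines \<open>f\<close>.\<close>

definition logder :: "(('g \<Rightarrow> 'k) \<Rightarrow> 'g \<Rightarrow> 'k) \<Rightarrow> 'g \<Rightarrow> 'g \<Rightarrow> 'k" where
  "logder f u = g (inv\<^bsub>P\<^esub> u) \<otimes>\<^bsub>A\<^esub> f (g u)"

lemma logder:
  assumes f: "f \<in> derivations K A"
  shows "u \<in> carrier P \<Longrightarrow> logder f u \<in> carrier A"
    "u \<in> carrier P \<Longrightarrow> f (g u) = g u \<otimes>\<^bsub>A\<^esub> logder f u"
    "\<lbrakk>u \<in> carrier P; v \<in> carrier P\<rbrakk> \<Longrightarrow> logder f (u \<otimes>\<^bsub>P\<^esub> v) = logder f u \<oplus>\<^bsub>A\<^esub> logder f v"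
proof -
  have c: "f (g u) \<in> carrier A" for u using derD(1)[OF f] by auto
  show "u \<in> carrier P \<Longrightarrow> logder f u \<in> carrier A" for u unfolding logder_def using c by simp
  have gi: "g u \<otimes>\<^bsub>A\<^esub> g (inv\<^bsub>P\<^esub> u) = \<one>\<^bsub>A\<^esub>" if "u \<in> carrier P" for u using that by (simp add: g_mult)
  show "u \<in> carrier P \<Longrightarrow> f (g u) = g u \<otimes>\<^bsub>A\<^esub> logder f u"
    unfolding logder_def using c gi by (simp add: A.m_assoc[symmetric])
  assume uv: "u \<in> carrier P" "v \<in> carrier P"
  have "logder f (u \<otimes>\<^bsub>P\<^esub> v) = g (inv\<^bsub>P\<^esub> u) \<otimes>\<^bsub>A\<^esub> g (inv\<^bsub>P\<^esub> v) \<otimes>\<^bsub>A\<^esub> f (g u \<otimes>\<^bsub>A\<^esub> g v)"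
    unfolding logder_def using uv by (simp add: g_mult P.inv_mult)
  also have "f (g u \<otimes>\<^bsub>A\<^esub> g v) = f (g u) \<otimes>\<^bsub>A\<^esub> g v \<oplus>\<^bsub>A\<^esub> g u \<otimes>\<^bsub>A\<^esub> f (g v)" using derD(4)[OF f] by simp
  also have "g (inv\<^bsub>P\<^esub> u) \<otimes>\<^bsub>A\<^esub> g (inv\<^bsub>P\<^esub> v) \<otimes>\<^bsub>A\<^esub> \<dots> =
      (g v \<otimes>\<^bsub>A\<^esub> g (inv\<^bsub>P\<^esub> v)) \<otimes>\<^bsub>A\<^esub> (g (inv\<^bsub>P\<^esub> u) \<otimes>\<^bsub>A\<^esub> f (g u)) \<oplus>\<^bsub>A\<^esub>
      (g u \<otimes>\<^bsub>A\<^esub> g (inv\<^bsub>P\<^esub> u)) \<otimes>\<^bsub>A\<^esub> (g (inv\<^bsub>P\<^esub> v) \<otimes>\<^bsub>A\<^esub> f (g v))"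
    using c by (simp add: A.r_distr A.m_ac)
  finally show "logder f (u \<otimes>\<^bsub>P\<^esub> v) = logder f u \<oplus>\<^bsub>A\<^esub> logder f v"
    unfolding logder_def using uv gi c by simp
qed

lemma stable_image:
  assumes f: "f \<in> stable_derivations K P E \<phi>" and comm: "commutator_of_action P E \<phi> = carrier P"
    and x: "x \<in> carrier A"
  shows "f x \<in> J 1"
proof -
  have fd: "f \<in> derivations K A" and st: "\<And>e u. e \<in> carrier E \<Longrightarrow> u \<in> carrier P \<Longrightarrow> f (g (\<phi> e u)) = \<epsilon> e (f (g u))"
    using f unfolding stable_iff by auto
  note lc = logder(1)[OF fd]
  \<comment> \<open>This is also the augmentation of \<open>logder f u\<close>, as multiplying by a
    group element does not change the augmentation.\<close>
  define \<chi> where "\<chi> u = aug (f (g u))" for u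
  have c: "f (g u) \<in> carrier A" for u using derD(1)[OF fd] by auto
  have add: "\<chi> (u \<otimes>\<^bsub>P\<^esub> v) = \<chi> u \<oplus>\<^bsub>K\<^esub> \<chi> v" if uv: "u \<in> carrier P" "v \<in> carrier P" for u v
  proof -
    have "f (g (u \<otimes>\<^bsub>P\<^esub> v)) = f (g u) \<otimes>\<^bsub>A\<^esub> g v \<oplus>\<^bsub>A\<^esub> f (g v) \<otimes>\<^bsub>A\<^esub> g u"
      using derD(4)[OF fd, of "g u" "g v"] uv c by (simp add: g_mult A.m_comm)
    then show ?thesis unfolding \<chi>_def using uv c by (simp add: aug_add aug_mult_g)
  qed
  have \<chi>c: "\<chi> u \<in> carrier K" for u unfolding \<chi>_def using c by simp
  have aug_\<epsilon>: "aug (\<epsilon> e y) = aug y" if "e \<in> carrier E" "y \<in> carrier A" for e y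
    using that(2)
  proof (induction y rule: A_induct)
    case zero
    have "\<epsilon> e \<zero>\<^bsub>A\<^esub> = \<zero>\<^bsub>A\<^esub>"
      using \<epsilon>_smult[OF that(1), of "\<zero>\<^bsub>K\<^esub>" "\<zero>\<^bsub>A\<^esub>"] \<epsilon>_closed[OF that(1), of "\<zero>\<^bsub>A\<^esub>"] by simp
    then show ?case by simp
  qed (use that(1) in \<open>simp_all add: \<epsilon>_add \<epsilon>_smult \<epsilon>_g aug_add aug_smult aug_g\<close>)
  have one: "\<chi> \<one>\<^bsub>P\<^esub> = \<zero>\<^bsub>K\<^esub>" unfolding \<chi>_def using der_one[OF fd] by simp
  have inv: "\<chi> (inv\<^bsub>P\<^esub> u) = \<ominus>\<^bsub>K\<^esub> \<chi> u" if "u \<in> carrier P" for u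
    using add[of "inv\<^bsub>P\<^esub> u" u] that one \<chi>c K.minus_equality by simp
  have "\<chi> u = \<zero>\<^bsub>K\<^esub>" if "u \<in> commutator_of_action P E \<phi>" for u
    using that unfolding commutator_of_action_def
  proof (induction rule: generate.induct)
    case one
    then show ?case by (rule \<open>\<chi> \<one>\<^bsub>P\<^esub> = \<zero>\<^bsub>K\<^esub>\<close>)
  next
    case (incl h)
    then obtain e u where eu: "e \<in> carrier E" "u \<in> carrier P" "h = \<phi> e u \<otimes>\<^bsub>P\<^esub> inv\<^bsub>P\<^esub> u" by auto
    have "\<chi> (\<phi> e u) = \<chi> u" unfolding \<chi>_def using st[OF eu(1,2)] aug_\<epsilon>[OF eu(1)] c by simp
    then show ?case using eu add[of "\<phi> e u" "inv\<^bsub>P\<^esub> u"] inv[OF eu(2)] \<chi>c by (simp add: K.r_neg)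
  next
    case (inv h)
    then obtain e u where eu: "e \<in> carrier E" "u \<in> carrier P" "h = \<phi> e u \<otimes>\<^bsub>P\<^esub> inv\<^bsub>P\<^esub> u" by auto
    have "\<chi> (\<phi> e u) = \<chi> u" unfolding \<chi>_def using st[OF eu(1,2)] aug_\<epsilon>[OF eu(1)] c by simp
    then have "\<chi> h = \<zero>\<^bsub>K\<^esub>" using eu add[of "\<phi> e u" "inv\<^bsub>P\<^esub> u"] \<open>\<And>u. u \<in> carrier P \<Longrightarrow> \<chi> (inv\<^bsub>P\<^esub> u) = \<ominus>\<^bsub>K\<^esub> \<chi> u\<close>[OF eu(2)] \<chi>c by (simp add: K.r_neg)
    then show ?case using \<open>\<And>u. u \<in> carrier P \<Longrightarrow> \<chi> (inv\<^bsub>P\<^esub> u) = \<ominus>\<^bsub>K\<^esub> \<chi> u\<close>[of h] eu by simp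
  next
    case (eng h1 h2)
    have sub: "{\<phi> e u \<otimes>\<^bsub>P\<^esub> inv\<^bsub>P\<^esub> u |e u. e \<in> carrier E \<and> u \<in> carrier P} \<subseteq> carrier P" by auto
    have "h1 \<in> carrier P" "h2 \<in> carrier P"
      using P.generate_in_carrier[OF sub] eng by auto
    then show ?case using eng add by simp
  qed
  then have \<chi>0: "\<chi> u = \<zero>\<^bsub>K\<^esub>" if "u \<in> carrier P" for u using that comm by simp
  have "f y \<in> J 1" if "y \<in> carrier A" for y
    using that
  proof (induction y rule: A_induct)
    case (smult b u)
    have "f (g u) \<in> J 1" using J_1 c \<chi>0[OF smult(2)] unfolding \<chi>_def by simp
    then show ?case using smult by (simp add: derD(3)[OF fd] J_smult)
  qed (simp_all add: der_zero[OF fd] derD(2)[OF fd] J_add)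
  then show ?thesis using x by blast
qed

section \<open>Congruence modulo the square of the augmentation ideal\<close>

definition cg :: "('g \<Rightarrow> 'k) \<Rightarrow> ('g \<Rightarrow> 'k) \<Rightarrow> bool" where
  "cg x y \<longleftrightarrow> x \<in> carrier A \<and> y \<in> carrier A \<and> x \<ominus>\<^bsub>A\<^esub> y \<in> J 2"

lemma cg_closed: "cg x y \<Longrightarrow> x \<in> carrier A" "cg x y \<Longrightarrow> y \<in> carrier A"
  unfolding cg_def by auto

lemma cg_refl [simp]: "x \<in> carrier A \<Longrightarrow> cg x x"
  unfolding cg_def by (simp add: A.minus_eq A.r_neg)

lemma cg_sym: "cg x y \<Longrightarrow> cg y x"
proof -
  assume xy: "cg x y"
  then have "y \<ominus>\<^bsub>A\<^esub> x = \<ominus>\<^bsub>A\<^esub> (x \<ominus>\<^bsub>A\<^esub> y)"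
    unfolding cg_def by (simp add: A.minus_eq A.minus_add A.a_comm)
  then show ?thesis using xy J_neg unfolding cg_def by auto
qed

lemma cg_trans [trans]: "cg x y \<Longrightarrow> cg y z \<Longrightarrow> cg x z"
proof -
  assume xy: "cg x y" and yz: "cg y z"
  have "x \<in> carrier A" "y \<in> carrier A" "z \<in> carrier A" using xy yz unfolding cg_def by auto
  then have "x \<ominus>\<^bsub>A\<^esub> z = (x \<ominus>\<^bsub>A\<^esub> y) \<oplus>\<^bsub>A\<^esub> (y \<ominus>\<^bsub>A\<^esub> z)"
    by (simp add: A.minus_eq A.a_assoc A.r_neg1)
  then show ?thesis using xy yz J_add unfolding cg_def by auto
qed

lemma cg_add: "cg x y \<Longrightarrow> cg z w \<Longrightarrow> cg (x \<oplus>\<^bsub>A\<^esub> z) (y \<oplus>\<^bsub>A\<^esub> w)"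
proof -
  assume xy: "cg x y" and zw: "cg z w"
  have "x \<in> carrier A" "y \<in> carrier A" "z \<in> carrier A" "w \<in> carrier A" using xy zw unfolding cg_def by auto
  then have "(x \<oplus>\<^bsub>A\<^esub> z) \<ominus>\<^bsub>A\<^esub> (y \<oplus>\<^bsub>A\<^esub> w) = (x \<ominus>\<^bsub>A\<^esub> y) \<oplus>\<^bsub>A\<^esub> (z \<ominus>\<^bsub>A\<^esub> w)"
    by (simp add: A.minus_eq A.minus_add A.a_ac)
  then show ?thesis using xy zw J_add unfolding cg_def by auto
qed

lemma cg_smult: "c \<in> carrier K \<Longrightarrow> cg x y \<Longrightarrow> cg (c \<odot>\<^bsub>A\<^esub> x) (c \<odot>\<^bsub>A\<^esub> y)"
proof -
  assume c: "c \<in> carrier K" and xy: "cg x y"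
  have "x \<in> carrier A" "y \<in> carrier A" using xy unfolding cg_def by auto
  then have "c \<odot>\<^bsub>A\<^esub> x \<ominus>\<^bsub>A\<^esub> c \<odot>\<^bsub>A\<^esub> y = c \<odot>\<^bsub>A\<^esub> (x \<ominus>\<^bsub>A\<^esub> y)"
    using c by (simp add: A.minus_eq M.smult_r_distr M.smult_r_minus)
  then show ?thesis using c xy J_smult unfolding cg_def by auto
qed

lemma cg_minus: "cg x y \<Longrightarrow> cg z w \<Longrightarrow> cg (x \<ominus>\<^bsub>A\<^esub> z) (y \<ominus>\<^bsub>A\<^esub> w)"
  using cg_add[of x y "\<ominus>\<^bsub>A\<^esub> z" "\<ominus>\<^bsub>A\<^esub> w"] cg_smult[of "\<ominus>\<^bsub>K\<^esub> \<one>\<^bsub>K\<^esub>" z w] cg_closed[of z w]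
  by (simp add: A.minus_eq M.smult_l_minus)

lemma cg_finsum: "(\<And>i. i \<in> I \<Longrightarrow> cg (f i) (h i)) \<Longrightarrow> cg (finsum A f I) (finsum A h I)"
proof (induction I rule: infinite_finite_induct)
  case (insert i I)
  have "f \<in> I \<rightarrow> carrier A" "h \<in> I \<rightarrow> carrier A" "f i \<in> carrier A" "h i \<in> carrier A"
    using insert.prems cg_closed by blast+
  then show ?case using insert cg_add by simp
qed auto

lemma cg_zero: "cg x \<zero>\<^bsub>A\<^esub> \<longleftrightarrow> x \<in> J 2"
  unfolding cg_def using J_closed by (auto simp: A.minus_eq)

text \<open>Modulo \<open>J 2\<close> this is a homomorphism from \<open>P\<close> to the additive
  group of J/J^2 (\<open>L_mult\<close>). It depends only on the Frattini coset
  (\<open>L_cong\<close>) and has kernel \<Phi> (\<open>L_J2_imp\<close>, \<open>L_\<Phi>\<close>);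
  this is how \<open>V\<close> is seen inside J/J^2.\<close>

definition L :: "'g \<Rightarrow> 'g \<Rightarrow> 'k" where "L u = g u \<ominus>\<^bsub>A\<^esub> \<one>\<^bsub>A\<^esub>"

lemma L_closed [simp, intro]: "L u \<in> carrier A"
  unfolding L_def by simp

lemma L_J: "u \<in> carrier P \<Longrightarrow> L u \<in> J 1"
  unfolding L_def by (rule g_minus_one_J)

lemma L_one [simp]: "L \<one>\<^bsub>P\<^esub> = \<zero>\<^bsub>A\<^esub>"
  unfolding L_def by (simp add: A.minus_eq A.r_neg)

lemma cg_mult_g: "u \<in> carrier P \<Longrightarrow> x \<in> J 1 \<Longrightarrow> cg (g u \<otimes>\<^bsub>A\<^esub> x) x"
proof -
  assume u: "u \<in> carrier P" and x: "x \<in> J 1"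
  have "L u \<otimes>\<^bsub>A\<^esub> x \<in> J (1 + 1)" using L_J[OF u] x by (rule J_mult_J)
  moreover have "L u \<otimes>\<^bsub>A\<^esub> x = g u \<otimes>\<^bsub>A\<^esub> x \<ominus>\<^bsub>A\<^esub> x"
    unfolding L_def using J_closed[OF x] by (simp add: A.minus_eq A.l_distr A.l_minus)
  ultimately show ?thesis unfolding cg_def using J_closed[OF x] by (simp add: numeral_2_eq_2)
qed

text \<open>From uv - 1 = (u - 1) + u(v - 1), where the factor u may be dropped modulo
  \<open>J 2\<close> by \<open>cg_mult_g\<close>.\<close>

lemma L_mult: "\<lbrakk>u \<in> carrier P; v \<in> carrier P\<rbrakk> \<Longrightarrow> cg (L (u \<otimes>\<^bsub>P\<^esub> v)) (L u \<oplus>\<^bsub>A\<^esub> L v)"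
proof -
  assume u: "u \<in> carrier P" and v: "v \<in> carrier P"
  have "g u \<otimes>\<^bsub>A\<^esub> L v = g (u \<otimes>\<^bsub>P\<^esub> v) \<oplus>\<^bsub>A\<^esub> \<ominus>\<^bsub>A\<^esub> g u"
    unfolding L_def using u v by (simp add: A.minus_eq A.r_distr A.r_minus g_mult)
  then have "L u \<oplus>\<^bsub>A\<^esub> g u \<otimes>\<^bsub>A\<^esub> L v = L (u \<otimes>\<^bsub>P\<^esub> v) \<oplus>\<^bsub>A\<^esub> (g u \<oplus>\<^bsub>A\<^esub> \<ominus>\<^bsub>A\<^esub> g u)"
    unfolding L_def by (simp add: A.minus_eq A.a_ac del: A.r_neg)
  then have "L (u \<otimes>\<^bsub>P\<^esub> v) = L u \<oplus>\<^bsub>A\<^esub> g u \<otimes>\<^bsub>A\<^esub> L v"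
    by (simp add: A.r_neg)
  moreover have "cg (L u \<oplus>\<^bsub>A\<^esub> g u \<otimes>\<^bsub>A\<^esub> L v) (L u \<oplus>\<^bsub>A\<^esub> L v)"
    using u v by (intro cg_add cg_mult_g L_J) auto
  ultimately show ?thesis by simp
qed

lemma L_nat_pow: "u \<in> carrier P \<Longrightarrow> cg (L (u [^]\<^bsub>P\<^esub> n)) (\<kappa> (int n) \<odot>\<^bsub>A\<^esub> L u)" for n :: nat
proof (induction n)
  case (Suc n)
  have "cg (L (u [^]\<^bsub>P\<^esub> Suc n)) (L (u [^]\<^bsub>P\<^esub> n) \<oplus>\<^bsub>A\<^esub> L u)"
    using L_mult[of "u [^]\<^bsub>P\<^esub> n" u] Suc by simp
  also have "cg \<dots> (\<kappa> (int n) \<odot>\<^bsub>A\<^esub> L u \<oplus>\<^bsub>A\<^esub> L u)" using Suc by (intro cg_add) auto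
  also have "\<kappa> (int n) \<odot>\<^bsub>A\<^esub> L u \<oplus>\<^bsub>A\<^esub> L u = \<kappa> (int (Suc n)) \<odot>\<^bsub>A\<^esub> L u"
    using \<kappa>_add[of "int n" 1] by (simp add: M.smult_l_distr add.commute)
  finally show ?case .
qed simp

lemma L_inv: "u \<in> carrier P \<Longrightarrow> cg (L (inv\<^bsub>P\<^esub> u)) (\<ominus>\<^bsub>A\<^esub> L u)"
proof -
  assume u: "u \<in> carrier P"
  have "cg (\<zero>\<^bsub>A\<^esub> \<ominus>\<^bsub>A\<^esub> L u) (L (inv\<^bsub>P\<^esub> u) \<oplus>\<^bsub>A\<^esub> L u \<ominus>\<^bsub>A\<^esub> L u)"
    using L_mult[of "inv\<^bsub>P\<^esub> u" u] u by (intro cg_minus) auto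
  then have "cg (L (inv\<^bsub>P\<^esub> u) \<oplus>\<^bsub>A\<^esub> L u \<ominus>\<^bsub>A\<^esub> L u) (\<zero>\<^bsub>A\<^esub> \<ominus>\<^bsub>A\<^esub> L u)"
    by (rule cg_sym)
  then show ?thesis by (simp add: A.minus_eq A.a_assoc A.r_neg)
qed

lemma L_int_pow: "u \<in> carrier P \<Longrightarrow> cg (L (u [^]\<^bsub>P\<^esub> k)) (\<kappa> k \<odot>\<^bsub>A\<^esub> L u)" for k :: int
proof (cases "k \<ge> 0")
  case True
  assume u: "u \<in> carrier P"
  then show ?thesis using L_nat_pow[OF u, of "nat k"] True by (simp add: int_pow_int[symmetric])
next
  case False
  assume u: "u \<in> carrier P"
  define n where "n = nat (- k)"
  have k: "k = - int n" using False n_def by simp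
  have "cg (L (u [^]\<^bsub>P\<^esub> k)) (\<ominus>\<^bsub>A\<^esub> L (u [^]\<^bsub>P\<^esub> n))"
    unfolding k P.int_pow_neg_int[OF u] using u by (intro L_inv) auto
  also have "cg \<dots> (\<ominus>\<^bsub>A\<^esub> (\<kappa> (int n) \<odot>\<^bsub>A\<^esub> L u))"
    using cg_minus[OF cg_refl[OF A.zero_closed] L_nat_pow[OF u, of n]] by (simp add: A.minus_eq)
  also have "\<ominus>\<^bsub>A\<^esub> (\<kappa> (int n) \<odot>\<^bsub>A\<^esub> L u) = \<kappa> k \<odot>\<^bsub>A\<^esub> L u"
    unfolding k by (simp add: \<kappa>_minus M.smult_l_minus)
  finally show ?thesis .
qed

lemma L_finprod: "f \<in> I \<rightarrow> carrier P \<Longrightarrow> cg (L (finprod P f I)) (finsum A (\<lambda>i. L (f i)) I)"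
proof (induction I rule: infinite_finite_induct)
  case (insert i I)
  then have f: "f \<in> I \<rightarrow> carrier P" "f i \<in> carrier P" by auto
  have "cg (L (finprod P f (insert i I))) (L (f i) \<oplus>\<^bsub>A\<^esub> L (finprod P f I))"
    using insert f L_mult[of "f i" "finprod P f I"] by simp
  also have "cg \<dots> (L (f i) \<oplus>\<^bsub>A\<^esub> finsum A (\<lambda>i. L (f i)) I)"
    using insert f by (intro cg_add) auto
  finally show ?case using insert by simp
qed auto

lemma L_\<Phi>: "z \<in> \<Phi> \<Longrightarrow> L z \<in> J 2"
proof -
  assume "z \<in> \<Phi>"
  then obtain w where w: "w \<in> carrier P" "z = w [^]\<^bsub>P\<^esub> p" unfolding P.frattini_eq_p_powers by auto
  have "\<kappa> (int p) = \<zero>\<^bsub>K\<^esub>" by (simp add: \<kappa>_eq_zero)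
  then show ?thesis using L_nat_pow[OF w(1), of p] w cg_zero by simp
qed

lemma L_cong: "\<lbrakk>u \<in> carrier P; v \<in> carrier P; \<pi> u = \<pi> v\<rbrakk> \<Longrightarrow> cg (L u) (L v)"
proof -
  assume u: "u \<in> carrier P" and v: "v \<in> carrier P" and eq: "\<pi> u = \<pi> v"
  have "u \<in> \<pi> v" using P.rcos_self[OF u \<Phi>_subgroup] eq by simp
  then obtain z where z: "z \<in> \<Phi>" "u = z \<otimes>\<^bsub>P\<^esub> v" unfolding r_coset_def by auto
  have zP: "z \<in> carrier P" using z(1) by (rule \<Phi>.mem_carrier)
  have "cg (L u) (L z \<oplus>\<^bsub>A\<^esub> L v)" unfolding z(2) using zP v by (rule L_mult)
  also have "cg \<dots> (\<zero>\<^bsub>A\<^esub> \<oplus>\<^bsub>A\<^esub> L v)" using L_\<Phi>[OF z(1)] cg_zero by (intro cg_add) auto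
  finally show ?thesis by simp
qed

text \<open>A linear functional from \<open>V\<close> to \<F>_p, given by integer representatives of
  its values.\<close>

definition frattini_character :: "('g set \<Rightarrow> int) \<Rightarrow> bool" where
  "frattini_character \<chi> \<longleftrightarrow>
     (\<forall>S\<in>carrier V. \<forall>T\<in>carrier V. [\<chi> (S \<otimes>\<^bsub>V\<^esub> T) = \<chi> S + \<chi> T] (mod int p))"

lemma frattini_characterD:
  "\<lbrakk>frattini_character \<chi>; S \<in> carrier V; T \<in> carrier V\<rbrakk> \<Longrightarrow> \<kappa> (\<chi> (S \<otimes>\<^bsub>V\<^esub> T)) = \<kappa> (\<chi> S) \<oplus>\<^bsub>K\<^esub> \<kappa> (\<chi> T)"
  using \<kappa>_cong[of "\<chi> (S \<otimes>\<^bsub>V\<^esub> T)" "\<chi> S + \<chi> T"] \<kappa>_add unfolding frattini_character_def by simp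

lemma V_coordinates:
  obtains I \<chi> where "I \<subseteq> carrier V" "\<And>u. u \<in> I \<Longrightarrow> frattini_character (\<chi> u)"
    "\<And>S. S \<in> carrier V \<Longrightarrow> (\<Otimes>\<^bsub>V\<^esub>u\<in>I. u [^]\<^bsub>V\<^esub> (\<chi> u S :: int)) = S"
proof (rule V.coordinates[OF V.subgroup_self])
  fix I and \<chi> :: "'g set \<Rightarrow> 'g set \<Rightarrow> int"
  assume a: "I \<subseteq> carrier V"
    "\<And>u x y. \<lbrakk>u \<in> I; x \<in> carrier V; y \<in> carrier V\<rbrakk> \<Longrightarrow> [\<chi> u (x \<otimes>\<^bsub>V\<^esub> y) = \<chi> u x + \<chi> u y] (mod int p)"
    and b: "\<And>x. x \<in> carrier V \<Longrightarrow> x = (\<Otimes>\<^bsub>V\<^esub>u\<in>I. u [^]\<^bsub>V\<^esub> (\<chi> u x :: int))"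
  show thesis
  proof (rule that[of I \<chi>])
    show "frattini_character (\<chi> u)" if "u \<in> I" for u
      unfolding frattini_character_def using a(2)[OF that] by blast
    show "(\<Otimes>\<^bsub>V\<^esub>u\<in>I. u [^]\<^bsub>V\<^esub> \<chi> u S) = S" if "S \<in> carrier V" for S
      using b[OF that] by (rule sym)
  qed (rule a(1))
qed

text \<open>Injectivity of \<open>V\<close> into J/J^2, tested by derivations: a functional \<chi>
  gives the derivation v -> \<chi>(v) v, which maps \<open>J 2\<close> into \<open>J 1\<close>.
  Applied to w - 1 it gives \<chi>(w) w, whose augmentation \<chi>(w) must therefore vanish. This
  holds for all coordinates of \<open>w\<close>.\<close>

lemma L_J2_imp: 
  assumes w: "w \<in> carrier P" and L: "L w \<in> J 2"
  shows "\<pi> w = \<one>\<^bsub>V\<^esub>"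
proof -
  obtain I \<chi> where I: "I \<subseteq> carrier V" and \<chi>: "\<And>u. u \<in> I \<Longrightarrow> frattini_character (\<chi> u)"
    and gen: "\<And>S. S \<in> carrier V \<Longrightarrow> (\<Otimes>\<^bsub>V\<^esub>u\<in>I. u [^]\<^bsub>V\<^esub> (\<chi> u S :: int)) = S"
    using V_coordinates by blast
  have zero: "u [^]\<^bsub>V\<^esub> \<chi> u (\<pi> w) = \<one>\<^bsub>V\<^esub>" if u: "u \<in> I" for u
  proof -
    let ?\<delta> = "\<lambda>v. \<kappa> (\<chi> u (\<pi> v)) \<odot>\<^bsub>A\<^esub> \<one>\<^bsub>A\<^esub>"
    have hom: "?\<delta> (x \<otimes>\<^bsub>P\<^esub> y) = ?\<delta> x \<oplus>\<^bsub>A\<^esub> ?\<delta> y" if "x \<in> carrier P" "y \<in> carrier P" for x y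
      using frattini_characterD[OF \<chi>[OF u], of "\<pi> x" "\<pi> y"] that by (simp add: \<pi>_mult M.smult_l_distr)
    have c: "?\<delta> x \<in> carrier A" for x by simp
    have Dd: "der_of ?\<delta> \<in> derivations K A" using c hom by (rule der_of(1))
    have Dg: "der_of ?\<delta> (g w) = g w \<otimes>\<^bsub>A\<^esub> ?\<delta> w" using c hom w by (rule der_of(2))
    have "der_of ?\<delta> (L w) \<in> J (1 + 0)"
      using L by (intro der_J[OF Dd]) (simp_all add: J_0 derD(1)[OF Dd] numeral_2_eq_2)
    then have "aug (der_of ?\<delta> (L w)) = \<zero>\<^bsub>K\<^esub>" using J_1 by simp
    moreover have "der_of ?\<delta> (L w) = \<kappa> (\<chi> u (\<pi> w)) \<odot>\<^bsub>A\<^esub> g w"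
      unfolding L_def using der_minus[OF Dd, of "g w" "\<one>\<^bsub>A\<^esub>"] der_one[OF Dd] Dg
      by (simp add: A.minus_eq smult_assoc_right)
    ultimately have "\<kappa> (\<chi> u (\<pi> w)) = \<zero>\<^bsub>K\<^esub>" using w by (simp add: aug_smult aug_g)
    then show ?thesis using V.int_pow_dvd[of u] I u by (auto simp: \<kappa>_eq_zero)
  qed
  have "\<pi> w = (\<Otimes>\<^bsub>V\<^esub>u\<in>I. u [^]\<^bsub>V\<^esub> \<chi> u (\<pi> w))" using gen[of "\<pi> w"] w by auto
  also have "\<dots> = \<one>\<^bsub>V\<^esub>" using zero by (rule V.finprod_one_eqI)
  finally show ?thesis .
qed

text \<open>\<open>\<tau> (\<pi> v)\<close> is a coset, so the condition refers to all of its
  representatives \<open>w\<close>; by \<open>L_cong\<close> they agree modulo \<open>J 2\<close>.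
  Using \<open>g v\<close> in place of \<open>L v\<close> makes no difference, since derivations
  vanish at 1.\<close>

definition induces :: "(('g \<Rightarrow> 'k) \<Rightarrow> 'g \<Rightarrow> 'k) \<Rightarrow> 'k \<Rightarrow> ('g set \<Rightarrow> 'g set) \<Rightarrow> bool" where
  "induces f c \<tau> \<longleftrightarrow> (\<forall>v\<in>carrier P. \<forall>w\<in>carrier P. \<pi> w = \<tau> (\<pi> v) \<longrightarrow> cg (f (g v)) (c \<odot>\<^bsub>A\<^esub> L w))"

definition lie_br :: "(('g \<Rightarrow> 'k) \<Rightarrow> 'g \<Rightarrow> 'k) \<Rightarrow> (('g \<Rightarrow> 'k) \<Rightarrow> 'g \<Rightarrow> 'k) \<Rightarrow> ('g \<Rightarrow> 'k) \<Rightarrow> 'g \<Rightarrow> 'k" where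
  "lie_br f h = (\<lambda>x\<in>carrier A. f (h x) \<ominus>\<^bsub>A\<^esub> h (f x))"

text \<open>A derivation with values in \<open>J 1\<close> maps \<open>J 2\<close> into itself by
  \<open>der_J\<close>, so it acts on classes modulo \<open>J 2\<close>.\<close>

lemma der_cg:
  assumes f: "f \<in> derivations K A" "\<And>x. x \<in> carrier A \<Longrightarrow> f x \<in> J 1" and xy: "cg x y"
  shows "cg (f x) (f y)"
proof -
  have "f (x \<ominus>\<^bsub>A\<^esub> y) \<in> J (1 + 1)"
    using xy f(2) by (intro der_J[OF f(1)]) (auto simp: cg_def numeral_2_eq_2)
  then show ?thesis using der_minus[OF f(1)] cg_closed[OF xy] derD(1)[OF f(1)] unfolding cg_def by (simp add: numeral_2_eq_2)
qed

lemma comp_cg: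
  assumes f: "f \<in> derivations K A" "\<And>x. x \<in> carrier A \<Longrightarrow> f x \<in> J 1" "induces f c \<tau>" "c \<in> carrier K"
    and h: "induces h d \<sigma>" "d \<in> carrier K"
    and \<sigma>: "\<And>S. S \<in> carrier V \<Longrightarrow> \<sigma> S \<in> carrier V"
    and v: "v \<in> carrier P" and w: "w \<in> carrier P" "\<pi> w = \<tau> (\<sigma> (\<pi> v))"
  shows "cg (f (h (g v))) ((c \<otimes>\<^bsub>K\<^esub> d) \<odot>\<^bsub>A\<^esub> L w)"
proof -
  obtain u where u: "u \<in> carrier P" "\<sigma> (\<pi> v) = \<pi> u" using \<pi>_surj[OF \<sigma>[OF \<pi>_closed[OF v]]] .
  have "cg (h (g v)) (d \<odot>\<^bsub>A\<^esub> L u)" using h(1) v u unfolding induces_def by simp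
  then have "cg (f (h (g v))) (f (d \<odot>\<^bsub>A\<^esub> L u))" by (intro der_cg[OF f(1)]) (rule f(2))
  also have "f (d \<odot>\<^bsub>A\<^esub> L u) = d \<odot>\<^bsub>A\<^esub> f (g u)"
    unfolding L_def using h(2) derD(1,3)[OF f(1)] der_minus[OF f(1)] der_one[OF f(1)] by (simp add: A.minus_eq)
  also have "cg (d \<odot>\<^bsub>A\<^esub> f (g u)) (d \<odot>\<^bsub>A\<^esub> (c \<odot>\<^bsub>A\<^esub> L w))"
    using f(3) u w h(2) unfolding induces_def by (intro cg_smult) auto
  also have "d \<odot>\<^bsub>A\<^esub> (c \<odot>\<^bsub>A\<^esub> L w) = (c \<otimes>\<^bsub>K\<^esub> d) \<odot>\<^bsub>A\<^esub> L w"
    using f(4) h(2) by (simp add: M.smult_assoc1[symmetric] K.m_comm)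
  finally show ?thesis .
qed

text \<open>[c \<otimes> \<tau>, d \<otimes> \<sigma>] = cd \<otimes> [\<tau>, \<sigma>], with the
  commutator in D written multiplicatively in \<open>V\<close>. Allowing it to be an m-fold multiple
  of a given \<rho> puts the integer into the scalar: m = 0 expresses commutation, and 1, 2, -2 are
  the structure constants of sl_2.\<close>

lemma bracket_induces:
  assumes f: "f \<in> derivations K A" "\<And>x. x \<in> carrier A \<Longrightarrow> f x \<in> J 1" "induces f c \<tau>" "c \<in> carrier K"
    and h: "h \<in> derivations K A" "\<And>x. x \<in> carrier A \<Longrightarrow> h x \<in> J 1" "induces h d \<sigma>" "d \<in> carrier K"
    and \<tau>: "\<And>S. S \<in> carrier V \<Longrightarrow> \<tau> S \<in> carrier V" and \<sigma>: "\<And>S. S \<in> carrier V \<Longrightarrow> \<sigma> S \<in> carrier V"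
    and \<rho>: "\<And>S. S \<in> carrier V \<Longrightarrow> \<tau> (\<sigma> S) \<otimes>\<^bsub>V\<^esub> inv\<^bsub>V\<^esub> (\<sigma> (\<tau> S)) = \<rho> S [^]\<^bsub>V\<^esub> (m::int)"
  shows "induces (lie_br f h) (\<kappa> m \<otimes>\<^bsub>K\<^esub> (c \<otimes>\<^bsub>K\<^esub> d)) \<rho>"
  unfolding induces_def
proof (intro ballI impI)
  fix v w assume v: "v \<in> carrier P" and w: "w \<in> carrier P" "\<pi> w = \<rho> (\<pi> v)"
  note vV = \<pi>_closed[OF v]
  obtain a where a: "a \<in> carrier P" "\<tau> (\<sigma> (\<pi> v)) = \<pi> a" using \<pi>_surj[OF \<tau>[OF \<sigma>[OF vV]]] .
  obtain b where b: "b \<in> carrier P" "\<sigma> (\<tau> (\<pi> v)) = \<pi> b" using \<pi>_surj[OF \<sigma>[OF \<tau>[OF vV]]] .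
  let ?cd = "c \<otimes>\<^bsub>K\<^esub> d"
  have cd: "?cd \<in> carrier K" using f(4) h(4) by simp
  have "\<pi> a \<otimes>\<^bsub>V\<^esub> inv\<^bsub>V\<^esub> (\<pi> b) = \<pi> w [^]\<^bsub>V\<^esub> m" using \<rho>[OF vV] a(2) b(2) w(2) by simp
  then have "\<pi> a = \<pi> w [^]\<^bsub>V\<^esub> m \<otimes>\<^bsub>V\<^esub> \<pi> b"
    using a(1) b(1) w(1) V.inv_solve_right'[of "\<pi> w [^]\<^bsub>V\<^esub> m" "\<pi> a" "\<pi> b"] by (simp add: V.inv_solve_right)
  also have "\<dots> = \<pi> (w [^]\<^bsub>P\<^esub> m \<otimes>\<^bsub>P\<^esub> b)" using w(1) b(1) by (simp add: \<pi>_mult \<pi>_int_pow)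
  finally have ab: "\<pi> a = \<pi> (w [^]\<^bsub>P\<^esub> m \<otimes>\<^bsub>P\<^esub> b)" .
  have "cg (L a) (L (w [^]\<^bsub>P\<^esub> m \<otimes>\<^bsub>P\<^esub> b))" using a(1) b(1) w(1) ab by (intro L_cong) auto
  also have "cg \<dots> (L (w [^]\<^bsub>P\<^esub> m) \<oplus>\<^bsub>A\<^esub> L b)" using w(1) b(1) by (intro L_mult) auto
  also have "cg \<dots> (\<kappa> m \<odot>\<^bsub>A\<^esub> L w \<oplus>\<^bsub>A\<^esub> L b)" using L_int_pow[OF w(1)] by (intro cg_add) auto
  finally have La: "cg (L a) (\<kappa> m \<odot>\<^bsub>A\<^esub> L w \<oplus>\<^bsub>A\<^esub> L b)" .
  have br: "lie_br f h (g v) = f (h (g v)) \<ominus>\<^bsub>A\<^esub> h (f (g v))" unfolding lie_br_def by simp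
  have "cg (lie_br f h (g v)) (?cd \<odot>\<^bsub>A\<^esub> L a \<ominus>\<^bsub>A\<^esub> ?cd \<odot>\<^bsub>A\<^esub> L b)"
    unfolding br
  proof (rule cg_minus)
    show "cg (f (h (g v))) (?cd \<odot>\<^bsub>A\<^esub> L a)"
      by (rule comp_cg[OF f(1) _ f(3,4) h(3,4) _ v a(1) a(2)[symmetric]]) (rule f(2) \<sigma>, assumption)+
    have "cg (h (f (g v))) ((d \<otimes>\<^bsub>K\<^esub> c) \<odot>\<^bsub>A\<^esub> L b)"
      by (rule comp_cg[OF h(1) _ h(3,4) f(3,4) _ v b(1) b(2)[symmetric]]) (rule h(2) \<tau>, assumption)+
    then show "cg (h (f (g v))) (?cd \<odot>\<^bsub>A\<^esub> L b)" using f(4) h(4) by (simp add: K.m_comm)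
  qed
  also have "cg (?cd \<odot>\<^bsub>A\<^esub> L a \<ominus>\<^bsub>A\<^esub> ?cd \<odot>\<^bsub>A\<^esub> L b) (?cd \<odot>\<^bsub>A\<^esub> (\<kappa> m \<odot>\<^bsub>A\<^esub> L w \<oplus>\<^bsub>A\<^esub> L b) \<ominus>\<^bsub>A\<^esub> ?cd \<odot>\<^bsub>A\<^esub> L b)"
    using cd La by (intro cg_minus cg_smult cg_refl) auto
  also have "?cd \<odot>\<^bsub>A\<^esub> (\<kappa> m \<odot>\<^bsub>A\<^esub> L w \<oplus>\<^bsub>A\<^esub> L b) \<ominus>\<^bsub>A\<^esub> ?cd \<odot>\<^bsub>A\<^esub> L b = (\<kappa> m \<otimes>\<^bsub>K\<^esub> ?cd) \<odot>\<^bsub>A\<^esub> L w"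
    using cd by (simp add: M.smult_r_distr A.minus_eq A.a_assoc A.r_neg M.smult_assoc1[symmetric] K.m_comm[of "\<kappa> m"])
  finally show "cg (lie_br f h (g v)) ((\<kappa> m \<otimes>\<^bsub>K\<^esub> ?cd) \<odot>\<^bsub>A\<^esub> L w)" .
qed

section \<open>Derivations averaged over E\<close>

lemma \<epsilon>_zero: "e \<in> carrier E \<Longrightarrow> \<epsilon> e \<zero>\<^bsub>A\<^esub> = \<zero>\<^bsub>A\<^esub>"
  using \<epsilon>_smult[of e "\<zero>\<^bsub>K\<^esub>" "\<zero>\<^bsub>A\<^esub>"] \<epsilon>_closed[of e "\<zero>\<^bsub>A\<^esub>"] by simp

lemma \<epsilon>_minus: "\<lbrakk>e \<in> carrier E; x \<in> carrier A; y \<in> carrier A\<rbrakk> \<Longrightarrow> \<epsilon> e (x \<ominus>\<^bsub>A\<^esub> y) = \<epsilon> e x \<ominus>\<^bsub>A\<^esub> \<epsilon> e y"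
  using \<epsilon>_smult[of e "\<ominus>\<^bsub>K\<^esub> \<one>\<^bsub>K\<^esub>" y] by (simp add: A.minus_eq \<epsilon>_add M.smult_l_minus)

lemma \<epsilon>_L: "\<lbrakk>e \<in> carrier E; u \<in> carrier P\<rbrakk> \<Longrightarrow> \<epsilon> e (L u) = L (\<phi> e u)"
proof -
  assume e: "e \<in> carrier E" and u: "u \<in> carrier P"
  have "\<phi> e \<one>\<^bsub>P\<^esub> = \<one>\<^bsub>P\<^esub>" using hom_one[OF \<phi>_auto(1)[OF e] P.group_axioms P.group_axioms] .
  then have "\<epsilon> e \<one>\<^bsub>A\<^esub> = \<one>\<^bsub>A\<^esub>" using \<epsilon>_g[OF e P.one_closed] by simp
  then show ?thesis unfolding L_def using e u by (simp add: \<epsilon>_minus \<epsilon>_g)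
qed

lemma \<epsilon>_g_mult: "\<lbrakk>e \<in> carrier E; u \<in> carrier P; x \<in> carrier A\<rbrakk> \<Longrightarrow> \<epsilon> e (g u \<otimes>\<^bsub>A\<^esub> x) = g (\<phi> e u) \<otimes>\<^bsub>A\<^esub> \<epsilon> e x"
proof -
  assume e: "e \<in> carrier E" and u: "u \<in> carrier P" and x: "x \<in> carrier A"
  show ?thesis
    using x
  proof (induction x rule: A_induct)
    case zero
    then show ?case using e by (simp add: \<epsilon>_zero)
  next
    case (add x y)
    then show ?case using e by (simp add: \<epsilon>_add A.r_distr)
  next
    case (smult c v)
    then show ?case using e u by (simp add: smult_assoc_right g_mult \<epsilon>_smult \<epsilon>_g \<phi>_dist)
  qed
qed

lemma \<epsilon>_finsum: "\<lbrakk>e \<in> carrier E; f \<in> I \<rightarrow> carrier A\<rbrakk> \<Longrightarrow> \<epsilon> e (finsum A f I) = finsum A (\<lambda>i. \<epsilon> e (f i)) I"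
  by (rule additive_finsum) (auto simp: \<epsilon>_add)

text \<open>The derivation v -> v \<Sum> \<chi>_i(v) (w_i - 1), conjugated by e, has logarithmic
  derivative \<Sum> \<chi>_i(e^-1 v) (e w_i - 1); this is the sum of these over all e.\<close>

definition avg_logder :: "'i set \<Rightarrow> ('i \<Rightarrow> 'g) \<Rightarrow> ('i \<Rightarrow> 'g set \<Rightarrow> int) \<Rightarrow> 'g \<Rightarrow> 'g \<Rightarrow> 'k" where
  "avg_logder I w \<chi> v = finsum A (\<lambda>e. finsum A (\<lambda>i. \<kappa> (\<chi> i (\<pi> (\<phi> (inv\<^bsub>E\<^esub> e) v))) \<odot>\<^bsub>A\<^esub> L (\<phi> e (w i))) I) (carrier E)"

definition avg_der :: "'i set \<Rightarrow> ('i \<Rightarrow> 'g) \<Rightarrow> ('i \<Rightarrow> 'g set \<Rightarrow> int) \<Rightarrow> ('g \<Rightarrow> 'k) \<Rightarrow> 'g \<Rightarrow> 'k" where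
  "avg_der I w \<chi> = der_of (avg_logder I w \<chi>)"

text \<open>The same construction on \<open>V\<close>: the sum over e of the conjugates of the
  linear map S -> \<Sum> \<chi>_i(S) w_i.\<close>

definition avg_endo :: "'i set \<Rightarrow> ('i \<Rightarrow> 'g) \<Rightarrow> ('i \<Rightarrow> 'g set \<Rightarrow> int) \<Rightarrow> 'g set \<Rightarrow> 'g set" where
  "avg_endo I w \<chi> S = (\<Otimes>\<^bsub>V\<^esub>e\<in>carrier E. \<phi> e ` (\<Otimes>\<^bsub>V\<^esub>i\<in>I. \<pi> (w i) [^]\<^bsub>V\<^esub> \<chi> i (\<phi> (inv\<^bsub>E\<^esub> e) ` S)))"

text \<open>Stability is invariance of a sum over E under translation. The induced map is found by
  pulling sums through \<open>L\<close>, which is additive modulo \<open>J 2\<close>; the factors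
  w_i - 1 bring the values into \<open>J 1\<close>.\<close>

lemma avg_der_props:
  assumes w: "\<And>i. i \<in> I \<Longrightarrow> w i \<in> carrier P" and \<chi>: "\<And>i. i \<in> I \<Longrightarrow> frattini_character (\<chi> i)"
  shows avg_logder_J: "v \<in> carrier P \<Longrightarrow> avg_logder I w \<chi> v \<in> J 1"
    and avg_der_derivation: "avg_der I w \<chi> \<in> derivations K A"
    and avg_der_g: "v \<in> carrier P \<Longrightarrow> avg_der I w \<chi> (g v) = g v \<otimes>\<^bsub>A\<^esub> avg_logder I w \<chi> v"
    and avg_der_J: "x \<in> carrier A \<Longrightarrow> avg_der I w \<chi> x \<in> J 1"
    and avg_der_stable: "avg_der I w \<chi> \<in> stable_derivations K P E \<phi>"
    and avg_der_induces: "induces (avg_der I w \<chi>) \<one>\<^bsub>K\<^esub> (avg_endo I w \<chi>)"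
    and avg_endo: "V.endo (avg_endo I w \<chi>)"
proof -
  let ?t = "\<lambda>v e i. \<kappa> (\<chi> i (\<pi> (\<phi> (inv\<^bsub>E\<^esub> e) v))) \<odot>\<^bsub>A\<^esub> L (\<phi> e (w i))"
  have tc: "?t v e i \<in> carrier A" for v e i by simp
  have sc: "finsum A (?t v e) I \<in> carrier A" for v e using tc by (intro A.finsum_closed Pi_I)
  show TJ: "avg_logder I w \<chi> v \<in> J 1" if "v \<in> carrier P" for v
    unfolding avg_logder_def using w by (intro J_finsum J_smult L_J) auto
  have Tc: "avg_logder I w \<chi> v \<in> carrier A" if "v \<in> carrier P" for v using J_closed[OF TJ[OF that]] .
  have Th: "avg_logder I w \<chi> (u \<otimes>\<^bsub>P\<^esub> v) = avg_logder I w \<chi> u \<oplus>\<^bsub>A\<^esub> avg_logder I w \<chi> v"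
    if u: "u \<in> carrier P" and v: "v \<in> carrier P" for u v
  proof -
    have "avg_logder I w \<chi> (u \<otimes>\<^bsub>P\<^esub> v) =
        finsum A (\<lambda>e. finsum A (?t u e) I \<oplus>\<^bsub>A\<^esub> finsum A (?t v e) I) (carrier E)"
      unfolding avg_logder_def
    proof (rule A.finsum_cong')
      fix e assume e: "e \<in> carrier E"
      have "finsum A (?t (u \<otimes>\<^bsub>P\<^esub> v) e) I = finsum A (\<lambda>i. ?t u e i \<oplus>\<^bsub>A\<^esub> ?t v e i) I"
      proof (rule A.finsum_cong')
        fix i assume i: "i \<in> I"
        show "?t (u \<otimes>\<^bsub>P\<^esub> v) e i = ?t u e i \<oplus>\<^bsub>A\<^esub> ?t v e i"
          using frattini_characterD[OF \<chi>[OF i], of "\<pi> (\<phi> (inv\<^bsub>E\<^esub> e) u)" "\<pi> (\<phi> (inv\<^bsub>E\<^esub> e) v)"] e u v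
          by (simp add: \<phi>_dist \<pi>_mult M.smult_l_distr)
      qed (use tc in auto)
      also have "\<dots> = finsum A (?t u e) I \<oplus>\<^bsub>A\<^esub> finsum A (?t v e) I"
        using tc by (intro A.finsum_addf) auto
      finally show "finsum A (?t (u \<otimes>\<^bsub>P\<^esub> v) e) I = finsum A (?t u e) I \<oplus>\<^bsub>A\<^esub> finsum A (?t v e) I" .
    qed (use sc in auto)
    also have "\<dots> = avg_logder I w \<chi> u \<oplus>\<^bsub>A\<^esub> avg_logder I w \<chi> v"
      unfolding avg_logder_def using sc by (intro A.finsum_addf) auto
    finally show ?thesis .
  qed
  show Td: "avg_der I w \<chi> \<in> derivations K A" unfolding avg_der_def using Tc Th by (rule der_of(1))
  show Tg: "avg_der I w \<chi> (g v) = g v \<otimes>\<^bsub>A\<^esub> avg_logder I w \<chi> v" if "v \<in> carrier P" for v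
    unfolding avg_der_def using Tc Th that by (rule der_of(2))
  show "avg_der I w \<chi> x \<in> J 1" if "x \<in> carrier A"
    using that
  proof (induction x rule: A_induct)
    case (smult c u)
    have "g u \<otimes>\<^bsub>A\<^esub> avg_logder I w \<chi> u \<in> J 1" using TJ[OF smult(2)] by (intro J_mult) auto
    then show ?case using smult by (simp add: derD(3)[OF Td] Tg J_smult)
  qed (simp_all add: der_zero[OF Td] derD(2)[OF Td] J_add)
  show "avg_der I w \<chi> \<in> stable_derivations K P E \<phi>"
    unfolding stable_iff
  proof (intro conjI ballI Td)
    fix h u assume h: "h \<in> carrier E" and u: "u \<in> carrier P"
    \<comment> \<open>Translating the index by \<open>h\<close> cancels \<open>h\<close> in the
      argument and makes it appear in front, as \<open>\<epsilon> h\<close>.\<close>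
    have im: "(\<lambda>e. h \<otimes>\<^bsub>E\<^esub> e) ` carrier E = carrier E" using h by (rule E.surj_const_mult)
    have "avg_logder I w \<chi> (\<phi> h u) = finsum A (\<lambda>e. finsum A (?t (\<phi> h u) e) I) ((\<lambda>e. h \<otimes>\<^bsub>E\<^esub> e) ` carrier E)"
      unfolding im avg_logder_def ..
    also have "\<dots> = finsum A (\<lambda>e. finsum A (?t (\<phi> h u) (h \<otimes>\<^bsub>E\<^esub> e)) I) (carrier E)"
      using h sc by (intro A.finsum_reindex) (auto simp: E.inj_on_cmult)
    also have "\<dots> = finsum A (\<lambda>e. \<epsilon> h (finsum A (?t u e) I)) (carrier E)"
    proof (rule A.finsum_cong')
      fix e assume e: "e \<in> carrier E"
      have "inv\<^bsub>E\<^esub> (h \<otimes>\<^bsub>E\<^esub> e) \<otimes>\<^bsub>E\<^esub> h = inv\<^bsub>E\<^esub> e" using e h by (simp add: E.inv_mult_group E.m_assoc)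
      then have inv: "\<phi> (inv\<^bsub>E\<^esub> (h \<otimes>\<^bsub>E\<^esub> e)) (\<phi> h u) = \<phi> (inv\<^bsub>E\<^esub> e) u"
        using \<phi>_mult[of "inv\<^bsub>E\<^esub> (h \<otimes>\<^bsub>E\<^esub> e)" h u] e h u by simp
      have "\<epsilon> h (finsum A (?t u e) I) = finsum A (\<lambda>i. \<epsilon> h (?t u e i)) I" using h tc by (intro \<epsilon>_finsum) auto
      also have "\<dots> = finsum A (?t (\<phi> h u) (h \<otimes>\<^bsub>E\<^esub> e)) I"
      proof (rule A.finsum_cong')
        fix i assume i: "i \<in> I"
        show "\<epsilon> h (?t u e i) = ?t (\<phi> h u) (h \<otimes>\<^bsub>E\<^esub> e) i"
          unfolding inv using \<phi>_mult[OF h e w[OF i]] h e w[OF i] by (simp add: \<epsilon>_smult \<epsilon>_L)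
      qed (use tc in auto)
      finally show "finsum A (?t (\<phi> h u) (h \<otimes>\<^bsub>E\<^esub> e)) I = \<epsilon> h (finsum A (?t u e) I)" ..
    qed (use sc h in auto)
    also have "\<dots> = \<epsilon> h (avg_logder I w \<chi> u)"
      unfolding avg_logder_def using h sc by (intro \<epsilon>_finsum[symmetric]) auto
    finally show "avg_der I w \<chi> (g (\<phi> h u)) = \<epsilon> h (avg_der I w \<chi> (g u))"
      using h u Tc by (simp add: Tg \<epsilon>_g_mult)
  qed
  have \<pi>w: "\<pi> (w i) \<in> carrier V" if "i \<in> I" for i using w[OF that] by auto
  \<comment> \<open>The linear map before averaging; equivariance of its average is
    \<open>endo_from_hom_on\<close> with N all of \<open>V\<close>.\<close>
  define qq where "qq = (\<lambda>S. \<Otimes>\<^bsub>V\<^esub>i\<in>I. \<pi> (w i) [^]\<^bsub>V\<^esub> \<chi> i S)"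
  have qc: "qq S \<in> carrier V" for S unfolding qq_def using \<pi>w by (intro V.finprod_closed) auto
  have qh: "qq \<in> hom V V"
  proof (rule homI)
    fix S R assume S: "S \<in> carrier V" and R: "R \<in> carrier V"
    have "qq S \<otimes>\<^bsub>V\<^esub> qq R = (\<Otimes>\<^bsub>V\<^esub>i\<in>I. \<pi> (w i) [^]\<^bsub>V\<^esub> \<chi> i S \<otimes>\<^bsub>V\<^esub> \<pi> (w i) [^]\<^bsub>V\<^esub> \<chi> i R)"
      unfolding qq_def using \<pi>w by (intro V.finprod_multf[symmetric]) auto
    also have "\<dots> = qq (S \<otimes>\<^bsub>V\<^esub> R)"
      unfolding qq_def
    proof (rule V.finprod_cong')
      fix i assume i: "i \<in> I"
      have "[\<chi> i (S \<otimes>\<^bsub>V\<^esub> R) = \<chi> i S + \<chi> i R] (mod int p)"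
        using \<chi>[OF i] S R unfolding frattini_character_def by blast
      then show "\<pi> (w i) [^]\<^bsub>V\<^esub> \<chi> i S \<otimes>\<^bsub>V\<^esub> \<pi> (w i) [^]\<^bsub>V\<^esub> \<chi> i R = \<pi> (w i) [^]\<^bsub>V\<^esub> \<chi> i (S \<otimes>\<^bsub>V\<^esub> R)"
        using V.int_pow_cong[OF \<pi>w[OF i]] V.int_pow_mult[OF \<pi>w[OF i]] by simp
    qed (use \<pi>w in auto)
    finally show "qq (S \<otimes>\<^bsub>V\<^esub> R) = qq S \<otimes>\<^bsub>V\<^esub> qq R" ..
  qed (rule qc)
  show "V.endo (avg_endo I w \<chi>)"
    using V.endo_from_hom_on(1)[OF V.stable_carrier qh qc] unfolding avg_endo_def qq_def by simp
  show "induces (avg_der I w \<chi>) \<one>\<^bsub>K\<^esub> (avg_endo I w \<chi>)"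
    unfolding induces_def
  proof (intro ballI impI)
    fix v w' assume v: "v \<in> carrier P" and w': "w' \<in> carrier P" "\<pi> w' = avg_endo I w \<chi> (\<pi> v)"
    let ?k = "\<lambda>e i. \<chi> i (\<pi> (\<phi> (inv\<^bsub>E\<^esub> e) v))"
    \<comment> \<open>A product in \<open>P\<close> whose image under \<open>L\<close> is the inner
      sum of \<open>avg_logder\<close> modulo \<open>J 2\<close>, and whose coset is the factor at
      \<open>e\<close> of \<open>avg_endo\<close>.\<close>
    let ?z = "\<lambda>e. \<Otimes>\<^bsub>P\<^esub>i\<in>I. \<phi> e (w i) [^]\<^bsub>P\<^esub> ?k e i"
    have fw: "\<phi> e (w i) \<in> carrier P" if "e \<in> carrier E" "i \<in> I" for e i using w that by auto
    have zc: "?z e \<in> carrier P" if "e \<in> carrier E" for e using fw[OF that] by (intro P.finprod_closed) auto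
    have "cg (avg_der I w \<chi> (g v)) (avg_logder I w \<chi> v)" unfolding Tg[OF v] using v TJ[OF v] by (rule cg_mult_g)
    also have "cg (avg_logder I w \<chi> v) (finsum A (\<lambda>e. finsum A (\<lambda>i. L (\<phi> e (w i) [^]\<^bsub>P\<^esub> ?k e i)) I) (carrier E))"
      unfolding avg_logder_def by (intro cg_finsum cg_sym[OF L_int_pow] fw)
    also have "cg (finsum A (\<lambda>e. finsum A (\<lambda>i. L (\<phi> e (w i) [^]\<^bsub>P\<^esub> ?k e i)) I) (carrier E))
        (finsum A (\<lambda>e. L (?z e)) (carrier E))"
    proof (rule cg_finsum)
      fix e assume e: "e \<in> carrier E"
      show "cg (finsum A (\<lambda>i. L (\<phi> e (w i) [^]\<^bsub>P\<^esub> ?k e i)) I) (L (?z e))"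
        by (rule cg_sym[OF L_finprod]) (use fw[OF e] in auto)
    qed
    also have "cg (finsum A (\<lambda>e. L (?z e)) (carrier E)) (L (\<Otimes>\<^bsub>P\<^esub>e\<in>carrier E. ?z e))"
      by (rule cg_sym[OF L_finprod]) (use zc in auto)
    also have "cg (L (\<Otimes>\<^bsub>P\<^esub>e\<in>carrier E. ?z e)) (L w')"
    proof (rule L_cong)
      show "(\<Otimes>\<^bsub>P\<^esub>e\<in>carrier E. ?z e) \<in> carrier P" using zc by (intro P.finprod_closed) auto
      show "w' \<in> carrier P" by (rule w'(1))
      have "\<pi> (\<Otimes>\<^bsub>P\<^esub>e\<in>carrier E. ?z e) = (\<Otimes>\<^bsub>V\<^esub>e\<in>carrier E. \<pi> (?z e))"
        using zc by (intro hom_finprod[OF P.comm_group_axioms V_comm_group \<pi>_hom]) auto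
      also have "\<dots> = avg_endo I w \<chi> (\<pi> v)"
        unfolding avg_endo_def
      proof (rule V.finprod_cong')
        fix e assume e: "e \<in> carrier E"
        have "\<pi> (?z e) = (\<Otimes>\<^bsub>V\<^esub>i\<in>I. \<pi> (\<phi> e (w i) [^]\<^bsub>P\<^esub> ?k e i))"
          using fw[OF e] by (intro hom_finprod[OF P.comm_group_axioms V_comm_group \<pi>_hom]) auto
        also have "\<dots> = (\<Otimes>\<^bsub>V\<^esub>i\<in>I. \<phi> e ` (\<pi> (w i) [^]\<^bsub>V\<^esub> \<chi> i (\<phi> (inv\<^bsub>E\<^esub> e) ` \<pi> v)))"
        proof (rule V.finprod_cong')
          fix i assume i: "i \<in> I"
          have "\<phi> e ` (\<pi> (w i) [^]\<^bsub>V\<^esub> ?k e i) = (\<phi> e ` \<pi> (w i)) [^]\<^bsub>V\<^esub> ?k e i"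
            by (rule V.act_int_pow[OF e \<pi>w[OF i]])
          also have "\<dots> = \<pi> (\<phi> e (w i) [^]\<^bsub>P\<^esub> ?k e i)"
            using \<pi>_action[OF e w[OF i]] \<pi>_int_pow[OF fw[OF e i]] by simp
          finally show "\<pi> (\<phi> e (w i) [^]\<^bsub>P\<^esub> ?k e i) = \<phi> e ` (\<pi> (w i) [^]\<^bsub>V\<^esub> \<chi> i (\<phi> (inv\<^bsub>E\<^esub> e) ` \<pi> v))"
            using \<pi>_action[OF E.inv_closed[OF e] v] by simp
        qed (use \<pi>w e in \<open>auto intro!: V.act_closed\<close>)
        also have "\<dots> = \<phi> e ` (\<Otimes>\<^bsub>V\<^esub>i\<in>I. \<pi> (w i) [^]\<^bsub>V\<^esub> \<chi> i (\<phi> (inv\<^bsub>E\<^esub> e) ` \<pi> v))"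
          using \<pi>w e by (intro V.act_finprod[symmetric]) auto
        finally show "\<pi> (?z e) = \<phi> e ` (\<Otimes>\<^bsub>V\<^esub>i\<in>I. \<pi> (w i) [^]\<^bsub>V\<^esub> \<chi> i (\<phi> (inv\<^bsub>E\<^esub> e) ` \<pi> v))" .
      qed (use \<pi>w in \<open>auto intro!: V.act_closed V.finprod_closed\<close>)
      finally show "\<pi> (\<Otimes>\<^bsub>P\<^esub>e\<in>carrier E. ?z e) = \<pi> w'" using w'(2) by simp
    qed
    finally show "cg (avg_der I w \<chi> (g v)) (\<one>\<^bsub>K\<^esub> \<odot>\<^bsub>A\<^esub> L w')" by simp
  qed
qed

text \<open>The coefficients sum to 0, so subtracting 1 from every group element changes
  nothing.\<close>

lemma J1_expand: "x \<in> J 1 \<Longrightarrow> x = finsum A (\<lambda>w. x w \<odot>\<^bsub>A\<^esub> L w) (carrier P)"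
proof -
  assume x: "x \<in> J 1"
  have xA: "x \<in> carrier A" and aug: "aug x = \<zero>\<^bsub>K\<^esub>" using x J_1 by auto
  have "lin L y = y \<ominus>\<^bsub>A\<^esub> aug y \<odot>\<^bsub>A\<^esub> \<one>\<^bsub>A\<^esub>" if "y \<in> carrier A" for y
    using that
  proof (induction y rule: A_induct)
    case zero
    have "lin L (\<zero>\<^bsub>K\<^esub> \<odot>\<^bsub>A\<^esub> \<zero>\<^bsub>A\<^esub>) = \<zero>\<^bsub>K\<^esub> \<odot>\<^bsub>A\<^esub> lin L \<zero>\<^bsub>A\<^esub>" by (rule lin_smult) auto
    then show ?case by (simp add: A.minus_eq)
  next
    case (add x y)
    have "lin L (x \<oplus>\<^bsub>A\<^esub> y) = lin L x \<oplus>\<^bsub>A\<^esub> lin L y" using add by (intro lin_add) auto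
    then show ?case using add by (simp add: aug_add M.smult_l_distr A.minus_eq A.minus_add A.a_ac)
  next
    case (smult c u)
    have "lin L (c \<odot>\<^bsub>A\<^esub> g u) = c \<odot>\<^bsub>A\<^esub> lin L (g u)" using smult by (intro lin_smult) auto
    also have "lin L (g u) = L u" using smult by (intro lin_g) auto
    finally show ?case
      using smult by (simp add: aug_smult aug_g L_def A.minus_eq M.smult_r_distr M.smult_r_minus)
  qed
  then have "lin L x = x" using xA aug by (simp add: A.minus_eq)
  then show ?thesis unfolding lin_def by simp
qed

lemma der_finsum: "\<lbrakk>f \<in> derivations K A; h \<in> I \<rightarrow> carrier A\<rbrakk> \<Longrightarrow> f (finsum A h I) = finsum A (\<lambda>i. f (h i)) I"
  by (rule additive_finsum) (auto simp: derD)

lemma logder_stable: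
  assumes f: "f \<in> stable_derivations K P E \<phi>" and e: "e \<in> carrier E" and v: "v \<in> carrier P"
  shows "logder f (\<phi> e v) = \<epsilon> e (logder f v)"
proof -
  have fd: "f \<in> derivations K A" using f unfolding stable_iff by auto
  interpret h: group_hom P P "\<phi> e" using \<phi>_auto(1)[OF e] by unfold_locales
  have "logder f (\<phi> e v) = g (\<phi> e (inv\<^bsub>P\<^esub> v)) \<otimes>\<^bsub>A\<^esub> \<epsilon> e (f (g v))"
    unfolding logder_def using f e v by (simp add: stable_iff)
  also have "\<dots> = \<epsilon> e (logder f v)"
    unfolding logder_def using e v derD(1)[OF fd] by (simp add: \<epsilon>_g_mult)
  finally show ?thesis .
qed

lemma logder_nat_pow:
  assumes f: "f \<in> derivations K A" and u: "u \<in> carrier P"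
  shows "logder f (u [^]\<^bsub>P\<^esub> (n::nat)) = \<kappa> (int n) \<odot>\<^bsub>A\<^esub> logder f u"
proof (induction n)
  case 0
  have "logder f \<one>\<^bsub>P\<^esub> = \<zero>\<^bsub>A\<^esub>" unfolding logder_def using der_one[OF f] by simp
  then show ?case using logder(1)[OF f u] by simp
next
  case (Suc n)
  then show ?case
    using logder(3)[OF f, of "u [^]\<^bsub>P\<^esub> n" u] u logder(1)[OF f u] \<kappa>_add[of "int n" 1]
    by (simp add: M.smult_l_distr add.commute)
qed

text \<open>The additive group of kP has exponent p, so \<open>logder f\<close> kills p-th powers
  and factors through \<open>V\<close>; its value at \<open>v\<close> is the corresponding linear
  combination of its values at representatives of the generators.\<close>

lemma logder_coordinates:
  assumes f: "f \<in> derivations K A" and v: "v \<in> carrier P"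
    and I: "finite I" "\<And>u. u \<in> I \<Longrightarrow> r u \<in> carrier P"
    and gen: "(\<Otimes>\<^bsub>V\<^esub>u\<in>I. \<pi> (r u) [^]\<^bsub>V\<^esub> (k u :: int)) = \<pi> v"
  shows "logder f v = finsum A (\<lambda>u. \<kappa> (k u) \<odot>\<^bsub>A\<^esub> logder f (r u)) I"
proof -
  let ?D = "\<lambda>u. logder f u"
  note Dc = logder(1)[OF f] and Dm = logder(3)[OF f]
  have D1: "?D \<one>\<^bsub>P\<^esub> = \<zero>\<^bsub>A\<^esub>" unfolding logder_def using der_one[OF f] by simp
  have D\<Phi>: "?D z = \<zero>\<^bsub>A\<^esub>" if z: "z \<in> \<Phi>" for z
  proof -
    obtain w where w: "w \<in> carrier P" "z = w [^]\<^bsub>P\<^esub> p" using z unfolding P.frattini_eq_p_powers by auto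
    have "\<kappa> (int p) = \<zero>\<^bsub>K\<^esub>" by (simp add: \<kappa>_eq_zero)
    then show ?thesis unfolding w(2) logder_nat_pow[OF f w(1)] using Dc[OF w(1)] by simp
  qed
  have Dcong: "?D u = ?D w" if "u \<in> carrier P" "w \<in> carrier P" "\<pi> u = \<pi> w" for u w
  proof -
    have "u \<in> \<pi> w" using P.rcos_self[OF that(1) \<Phi>_subgroup] that(3) by simp
    then obtain z where z: "z \<in> \<Phi>" "u = z \<otimes>\<^bsub>P\<^esub> w" unfolding r_coset_def by auto
    then show ?thesis using Dm[OF \<Phi>.mem_carrier[OF z(1)] that(2)] D\<Phi>[OF z(1)] Dc[OF that(2)] by simp
  qed
  \<comment> \<open>Exponents are replaced by their non-negative residues modulo p, because
    \<open>logder_nat_pow\<close> is about natural exponents.\<close>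
  define m where "m u = nat (k u mod int p)" for u
  have p0: "int p > 0" using prime_gt_0_nat[OF prime_p] by simp
  have mk: "[int (m u) = k u] (mod int p)" for u unfolding m_def using p0 by (simp add: cong_def)
  have z: "(\<Otimes>\<^bsub>P\<^esub>u\<in>I. r u [^]\<^bsub>P\<^esub> m u) \<in> carrier P" using I by (intro P.finprod_closed) auto
  have "\<pi> (\<Otimes>\<^bsub>P\<^esub>u\<in>I. r u [^]\<^bsub>P\<^esub> m u) = (\<Otimes>\<^bsub>V\<^esub>u\<in>I. \<pi> (r u [^]\<^bsub>P\<^esub> m u))"
    using I by (intro hom_finprod[OF P.comm_group_axioms V_comm_group \<pi>_hom]) auto
  also have "\<dots> = (\<Otimes>\<^bsub>V\<^esub>u\<in>I. \<pi> (r u) [^]\<^bsub>V\<^esub> (k u :: int))"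
  proof (rule V.finprod_cong')
    fix u assume u: "u \<in> I"
    have "\<pi> (r u [^]\<^bsub>P\<^esub> m u) = \<pi> (r u) [^]\<^bsub>V\<^esub> int (m u)"
      using \<pi>_int_pow[OF I(2)[OF u], of "int (m u)"] by (simp add: int_pow_int)
    also have "\<dots> = \<pi> (r u) [^]\<^bsub>V\<^esub> k u" using mk I(2)[OF u] by (intro V.int_pow_cong) auto
    finally show "\<pi> (r u [^]\<^bsub>P\<^esub> m u) = \<pi> (r u) [^]\<^bsub>V\<^esub> k u" .
  qed (use I in auto)
  finally have "?D v = ?D (\<Otimes>\<^bsub>P\<^esub>u\<in>I. r u [^]\<^bsub>P\<^esub> m u)" using gen z v by (intro Dcong) auto
  also have "\<dots> = finsum A (\<lambda>u. \<kappa> (k u) \<odot>\<^bsub>A\<^esub> ?D (r u)) I"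
    using I
  proof (induction I rule: finite_induct)
    case (insert i I)
    have c: "(\<lambda>u. r u [^]\<^bsub>P\<^esub> m u) \<in> I \<rightarrow> carrier P" "r i \<in> carrier P" using insert.prems by auto
    have c2: "(\<lambda>u. \<kappa> (k u) \<odot>\<^bsub>A\<^esub> ?D (r u)) \<in> I \<rightarrow> carrier A" using insert.prems Dc by auto
    have "?D (\<Otimes>\<^bsub>P\<^esub>u\<in>insert i I. r u [^]\<^bsub>P\<^esub> m u) = ?D (r i [^]\<^bsub>P\<^esub> m i) \<oplus>\<^bsub>A\<^esub> ?D (\<Otimes>\<^bsub>P\<^esub>u\<in>I. r u [^]\<^bsub>P\<^esub> m u)"
      using insert.hyps c Dm[of "r i [^]\<^bsub>P\<^esub> m i" "\<Otimes>\<^bsub>P\<^esub>u\<in>I. r u [^]\<^bsub>P\<^esub> m u"] by simp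
    also have "?D (r i [^]\<^bsub>P\<^esub> m i) = \<kappa> (k i) \<odot>\<^bsub>A\<^esub> ?D (r i)"
      unfolding logder_nat_pow[OF f c(2)] using \<kappa>_cong[OF mk] by simp
    also have "?D (\<Otimes>\<^bsub>P\<^esub>u\<in>I. r u [^]\<^bsub>P\<^esub> m u) = finsum A (\<lambda>u. \<kappa> (k u) \<odot>\<^bsub>A\<^esub> ?D (r u)) I"
      using insert.IH insert.prems by auto
    finally show ?case using insert.hyps c c2 Dc by simp
  qed (simp add: D1)
  finally show ?thesis .
qed

lemma order_E_nonzero: "\<kappa> (int (order E)) \<noteq> \<zero>\<^bsub>K\<^esub>"
proof
  assume "\<kappa> (int (order E)) = \<zero>\<^bsub>K\<^esub>"
  then have "p dvd order E" by (simp add: \<kappa>_eq_zero)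
  then show False using coprime_E prime_p by (metis coprime_absorb_right not_prime_unit coprime_commute)
qed

lemma finsum_const: "x \<in> carrier A \<Longrightarrow> finsum A (\<lambda>i. x) I = \<kappa> (int (card I)) \<odot>\<^bsub>A\<^esub> x"
proof (induction I rule: infinite_finite_induct)
  case (insert i I)
  then show ?case using \<kappa>_add[of 1 "int (card I)"] by (simp add: M.smult_l_distr)
qed auto

text \<open>Averaging over \<open>E\<close>: modulo the invertible factor \<open>|E|\<close>, a stable derivation with values in the
  augmentation ideal is a linear combination of averages of derivations \<open>(w - 1) D\<^sub>\<chi>\<close> with \<open>\<chi>\<close> a
  character of \<open>P\<close> into the prime field, and these induce \<open>\<F>\<^sub>p E\<close>-endomorphisms of \<open>P/\<Phi>(P)\<close>.\<close>

lemma stable_decomposition: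
  assumes f: "f \<in> stable_derivations K P E \<phi>" "\<And>x. x \<in> carrier A \<Longrightarrow> f x \<in> J 1"
  obtains I :: "'g set set" and c \<chi> where "\<And>u w. u \<in> I \<Longrightarrow> w \<in> carrier P \<Longrightarrow> c u w \<in> carrier K"
    "\<And>u. u \<in> I \<Longrightarrow> frattini_character (\<chi> u)"
    "\<And>x. x \<in> carrier A \<Longrightarrow> f x = finsum A (\<lambda>u. finsum A (\<lambda>w. c u w \<odot>\<^bsub>A\<^esub> avg_der {()} (\<lambda>_. w) (\<lambda>_. \<chi> u) x) (carrier P)) I"
proof -
  have fd: "f \<in> derivations K A" using f unfolding stable_iff by auto
  obtain I \<chi> where I: "I \<subseteq> carrier V" and \<chi>: "\<And>u. u \<in> I \<Longrightarrow> frattini_character (\<chi> u)"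
    and gen: "\<And>S. S \<in> carrier V \<Longrightarrow> (\<Otimes>\<^bsub>V\<^esub>u\<in>I. u [^]\<^bsub>V\<^esub> (\<chi> u S :: int)) = S"
    using V_coordinates by blast
  have finI: "finite I" using I V.finite_V finite_subset by blast
  have "\<exists>r. r \<in> carrier P \<and> \<pi> r = u" if "u \<in> I" for u
    using I that \<pi>_surj[of u] by blast
  then obtain r where r: "\<And>u. u \<in> I \<Longrightarrow> r u \<in> carrier P" "\<And>u. u \<in> I \<Longrightarrow> \<pi> (r u) = u" by metis
  \<comment> \<open>These finitely many values determine \<open>f\<close>; they lie in
    \<open>J 1\<close>, since \<open>f\<close> takes its values there.\<close>
  define a where "a u = logder f (r u)" for u
  have aJ: "a u \<in> J 1" if "u \<in> I" for u
    unfolding a_def logder_def using f(2)[of "g (r u)"] by (intro J_mult) auto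
  have aA: "a u \<in> carrier A" if "u \<in> I" for u using J_closed[OF aJ[OF that]] .
  define n where "n = \<kappa> (int (order E))"
  have nK: "n \<in> carrier K" "n \<noteq> \<zero>\<^bsub>K\<^esub>" unfolding n_def using order_E_nonzero by auto
  define ni where "ni = inv\<^bsub>K\<^esub> n"
  have nU: "n \<in> Units K" using nK by (simp add: K.field_Units)
  have niK: "ni \<in> carrier K" "ni \<otimes>\<^bsub>K\<^esub> n = \<one>\<^bsub>K\<^esub>" unfolding ni_def using nU by auto
  \<comment> \<open>With a one-element index set, \<open>avg_der\<close> averages a single
    derivation (w - 1) D with D given by the character.\<close>
  let ?T = "\<lambda>u w. avg_der {()} (\<lambda>_. w) (\<lambda>_. \<chi> u)"
  let ?k = "\<lambda>e u v. \<kappa> (\<chi> u (\<pi> (\<phi> (inv\<^bsub>E\<^esub> e) v)))"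
  have TP: "?T u w \<in> derivations K A" "\<And>v. v \<in> carrier P \<Longrightarrow> ?T u w (g v) = g v \<otimes>\<^bsub>A\<^esub> avg_logder {()} (\<lambda>_. w) (\<lambda>_. \<chi> u) v"
    if "u \<in> I" "w \<in> carrier P" for u w
    using avg_der_derivation[of "{()}" "\<lambda>_. w" "\<lambda>_. \<chi> u"] avg_der_g[of "{()}" "\<lambda>_. w" "\<lambda>_. \<chi> u"] that \<chi> by auto
  have TL: "avg_logder {()} (\<lambda>_. w) (\<lambda>_. \<chi> u) v = finsum A (\<lambda>e. ?k e u v \<odot>\<^bsub>A\<^esub> L (\<phi> e w)) (carrier E)" for w u v
    unfolding avg_logder_def by (intro A.finsum_cong') (auto intro!: A.finsum_closed)
  have TLc: "avg_logder {()} (\<lambda>_. w) (\<lambda>_. \<chi> u) v \<in> carrier A" for w u v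
    unfolding TL by (intro A.finsum_closed) auto
  have log_sum: "n \<odot>\<^bsub>A\<^esub> logder f v = finsum A (\<lambda>u. finsum A (\<lambda>w. a u w \<odot>\<^bsub>A\<^esub> avg_logder {()} (\<lambda>_. w) (\<lambda>_. \<chi> u) v) (carrier P)) I"
    if v: "v \<in> carrier P" for v
  proof -
    have vc: "logder f v \<in> carrier A" using logder(1)[OF fd v] .
    have inner: "\<epsilon> e (a u) = finsum A (\<lambda>w. a u w \<odot>\<^bsub>A\<^esub> L (\<phi> e w)) (carrier P)"
      if e: "e \<in> carrier E" and u: "u \<in> I" for e u
    proof -
      have "\<epsilon> e (a u) = \<epsilon> e (finsum A (\<lambda>w. a u w \<odot>\<^bsub>A\<^esub> L w) (carrier P))"
        using J1_expand[OF aJ[OF u]] by simp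
      also have "\<dots> = finsum A (\<lambda>w. \<epsilon> e (a u w \<odot>\<^bsub>A\<^esub> L w)) (carrier P)"
        using e aA[OF u] by (intro \<epsilon>_finsum) auto
      also have "\<dots> = finsum A (\<lambda>w. a u w \<odot>\<^bsub>A\<^esub> L (\<phi> e w)) (carrier P)"
        using e aA[OF u] by (intro A.finsum_cong') (auto simp: \<epsilon>_smult \<epsilon>_L)
      finally show ?thesis .
    qed
    \<comment> \<open>By stability \<open>logder f v\<close> equals \<open>\<epsilon> e\<close> of
      the value at e^-1 v for each e; summing over E produces the factor \<open>n\<close>. The inner
      values are then expanded in coordinates.\<close>
    have "n \<odot>\<^bsub>A\<^esub> logder f v = finsum A (\<lambda>e. logder f v) (carrier E)"
      unfolding n_def using finsum_const[OF vc, of "carrier E"] by (simp add: Coset.order_def)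
    also have "\<dots> = finsum A (\<lambda>e. finsum A (\<lambda>u. ?k e u v \<odot>\<^bsub>A\<^esub> \<epsilon> e (a u)) I) (carrier E)"
    proof (rule A.finsum_cong')
      fix e assume e: "e \<in> carrier E"
      have ev: "\<phi> (inv\<^bsub>E\<^esub> e) v \<in> carrier P" using e v by auto
      have "logder f v = \<epsilon> e (logder f (\<phi> (inv\<^bsub>E\<^esub> e) v))"
        using logder_stable[OF f(1) e ev] \<phi>_inv(1)[OF e v] by simp
      also have "logder f (\<phi> (inv\<^bsub>E\<^esub> e) v) = finsum A (\<lambda>u. ?k e u v \<odot>\<^bsub>A\<^esub> a u) I"
        unfolding a_def
      proof (rule logder_coordinates[OF fd ev finI r(1)])
        have "(\<Otimes>\<^bsub>V\<^esub>u\<in>I. \<pi> (r u) [^]\<^bsub>V\<^esub> \<chi> u (\<pi> (\<phi> (inv\<^bsub>E\<^esub> e) v))) = (\<Otimes>\<^bsub>V\<^esub>u\<in>I. u [^]\<^bsub>V\<^esub> \<chi> u (\<pi> (\<phi> (inv\<^bsub>E\<^esub> e) v)))"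
          using r(2) I by (intro V.finprod_cong') auto
        also have "\<dots> = \<pi> (\<phi> (inv\<^bsub>E\<^esub> e) v)" using ev by (intro gen) auto
        finally show "(\<Otimes>\<^bsub>V\<^esub>u\<in>I. \<pi> (r u) [^]\<^bsub>V\<^esub> \<chi> u (\<pi> (\<phi> (inv\<^bsub>E\<^esub> e) v))) = \<pi> (\<phi> (inv\<^bsub>E\<^esub> e) v)" .
      qed
      also have "\<epsilon> e \<dots> = finsum A (\<lambda>u. \<epsilon> e (?k e u v \<odot>\<^bsub>A\<^esub> a u)) I"
        using e aA by (intro \<epsilon>_finsum) auto
      also have "\<dots> = finsum A (\<lambda>u. ?k e u v \<odot>\<^bsub>A\<^esub> \<epsilon> e (a u)) I"
        using e aA by (intro A.finsum_cong') (auto simp: \<epsilon>_smult)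
      finally show "logder f v = finsum A (\<lambda>u. ?k e u v \<odot>\<^bsub>A\<^esub> \<epsilon> e (a u)) I" .
    qed (use aA in \<open>auto intro!: A.finsum_closed\<close>)
    \<comment> \<open>Each \<open>a u\<close> has augmentation 0 and is expanded in elements w - 1.
      Once the sum over E has moved inside, it is an \<open>avg_logder\<close>.\<close>
    also have "\<dots> = finsum A (\<lambda>e. finsum A (\<lambda>u. finsum A (\<lambda>w. a u w \<odot>\<^bsub>A\<^esub> (?k e u v \<odot>\<^bsub>A\<^esub> L (\<phi> e w))) (carrier P)) I) (carrier E)"
    proof (intro A.finsum_cong')
      fix e u assume e: "e \<in> carrier E" and u: "u \<in> I"
      have "?k e u v \<odot>\<^bsub>A\<^esub> \<epsilon> e (a u) = finsum A (\<lambda>w. ?k e u v \<odot>\<^bsub>A\<^esub> (a u w \<odot>\<^bsub>A\<^esub> L (\<phi> e w))) (carrier P)"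
        unfolding inner[OF e u] using finite_P aA[OF u] by (intro M.finsum_smult_ldistr) auto
      also have "\<dots> = finsum A (\<lambda>w. a u w \<odot>\<^bsub>A\<^esub> (?k e u v \<odot>\<^bsub>A\<^esub> L (\<phi> e w))) (carrier P)"
        using aA[OF u] by (intro A.finsum_cong') (auto simp: M.smult_assoc1[symmetric] K.m_comm)
      finally show "?k e u v \<odot>\<^bsub>A\<^esub> \<epsilon> e (a u) = finsum A (\<lambda>w. a u w \<odot>\<^bsub>A\<^esub> (?k e u v \<odot>\<^bsub>A\<^esub> L (\<phi> e w))) (carrier P)" .
    qed (use aA in \<open>auto intro!: A.finsum_closed\<close>)
    also have "\<dots> = finsum A (\<lambda>u. finsum A (\<lambda>e. finsum A (\<lambda>w. a u w \<odot>\<^bsub>A\<^esub> (?k e u v \<odot>\<^bsub>A\<^esub> L (\<phi> e w))) (carrier P)) (carrier E)) I"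
      using aA by (intro A.finsum_swap) (auto intro!: A.finsum_closed)
    also have "\<dots> = finsum A (\<lambda>u. finsum A (\<lambda>w. a u w \<odot>\<^bsub>A\<^esub> avg_logder {()} (\<lambda>_. w) (\<lambda>_. \<chi> u) v) (carrier P)) I"
    proof (rule A.finsum_cong')
      fix u assume u: "u \<in> I"
      have "finsum A (\<lambda>e. finsum A (\<lambda>w. a u w \<odot>\<^bsub>A\<^esub> (?k e u v \<odot>\<^bsub>A\<^esub> L (\<phi> e w))) (carrier P)) (carrier E) =
          finsum A (\<lambda>w. finsum A (\<lambda>e. a u w \<odot>\<^bsub>A\<^esub> (?k e u v \<odot>\<^bsub>A\<^esub> L (\<phi> e w))) (carrier E)) (carrier P)"
        using aA[OF u] by (intro A.finsum_swap) auto
      also have "\<dots> = finsum A (\<lambda>w. a u w \<odot>\<^bsub>A\<^esub> avg_logder {()} (\<lambda>_. w) (\<lambda>_. \<chi> u) v) (carrier P)"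
        unfolding TL using aA[OF u] finite_E
        by (intro A.finsum_cong' M.finsum_smult_ldistr[symmetric]) (auto intro!: A.finsum_closed)
      finally show "finsum A (\<lambda>e. finsum A (\<lambda>w. a u w \<odot>\<^bsub>A\<^esub> (?k e u v \<odot>\<^bsub>A\<^esub> L (\<phi> e w))) (carrier P)) (carrier E) =
          finsum A (\<lambda>w. a u w \<odot>\<^bsub>A\<^esub> avg_logder {()} (\<lambda>_. w) (\<lambda>_. \<chi> u) v) (carrier P)" .
    qed (use aA TLc in \<open>auto intro!: A.finsum_closed\<close>)
    finally show ?thesis .
  qed
  show thesis
  proof (rule that[of I "\<lambda>u w. ni \<otimes>\<^bsub>K\<^esub> a u w" \<chi>])
    show "ni \<otimes>\<^bsub>K\<^esub> a u w \<in> carrier K" if "u \<in> I" "w \<in> carrier P" for u w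
      using aA[OF that(1)] that(2) niK by simp
    show "frattini_character (\<chi> u)" if "u \<in> I" for u using \<chi>[OF that] .
    let ?S = "\<lambda>x. finsum A (\<lambda>u. finsum A (\<lambda>w. (ni \<otimes>\<^bsub>K\<^esub> a u w) \<odot>\<^bsub>A\<^esub> ?T u w x) (carrier P)) I"
    have tc: "(ni \<otimes>\<^bsub>K\<^esub> a u w) \<odot>\<^bsub>A\<^esub> ?T u w x \<in> carrier A" if "u \<in> I" "w \<in> carrier P" "x \<in> carrier A" for u w x
      using aA[OF that(1)] that niK derD(1)[OF TP(1)] by simp
    have sc: "finsum A (\<lambda>w. (ni \<otimes>\<^bsub>K\<^esub> a u w) \<odot>\<^bsub>A\<^esub> ?T u w x) (carrier P) \<in> carrier A" if "u \<in> I" "x \<in> carrier A" for u x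
      using tc that by (intro A.finsum_closed) auto
    show "f x = ?S x" if "x \<in> carrier A" for x
      using that
    proof (induction x rule: A_induct)
      case zero
      have "?S \<zero>\<^bsub>A\<^esub> = finsum A (\<lambda>u. \<zero>\<^bsub>A\<^esub>) I"
      proof (rule A.finsum_cong')
        fix u assume u: "u \<in> I"
        have "finsum A (\<lambda>w. (ni \<otimes>\<^bsub>K\<^esub> a u w) \<odot>\<^bsub>A\<^esub> ?T u w \<zero>\<^bsub>A\<^esub>) (carrier P) = finsum A (\<lambda>w. \<zero>\<^bsub>A\<^esub>) (carrier P)"
          using u aA[OF u] niK der_zero[OF TP(1)] by (intro A.finsum_cong') auto
        then show "finsum A (\<lambda>w. (ni \<otimes>\<^bsub>K\<^esub> a u w) \<odot>\<^bsub>A\<^esub> ?T u w \<zero>\<^bsub>A\<^esub>) (carrier P) = \<zero>\<^bsub>A\<^esub>" by simp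
      qed auto
      then show ?case using der_zero[OF fd] by simp
    next
      case (add x y)
      have "?S (x \<oplus>\<^bsub>A\<^esub> y) = finsum A (\<lambda>u. finsum A (\<lambda>w. (ni \<otimes>\<^bsub>K\<^esub> a u w) \<odot>\<^bsub>A\<^esub> ?T u w x) (carrier P) \<oplus>\<^bsub>A\<^esub>
          finsum A (\<lambda>w. (ni \<otimes>\<^bsub>K\<^esub> a u w) \<odot>\<^bsub>A\<^esub> ?T u w y) (carrier P)) I"
      proof (rule A.finsum_cong')
        fix u assume u: "u \<in> I"
        have "finsum A (\<lambda>w. (ni \<otimes>\<^bsub>K\<^esub> a u w) \<odot>\<^bsub>A\<^esub> ?T u w (x \<oplus>\<^bsub>A\<^esub> y)) (carrier P) =
            finsum A (\<lambda>w. (ni \<otimes>\<^bsub>K\<^esub> a u w) \<odot>\<^bsub>A\<^esub> ?T u w x \<oplus>\<^bsub>A\<^esub> (ni \<otimes>\<^bsub>K\<^esub> a u w) \<odot>\<^bsub>A\<^esub> ?T u w y) (carrier P)"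
        proof (rule A.finsum_cong')
          fix w assume w: "w \<in> carrier P"
          show "(ni \<otimes>\<^bsub>K\<^esub> a u w) \<odot>\<^bsub>A\<^esub> ?T u w (x \<oplus>\<^bsub>A\<^esub> y) =
              (ni \<otimes>\<^bsub>K\<^esub> a u w) \<odot>\<^bsub>A\<^esub> ?T u w x \<oplus>\<^bsub>A\<^esub> (ni \<otimes>\<^bsub>K\<^esub> a u w) \<odot>\<^bsub>A\<^esub> ?T u w y"
            using derD(1,2)[OF TP(1)[OF u w]] aA[OF u] w niK add by (simp add: M.smult_r_distr)
        qed (use tc u add in auto)
        also have "\<dots> = finsum A (\<lambda>w. (ni \<otimes>\<^bsub>K\<^esub> a u w) \<odot>\<^bsub>A\<^esub> ?T u w x) (carrier P) \<oplus>\<^bsub>A\<^esub>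
            finsum A (\<lambda>w. (ni \<otimes>\<^bsub>K\<^esub> a u w) \<odot>\<^bsub>A\<^esub> ?T u w y) (carrier P)"
          using tc u add by (intro A.finsum_addf) auto
        finally show "finsum A (\<lambda>w. (ni \<otimes>\<^bsub>K\<^esub> a u w) \<odot>\<^bsub>A\<^esub> ?T u w (x \<oplus>\<^bsub>A\<^esub> y)) (carrier P) = \<dots>" .
      qed (use sc add in auto)
      also have "\<dots> = ?S x \<oplus>\<^bsub>A\<^esub> ?S y" using sc add by (intro A.finsum_addf) auto
      finally show ?case using add derD(2)[OF fd] by simp
    next
      case (smult d v)
      note v = smult(2) and d = smult(1)
      have "f (d \<odot>\<^bsub>A\<^esub> g v) = (d \<otimes>\<^bsub>K\<^esub> (ni \<otimes>\<^bsub>K\<^esub> n)) \<odot>\<^bsub>A\<^esub> (g v \<otimes>\<^bsub>A\<^esub> logder f v)"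
        using d niK logder(2)[OF fd v] derD(3)[OF fd] by simp
      also have "\<dots> = (d \<otimes>\<^bsub>K\<^esub> ni) \<odot>\<^bsub>A\<^esub> (g v \<otimes>\<^bsub>A\<^esub> (n \<odot>\<^bsub>A\<^esub> logder f v))"
        using d niK(1) nK logder(1)[OF fd v] by (simp add: smult_assoc_right M.smult_assoc1[symmetric] K.m_assoc)
      also have "\<dots> = finsum A (\<lambda>u. (d \<otimes>\<^bsub>K\<^esub> ni) \<odot>\<^bsub>A\<^esub> (g v \<otimes>\<^bsub>A\<^esub> finsum A (\<lambda>w. a u w \<odot>\<^bsub>A\<^esub> avg_logder {()} (\<lambda>_. w) (\<lambda>_. \<chi> u) v) (carrier P))) I"
        unfolding log_sum[OF v] using d niK(1) aA TLc
        by (intro additive_finsum[where F = "\<lambda>x. (d \<otimes>\<^bsub>K\<^esub> ni) \<odot>\<^bsub>A\<^esub> (g v \<otimes>\<^bsub>A\<^esub> x)"])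
          (auto intro!: A.finsum_closed simp: A.r_distr M.smult_r_distr)
      also have "\<dots> = ?S (d \<odot>\<^bsub>A\<^esub> g v)"
      proof (rule A.finsum_cong')
        fix u assume u: "u \<in> I"
        have "(d \<otimes>\<^bsub>K\<^esub> ni) \<odot>\<^bsub>A\<^esub> (g v \<otimes>\<^bsub>A\<^esub> finsum A (\<lambda>w. a u w \<odot>\<^bsub>A\<^esub> avg_logder {()} (\<lambda>_. w) (\<lambda>_. \<chi> u) v) (carrier P)) =
            finsum A (\<lambda>w. (d \<otimes>\<^bsub>K\<^esub> ni) \<odot>\<^bsub>A\<^esub> (g v \<otimes>\<^bsub>A\<^esub> (a u w \<odot>\<^bsub>A\<^esub> avg_logder {()} (\<lambda>_. w) (\<lambda>_. \<chi> u) v))) (carrier P)"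
          using d niK(1) aA[OF u] TLc
          by (intro additive_finsum[where F = "\<lambda>x. (d \<otimes>\<^bsub>K\<^esub> ni) \<odot>\<^bsub>A\<^esub> (g v \<otimes>\<^bsub>A\<^esub> x)"])
            (auto simp: A.r_distr M.smult_r_distr)
        also have "\<dots> = finsum A (\<lambda>w. (ni \<otimes>\<^bsub>K\<^esub> a u w) \<odot>\<^bsub>A\<^esub> ?T u w (d \<odot>\<^bsub>A\<^esub> g v)) (carrier P)"
        proof (rule A.finsum_cong')
          fix w assume w: "w \<in> carrier P"
          have k: "a u w \<in> carrier K" using aA[OF u] w by simp
          show "(d \<otimes>\<^bsub>K\<^esub> ni) \<odot>\<^bsub>A\<^esub> (g v \<otimes>\<^bsub>A\<^esub> (a u w \<odot>\<^bsub>A\<^esub> avg_logder {()} (\<lambda>_. w) (\<lambda>_. \<chi> u) v)) =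
              (ni \<otimes>\<^bsub>K\<^esub> a u w) \<odot>\<^bsub>A\<^esub> ?T u w (d \<odot>\<^bsub>A\<^esub> g v)"
            using d niK(1) k TLc derD(3)[OF TP(1)[OF u w]] TP(2)[OF u w v]
            by (simp add: smult_assoc_right M.smult_assoc1[symmetric] K.m_ac)
        qed (use tc u d v in auto)
        finally show "(d \<otimes>\<^bsub>K\<^esub> ni) \<odot>\<^bsub>A\<^esub> (g v \<otimes>\<^bsub>A\<^esub> finsum A (\<lambda>w. a u w \<odot>\<^bsub>A\<^esub> avg_logder {()} (\<lambda>_. w) (\<lambda>_. \<chi> u) v) (carrier P)) = \<dots>" .
      qed (use sc d v in auto)
      finally show ?case .
    qed
  qed
qed

section \<open>Commutators of stable derivations, and lifts of endomorphisms\<close>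

lemma commute_lincomb:
  assumes f: "\<And>x. x \<in> carrier A \<Longrightarrow> f x = finsum A (\<lambda>u. finsum A (\<lambda>w. c u w \<odot>\<^bsub>A\<^esub> t u w x) W) I"
    and c: "\<And>u w. u \<in> I \<Longrightarrow> w \<in> W \<Longrightarrow> c u w \<in> carrier K"
    and t: "\<And>u w x. u \<in> I \<Longrightarrow> w \<in> W \<Longrightarrow> x \<in> carrier A \<Longrightarrow> t u w x \<in> carrier A"
    and h: "h \<in> derivations K A"
    and comm: "\<And>u w x. u \<in> I \<Longrightarrow> w \<in> W \<Longrightarrow> x \<in> carrier A \<Longrightarrow> cg (t u w (h x)) (h (t u w x))"
    and x: "x \<in> carrier A"
  shows "cg (f (h x)) (h (f x))"
proof -
  have tc: "c u w \<odot>\<^bsub>A\<^esub> t u w y \<in> carrier A" if "u \<in> I" "w \<in> W" "y \<in> carrier A" for u w y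
    using c t that by simp
  have hx: "h x \<in> carrier A" using derD(1)[OF h x] .
  have "h (f x) = finsum A (\<lambda>u. h (finsum A (\<lambda>w. c u w \<odot>\<^bsub>A\<^esub> t u w x) W)) I"
    unfolding f[OF x] using tc x by (intro der_finsum[OF h] Pi_I A.finsum_closed) auto
  also have "\<dots> = finsum A (\<lambda>u. finsum A (\<lambda>w. c u w \<odot>\<^bsub>A\<^esub> h (t u w x)) W) I"
  proof (rule A.finsum_cong')
    fix u assume u: "u \<in> I"
    have "h (finsum A (\<lambda>w. c u w \<odot>\<^bsub>A\<^esub> t u w x) W) = finsum A (\<lambda>w. h (c u w \<odot>\<^bsub>A\<^esub> t u w x)) W"
      using tc u x by (intro der_finsum[OF h] Pi_I) auto
    also have "\<dots> = finsum A (\<lambda>w. c u w \<odot>\<^bsub>A\<^esub> h (t u w x)) W"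
      using c t u x derD(1,3)[OF h] by (intro A.finsum_cong') auto
    finally show "h (finsum A (\<lambda>w. c u w \<odot>\<^bsub>A\<^esub> t u w x) W) = finsum A (\<lambda>w. c u w \<odot>\<^bsub>A\<^esub> h (t u w x)) W" .
  next
    show "(\<lambda>u. finsum A (\<lambda>w. c u w \<odot>\<^bsub>A\<^esub> h (t u w x)) W) \<in> I \<rightarrow> carrier A"
      using c t x derD(1)[OF h] by (intro Pi_I A.finsum_closed) auto
  qed simp
  finally have e: "h (f x) = finsum A (\<lambda>u. finsum A (\<lambda>w. c u w \<odot>\<^bsub>A\<^esub> h (t u w x)) W) I" .
  show ?thesis unfolding e f[OF hx] by (intro cg_finsum cg_smult c comm x)
qed

lemma cg_from_g:
  assumes f: "f \<in> derivations K A" and h: "h \<in> derivations K A"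
    and eq: "\<And>u. u \<in> carrier P \<Longrightarrow> cg (f (h (g u))) (h (f (g u)))"
    and x: "x \<in> carrier A"
  shows "cg (f (h x)) (h (f x))"
  using x
proof (induction x rule: A_induct)
  case (add x y)
  then show ?case using cg_add[OF add(3,4)] by (simp add: derD(1,2)[OF f] derD(1,2)[OF h])
next
  case (smult c u)
  then show ?case using cg_smult[OF smult(1) eq[OF smult(2)]] by (simp add: derD(1,3)[OF f] derD(1,3)[OF h])
qed (simp add: der_zero[OF f] der_zero[OF h])

text \<open>Commuting modulo \<open>J 2\<close> is linear in each argument, so by
  \<open>stable_decomposition\<close> it is enough to treat two averages. These induce endomorphisms
  of the \<F>_p E-module \<open>V\<close>, which commute by hypothesis.\<close>

theorem stable_commute:
  assumes comm: "\<And>\<sigma> \<tau> S. \<lbrakk>V.endo \<sigma>; V.endo \<tau>; S \<in> carrier V\<rbrakk> \<Longrightarrow> \<sigma> (\<tau> S) = \<tau> (\<sigma> S)"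
    and f: "f \<in> stable_derivations K P E \<phi>" "\<And>x. x \<in> carrier A \<Longrightarrow> f x \<in> J 1"
    and h: "h \<in> stable_derivations K P E \<phi>" "\<And>x. x \<in> carrier A \<Longrightarrow> h x \<in> J 1"
    and x: "x \<in> carrier A"
  shows "f (h x) \<ominus>\<^bsub>A\<^esub> h (f x) \<in> J 2"
proof -
  have base: "cg (avg_der {()} (\<lambda>_. w) (\<lambda>_. \<chi>) (avg_der {()} (\<lambda>_. w') (\<lambda>_. \<chi>') x)) (avg_der {()} (\<lambda>_. w') (\<lambda>_. \<chi>') (avg_der {()} (\<lambda>_. w) (\<lambda>_. \<chi>) x))"
    if t: "w \<in> carrier P" "w' \<in> carrier P" "frattini_character \<chi>" "frattini_character \<chi>'" "x \<in> carrier A" for w w' \<chi> \<chi>' x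
  proof -
    let ?t = "avg_der {()} (\<lambda>_. w) (\<lambda>_. \<chi>)" and ?t' = "avg_der {()} (\<lambda>_. w') (\<lambda>_. \<chi>')"
    let ?s = "avg_endo {()} (\<lambda>_. w) (\<lambda>_. \<chi>)" and ?s' = "avg_endo {()} (\<lambda>_. w') (\<lambda>_. \<chi>')"
    have d: "?t \<in> derivations K A" "?t' \<in> derivations K A" using t by (auto intro: avg_der_derivation)
    have j: "y \<in> carrier A \<Longrightarrow> ?t y \<in> J 1" "y \<in> carrier A \<Longrightarrow> ?t' y \<in> J 1" for y
      using t avg_der_J[of "{()}" "\<lambda>_. w" "\<lambda>_. \<chi>" y] avg_der_J[of "{()}" "\<lambda>_. w'" "\<lambda>_. \<chi>'" y] by auto
    have i: "induces ?t \<one>\<^bsub>K\<^esub> ?s" "induces ?t' \<one>\<^bsub>K\<^esub> ?s'" using t by (auto intro: avg_der_induces)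
    have e: "V.endo ?s" "V.endo ?s'" using t by (auto intro: avg_endo)
    note c = V.endoD(2)[OF e(1)] V.endoD(2)[OF e(2)]
    \<comment> \<open>With multiplier 0 any map can stand on the right; the identity is taken. The
      scalar becomes 0, so the bracket vanishes modulo \<open>J 2\<close> on group elements.\<close>
    have "induces (lie_br ?t ?t') (\<kappa> 0 \<otimes>\<^bsub>K\<^esub> (\<one>\<^bsub>K\<^esub> \<otimes>\<^bsub>K\<^esub> \<one>\<^bsub>K\<^esub>)) (\<lambda>S. S)"
    proof (rule bracket_induces[OF d(1) _ i(1) _ d(2) _ i(2)])
      show "?s (?s' S) \<otimes>\<^bsub>V\<^esub> inv\<^bsub>V\<^esub> (?s' (?s S)) = S [^]\<^bsub>V\<^esub> (0::int)" if S: "S \<in> carrier V" for S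
        using comm[OF e S] c(2)[OF c(1)[OF S]] by simp
    qed (use j c in auto)
    then have br: "cg (lie_br ?t ?t' (g v)) \<zero>\<^bsub>A\<^esub>" if "v \<in> carrier P" for v
      using that unfolding induces_def by force
    show ?thesis
    proof (rule cg_from_g[OF d _ t(5)])
      fix u assume u: "u \<in> carrier P"
      show "cg (?t (?t' (g u))) (?t' (?t (g u)))"
        using br[OF u] derD(1)[OF d(1)] derD(1)[OF d(2)] unfolding cg_zero cg_def[of "?t _"] lie_br_def by simp
    qed
  qed
  have fd: "f \<in> derivations K A" and hd: "h \<in> derivations K A" using f h unfolding stable_iff by auto
  \<comment> \<open>One side at a time: first \<open>h\<close> is decomposed against an average,
    afterwards \<open>f\<close> against \<open>h\<close>.\<close>
  have right: "cg (h (t x)) (t (h x))"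
    if w: "w \<in> carrier P" and \<chi>: "frattini_character \<chi>" and t: "t = avg_der {()} (\<lambda>_. w) (\<lambda>_. \<chi>)" and x: "x \<in> carrier A"
    for w \<chi> t x
  proof -
    have td: "t \<in> derivations K A" using w \<chi> t by (auto intro: avg_der_derivation)
    show ?thesis
    proof (rule stable_decomposition[OF h(1)])
      show "h x \<in> J 1" if "x \<in> carrier A" for x using h(2)[OF that] .
      fix I :: "'g set set" and c and \<chi>' :: "'g set \<Rightarrow> 'g set \<Rightarrow> int"
      assume c: "\<And>u w. u \<in> I \<Longrightarrow> w \<in> carrier P \<Longrightarrow> c u w \<in> carrier K"
        and \<chi>': "\<And>u. u \<in> I \<Longrightarrow> frattini_character (\<chi>' u)"
        and e: "\<And>x. x \<in> carrier A \<Longrightarrow> h x = finsum A (\<lambda>u. finsum A (\<lambda>w. c u w \<odot>\<^bsub>A\<^esub> avg_der {()} (\<lambda>_. w) (\<lambda>_. \<chi>' u) x) (carrier P)) I"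
      show ?thesis
      proof (rule commute_lincomb[OF e c _ td _ x])
        fix u w' y assume u: "u \<in> I" "w' \<in> carrier P" "y \<in> carrier A"
        have "avg_der {()} (\<lambda>_. w') (\<lambda>_. \<chi>' u) \<in> derivations K A" using u \<chi>' by (auto intro: avg_der_derivation)
        then show "avg_der {()} (\<lambda>_. w') (\<lambda>_. \<chi>' u) y \<in> carrier A" using derD(1) u(3) by blast
        show "cg (avg_der {()} (\<lambda>_. w') (\<lambda>_. \<chi>' u) (t y)) (t (avg_der {()} (\<lambda>_. w') (\<lambda>_. \<chi>' u) y))"
          unfolding t by (rule base[OF u(2) w \<chi>'[OF u(1)] \<chi> u(3)])
      qed
    qed
  qed
  have "cg (f (h x)) (h (f x))"
  proof (rule stable_decomposition[OF f(1)])
    show "f x \<in> J 1" if "x \<in> carrier A" for x using f(2)[OF that] .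
    fix I :: "'g set set" and c and \<chi> :: "'g set \<Rightarrow> 'g set \<Rightarrow> int"
    assume c: "\<And>u w. u \<in> I \<Longrightarrow> w \<in> carrier P \<Longrightarrow> c u w \<in> carrier K"
      and \<chi>: "\<And>u. u \<in> I \<Longrightarrow> frattini_character (\<chi> u)"
      and e: "\<And>x. x \<in> carrier A \<Longrightarrow> f x = finsum A (\<lambda>u. finsum A (\<lambda>w. c u w \<odot>\<^bsub>A\<^esub> avg_der {()} (\<lambda>_. w) (\<lambda>_. \<chi> u) x) (carrier P)) I"
    show ?thesis
    proof (rule commute_lincomb[OF e c _ hd _ x])
      fix u w y assume u: "u \<in> I" "w \<in> carrier P" "y \<in> carrier A"
      have "avg_der {()} (\<lambda>_. w) (\<lambda>_. \<chi> u) \<in> derivations K A" using u \<chi> by (auto intro: avg_der_derivation)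
      then show "avg_der {()} (\<lambda>_. w) (\<lambda>_. \<chi> u) y \<in> carrier A" using derD(1) u(3) by blast
      show "cg (avg_der {()} (\<lambda>_. w) (\<lambda>_. \<chi> u) (h y)) (h (avg_der {()} (\<lambda>_. w) (\<lambda>_. \<chi> u) y))"
        by (rule cg_sym[OF right[OF u(2) \<chi>[OF u(1)] refl u(3)]])
    qed
  qed
  then show ?thesis unfolding cg_def by simp
qed

text \<open>Lifting the images under \<tau> of the coordinate generators makes \<Sum> \<chi>_u(S)
  \<tau>(u) equal to \<tau>(S). This map already commutes with E, so averaging only multiplies it by
  |E|, which is invertible in k and is kept as the scalar.\<close>

theorem endo_lift:
  assumes \<tau>: "V.endo \<tau>"
  obtains f where "f \<in> stable_derivations K P E \<phi>" "\<And>x. x \<in> carrier A \<Longrightarrow> f x \<in> J 1"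
    "induces f (\<kappa> (int (order E))) \<tau>"
proof -
  obtain I \<chi> where I: "I \<subseteq> carrier V" and \<chi>: "\<And>u. u \<in> I \<Longrightarrow> frattini_character (\<chi> u)"
    and gen: "\<And>S. S \<in> carrier V \<Longrightarrow> (\<Otimes>\<^bsub>V\<^esub>u\<in>I. u [^]\<^bsub>V\<^esub> (\<chi> u S :: int)) = S"
    using V_coordinates by blast
  note \<tau>D = V.endoD[OF \<tau>]
  interpret h: group_hom V V \<tau> using \<tau>D(1) by unfold_locales
  have IV: "u \<in> carrier V" if "u \<in> I" for u using I that by auto
  have "\<exists>r. r \<in> carrier P \<and> \<pi> r = \<tau> u" if "u \<in> I" for u
    using \<pi>_surj[OF \<tau>D(2)[OF IV[OF that]]] by metis
  then obtain w where w: "\<And>u. u \<in> I \<Longrightarrow> w u \<in> carrier P" "\<And>u. u \<in> I \<Longrightarrow> \<pi> (w u) = \<tau> u" by metis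
  \<comment> \<open>Every conjugate in the average is \<tau> itself, so the product over E is a
    power with exponent |E|.\<close>
  have endo: "avg_endo I w \<chi> S = \<tau> S [^]\<^bsub>V\<^esub> int (order E)" if S: "S \<in> carrier V" for S
  proof -
    have "avg_endo I w \<chi> S = (\<Otimes>\<^bsub>V\<^esub>e\<in>carrier E. \<tau> S)"
      unfolding avg_endo_def
    proof (rule V.finprod_cong')
      fix e assume e: "e \<in> carrier E"
      have eS: "\<phi> (inv\<^bsub>E\<^esub> e) ` S \<in> carrier V" using V.act_closed[OF E.inv_closed[OF e] S] .
      let ?S = "\<phi> (inv\<^bsub>E\<^esub> e) ` S"
      have "(\<Otimes>\<^bsub>V\<^esub>i\<in>I. \<pi> (w i) [^]\<^bsub>V\<^esub> \<chi> i ?S) = (\<Otimes>\<^bsub>V\<^esub>i\<in>I. \<tau> (i [^]\<^bsub>V\<^esub> \<chi> i ?S))"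
        using w IV \<tau>D(2) by (intro V.finprod_cong') (auto simp: h.hom_int_pow)
      also have "\<dots> = \<tau> (\<Otimes>\<^bsub>V\<^esub>i\<in>I. i [^]\<^bsub>V\<^esub> \<chi> i ?S)"
        using IV by (intro hom_finprod[OF V_comm_group V_comm_group \<tau>D(1), symmetric]) auto
      also have "\<dots> = \<tau> ?S" unfolding gen[OF eS] ..
      finally have *: "(\<Otimes>\<^bsub>V\<^esub>i\<in>I. \<pi> (w i) [^]\<^bsub>V\<^esub> \<chi> i ?S) = \<tau> ?S" .
      have "\<phi> e ` \<tau> ?S = \<tau> (\<phi> e ` ?S)" using \<tau>D(4)[OF e eS] by simp
      also have "\<phi> e ` ?S = S"
        using V.act_mult[OF e E.inv_closed[OF e] S] V.act_one[OF S] e by simp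
      finally show "\<phi> e ` (\<Otimes>\<^bsub>V\<^esub>i\<in>I. \<pi> (w i) [^]\<^bsub>V\<^esub> \<chi> i ?S) = \<tau> S" unfolding * .
    qed (use \<tau>D(2)[OF S] in auto)
    also have "\<dots> = \<tau> S [^]\<^bsub>V\<^esub> card (carrier E)" using \<tau>D(2)[OF S] by (rule V.finprod_const)
    finally show ?thesis by (simp add: Coset.order_def int_pow_int)
  qed
  show thesis
  proof (rule that[of "avg_der I w \<chi>"])
    show "avg_der I w \<chi> \<in> stable_derivations K P E \<phi>" using w(1) \<chi> by (rule avg_der_stable)
    show "avg_der I w \<chi> x \<in> J 1" if "x \<in> carrier A" for x using w(1) \<chi> that by (rule avg_der_J)
    have ind: "induces (avg_der I w \<chi>) \<one>\<^bsub>K\<^esub> (avg_endo I w \<chi>)" using w(1) \<chi> by (rule avg_der_induces)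
    show "induces (avg_der I w \<chi>) (\<kappa> (int (order E))) \<tau>"
      unfolding induces_def
    proof (intro ballI impI)
      fix v z assume v: "v \<in> carrier P" and z: "z \<in> carrier P" "\<pi> z = \<tau> (\<pi> v)"
      let ?n = "int (order E)"
      have "\<pi> (z [^]\<^bsub>P\<^esub> ?n) = avg_endo I w \<chi> (\<pi> v)"
        using endo[OF \<pi>_closed[OF v]] \<pi>_int_pow[OF z(1)] z(2) by simp
      then have "cg (avg_der I w \<chi> (g v)) (\<one>\<^bsub>K\<^esub> \<odot>\<^bsub>A\<^esub> L (z [^]\<^bsub>P\<^esub> ?n))"
        using ind v z(1) unfolding induces_def by blast
      also have "\<one>\<^bsub>K\<^esub> \<odot>\<^bsub>A\<^esub> L (z [^]\<^bsub>P\<^esub> ?n) = L (z [^]\<^bsub>P\<^esub> ?n)" by simp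
      also have "cg (L (z [^]\<^bsub>P\<^esub> ?n)) (\<kappa> ?n \<odot>\<^bsub>A\<^esub> L z)" by (rule L_int_pow[OF z(1)])
      finally show "cg (avg_der I w \<chi> (g v)) (\<kappa> ?n \<odot>\<^bsub>A\<^esub> L z)" .
    qed
  qed
qed

end

section \<open>Translation to modules over the group algebra\<close>

text \<open>\<open>V\<close> and the additive monoid of the module have different record types,
  though their carrier and operations agree; subgroups and finite products depend on these
  alone.\<close>

lemma subgroup_same_structure:
  assumes "carrier G = carrier H" "monoid.mult G = monoid.mult H" "one G = one H"
  shows "subgroup N G \<longleftrightarrow> subgroup N H"
  using assms unfolding subgroup_def m_inv_def by simp

lemma finprod_same_structure:
  assumes "carrier G = carrier H" "monoid.mult G = monoid.mult H" "one G = one H"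
  shows "finprod G f A = finprod H f A"
  using assms unfolding finprod_def by simp

context p_group_action
begin

abbreviation M where "M \<equiv> frattini_quotient_module p P E \<phi>"
abbreviation R where "R \<equiv> group_algebra (residue_ring (int p)) E"

lemma Mod_simps:
  "carrier M = carrier V" "\<zero>\<^bsub>M\<^esub> = \<one>\<^bsub>V\<^esub>" "S \<oplus>\<^bsub>M\<^esub> S' = S \<otimes>\<^bsub>V\<^esub> S'"
  "a \<odot>\<^bsub>M\<^esub> S = (\<Otimes>\<^bsub>V\<^esub>e\<in>carrier E. (\<phi> e ` S) [^]\<^bsub>V\<^esub> a e)"
  unfolding frattini_quotient_module_def Let_def by simp_all

lemma Mod_add_monoid:
  "subgroup N (add_monoid M) \<longleftrightarrow> subgroup N V"
  "subgroup N' (add_monoid (M\<lparr>carrier := N\<rparr>)) \<longleftrightarrow> subgroup N' (V\<lparr>carrier := N\<rparr>)"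
  "finsum M f I = finprod V f I"
  unfolding finsum_def
  by (rule subgroup_same_structure finprod_same_structure; simp add: frattini_quotient_module_def Let_def)+

text \<open>A group element as an element of \<F>_p E, the link from linearity over the group
  algebra back to equivariance.\<close>

lemma R_indicator:
  assumes e: "e \<in> carrier E"
  obtains a where "a \<in> carrier R" "\<And>S. S \<in> carrier V \<Longrightarrow> a \<odot>\<^bsub>M\<^esub> S = \<phi> e ` S"
proof (rule that[of "\<lambda>f\<in>carrier E. if e = f then 1 else 0"])
  \<comment> \<open>The coefficient 1 has to lie in {0..p-1}.\<close>
  have "p \<ge> 2" using prime_ge_2_nat[OF prime_p] .
  then show "(\<lambda>f\<in>carrier E. if e = f then 1 else 0) \<in> carrier R"
    unfolding group_algebra_def residue_ring_def by auto
  fix S assume S: "S \<in> carrier V"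
  have "(\<lambda>f\<in>carrier E. if e = f then 1 else 0) \<odot>\<^bsub>M\<^esub> S = (\<Otimes>\<^bsub>V\<^esub>f\<in>carrier E. if e = f then \<phi> f ` S else \<one>\<^bsub>V\<^esub>)"
    unfolding Mod_simps using V.act_closed[OF _ S] by (intro V.finprod_cong') auto
  also have "\<dots> = \<phi> e ` S" using e finite_E V.act_closed[OF _ S] by (intro V.finprod_singleton) auto
  finally show "(\<lambda>f\<in>carrier E. if e = f then 1 else 0) \<odot>\<^bsub>M\<^esub> S = \<phi> e ` S" .
qed

text \<open>Group elements belong to the group algebra, which gives one direction; conversely its
  scalars act by products of powers of translates, which stay in a stable subgroup.\<close>

lemma submodule_iff_stable: "submodule N R M \<longleftrightarrow> V.stable N"
proof
  assume N: "submodule N R M"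
  then interpret submodule N R M .
  have sub: "subgroup N V" using subgroup_axioms unfolding Mod_add_monoid .
  have "\<phi> e ` S \<in> N" if e: "e \<in> carrier E" and S: "S \<in> N" for e S
  proof -
    obtain a where a: "a \<in> carrier R" "\<And>S. S \<in> carrier V \<Longrightarrow> a \<odot>\<^bsub>M\<^esub> S = \<phi> e ` S" using R_indicator[OF e] by blast
    show ?thesis using smult_closed[OF a(1) S] a(2)[of S] subgroup.mem_carrier[OF sub S] by simp
  qed
  then show "V.stable N" unfolding V.stable_def using sub by simp
next
  assume N: "V.stable N"
  note ND = V.stableD[OF N]
  show "submodule N R M"
  proof (intro submodule.intro submodule_axioms.intro)
    show "subgroup N (add_monoid M)" unfolding Mod_add_monoid by (rule ND(1))
    show "a \<odot>\<^bsub>M\<^esub> S \<in> N" if "a \<in> carrier R" "S \<in> N" for a S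
      unfolding Mod_simps
      by (intro V.finprod_comm_closed_subgroup[OF ND(1)] Pi_I V.subgroup_int_pow_closed[OF ND(1)] ND(6) that(2))
  qed
qed

lemma simple_iff:
  assumes N: "V.stable N"
  shows "simple_module R (M\<lparr>carrier := N\<rparr>) \<longleftrightarrow> V.simple N"
proof -
  have sN: "subgroup N V" using V.stableD(1)[OF N] .
  have smult: "a \<odot>\<^bsub>M\<lparr>carrier := N\<rparr>\<^esub> S = a \<odot>\<^bsub>M\<^esub> S" for a S by simp
  have "submodule N' R (M\<lparr>carrier := N\<rparr>) \<longleftrightarrow> V.stable N' \<and> N' \<subseteq> N" for N'
  proof
    assume N': "submodule N' R (M\<lparr>carrier := N\<rparr>)"
    then interpret submodule N' R "M\<lparr>carrier := N\<rparr>" .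
    have "subgroup N' (V\<lparr>carrier := N\<rparr>)" using subgroup_axioms unfolding Mod_add_monoid .
    then have sub': "subgroup N' V" "N' \<subseteq> N" using V.incl_subgroup[OF sN] subgroup.subset by force+
    moreover have "a \<odot>\<^bsub>M\<^esub> S \<in> N'" if "a \<in> carrier R" "S \<in> N'" for a S
      using smult_closed[OF that] by simp
    moreover have "subgroup N' (add_monoid M)" unfolding Mod_add_monoid by (rule sub')
    ultimately have "submodule N' R M"
      by (intro submodule.intro submodule_axioms.intro) simp_all
    then show "V.stable N' \<and> N' \<subseteq> N" using submodule_iff_stable \<open>N' \<subseteq> N\<close> by simp
  next
    assume N': "V.stable N' \<and> N' \<subseteq> N"
    then have sub: "submodule N' R M" using submodule_iff_stable by simp
    then interpret submodule N' R M .
    have "subgroup N' (V\<lparr>carrier := N\<rparr>)"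
      using V.subgroup_incl[OF V.stableD(1) sN] N' by blast
    then have "subgroup N' (add_monoid (M\<lparr>carrier := N\<rparr>))" unfolding Mod_add_monoid .
    then show "submodule N' R (M\<lparr>carrier := N\<rparr>)"
      by (intro submodule.intro submodule_axioms.intro) simp_all
  qed
  then show ?thesis
    unfolding simple_module_def V.simple_def using N by (auto simp: Mod_simps(2))
qed

lemma direct_sum_iff: "internal_direct_sum M \<S> \<longleftrightarrow> V.direct_sum \<S>"
  unfolding internal_direct_sum_def V.direct_sum_def Mod_add_monoid Mod_simps ..

text \<open>The nontrivial direction recovers linearity over \<F>_p E from equivariance by moving
  \<open>h\<close> through a finite product over E.\<close>

lemma isomorphic_iff:
  assumes N: "V.stable N" and N': "V.stable N'"
  shows "module_isomorphic R (M\<lparr>carrier := N\<rparr>) (M\<lparr>carrier := N'\<rparr>) \<longleftrightarrow>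
    (\<exists>h. V.stable_hom h N N' \<and> bij_betw h N N')"
proof
  assume "module_isomorphic R (M\<lparr>carrier := N\<rparr>) (M\<lparr>carrier := N'\<rparr>)"
  then obtain h where bij: "bij_betw h N N'"
    and add: "\<And>S S'. S \<in> N \<Longrightarrow> S' \<in> N \<Longrightarrow> h (S \<otimes>\<^bsub>V\<^esub> S') = h S \<otimes>\<^bsub>V\<^esub> h S'"
    and smult: "\<And>a S. a \<in> carrier R \<Longrightarrow> S \<in> N \<Longrightarrow> h (a \<odot>\<^bsub>M\<^esub> S) = a \<odot>\<^bsub>M\<^esub> h S"
    unfolding module_isomorphic_def by (auto simp: Mod_simps(3))
  have hN: "h S \<in> N'" if "S \<in> N" for S using bij that by (auto simp: bij_betw_def)
  have "h (\<phi> e ` S) = \<phi> e ` h S" if e: "e \<in> carrier E" and S: "S \<in> N" for e S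
  proof -
    obtain a where a: "a \<in> carrier R" "\<And>S. S \<in> carrier V \<Longrightarrow> a \<odot>\<^bsub>M\<^esub> S = \<phi> e ` S" using R_indicator[OF e] by blast
    show ?thesis
      using smult[OF a(1) S] a(2)[OF subsetD[OF V.stableD(2)[OF N] S]] a(2)[OF subsetD[OF V.stableD(2)[OF N'] hN[OF S]]] by simp
  qed
  then have "V.stable_hom h N N'" unfolding V.stable_hom_def using hN add by simp
  then show "\<exists>h. V.stable_hom h N N' \<and> bij_betw h N N'" using bij by blast
next
  assume "\<exists>h. V.stable_hom h N N' \<and> bij_betw h N N'"
  then obtain h where h: "V.stable_hom h N N'" and bij: "bij_betw h N N'" by blast
  note hD = V.stable_homD[OF h] and ND = V.stableD[OF N] and N'D = V.stableD[OF N']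
  have NV: "S \<in> carrier V" if "S \<in> N" for S using subsetD[OF ND(2) that] .
  \<comment> \<open>\<open>hom_finprod\<close> requires a homomorphism on all of \<open>V\<close>,
    while \<open>h\<close> is one only on \<open>N\<close>; the Maschke projection extends
    it.\<close>
  obtain \<tau> where \<tau>: "V.endo \<tau>" "\<And>S. S \<in> carrier V \<Longrightarrow> \<tau> S \<in> N" "\<And>S. S \<in> N \<Longrightarrow> \<tau> S = S"
    using V.maschke[OF N] by blast
  note \<tau>D = V.endoD[OF \<tau>(1)]
  have hh: "(\<lambda>S. h (\<tau> S)) \<in> hom V V"
  proof (rule homI)
    fix S S' assume S: "S \<in> carrier V" "S' \<in> carrier V"
    show "h (\<tau> (S \<otimes>\<^bsub>V\<^esub> S')) = h (\<tau> S) \<otimes>\<^bsub>V\<^esub> h (\<tau> S')"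
      unfolding \<tau>D(3)[OF S] by (rule hD(2)[OF \<tau>(2)[OF S(1)] \<tau>(2)[OF S(2)]])
  qed (use subsetD[OF N'D(2) hD(1)[OF \<tau>(2)]] in blast)
  have "h (a \<odot>\<^bsub>M\<^esub> S) = a \<odot>\<^bsub>M\<^esub> h S" if a: "a \<in> carrier R" and S: "S \<in> N" for a S
  proof -
    have e: "(\<phi> e ` S) [^]\<^bsub>V\<^esub> a e \<in> N" if "e \<in> carrier E" for e
      by (rule V.subgroup_int_pow_closed[OF ND(1) ND(6)[OF that S]])
    have "h (a \<odot>\<^bsub>M\<^esub> S) = h (\<tau> (\<Otimes>\<^bsub>V\<^esub>e\<in>carrier E. (\<phi> e ` S) [^]\<^bsub>V\<^esub> a e))"
      unfolding Mod_simps using \<tau>(3) V.finprod_comm_closed_subgroup[OF ND(1), of "\<lambda>e. (\<phi> e ` S) [^]\<^bsub>V\<^esub> a e"] e by simp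
    also have "\<dots> = (\<Otimes>\<^bsub>V\<^esub>e\<in>carrier E. h (\<tau> ((\<phi> e ` S) [^]\<^bsub>V\<^esub> a e)))"
      using NV e by (intro hom_finprod[OF V_comm_group V_comm_group hh]) blast
    also have "\<dots> = (\<Otimes>\<^bsub>V\<^esub>e\<in>carrier E. (\<phi> e ` h S) [^]\<^bsub>V\<^esub> a e)"
    proof (rule V.finprod_cong')
      fix e assume e: "e \<in> carrier E"
      have "h (\<tau> ((\<phi> e ` S) [^]\<^bsub>V\<^esub> a e)) = h (\<tau> (\<phi> e ` S)) [^]\<^bsub>V\<^esub> a e"
        using hom_int_pow[OF hh NV[OF ND(6)[OF e S]] V.group_axioms V.group_axioms] .
      also have "h (\<tau> (\<phi> e ` S)) = \<phi> e ` h S" using \<tau>(3)[OF ND(6)[OF e S]] hD(3)[OF e S] by simp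
      finally show "h (\<tau> ((\<phi> e ` S) [^]\<^bsub>V\<^esub> a e)) = (\<phi> e ` h S) [^]\<^bsub>V\<^esub> a e" .
    qed (use V.act_closed[OF _ subsetD[OF N'D(2) hD(1)[OF S]]] in auto)
    finally show ?thesis unfolding Mod_simps .
  qed
  then show "module_isomorphic R (M\<lparr>carrier := N\<rparr>) (M\<lparr>carrier := N'\<rparr>)"
    unfolding module_isomorphic_def using bij hD(2) by (intro exI[of _ h]) (simp add: Mod_simps(3))
qed

lemma multiplicity_free_iff:
  "multiplicity_free R M \<longleftrightarrow> (\<exists>\<S>. V.direct_sum \<S> \<and> (\<forall>N\<in>\<S>. V.simple N) \<and>
     (\<forall>N\<in>\<S>. \<forall>N'\<in>\<S>. N \<noteq> N' \<longrightarrow> \<not> (\<exists>h. V.stable_hom h N N' \<and> bij_betw h N N')))"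
proof -
  have st: "V.simple N \<Longrightarrow> V.stable N" for N unfolding V.simple_def by simp
  have "((\<forall>N\<in>\<S>. submodule N R M \<and> simple_module R (M\<lparr>carrier := N\<rparr>)) \<and> V.direct_sum \<S> \<and>
      (\<forall>N\<in>\<S>. \<forall>N'\<in>\<S>. N \<noteq> N' \<longrightarrow> \<not> module_isomorphic R (M\<lparr>carrier := N\<rparr>) (M\<lparr>carrier := N'\<rparr>))) \<longleftrightarrow>
    (V.direct_sum \<S> \<and> (\<forall>N\<in>\<S>. V.simple N) \<and>
      (\<forall>N\<in>\<S>. \<forall>N'\<in>\<S>. N \<noteq> N' \<longrightarrow> \<not> (\<exists>h. V.stable_hom h N N' \<and> bij_betw h N N')))" for \<S>
  proof -
    have simple: "(\<forall>N\<in>\<S>. submodule N R M \<and> simple_module R (M\<lparr>carrier := N\<rparr>)) \<longleftrightarrow> (\<forall>N\<in>\<S>. V.simple N)"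
      by (rule ball_cong[OF refl]) (metis submodule_iff_stable simple_iff st)
    have iso: "(\<forall>N\<in>\<S>. \<forall>N'\<in>\<S>. N \<noteq> N' \<longrightarrow> \<not> module_isomorphic R (M\<lparr>carrier := N\<rparr>) (M\<lparr>carrier := N'\<rparr>)) \<longleftrightarrow>
      (\<forall>N\<in>\<S>. \<forall>N'\<in>\<S>. N \<noteq> N' \<longrightarrow> \<not> (\<exists>h. V.stable_hom h N N' \<and> bij_betw h N N'))"
      if s: "\<forall>N\<in>\<S>. V.simple N"
    proof (intro ball_cong refl imp_cong)
      fix N N' assume "N \<in> \<S>" "N' \<in> \<S>"
      then show "(\<not> module_isomorphic R (M\<lparr>carrier := N\<rparr>) (M\<lparr>carrier := N'\<rparr>)) =
          (\<not> (\<exists>h. V.stable_hom h N N' \<and> bij_betw h N N'))"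
        using isomorphic_iff[OF st st, of N N'] s by simp
    qed
    show ?thesis
    proof (cases "\<forall>N\<in>\<S>. V.simple N")
      case True
      show ?thesis unfolding simple iso[OF True] by (intro iffI; elim conjE; intro conjI; assumption)
    next
      case False
      then show ?thesis unfolding simple by (simp only: simp_thms)
    qed
  qed
  then show ?thesis unfolding multiplicity_free_def direct_sum_iff by simp
qed

theorem endo_commute:
  assumes "multiplicity_free R M" "V.endo \<sigma>" "V.endo \<tau>" "S \<in> carrier V"
  shows "\<sigma> (\<tau> S) = \<tau> (\<sigma> S)"
proof -
  obtain \<S> where S: "V.direct_sum \<S>" "\<forall>N\<in>\<S>. V.simple N"
    and iso: "\<forall>N\<in>\<S>. \<forall>N'\<in>\<S>. N \<noteq> N' \<longrightarrow> \<not> (\<exists>h. V.stable_hom h N N' \<and> bij_betw h N N')"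
    using assms(1) unfolding multiplicity_free_iff by (elim exE conjE)
  show ?thesis
  proof (rule V.endo_commute_if_multiplicity_free[OF S(1) _ _ assms(2-4)])
    show "V.simple N" if "N \<in> \<S>" for N using S(2) that by (rule bspec)
    show "\<not> bij_betw h N N'" if "N \<in> \<S>" "N' \<in> \<S>" "N \<noteq> N'" "V.stable_hom h N N'" for N N' h
    proof
      assume "bij_betw h N N'"
      then have "\<exists>h. V.stable_hom h N N' \<and> bij_betw h N N'" using that(4) by (intro exI conjI)
      then show False using bspec[OF bspec[OF iso that(1)] that(2)] that(3) by simp
    qed
  qed
qed

text \<open>One decomposition into simple submodules exists by \<open>semisimple\<close>. If all its
  summands were pairwise non-isomorphic, it would itself prove the module multiplicity free.\<close>

theorem matrix_units:
  assumes "\<not> multiplicity_free R M"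
  obtains \<alpha> \<beta> S where "V.endo \<alpha>" "V.endo \<beta>"
    "\<And>S. S \<in> carrier V \<Longrightarrow> \<alpha> (\<alpha> S) = \<one>\<^bsub>V\<^esub>" "\<And>S. S \<in> carrier V \<Longrightarrow> \<beta> (\<beta> S) = \<one>\<^bsub>V\<^esub>"
    "\<And>S. S \<in> carrier V \<Longrightarrow> \<alpha> (\<beta> (\<alpha> S)) = \<alpha> S" "\<And>S. S \<in> carrier V \<Longrightarrow> \<beta> (\<alpha> (\<beta> S)) = \<beta> S"
    "S \<in> carrier V" "\<alpha> S \<noteq> \<one>\<^bsub>V\<^esub>"
proof -
  obtain \<S> where ds: "V.direct_sum \<S>" and simp: "\<And>N. N \<in> \<S> \<Longrightarrow> V.simple N" using V.semisimple by blast
  obtain N N' h where N: "N \<in> \<S>" "N' \<in> \<S>" "N \<noteq> N'" "V.stable_hom h N N'" "bij_betw h N N'"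
  proof -
    have "\<not> (\<forall>N\<in>\<S>. \<forall>N'\<in>\<S>. N \<noteq> N' \<longrightarrow> \<not> (\<exists>h. V.stable_hom h N N' \<and> bij_betw h N N'))"
    proof
      assume iso: "\<forall>N\<in>\<S>. \<forall>N'\<in>\<S>. N \<noteq> N' \<longrightarrow> \<not> (\<exists>h. V.stable_hom h N N' \<and> bij_betw h N N')"
      have "\<forall>N\<in>\<S>. V.simple N" by (rule ballI) (rule simp)
      then have "multiplicity_free R M"
        unfolding multiplicity_free_iff by (intro exI[of _ \<S>] conjI ds iso)
      then show False using assms by contradiction
    qed
    then show thesis using that by auto
  qed
  show thesis
  proof (rule V.matrix_units_if_not_multiplicity_free[OF ds _ N])
    show "V.simple N" if "N \<in> \<S>" for N using simp[OF that] .
  qed (rule that)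
qed

end

section \<open>The Lie algebra of stable derivations\<close>

context p_group_action
begin

abbreviation St where "St \<equiv> stable_derivations K P E \<phi>"
abbreviation H where "H \<equiv> HH1_fixed K P E \<phi>"

section \<open>Stable derivations as a Lie algebra, and its identification with the fixed
  points\<close>

definition der_zero_map :: "('g \<Rightarrow> 'k) \<Rightarrow> 'g \<Rightarrow> 'k" where
  "der_zero_map = (\<lambda>x\<in>carrier A. \<zero>\<^bsub>A\<^esub>)"

definition der_add :: "(('g \<Rightarrow> 'k) \<Rightarrow> 'g \<Rightarrow> 'k) \<Rightarrow> (('g \<Rightarrow> 'k) \<Rightarrow> 'g \<Rightarrow> 'k) \<Rightarrow> ('g \<Rightarrow> 'k) \<Rightarrow> 'g \<Rightarrow> 'k" where
  "der_add f h = (\<lambda>x\<in>carrier A. f x \<oplus>\<^bsub>A\<^esub> h x)"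

definition der_smult :: "'k \<Rightarrow> (('g \<Rightarrow> 'k) \<Rightarrow> 'g \<Rightarrow> 'k) \<Rightarrow> ('g \<Rightarrow> 'k) \<Rightarrow> 'g \<Rightarrow> 'k" where
  "der_smult c f = (\<lambda>x\<in>carrier A. c \<odot>\<^bsub>A\<^esub> f x)"

lemma derI:
  assumes "f \<in> extensional (carrier A)" "\<And>x. x \<in> carrier A \<Longrightarrow> f x \<in> carrier A"
    "\<And>x y. \<lbrakk>x \<in> carrier A; y \<in> carrier A\<rbrakk> \<Longrightarrow> f (x \<oplus>\<^bsub>A\<^esub> y) = f x \<oplus>\<^bsub>A\<^esub> f y"
    "\<And>c x. \<lbrakk>c \<in> carrier K; x \<in> carrier A\<rbrakk> \<Longrightarrow> f (c \<odot>\<^bsub>A\<^esub> x) = c \<odot>\<^bsub>A\<^esub> f x"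
    "\<And>x y. \<lbrakk>x \<in> carrier A; y \<in> carrier A\<rbrakk> \<Longrightarrow> f (x \<otimes>\<^bsub>A\<^esub> y) = f x \<otimes>\<^bsub>A\<^esub> y \<oplus>\<^bsub>A\<^esub> x \<otimes>\<^bsub>A\<^esub> f y"
  shows "f \<in> derivations K A"
  using assms unfolding derivations_def PiE_def by auto

lemma St_der: "f \<in> St \<Longrightarrow> f \<in> derivations K A"
  unfolding stable_iff by simp

lemma St_closed: "f \<in> St \<Longrightarrow> x \<in> carrier A \<Longrightarrow> f x \<in> carrier A"
  using derD(1)[OF St_der] .

lemma der_zero_map_St: "der_zero_map \<in> St"
proof -
  have "der_zero_map \<in> derivations K A"
    unfolding der_zero_map_def by (rule derI) auto
  then show ?thesis unfolding stable_iff by (simp add: der_zero_map_def \<epsilon>_zero)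
qed

lemma der_add_St:
  assumes f: "f \<in> St" and h: "h \<in> St"
  shows "der_add f h \<in> St"
proof -
  note fD = derD[OF St_der[OF f]] and hD = derD[OF St_der[OF h]]
  have "der_add f h \<in> derivations K A"
  proof (rule derI)
    fix x y assume x: "x \<in> carrier A" and y: "y \<in> carrier A"
    note c = fD(1)[OF x] fD(1)[OF y] hD(1)[OF x] hD(1)[OF y]
    show "der_add f h (x \<oplus>\<^bsub>A\<^esub> y) = der_add f h x \<oplus>\<^bsub>A\<^esub> der_add f h y"
      unfolding der_add_def using x y c by (simp add: fD(2) hD(2) A.a_ac)
    show "der_add f h (x \<otimes>\<^bsub>A\<^esub> y) = der_add f h x \<otimes>\<^bsub>A\<^esub> y \<oplus>\<^bsub>A\<^esub> x \<otimes>\<^bsub>A\<^esub> der_add f h y"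
      unfolding der_add_def using x y c by (simp add: fD(4) hD(4) A.l_distr A.r_distr A.a_ac)
  next
    fix c x assume "c \<in> carrier K" "x \<in> carrier A"
    then show "der_add f h (c \<odot>\<^bsub>A\<^esub> x) = c \<odot>\<^bsub>A\<^esub> der_add f h x"
      unfolding der_add_def by (simp add: fD(1,3) hD(1,3) M.smult_r_distr)
  qed (simp_all add: der_add_def fD(1) hD(1))
  then show ?thesis
    using f h unfolding stable_iff by (simp add: der_add_def \<epsilon>_add fD(1) hD(1))
qed

lemma der_smult_St:
  assumes f: "f \<in> St" and c: "c \<in> carrier K"
  shows "der_smult c f \<in> St"
proof -
  note fD = derD[OF St_der[OF f]]
  have "der_smult c f \<in> derivations K A"
  proof (rule derI)
    fix x y assume x: "x \<in> carrier A" and y: "y \<in> carrier A"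
    note cl = fD(1)[OF x] fD(1)[OF y]
    show "der_smult c f (x \<oplus>\<^bsub>A\<^esub> y) = der_smult c f x \<oplus>\<^bsub>A\<^esub> der_smult c f y"
      unfolding der_smult_def using x y c cl by (simp add: fD(2) M.smult_r_distr)
    show "der_smult c f (x \<otimes>\<^bsub>A\<^esub> y) = der_smult c f x \<otimes>\<^bsub>A\<^esub> y \<oplus>\<^bsub>A\<^esub> x \<otimes>\<^bsub>A\<^esub> der_smult c f y"
      unfolding der_smult_def using x y c cl by (simp add: fD(4) M.smult_r_distr M.smult_assoc2 smult_assoc_right)
  next
    fix d x assume "d \<in> carrier K" "x \<in> carrier A"
    then show "der_smult c f (d \<odot>\<^bsub>A\<^esub> x) = d \<odot>\<^bsub>A\<^esub> der_smult c f x"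
      unfolding der_smult_def using c by (simp add: fD(1,3) M.smult_assoc1[symmetric] K.m_comm)
  qed (simp_all add: der_smult_def fD(1) c)
  then show ?thesis
    using f c unfolding stable_iff by (simp add: der_smult_def \<epsilon>_smult fD(1))
qed

lemma lie_br_St:
  assumes f: "f \<in> St" and h: "h \<in> St"
  shows "lie_br f h \<in> St"
proof -
  note fd = St_der[OF f] and hd = St_der[OF h]
  note fD = derD[OF fd] and hD = derD[OF hd]
  have fh: "f (h x) \<in> carrier A" "h (f x) \<in> carrier A" if "x \<in> carrier A" for x
    using fD(1)[OF hD(1)[OF that]] hD(1)[OF fD(1)[OF that]] by auto
  have sub: "(a \<oplus>\<^bsub>A\<^esub> b) \<ominus>\<^bsub>A\<^esub> (c \<oplus>\<^bsub>A\<^esub> d) = (a \<ominus>\<^bsub>A\<^esub> c) \<oplus>\<^bsub>A\<^esub> (b \<ominus>\<^bsub>A\<^esub> d)"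
    if "a \<in> carrier A" "b \<in> carrier A" "c \<in> carrier A" "d \<in> carrier A" for a b c d
    using that by (simp add: A.minus_eq A.minus_add A.a_ac)
  have "lie_br f h \<in> derivations K A"
  proof (rule derI)
    fix x y assume x: "x \<in> carrier A" and y: "y \<in> carrier A"
    note c = fD(1)[OF x] fD(1)[OF y] hD(1)[OF x] hD(1)[OF y] fh[OF x] fh[OF y]
    show "lie_br f h (x \<oplus>\<^bsub>A\<^esub> y) = lie_br f h x \<oplus>\<^bsub>A\<^esub> lie_br f h y"
      unfolding lie_br_def using x y c by (simp add: fD(2) hD(2) sub)
    \<comment> \<open>The mixed terms are collected in a last summand that is the same for both
      compositions, so that it cancels in the difference.\<close>
    have "f (h (x \<otimes>\<^bsub>A\<^esub> y)) = (f (h x) \<otimes>\<^bsub>A\<^esub> y \<oplus>\<^bsub>A\<^esub> x \<otimes>\<^bsub>A\<^esub> f (h y)) \<oplus>\<^bsub>A\<^esub> (h x \<otimes>\<^bsub>A\<^esub> f y \<oplus>\<^bsub>A\<^esub> f x \<otimes>\<^bsub>A\<^esub> h y)"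
      using x y c by (simp add: fD(2,4) hD(4) A.a_ac)
    moreover have "h (f (x \<otimes>\<^bsub>A\<^esub> y)) = (h (f x) \<otimes>\<^bsub>A\<^esub> y \<oplus>\<^bsub>A\<^esub> x \<otimes>\<^bsub>A\<^esub> h (f y)) \<oplus>\<^bsub>A\<^esub> (h x \<otimes>\<^bsub>A\<^esub> f y \<oplus>\<^bsub>A\<^esub> f x \<otimes>\<^bsub>A\<^esub> h y)"
      using x y c by (simp add: hD(2,4) fD(4) A.a_ac)
    ultimately have "f (h (x \<otimes>\<^bsub>A\<^esub> y)) \<ominus>\<^bsub>A\<^esub> h (f (x \<otimes>\<^bsub>A\<^esub> y)) =
        (f (h x) \<otimes>\<^bsub>A\<^esub> y \<ominus>\<^bsub>A\<^esub> h (f x) \<otimes>\<^bsub>A\<^esub> y) \<oplus>\<^bsub>A\<^esub> (x \<otimes>\<^bsub>A\<^esub> f (h y) \<ominus>\<^bsub>A\<^esub> x \<otimes>\<^bsub>A\<^esub> h (f y))"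
      using x y c by (simp add: sub) (simp add: A.minus_eq A.r_neg)
    then show "lie_br f h (x \<otimes>\<^bsub>A\<^esub> y) = lie_br f h x \<otimes>\<^bsub>A\<^esub> y \<oplus>\<^bsub>A\<^esub> x \<otimes>\<^bsub>A\<^esub> lie_br f h y"
      unfolding lie_br_def using x y c by (simp add: A.minus_eq A.l_distr A.r_distr A.l_minus A.r_minus)
  next
    fix d x assume d: "d \<in> carrier K" and x: "x \<in> carrier A"
    then show "lie_br f h (d \<odot>\<^bsub>A\<^esub> x) = d \<odot>\<^bsub>A\<^esub> lie_br f h x"
      unfolding lie_br_def using fh[OF x]
      by (simp add: fD(1,3) hD(1,3) A.minus_eq M.smult_r_distr M.smult_r_minus)
  qed (simp_all add: lie_br_def fh)
  moreover have "lie_br f h (g (\<phi> e u)) = \<epsilon> e (lie_br f h (g u))" if e: "e \<in> carrier E" and u: "u \<in> carrier P" for e u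
  proof -
    have "f (h (g (\<phi> e u))) = \<epsilon> e (f (h (g u)))" "h (f (g (\<phi> e u))) = \<epsilon> e (h (f (g u)))"
      using f h e u stable_\<epsilon>[OF f e hD(1)] stable_\<epsilon>[OF h e fD(1)] unfolding stable_iff by auto
    then show ?thesis unfolding lie_br_def using e fh by (simp add: \<epsilon>_minus)
  qed
  ultimately show ?thesis unfolding stable_iff by simp
qed

lemma der_add_zero: "f \<in> derivations K A \<Longrightarrow> der_add der_zero_map f = f"
proof (rule extensionalityI)
  assume f: "f \<in> derivations K A"
  show "f \<in> extensional (carrier A)" by (rule derD(5)[OF f])
  show "der_add der_zero_map f x = f x" if "x \<in> carrier A" for x
    unfolding der_add_def der_zero_map_def using that derD(1)[OF f that] by simp
qed (simp add: der_add_def)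

lemma Der_simps:
  "carrier (Der K A) = derivations K A" "\<zero>\<^bsub>Der K A\<^esub> = der_zero_map" "f \<oplus>\<^bsub>Der K A\<^esub> h = der_add f h"
  "c \<odot>\<^bsub>Der K A\<^esub> f = der_smult c f" "lie_bracket (Der K A) f h = lie_br f h"
  unfolding Der_def der_zero_map_def der_add_def der_smult_def lie_br_def by simp_all

lemma inner_derivations_trivial: "inner_derivations A = {der_zero_map}"
proof -
  have "(\<lambda>x\<in>carrier A. a \<otimes>\<^bsub>A\<^esub> x \<ominus>\<^bsub>A\<^esub> x \<otimes>\<^bsub>A\<^esub> a) = der_zero_map" if "a \<in> carrier A" for a
    unfolding der_zero_map_def using that by (intro restrict_ext) (simp add: A.m_comm A.minus_eq A.r_neg)
  then have "inner_derivations A = (\<lambda>a. der_zero_map) ` carrier A"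
    unfolding inner_derivations_def Setcompr_eq_image by (rule image_cong[OF refl])
  then show ?thesis using A.zero_closed by auto
qed

lemma coset_singleton: "f \<in> derivations K A \<Longrightarrow> {der_zero_map} +>\<^bsub>Der K A\<^esub> f = {f}"
  unfolding a_r_coset_def r_coset_def using der_add_zero by (simp add: Der_simps)

text \<open>There is only the zero inner derivation, so each class is a singleton, and a singleton
  is fixed by conjugation exactly when its member is. Everything below is therefore stated for
  stable derivations.\<close>

lemma H_simps:
  "carrier H = (\<lambda>f. {f}) ` St" "\<zero>\<^bsub>H\<^esub> = {der_zero_map}"
  "{f} \<oplus>\<^bsub>H\<^esub> {h} = {der_add f h}"
  "f \<in> St \<Longrightarrow> c \<in> carrier K \<Longrightarrow> c \<odot>\<^bsub>H\<^esub> {f} = {der_smult c f}"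
  "f \<in> St \<Longrightarrow> h \<in> St \<Longrightarrow> lie_bracket H {f} {h} = {lie_br f h}"
proof -
  have HD: "HH1 K A = lie_quotient (Der K A) {der_zero_map}"
    unfolding HH1_def inner_derivations_trivial ..
  have "a_rcosets\<^bsub>Der K A\<^esub> {der_zero_map} = (\<lambda>f. {f}) ` derivations K A"
    unfolding A_RCOSETS_def' using coset_singleton by (auto simp: Der_simps)
  then show "carrier H = (\<lambda>f. {f}) ` St"
    unfolding HH1_fixed_def HD lie_quotient_def stable_derivations_def by auto
  show "\<zero>\<^bsub>H\<^esub> = {der_zero_map}" unfolding HH1_fixed_def HD lie_quotient_def by simp
  show "{f} \<oplus>\<^bsub>H\<^esub> {h} = {der_add f h}"
    unfolding HH1_fixed_def HD lie_quotient_def by (simp add: set_add_def set_mult_def Der_simps)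
  show "c \<odot>\<^bsub>H\<^esub> {f} = {der_smult c f}" if "f \<in> St" "c \<in> carrier K"
    unfolding HH1_fixed_def HD lie_quotient_def
    using coset_singleton[OF St_der[OF der_smult_St[OF that]]] by (simp add: Der_simps)
  show "lie_bracket H {f} {h} = {lie_br f h}" if "f \<in> St" "h \<in> St"
    unfolding HH1_fixed_def HD lie_quotient_def
    using coset_singleton[OF St_der[OF lie_br_St[OF that]]] by (simp add: Der_simps)
qed

text \<open>The subgroup condition inside \<open>submodule\<close> mentions this inverse. It is
  computed from its definite description, so that the group laws of \<open>H\<close> need not be
  established as a whole.\<close>

lemma H_inv:
  assumes f: "f \<in> St"
  shows "inv\<^bsub>add_monoid H\<^esub> {f} = {der_smult (\<ominus>\<^bsub>K\<^esub> \<one>\<^bsub>K\<^esub>) f}"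
proof -
  let ?n = "der_smult (\<ominus>\<^bsub>K\<^esub> \<one>\<^bsub>K\<^esub>) f"
  note fD = derD[OF St_der[OF f]]
  have n: "?n \<in> St" using f by (intro der_smult_St) auto
  have nv: "?n x = \<ominus>\<^bsub>A\<^esub> f x" if "x \<in> carrier A" for x
    unfolding der_smult_def using that fD(1) by (simp add: M.smult_l_minus)
  have z: "der_add f ?n = der_zero_map" "der_add ?n f = der_zero_map"
    unfolding der_add_def der_zero_map_def
    by (rule restrict_ext, simp add: nv fD(1) A.r_neg A.l_neg)+
  have uniq: "h = ?n" if h: "h \<in> St" "der_add f h = der_zero_map" for h
  proof (rule extensionalityI[OF derD(5)[OF St_der[OF h(1)]] derD(5)[OF St_der[OF n]]])
    fix x assume x: "x \<in> carrier A"
    have "f x \<oplus>\<^bsub>A\<^esub> h x = \<zero>\<^bsub>A\<^esub>"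
      using fun_cong[OF h(2), of x] x unfolding der_add_def der_zero_map_def by simp
    then show "h x = ?n x"
      using nv[OF x] A.minus_equality[of "h x" "f x"] fD(1)[OF x] St_closed[OF h(1) x] by (simp add: A.a_comm)
  qed
  show ?thesis
    unfolding m_inv_def
  proof (rule the_equality)
    show "{?n} \<in> carrier (add_monoid H) \<and> {f} \<otimes>\<^bsub>add_monoid H\<^esub> {?n} = \<one>\<^bsub>add_monoid H\<^esub> \<and>
      {?n} \<otimes>\<^bsub>add_monoid H\<^esub> {f} = \<one>\<^bsub>add_monoid H\<^esub>"
      using n z by (simp add: H_simps)
    fix S assume S: "S \<in> carrier (add_monoid H) \<and> {f} \<otimes>\<^bsub>add_monoid H\<^esub> S = \<one>\<^bsub>add_monoid H\<^esub> \<and>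
      S \<otimes>\<^bsub>add_monoid H\<^esub> {f} = \<one>\<^bsub>add_monoid H\<^esub>"
    then obtain h where h: "h \<in> St" "S = {h}" by (auto simp: H_simps)
    then show "S = {?n}" using S uniq[OF h(1)] by (simp add: H_simps)
  qed
qed

section \<open>The filtration of the Lie algebra and the two implications\<close>

definition filt :: "nat \<Rightarrow> (('g \<Rightarrow> 'k) \<Rightarrow> 'g \<Rightarrow> 'k) set set" where
  "filt m = (\<lambda>f. {f}) ` {f \<in> St. \<forall>x\<in>carrier A. f x \<in> J m}"

lemma filt_submodule: "submodule (filt m) K H"
proof (intro submodule.intro submodule_axioms.intro subgroup.intro)
  show "filt m \<subseteq> carrier (add_monoid H)" unfolding filt_def by (auto simp: H_simps)
  show "\<one>\<^bsub>add_monoid H\<^esub> \<in> filt m"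
    unfolding filt_def using der_zero_map_St by (auto simp: H_simps der_zero_map_def)
  fix S assume "S \<in> filt m"
  then obtain f where f: "f \<in> St" "\<And>x. x \<in> carrier A \<Longrightarrow> f x \<in> J m" "S = {f}" unfolding filt_def by auto
  have sm: "{der_smult c f} \<in> filt m" if "c \<in> carrier K" for c
  proof -
    have "der_smult c f x \<in> J m" if "x \<in> carrier A" for x
      unfolding der_smult_def using J_smult[OF f(2)[OF that] \<open>c \<in> carrier K\<close>] that by simp
    then show ?thesis unfolding filt_def using der_smult_St[OF f(1) that] by blast
  qed
  show "inv\<^bsub>add_monoid H\<^esub> S \<in> filt m" unfolding f(3) H_inv[OF f(1)] by (rule sm) simp
  show "c \<odot>\<^bsub>H\<^esub> S \<in> filt m" if "c \<in> carrier K" for c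
    unfolding f(3) H_simps(4)[OF f(1) that] by (rule sm[OF that])
  fix S' assume "S' \<in> filt m"
  then obtain h where h: "h \<in> St" "\<And>x. x \<in> carrier A \<Longrightarrow> h x \<in> J m" "S' = {h}" unfolding filt_def by auto
  have "der_add f h x \<in> J m" if "x \<in> carrier A" for x
    unfolding der_add_def using J_add[OF f(2)[OF that] h(2)[OF that]] that by simp
  then show "S \<otimes>\<^bsub>add_monoid H\<^esub> S' \<in> filt m"
    unfolding filt_def f(3) h(3) using der_add_St[OF f(1) h(1)] by (auto simp: H_simps)
qed

text \<open>The derived subspace is an intersection of submodules, so it suffices that
  \<open>filt n\<close> is one of those containing the brackets.\<close>

lemma derived_filt:
  assumes X: "X \<subseteq> filt m"
    and br: "\<And>f h x. \<lbrakk>f \<in> St; h \<in> St; \<And>x. x \<in> carrier A \<Longrightarrow> f x \<in> J m; \<And>x. x \<in> carrier A \<Longrightarrow> h x \<in> J m; x \<in> carrier A\<rbrakk>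
      \<Longrightarrow> f (h x) \<ominus>\<^bsub>A\<^esub> h (f x) \<in> J n"
  shows "lie_derived K H X \<subseteq> filt n"
  unfolding lie_derived_def
proof (rule Inter_lower, rule CollectI, intro conjI ballI filt_submodule)
  fix S S' assume "S \<in> X" "S' \<in> X"
  then have SS: "S \<in> filt m" "S' \<in> filt m" using X by auto
  obtain f where f: "f \<in> St" "\<And>x. x \<in> carrier A \<Longrightarrow> f x \<in> J m" "S = {f}"
    using SS(1) unfolding filt_def by auto
  obtain h where h: "h \<in> St" "\<And>x. x \<in> carrier A \<Longrightarrow> h x \<in> J m" "S' = {h}"
    using SS(2) unfolding filt_def by auto
  have "lie_br f h x \<in> J n" if "x \<in> carrier A" for x
    unfolding lie_br_def using br[OF f(1) h(1) f(2) h(2) that] that by simp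
  then show "lie_bracket H S S' \<in> filt n"
    unfolding f(3) h(3) H_simps(5)[OF f(1) h(1)] filt_def using lie_br_St[OF f(1) h(1)] by blast
qed

lemma zero_in_submodule: "submodule N K H \<Longrightarrow> {der_zero_map} \<in> N"
  using subgroup.one_closed[OF submodule.axioms(1)] by (force simp: H_simps)

text \<open>The n-th derived term consists of derivations with values in \<open>J (n + 1)\<close>,
  and \<open>J\<close> vanishes from q * q on.\<close>

theorem solvable_if_multiplicity_free:
  assumes comm: "commutator_of_action P E \<phi> = carrier P" and mf: "multiplicity_free R M"
  shows "lie_solvable K H"
proof -
  have sub: "(lie_derived K H ^^ n) (carrier H) \<subseteq> filt (n + 1)" for n
  proof (induction n)
    case 0
    have "St \<subseteq> {f \<in> St. \<forall>x\<in>carrier A. f x \<in> J 1}"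
      by (intro subsetI CollectI conjI ballI stable_image[OF _ comm])
    then show ?case unfolding filt_def by (simp add: H_simps(1) image_mono)
  next
    case (Suc n)
    have "lie_derived K H ((lie_derived K H ^^ n) (carrier H)) \<subseteq> filt (n + 2)"
    proof (rule derived_filt)
      show "(lie_derived K H ^^ n) (carrier H) \<subseteq> filt (n + 1)" by (rule Suc)
      fix f h x assume f: "f \<in> St" "\<And>x. x \<in> carrier A \<Longrightarrow> f x \<in> J (n + 1)"
        and h: "h \<in> St" "\<And>x. x \<in> carrier A \<Longrightarrow> h x \<in> J (n + 1)" and x: "x \<in> carrier A"
      show "f (h x) \<ominus>\<^bsub>A\<^esub> h (f x) \<in> J (n + 2)"
      \<comment> \<open>For values in \<open>J (n + 1)\<close>, \<open>der_J\<close> puts the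
        bracket into \<open>J (2n + 1)\<close>, and 2n + 1 >= n + 2 only for n >= 1. At n = 0
        commutativity of the endomorphism ring takes over.\<close>
      proof (cases "n = 0")
        case True
        have "f (h x) \<ominus>\<^bsub>A\<^esub> h (f x) \<in> J 2"
        proof (rule stable_commute[where f = f and h = h and x = x])
          show "\<sigma> (\<tau> S) = \<tau> (\<sigma> S)" if "V.endo \<sigma>" "V.endo \<tau>" "S \<in> carrier V" for \<sigma> \<tau> S
            by (rule endo_commute[OF mf that])
          show "f y \<in> J 1" "h y \<in> J 1" if "y \<in> carrier A" for y
            using stable_image[OF f(1) comm that] stable_image[OF h(1) comm that] .
        qed (rule f(1) h(1) x)+
        then show ?thesis using True by (simp add: numeral_2_eq_2)
      next
        case False
        have "f (h x) \<in> J (n + (n + 1))"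
          by (rule der_J[OF St_der[OF f(1)] f(2)]) (use h(2)[OF x] in auto)
        moreover have "h (f x) \<in> J (n + (n + 1))"
          by (rule der_J[OF St_der[OF h(1)] h(2)]) (use f(2)[OF x] in auto)
        moreover have "J (n + (n + 1)) \<subseteq> J (n + 2)" using False by (intro J_antimono) auto
        ultimately show ?thesis by (intro J_minus) auto
      qed
    qed
    then show ?case by simp
  qed
  have "filt (q * q + 1) \<subseteq> {{der_zero_map}}"
  proof
    fix S assume "S \<in> filt (q * q + 1)"
    then obtain f where f: "f \<in> St" "\<And>x. x \<in> carrier A \<Longrightarrow> f x \<in> J (q * q + 1)" "S = {f}" unfolding filt_def by blast
    have "f = der_zero_map"
    proof (rule extensionalityI[OF derD(5)[OF St_der[OF f(1)]]])
      show "der_zero_map \<in> extensional (carrier A)" unfolding der_zero_map_def by simp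
      fix x assume x: "x \<in> carrier A"
      have "f x = \<zero>\<^bsub>A\<^esub>" using f(2)[OF x] J_nilpotent[of "q * q + 1"] by simp
      then show "f x = der_zero_map x" unfolding der_zero_map_def using x by simp
    qed
    then show "S \<in> {{der_zero_map}}" using f(3) by simp
  qed
  then have "(lie_derived K H ^^ (q * q)) (carrier H) \<subseteq> {{der_zero_map}}" using sub[of "q * q"] by blast
  \<comment> \<open>Solvability asks for equality with the zero space, so zero must be shown to
    occur in every term.\<close>
  moreover have "{der_zero_map} \<in> (lie_derived K H ^^ n) (carrier H)" for n
  proof (cases n)
    case 0
    then show ?thesis using der_zero_map_St by (auto simp: H_simps)
  next
    case (Suc m)
    then show ?thesis using zero_in_submodule by (auto simp: lie_derived_def)
  qed
  ultimately have "(lie_derived K H ^^ (q * q)) (carrier H) = {\<zero>\<^bsub>H\<^esub>}" by (auto simp: H_simps)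
  then show ?thesis unfolding lie_solvable_def by blast
qed

lemma bracket_in_derived:
  "\<lbrakk>S \<in> X; S' \<in> X\<rbrakk> \<Longrightarrow> lie_bracket H S S' \<in> lie_derived K H X"
  unfolding lie_derived_def by blast

theorem multiplicity_free_if_solvable:
  assumes comm: "commutator_of_action P E \<phi> = carrier P" and odd: "odd p" and sol: "lie_solvable K H"
  shows "multiplicity_free R M"
proof (rule ccontr)
  assume nmf: "\<not> multiplicity_free R M"
  show False
  proof (rule matrix_units[OF nmf])
  fix \<alpha> \<beta> S assume e: "V.endo \<alpha>" "V.endo \<beta>"
    and aa: "\<And>S. S \<in> carrier V \<Longrightarrow> \<alpha> (\<alpha> S) = \<one>\<^bsub>V\<^esub>" and bb: "\<And>S. S \<in> carrier V \<Longrightarrow> \<beta> (\<beta> S) = \<one>\<^bsub>V\<^esub>"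
    and aba: "\<And>S. S \<in> carrier V \<Longrightarrow> \<alpha> (\<beta> (\<alpha> S)) = \<alpha> S" and bab: "\<And>S. S \<in> carrier V \<Longrightarrow> \<beta> (\<alpha> (\<beta> S)) = \<beta> S"
    and S: "S \<in> carrier V" "\<alpha> S \<noteq> \<one>\<^bsub>V\<^esub>"
  note aD = V.endoD[OF e(1)] and bD = V.endoD[OF e(2)]
  \<comment> \<open>The commutator [\<alpha>, \<beta>], the third basis element of sl_2 beside
    \<alpha> and \<beta>.\<close>
  define \<gamma> where "\<gamma> S = \<alpha> (\<beta> S) \<otimes>\<^bsub>V\<^esub> inv\<^bsub>V\<^esub> (\<beta> (\<alpha> S))" for S
  have ab: "\<alpha> (\<beta> S) \<in> carrier V" "\<beta> (\<alpha> S) \<in> carrier V" if "S \<in> carrier V" for S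
    using aD(2)[OF bD(2)[OF that]] bD(2)[OF aD(2)[OF that]] by auto
  have \<gamma>c: "\<gamma> S \<in> carrier V" if "S \<in> carrier V" for S unfolding \<gamma>_def using ab[OF that] by simp
  have br1: "\<alpha> (\<beta> S) \<otimes>\<^bsub>V\<^esub> inv\<^bsub>V\<^esub> (\<beta> (\<alpha> S)) = \<gamma> S [^]\<^bsub>V\<^esub> (1::int)" if "S \<in> carrier V" for S
    using \<gamma>c[OF that] unfolding \<gamma>_def by simp
  have ga: "\<gamma> (\<alpha> S) = \<alpha> S" "\<alpha> (\<gamma> S) = inv\<^bsub>V\<^esub> (\<alpha> S)" if s: "S \<in> carrier V" for S
  proof -
    show "\<gamma> (\<alpha> S) = \<alpha> S" unfolding \<gamma>_def using aba[OF s] aa[OF s] bD(5) aD(2)[OF s] by simp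
    have "\<alpha> (\<gamma> S) = \<alpha> (\<alpha> (\<beta> S)) \<otimes>\<^bsub>V\<^esub> inv\<^bsub>V\<^esub> (\<alpha> (\<beta> (\<alpha> S)))"
      unfolding \<gamma>_def using ab[OF s] aD(3)[OF ab(1)[OF s] V.inv_closed[OF ab(2)[OF s]]] aD(6)[OF ab(2)[OF s]] by simp
    then show "\<alpha> (\<gamma> S) = inv\<^bsub>V\<^esub> (\<alpha> S)" using aa[OF bD(2)[OF s]] aba[OF s] aD(2)[OF s] by simp
  qed
  have gb: "\<gamma> (\<beta> S) = inv\<^bsub>V\<^esub> (\<beta> S)" "\<beta> (\<gamma> S) = \<beta> S" if s: "S \<in> carrier V" for S
  proof -
    show "\<gamma> (\<beta> S) = inv\<^bsub>V\<^esub> (\<beta> S)" unfolding \<gamma>_def using bab[OF s] bb[OF s] aD(5) bD(2)[OF s] by simp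
    have "\<beta> (\<gamma> S) = \<beta> (\<alpha> (\<beta> S)) \<otimes>\<^bsub>V\<^esub> inv\<^bsub>V\<^esub> (\<beta> (\<beta> (\<alpha> S)))"
      unfolding \<gamma>_def using ab[OF s] bD(3)[OF ab(1)[OF s] V.inv_closed[OF ab(2)[OF s]]] bD(6)[OF ab(2)[OF s]] by simp
    then show "\<beta> (\<gamma> S) = \<beta> S" using bb[OF aD(2)[OF s]] bab[OF s] bD(2)[OF s] by simp
  qed
  \<comment> \<open>The relations [\<gamma>, \<alpha>] = 2\<alpha> and, next, [\<gamma>, \<beta>] =
    -2\<beta>, in the shape that \<open>bracket_induces\<close> expects.\<close>
  have br2: "\<gamma> (\<alpha> S) \<otimes>\<^bsub>V\<^esub> inv\<^bsub>V\<^esub> (\<alpha> (\<gamma> S)) = \<alpha> S [^]\<^bsub>V\<^esub> (2::int)" if "S \<in> carrier V" for S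
    using ga[OF that] aD(2)[OF that] V.int_pow_mult[of "\<alpha> S" 1 1] by simp
  have br3: "\<gamma> (\<beta> S) \<otimes>\<^bsub>V\<^esub> inv\<^bsub>V\<^esub> (\<beta> (\<gamma> S)) = \<beta> S [^]\<^bsub>V\<^esub> (-2::int)" if "S \<in> carrier V" for S
    using gb[OF that] bD(2)[OF that] V.int_pow_mult[of "\<beta> S" "-1" "-1"] by (simp add: V.int_pow_neg)
  have two: "\<kappa> 2 \<noteq> \<zero>\<^bsub>K\<^esub>" "\<kappa> (-2) \<noteq> \<zero>\<^bsub>K\<^esub>"
  proof -
    have "\<not> p dvd 2" using odd prime_p prime_ge_2_nat[OF prime_p] by (auto dest!: dvd_imp_le)
    then have "\<not> int p dvd 2" by (metis of_nat_dvd_iff of_nat_numeral)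
    then show "\<kappa> 2 \<noteq> \<zero>\<^bsub>K\<^esub>" "\<kappa> (-2) \<noteq> \<zero>\<^bsub>K\<^esub>" by (simp_all add: \<kappa>_eq_zero)
  qed
  have \<kappa>_one_nonzero: "\<kappa> 1 \<noteq> \<zero>\<^bsub>K\<^esub>" by simp
  note J1 = stable_image[OF _ comm]
  \<comment> \<open>The scalar is left open because each bracket changes it; it stays nonzero as k
    has no zero divisors and 1, 2, -2 are nonzero in k.\<close>
  define lifts where "lifts X \<tau> \<longleftrightarrow> (\<exists>f c. f \<in> St \<and> {f} \<in> X \<and> c \<in> carrier K \<and> c \<noteq> \<zero>\<^bsub>K\<^esub> \<and> induces f c \<tau>)"
    for X :: "(('g \<Rightarrow> 'k) \<Rightarrow> 'g \<Rightarrow> 'k) set set" and \<tau>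
  have step: "lifts (lie_derived K H X) \<rho>"
    if l: "lifts X \<sigma>" "lifts X \<tau>"
      and c: "V.endo \<sigma>" "V.endo \<tau>"
      and r: "\<forall>S\<in>carrier V. \<sigma> (\<tau> S) \<otimes>\<^bsub>V\<^esub> inv\<^bsub>V\<^esub> (\<tau> (\<sigma> S)) = \<rho> S [^]\<^bsub>V\<^esub> (m::int)"
      and m: "\<kappa> m \<noteq> \<zero>\<^bsub>K\<^esub>" for X \<sigma> \<tau> \<rho> m
  proof -
    obtain f a where f: "f \<in> St" "{f} \<in> X" "a \<in> carrier K" "a \<noteq> \<zero>\<^bsub>K\<^esub>" "induces f a \<sigma>"
      using l(1) unfolding lifts_def by blast
    obtain h b where h: "h \<in> St" "{h} \<in> X" "b \<in> carrier K" "b \<noteq> \<zero>\<^bsub>K\<^esub>" "induces h b \<tau>"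
      using l(2) unfolding lifts_def by blast
    have ind: "induces (lie_br f h) (\<kappa> m \<otimes>\<^bsub>K\<^esub> (a \<otimes>\<^bsub>K\<^esub> b)) \<rho>"
    proof (rule bracket_induces[OF St_der[OF f(1)] _ f(5,3) St_der[OF h(1)] _ h(5,3)])
      show "f x \<in> J 1" "h x \<in> J 1" if "x \<in> carrier A" for x using J1[OF f(1) that] J1[OF h(1) that] .
      show "\<sigma> S \<in> carrier V" "\<tau> S \<in> carrier V" if "S \<in> carrier V" for S
        using V.endoD(2)[OF c(1) that] V.endoD(2)[OF c(2) that] .
    qed (use r in blast)
    have "{lie_br f h} \<in> lie_derived K H X"
      using bracket_in_derived[OF f(2) h(2)] H_simps(5)[OF f(1) h(1)] by simp
    moreover have ab: "a \<otimes>\<^bsub>K\<^esub> b \<in> carrier K" "a \<otimes>\<^bsub>K\<^esub> b \<noteq> \<zero>\<^bsub>K\<^esub>"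
      using f(3,4) h(3,4) K.integral_iff[OF f(3) h(3)] by auto
    moreover have "\<kappa> m \<otimes>\<^bsub>K\<^esub> (a \<otimes>\<^bsub>K\<^esub> b) \<noteq> \<zero>\<^bsub>K\<^esub>"
      using m ab K.integral_iff[OF \<kappa>_closed ab(1)] by simp
    moreover have "\<kappa> m \<otimes>\<^bsub>K\<^esub> (a \<otimes>\<^bsub>K\<^esub> b) \<in> carrier K"
      by (rule K.m_closed[OF \<kappa>_closed ab(1)])
    ultimately show ?thesis
      unfolding lifts_def using ind lie_br_St[OF f(1) h(1)]
      by (intro exI[of _ "lie_br f h"] exI[of _ "\<kappa> m \<otimes>\<^bsub>K\<^esub> (a \<otimes>\<^bsub>K\<^esub> b)"] conjI)
  qed
  have start: "lifts (carrier H) \<tau>" if \<tau>: "V.endo \<tau>" for \<tau>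
  proof -
    obtain f where f: "f \<in> St" "induces f (\<kappa> (int (order E))) \<tau>"
      by (rule endo_lift[OF \<tau>])
    have "{f} \<in> carrier H" using f(1) by (simp add: H_simps(1))
    then show ?thesis
      unfolding lifts_def using f order_E_nonzero
      by (intro exI[of _ f] exI[of _ "\<kappa> (int (order E))"] conjI \<kappa>_closed)
  qed
  have \<gamma>_endo: "V.endo \<gamma>"
  proof -
    have ae: "V.endo (\<lambda>S. \<alpha> (\<beta> S))" and be: "V.endo (\<lambda>S. \<beta> (\<alpha> S))"
      using V.endo_comp e by auto
    note aeD = V.endoD[OF ae] and beD = V.endoD[OF be]
    show ?thesis
      unfolding V.endo_def
    proof (intro conjI ballI homI)
      fix S assume s: "S \<in> carrier V"
      show "\<gamma> S \<in> carrier V" by (rule \<gamma>c[OF s])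
      show "\<gamma> (S \<otimes>\<^bsub>V\<^esub> S') = \<gamma> S \<otimes>\<^bsub>V\<^esub> \<gamma> S'" if s': "S' \<in> carrier V" for S'
        unfolding \<gamma>_def using aeD(3)[OF s s'] beD(3)[OF s s'] ab[OF s] ab[OF s']
        by (simp add: V.inv_mult V.m_ac)
      show "\<gamma> (\<phi> f ` S) = \<phi> f ` \<gamma> S" if f: "f \<in> carrier E" for f
      proof -
        have "\<phi> f ` (inv\<^bsub>V\<^esub> (\<beta> (\<alpha> S))) = inv\<^bsub>V\<^esub> (\<phi> f ` \<beta> (\<alpha> S))"
          using V.act_int_pow[OF f ab(2)[OF s], of "-1"] V.act_closed[OF f ab(2)[OF s]] ab(2)[OF s]
          by (simp add: V.int_pow_neg)
        then show ?thesis
          unfolding \<gamma>_def using aeD(4)[OF f s] beD(4)[OF f s] V.act_dist[OF f ab(1)[OF s] V.inv_closed[OF ab(2)[OF s]]] by simp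
      qed
    qed
  qed
  \<comment> \<open>Each of the three maps is, up to a nonzero integer, a bracket of two of them, so
    the triple reproduces itself at every step.\<close>
  have all: "lifts ((lie_derived K H ^^ n) (carrier H)) \<alpha> \<and> lifts ((lie_derived K H ^^ n) (carrier H)) \<beta> \<and>
      lifts ((lie_derived K H ^^ n) (carrier H)) \<gamma>" for n
  proof (induction n)
    case 0
    show ?case using start e \<gamma>_endo by simp
  next
    case (Suc n)
    let ?X = "(lie_derived K H ^^ n) (carrier H)"
    have "lifts (lie_derived K H ?X) \<alpha>" using Suc br2 by (intro step[OF _ _ \<gamma>_endo e(1) _ two(1)] ballI) auto
    moreover have "lifts (lie_derived K H ?X) \<beta>" using Suc br3 by (intro step[OF _ _ \<gamma>_endo e(2) _ two(2)] ballI) auto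
    moreover have "lifts (lie_derived K H ?X) \<gamma>" using Suc br1 by (intro step[OF _ _ e _ \<kappa>_one_nonzero] ballI) auto
    ultimately show ?case by simp
  qed
  obtain n where n: "(lie_derived K H ^^ n) (carrier H) = {\<zero>\<^bsub>H\<^esub>}" using sol unfolding lie_solvable_def by blast
  obtain f c where f: "{f} \<in> (lie_derived K H ^^ n) (carrier H)" "c \<in> carrier K" "c \<noteq> \<zero>\<^bsub>K\<^esub>" "induces f c \<alpha>"
    using all[of n] unfolding lifts_def by blast
  have f0: "f = der_zero_map" using f(1) unfolding n by (simp add: H_simps)
  obtain v where v: "v \<in> carrier P" "S = \<pi> v" using \<pi>_surj[OF S(1)] .
  obtain w where w: "w \<in> carrier P" "\<alpha> S = \<pi> w" using \<pi>_surj[OF aD(2)[OF S(1)]] .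
  \<comment> \<open>The zero derivation would induce a nonzero multiple of \<alpha>; for a lift
    \<open>w\<close> of \<open>\<alpha> S\<close> this puts \<open>L w\<close> into
    \<open>J 2\<close>, against \<open>L_J2_imp\<close>.\<close>
  have "cg (f (g v)) (c \<odot>\<^bsub>A\<^esub> L w)" using f(4) v w unfolding induces_def by simp
  moreover have "f (g v) = \<zero>\<^bsub>A\<^esub>" unfolding f0 der_zero_map_def by simp
  ultimately have "cg \<zero>\<^bsub>A\<^esub> (c \<odot>\<^bsub>A\<^esub> L w)" by simp
  then have "cg (c \<odot>\<^bsub>A\<^esub> L w) \<zero>\<^bsub>A\<^esub>" by (rule cg_sym)
  then have cL: "c \<odot>\<^bsub>A\<^esub> L w \<in> J 2" unfolding cg_zero .
  have cU: "c \<in> Units K" using f(2,3) by (simp add: K.field_Units)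
  have "inv\<^bsub>K\<^esub> c \<odot>\<^bsub>A\<^esub> (c \<odot>\<^bsub>A\<^esub> L w) \<in> J 2" by (rule J_smult[OF cL K.Units_inv_closed[OF cU]])
  then have "L w \<in> J 2"
    using f(2) K.Units_inv_closed[OF cU] K.Units_l_inv[OF cU] by (simp add: M.smult_assoc1[symmetric])
  then show False using L_J2_imp[OF w(1)] w(2) S(2) by simp
  qed
qed

end

theorem theorem1p2:
  fixes p :: nat
    and K :: "('k, 'm) ring_scheme"
    and P :: "('g, 'n) monoid_scheme"
    and E :: "('e, 'l) monoid_scheme"
    and \<phi> :: "'e \<Rightarrow> 'g \<Rightarrow> 'g"
  assumes "Factorial_Ring.prime p"
    and "field K" and "ring_char K = p"
    and "comm_group P" and "finite (carrier P)"
    and "\<exists>n. order P = p ^ n" and "carrier P \<noteq> {\<one>\<^bsub>P\<^esub>}"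
    and "group E" and "finite (carrier E)" and "coprime (order E) p"
    and "\<phi> \<in> hom E (AutoGroup P)"
    and "commutator_of_action P E \<phi> = carrier P"
  shows
    "(\<forall>f\<in>stable_derivations K P E \<phi>.
        f ` carrier (group_algebra K P) \<subseteq> jacobson_radical (group_algebra K P)) \<and>
     (multiplicity_free (group_algebra (residue_ring (int p)) E)
          (frattini_quotient_module p P E \<phi>)
        \<longrightarrow> lie_solvable K (HH1_fixed K P E \<phi>)) \<and>
     (odd p \<and> lie_solvable K (HH1_fixed K P E \<phi>)
        \<longrightarrow> multiplicity_free (group_algebra (residue_ring (int p)) E)
          (frattini_quotient_module p P E \<phi>))"
proof -
  have "p_group_action K P p (order P) E \<phi>"
    by (intro p_group_action.intro p_group_algebra.intro finite_group_algebra.intro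
        finite_group_algebra_axioms.intro p_group_algebra_axioms.intro p_group_action_axioms.intro
        refl assms)
  from p_group_action.stable_image[OF this _ \<open>commutator_of_action P E \<phi> = carrier P\<close>]
    p_group_action.solvable_if_multiplicity_free[OF this \<open>commutator_of_action P E \<phi> = carrier P\<close>]
    p_group_action.multiplicity_free_if_solvable[OF this \<open>commutator_of_action P E \<phi> = carrier P\<close>]
    p_group_algebra.J_1_jacobson[OF p_group_action.axioms(1)[OF this]]
  show ?thesis by (intro conjI ballI impI image_subsetI) (blast)+
qed

end
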